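(* Let $1 \leq p < 4/3$ and $q = p'/3$, where $\frac1p + \frac1{p'} = 1$ (so $q = \infty$ if $p=1$). There exists a constant $C = C(p) < \infty$ such that for every function $g \in L^\infty(\mathbb{R}^2)$ with $\|g\|_{L^\infty(\mathbb{R}^2)} = 1$, every convex curve $\Gamma \subseteq \mathbb{R}^2$, and every Schwartz function $f \in \mathcal{S}(\mathbb{R}^2)$ we have $$\|\mathcal{M}_g \widehat{f}\|_{L^q(\Gamma,\nu)} \leq C \|f\|_{L^p(\mathbb{R}^2)},$$ where $$\mathcal{M}_g \widehat{f}(x) = \sup_R \Big| \int_{\mathbb{R}^2} \widehat{f}(x-y)\, g(x-y)\, |R|^{-1} 1_R(y)\, dy \Big|,$$ the supremum being taken over all rectangles $R$ centred at the origin with sides parallel to the axes, and $\nu$ is the affine arclength measure on $\Gamma$.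
   Context: $\widehat{f}(\xi) = \int_{\mathbb{R}^2} f(x) e^{-2\pi i x\cdot \xi}\,dx$ is the Fourier transform, and $|R|$ is the Lebesgue measure of $R$ (rectangles have non-empty interior). Convex curve: a convex curve $\Gamma \subseteq \mathbb{R}^2$ is the boundary $\partial K$ of a non-empty open convex set $K \subseteq \mathbb{R}^2$. No smoothness is assumed. Affine arclength measure $\nu$ (compact case): a compact convex curve $\Gamma$ (that is, $K$ bounded) is rectifiable; let $z \colon J = [0,\ell(\Gamma)) \to \Gamma$ be a counterclockwise arclength parametrization, where $\ell(\Gamma)$ is the length of $\Gamma$. The one-sided derivatives of $z$ exist everywhere as unit vectors (with $z$ extended periodically at the endpoints) and agree Lebesgue-almost everywhere, giving $z'$; they are themselves differentiable Lebesgue-almost everywhere with a common derivative $z''$, and $\det\begin{pmatrix} z'(t) & z''(t)\end{pmatrix} \geq 0$ for almost every $t$. The measure $\nu$ on $J$ is defined by $$d\nu(t) = \sqrt[3]{\det \begin{pmatrix} z'(t) & z''(t) \end{pmatrix}}\, dt,$$ and $\nu$ also denotes its push-forward to $\Gamma$ via $z$. Affine arclength measure $\nu$ (non-compact case): for $N \in \mathbb{N}$ large enough that $K \cap (-N,N)^2 \neq \varnothing$, let $\Gamma_N = \partial(K \cap [-N,N]^2)$, a compact convex curve, with affine arclength measure $\nu_{\Gamma_N}$. Then $\nu$ on $\Gamma$ is the Borel measure $\nu(E) = \lim_{N \to \infty} \nu_{\Gamma_N}(E \cap (-N,N)^2)$. *)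

theory Defs
  imports "HOL-Analysis.Analysis" "HOL-Probability.Essential_Supremum"
begin

section \<open>Lebesgue norms\<close>

text \<open>Only used for positive exponents \<open>r\<close>, where \<open>0\<close> is sent to \<open>0\<close>.\<close>

definition ennreal_powr :: "ennreal \<Rightarrow> real \<Rightarrow> ennreal" where
  "ennreal_powr x r = (if x = \<infinity> then \<infinity> else ennreal (enn2real x powr r))"

text \<open>The \<open>L\<^sup>q\<close> norm, \<open>0 < q \<le> \<infinity>\<close>, of a function given through its modulus \<open>h\<close>.\<close>

definition Lnorm :: "ennreal \<Rightarrow> 'a measure \<Rightarrow> ('a \<Rightarrow> ennreal) \<Rightarrow> ennreal" where
  "Lnorm q M h =
     (if q = \<infinity> then esssup M h
      else ennreal_powr (\<integral>\<^sup>+ x. ennreal_powr (h x) (enn2real q) \<partial>M) (1 / enn2real q))"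


section \<open>Schwartz functions and the Fourier transform on the plane\<close>

primrec iter_partial :: "2 list \<Rightarrow> (real^2 \<Rightarrow> complex) \<Rightarrow> real^2 \<Rightarrow> complex" where
  "iter_partial [] f = f"
| "iter_partial (i # is) f = (\<lambda>x. frechet_derivative (iter_partial is f) (at x) (axis i 1))"

text \<open>Total differentiability of all iterated partial derivatives is equivalent to
  \<open>f\<close> being of class \<open>C\<^sup>\<infinity>\<close>.\<close>

definition schwartz :: "(real^2 \<Rightarrow> complex) \<Rightarrow> bool" where
  "schwartz f \<longleftrightarrow>
     (\<forall>is. (\<forall>x. iter_partial is f differentiable at x) \<and>
           (\<forall>k. bounded (range (\<lambda>x. norm x ^ k *\<^sub>R iter_partial is f x))))"

definition fourier :: "(real^2 \<Rightarrow> complex) \<Rightarrow> real^2 \<Rightarrow> complex" where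
  "fourier f \<xi> = (LINT x|lebesgue. f x * exp (- (2 * complex_of_real pi * \<i> * complex_of_real (x \<bullet> \<xi>))))"


section \<open>The maximal operator\<close>

definition centred_rectangles :: "(real^2) set set" where
  "centred_rectangles = {cbox (- v) v | v. \<forall>i. 0 < v $ i}"

definition maximal_op :: "(real^2 \<Rightarrow> complex) \<Rightarrow> (real^2 \<Rightarrow> complex) \<Rightarrow> real^2 \<Rightarrow> ennreal" where
  "maximal_op g F x =
     (SUP R\<in>centred_rectangles.
        ennreal (norm (LINT y|lebesgue.
          F (x - y) * g (x - y) * complex_of_real (inverse (measure lebesgue R) * indicator R y))))"


section \<open>Affine arclength measure on convex curves\<close>

text \<open>The length of \<open>z\<close> on \<open>[a, b]\<close>: supremum over inscribed polygonal chains.\<close>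

definition curve_length :: "(real \<Rightarrow> 'a::metric_space) \<Rightarrow> real \<Rightarrow> real \<Rightarrow> ennreal" where
  "curve_length z a b =
     (SUP ts\<in>{ts. sorted ts \<and> set ts \<subseteq> {a..b}}.
        \<Sum>i<length ts - 1. ennreal (dist (z (ts ! i)) (z (ts ! Suc i))))"

text \<open>The determinant of the matrix with columns \<open>a\<close> and \<open>b\<close> (here entered as rows).\<close>

definition det2 :: "real^2 \<Rightarrow> real^2 \<Rightarrow> real" where
  "det2 a b = det (vector [a, b] :: real^2^2)"

text \<open>\<open>z\<close> is the \<open>L\<close>-periodic extension of a counterclockwise arclength parametrization of the
  boundary of the bounded convex set \<open>K\<close> by \<open>[0, L)\<close>; necessarily \<open>L\<close> is the length of the
  boundary. Counterclockwise means that \<open>K\<close> lies to the left of every one-sided tangent.\<close>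

definition ccw_arclength_param :: "(real^2) set \<Rightarrow> real \<Rightarrow> (real \<Rightarrow> real^2) \<Rightarrow> bool" where
  "ccw_arclength_param K L z \<longleftrightarrow>
     0 < L \<and> (\<forall>t. z (t + L) = z t) \<and> continuous_on UNIV z \<and>
     bij_betw z {0..<L} (frontier K) \<and>
     (\<forall>s t. s \<le> t \<longrightarrow> curve_length z s t = ennreal (t - s)) \<and>
     (\<forall>t. \<exists>d. (z has_vector_derivative d) (at_right t) \<and> (\<forall>w\<in>K. 0 \<le> det2 d (w - z t)))"

text \<open>The first derivative is taken one-sided throughout: \<open>z\<close> may have a dense set of corners, and
  then a two-sided \<open>z'\<close> would be undefined on a dense (null) set, which would spoil \<open>z''\<close>.
  Where \<open>z''\<close> does not exist (a null set) the value of the density is irrelevant.\<close>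

definition right_deriv :: "(real \<Rightarrow> real^2) \<Rightarrow> real \<Rightarrow> real^2" where
  "right_deriv z t = vector_derivative z (at_right t)"

definition affine_density :: "(real \<Rightarrow> real^2) \<Rightarrow> real \<Rightarrow> ennreal" where
  "affine_density z t =
     ennreal (root 3 (det2 (right_deriv z t) (vector_derivative (right_deriv z) (at t))))"

text \<open>\<open>K\<close> bounded and convex with non-empty interior. The parametrization is unique up to the choice
  of the starting point, on which the push-forward measure does not depend.\<close>

definition affine_arclength_compact :: "(real^2) set \<Rightarrow> (real^2) measure" where
  "affine_arclength_compact K =
     (let (L, z) = (SOME (L, z). ccw_arclength_param K L z)
      in distr (density (lebesgue_on {0..<L}) (affine_density z))
               (restrict_space borel (frontier K)) z)"

text \<open>The affine arclength measure of the convex curve \<open>frontier K\<close>, a Borel measure on that curve.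
  In the unbounded case the finitely many \<open>N\<close> for which \<open>K\<close> misses the open square do not
  affect the limit.\<close>

definition affine_arclength :: "(real^2) set \<Rightarrow> (real^2) measure" where
  "affine_arclength K =
     (if bounded K then affine_arclength_compact K
      else measure_of (frontier K) (sets (restrict_space borel (frontier K)))
        (\<lambda>E. lim (\<lambda>N::nat.
           emeasure (affine_arclength_compact (K \<inter> cbox (vec (- real N)) (vec (real N))))
                    (E \<inter> box (vec (- real N)) (vec (real N))))))"

end

theory Submission
  imports Defs "HOL-Probability.Characteristic_Functions"
begin

text \<open>For \<open>p = 1\<close> the averages are bounded by \<open>sup |ft f|\<close>. For \<open>p > 1\<close> a compact curve is cut into four pieces on
  which the tangent stays in a half plane. On a piece the supremum over rectangles is linearised, which turns the
  averaging into a kernel of mass at most one, and dualised. By Hausdorff-Young the dual estimate concerns the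
  self-convolution of the resulting measure; there the change of variables \<open>(s, t) \<mapsto> z s + z t\<close>, whose Jacobian is a
  difference of slopes, reduces matters to the strong maximal inequality and to a Hardy-Littlewood-Sobolev inequality
  in the slope variable. The affine arclength weight is exactly what makes the weights in this inequality cancel, so
  that the constant does not depend on the curve. For unbounded curves, the measures of the truncated curves increase
  with the truncation, because arclength parametrizations of curves that agree in an open set agree locally.\<close>

section \<open>Powers and Hoelder's inequality in the extended nonnegative reals\<close>

text \<open>All exponents depend on one parameter r: if b is conjugate to p, then b = 2r' with r' =
  r / (r - 1), that is, r = b / (b - 2). Squaring a Fourier transform turns its L^b norm into the
  L^r' norm of the transform of a self-convolution, and Hausdorff-Young from L^r to L^r' asks for r
  < 2, which is exactly b > 4, that is, p < 4/3. The slope difference then enters with exponent 1 -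
  r, which is above -1 in the same range. The obstacle peculiar to the maximal operator is that the
  rectangle depends on the point of the curve, so that the dual measure is smeared into the plane.
  Integrating its self-convolution against a test function moves both smearings to the test
  function, where the strong maximal operator, applied twice, dominates them. The lack of smoothness
  is the second obstacle: corners may be dense, and the right derivative of the parametrization is
  differentiable only almost everywhere. Changes of variables therefore take place on measurable
  sets, and their injectivity comes from convexity.\<close>

lemma ennreal_powr_ennreal [simp]: "0 \<le> a \<Longrightarrow> ennreal_powr (ennreal a) r = ennreal (a powr r)"
  by (simp add: ennreal_powr_def)

lemma ennreal_powr_top [simp]: "ennreal_powr top r = top"
  by (simp add: ennreal_powr_def)

lemma ennreal_powr_0 [simp]: "ennreal_powr 0 r = 0"
  by (simp add: ennreal_powr_def)

lemma ennreal_powr_1 [simp]: "ennreal_powr 1 r = 1"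
  by (simp add: ennreal_powr_def)

lemma ennreal_powr_one [simp]: "ennreal_powr x 1 = x"
  by (cases x) auto

lemma ennreal_powr_eq_0_iff [simp]: "ennreal_powr x r = 0 \<longleftrightarrow> x = 0"
  by (cases x) auto

lemma ennreal_powr_eq_top_iff [simp]: "ennreal_powr x r = top \<longleftrightarrow> x = top"
  by (cases x) auto

lemma ennreal_powr_less_top_iff [simp]: "ennreal_powr x r < top \<longleftrightarrow> x < top"
  by (cases x) auto

lemma ennreal_powr_mono: "x \<le> y \<Longrightarrow> 0 \<le> r \<Longrightarrow> ennreal_powr x r \<le> ennreal_powr y r"
  by (cases x; cases y) (auto intro!: ennreal_leI powr_mono2 simp: top_unique)

lemma ennreal_powr_powr: "ennreal_powr (ennreal_powr x r) s = ennreal_powr x (r * s)"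
  by (cases x) (auto simp: powr_powr)

lemma ennreal_powr_mult: "ennreal_powr (x * y) r = ennreal_powr x r * ennreal_powr y r"
proof (cases x; cases y)
  fix a b assume "0 \<le> a" "0 \<le> b" "x = ennreal a" "y = ennreal b"
  then show ?thesis by (simp add: ennreal_mult[symmetric] powr_mult)
next
  fix a assume a: "0 \<le> a" "x = ennreal a" "y = top"
  then show ?thesis by (cases "a = 0") (auto simp: ennreal_mult_top)
next
  fix a assume a: "0 \<le> a" "y = ennreal a" "x = top"
  then show ?thesis by (cases "a = 0") (auto simp: ennreal_top_mult)
qed (auto simp: ennreal_top_mult ennreal_powr_def)

lemma ennreal_powr_add: "ennreal_powr x r * ennreal_powr x s = ennreal_powr x (r + s)"
  by (cases x) (auto simp: powr_add ennreal_mult ennreal_top_mult ennreal_powr_def)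

lemma ennreal_powr_le_iff:
  assumes "0 < r" shows "ennreal_powr x r \<le> y \<longleftrightarrow> x \<le> ennreal_powr y (1 / r)"
  using ennreal_powr_mono[of "ennreal_powr x r" y "1 / r"] ennreal_powr_mono[of x "ennreal_powr y (1/r)" r] assms
  by (auto simp: ennreal_powr_powr)

text \<open>For a positive exponent the power is an order isomorphism of the extended half line,
  with inverse exponent \<open>1 / r\<close>, so it commutes with arbitrary suprema.\<close>

lemma ennreal_powr_SUP:
  assumes "0 < r" shows "ennreal_powr (SUP i\<in>I. f i) r = (SUP i\<in>I. ennreal_powr (f i) r)"
proof (rule antisym)
  show "ennreal_powr (SUP i\<in>I. f i) r \<le> (SUP i\<in>I. ennreal_powr (f i) r)"
    unfolding ennreal_powr_le_iff[OF assms]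
    by (rule SUP_least, subst ennreal_powr_le_iff[OF assms, symmetric]) (auto intro: SUP_upper)
  show "(SUP i\<in>I. ennreal_powr (f i) r) \<le> ennreal_powr (SUP i\<in>I. f i) r"
    using assms by (intro SUP_least ennreal_powr_mono SUP_upper) auto
qed

lemma borel_measurable_ennreal_powr [measurable (raw)]:
  assumes "f \<in> borel_measurable M" "g \<in> borel_measurable M"
  shows "(\<lambda>x. ennreal_powr (f x) (g x)) \<in> borel_measurable M"
  unfolding ennreal_powr_def using assms by measurable

lemma ennreal_Young:
  fixes x y :: ennreal and a b :: real
  assumes a: "a > 1" and b: "b > 1" and ab: "1 / a + 1 / b = 1"
  shows "x * y \<le> ennreal (1 / a) * ennreal_powr x a + ennreal (1 / b) * ennreal_powr y b"
proof (cases x; cases y)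
  fix u v assume u: "0 \<le> u" "x = ennreal u" and v: "0 \<le> v" "y = ennreal v"
  have "u * v \<le> u powr a / a + v powr b / b"
    using Youngs_inequality[of a b u v] a b ab u v by simp
  then show ?thesis using u v a b
    by (simp add: ennreal_mult[symmetric] ennreal_plus[symmetric] del: ennreal_plus)
qed (use a b in \<open>auto simp: ennreal_mult_top top_unique ennreal_powr_def\<close>)

text \<open>Both factors are divided by their norms and Young's inequality is integrated. If a norm
  is 0, the product vanishes almost everywhere; if both are nonzero and one is infinite, the bound
  is infinite.\<close>

lemma nn_integral_Holder:
  assumes f [measurable]: "f \<in> borel_measurable M" and g [measurable]: "g \<in> borel_measurable M"
    and a: "a > 1" and b: "b > 1" and ab: "1 / a + 1 / b = (1::real)"
  shows "(\<integral>\<^sup>+x. f x * g x \<partial>M) \<le> ennreal_powr (\<integral>\<^sup>+x. ennreal_powr (f x) a \<partial>M) (1 / a)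
           * ennreal_powr (\<integral>\<^sup>+x. ennreal_powr (g x) b \<partial>M) (1 / b)"
    (is "_ \<le> ennreal_powr ?F _ * ennreal_powr ?G _")
proof -
  have triv: "(\<integral>\<^sup>+x. f x * g x \<partial>M) = 0" if "?F = 0 \<or> ?G = 0"
    using that by (subst nn_integral_0_iff_AE) (auto simp: nn_integral_0_iff_AE)
  consider "?F = 0 \<or> ?G = 0" | "?F \<noteq> 0" "?G \<noteq> 0" "?F = \<infinity> \<or> ?G = \<infinity>" | "?F \<noteq> 0" "?G \<noteq> 0" "?F < \<infinity>" "?G < \<infinity>"
    unfolding infinity_ennreal_def less_top[symmetric] by blast
  then show ?thesis
  proof cases
    case 1 then show ?thesis using triv by simp
  next
    case 2 then show ?thesis by (auto simp: ennreal_top_mult ennreal_mult_top)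
  next
    case 3
    obtain A where A: "?F = ennreal A" "A > 0" using 3 by (cases ?F) (auto simp: less_le)
    obtain B where B: "?G = ennreal B" "B > 0" using 3 by (cases ?G) (auto simp: less_le)
    define al where "al = A powr (1 / a)"
    define be where "be = B powr (1 / b)"
    have pos: "al > 0" "be > 0" using A B by (auto simp: al_def be_def)
    have al: "al powr a = A" "be powr b = B" using A B a b by (auto simp: al_def be_def powr_powr)
    have inv: "ennreal (1 / A) * ?F = 1" "ennreal (1 / B) * ?G = 1"
      using A B by (auto simp: ennreal_mult[symmetric])
    have pa: "ennreal_powr (ennreal (1 / al) * f x) a = ennreal (1 / A) * ennreal_powr (f x) a" for x
      using pos al by (simp add: ennreal_powr_mult powr_divide)
    have pb: "ennreal_powr (ennreal (1 / be) * g x) b = ennreal (1 / B) * ennreal_powr (g x) b" for x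
      using pos al by (simp add: ennreal_powr_mult powr_divide)
    have "ennreal (1 / al) * ennreal (1 / be) * (\<integral>\<^sup>+x. f x * g x \<partial>M) =
        (\<integral>\<^sup>+x. (ennreal (1 / al) * f x) * (ennreal (1 / be) * g x) \<partial>M)"
      by (subst nn_integral_cmult[symmetric]) (auto simp: mult_ac)
    also have "\<dots> \<le> (\<integral>\<^sup>+x. ennreal (1 / a) * (ennreal (1 / A) * ennreal_powr (f x) a)
          + ennreal (1 / b) * (ennreal (1 / B) * ennreal_powr (g x) b) \<partial>M)"
      by (intro nn_integral_mono order_trans[OF ennreal_Young[OF a b ab]]) (simp add: pa pb)
    also have "\<dots> = ennreal (1 / a) * (ennreal (1 / A) * ?F) + ennreal (1 / b) * (ennreal (1 / B) * ?G)"
      by (simp add: nn_integral_add nn_integral_cmult)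
    also have "\<dots> = 1" using a b ab by (simp add: inv ennreal_plus[symmetric] del: ennreal_plus)
    finally have *: "ennreal (1 / al) * ennreal (1 / be) * (\<integral>\<^sup>+x. f x * g x \<partial>M) \<le> 1" .
    have "(\<integral>\<^sup>+x. f x * g x \<partial>M) = (ennreal al * ennreal be) * (ennreal (1 / al) * ennreal (1 / be)) * (\<integral>\<^sup>+x. f x * g x \<partial>M)"
      using pos by (simp add: ennreal_mult[symmetric])
    also have "\<dots> \<le> (ennreal al * ennreal be) * 1"
      unfolding mult.assoc[of "ennreal al * ennreal be"] using * by (intro mult_left_mono) auto
    also have "\<dots> = ennreal_powr ?F (1 / a) * ennreal_powr ?G (1 / b)"
      using A B by (simp add: al_def be_def)
    finally show ?thesis .
  qed
qed

section \<open>Power integrals and the layer cake formula\<close>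

lemma nn_integral_powr_from_0:
  assumes "-1 < e" "0 \<le> c"
  shows "(\<integral>\<^sup>+t. ennreal (t powr e) * indicator {0<..<c} t \<partial>lborel) = ennreal (c powr (e + 1) / (e + 1))"
proof -
  have "(\<integral>\<^sup>+t. ennreal (t powr e) * indicator {0<..<c} t \<partial>lborel) = (\<integral>\<^sup>+t. ennreal (t powr e) * indicator {0..c} t \<partial>lborel)"
  proof (rule nn_integral_cong_AE)
    have "AE t in lborel. t \<noteq> c \<and> t \<noteq> 0" using AE_lborel_singleton by auto
    then show "AE x in lborel. ennreal (x powr e) * indicator {0<..<c} x = ennreal (x powr e) * indicator {0..c} x"
      by eventually_elim (auto split: split_indicator)
  qed
  also have "\<dots> = ennreal (c powr (e + 1) / (e + 1))"
    by (subst nn_integral_has_integral_lebesgue[OF _ has_integral_powr_from_0[OF assms], symmetric])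
      (auto intro!: nn_integral_cong split: split_indicator)
  finally show ?thesis .
qed

lemma nn_integral_powr_to_inf:
  assumes "e < -1" "0 < c"
  shows "(\<integral>\<^sup>+t. ennreal (t powr e) * indicator {c..} t \<partial>lborel) = ennreal (c powr (e + 1) / (- e - 1))"
proof -
  have *: "-(c powr (e + 1)) / (e + 1) = c powr (e + 1) / (- e - 1)" using assms by (simp add: field_simps)
  show ?thesis
    unfolding *[symmetric]
    by (subst nn_integral_has_integral_lebesgue[OF _ has_integral_powr_to_inf[OF assms], symmetric])
      (auto intro!: nn_integral_cong split: split_indicator)
qed

text \<open>This is the integral of the derivative of \<open>t powr s\<close>. For
  \<open>x = top\<close> the integral is shown to be at least every \<open>n\<close>, by restricting
  it to \<open>t < n powr (1 / s)\<close>.\<close>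

lemma ennreal_powr_layer:
  assumes s: "s > 0"
  shows "(\<integral>\<^sup>+t. ennreal (s * t powr (s - 1)) * indicator {t. 0 < t \<and> ennreal t < x} t \<partial>lborel) = ennreal_powr x s"
proof -
  have *: "(\<integral>\<^sup>+t. ennreal (s * t powr (s - 1)) * indicator {0<..<c} t \<partial>lborel) = ennreal (c powr s)" if "c \<ge> 0" for c
  proof -
    have "(\<integral>\<^sup>+t. ennreal (s * t powr (s - 1)) * indicator {0<..<c} t \<partial>lborel)
      = (\<integral>\<^sup>+t. ennreal s * (ennreal (t powr (s - 1)) * indicator {0<..<c} t) \<partial>lborel)"
      using s by (simp add: ennreal_mult mult.assoc)
    also have "\<dots> = ennreal (c powr s)"
      using nn_integral_powr_from_0[of "s - 1" c] s that
      by (simp add: nn_integral_cmult ennreal_mult[symmetric])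
    finally show ?thesis .
  qed
  show ?thesis
  proof (cases x)
    case (real c)
    then have "{t. 0 < t \<and> ennreal t < x} = {0<..<c}" by (auto simp: ennreal_less_iff)
    then show ?thesis using * real by simp
  next
    case top
    let ?I = "\<integral>\<^sup>+t. ennreal (s * t powr (s - 1)) * indicator {t. 0 < t \<and> ennreal t < x} t \<partial>lborel"
    have "ennreal n \<le> (\<integral>\<^sup>+t. ennreal (s * t powr (s - 1)) * indicator {t. 0 < t \<and> ennreal t < x} t \<partial>lborel)"
      if n: "n > 0" for n
    proof -
      have "ennreal n = (\<integral>\<^sup>+t. ennreal (s * t powr (s - 1)) * indicator {0<..<n powr (1 / s)} t \<partial>lborel)"
        using *[of "n powr (1/s)"] s n by (simp add: powr_powr)
      also have "\<dots> \<le> ?I"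
        by (intro nn_integral_mono mult_left_mono) (auto simp: top split: split_indicator)
      finally show ?thesis .
    qed
    note le = this
    have "z = top" if z: "\<And>n. n > 0 \<Longrightarrow> ennreal n \<le> z" for z
    proof (cases z)
      case (real b)
      from z[of "b + 1"] real show ?thesis by (simp add: ennreal_le_iff del: ennreal_plus)
    qed
    from this[OF le] have "?I = top" .
    then show ?thesis using top by simp
  qed
qed

text \<open>\<open>ennreal_powr_layer\<close> is applied to each value of \<open>F\<close>, and
  Tonelli's theorem exchanges the integrals over the space and over the levels.\<close>

lemma nn_integral_layer_cake:
  assumes "sigma_finite_measure M" and F [measurable]: "F \<in> borel_measurable M" and s: "s > 0"
  shows "(\<integral>\<^sup>+x. ennreal_powr (F x) s \<partial>M) =
    (\<integral>\<^sup>+t. ennreal (s * t powr (s - 1)) * indicator {0<..} t * emeasure M {x \<in> space M. ennreal t < F x} \<partial>lborel)"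
proof -
  interpret sigma_finite_measure M by fact
  interpret P: pair_sigma_finite M lborel by unfold_locales
  have m [measurable]: "Measurable.pred (M \<Otimes>\<^sub>M lborel) (\<lambda>p. ennreal (snd p) < F (fst p))"
    by measurable
  have "(\<integral>\<^sup>+x. ennreal_powr (F x) s \<partial>M) =
     (\<integral>\<^sup>+x. (\<integral>\<^sup>+t. ennreal (s * t powr (s - 1)) * (indicator {0<..} t * indicator {p\<in>space (M \<Otimes>\<^sub>M lborel). ennreal (snd p) < F (fst p)} (x, t)) \<partial>lborel) \<partial>M)"
    by (intro nn_integral_cong, subst ennreal_powr_layer[OF s, symmetric])
      (auto intro!: nn_integral_cong simp: space_pair_measure split: split_indicator)
  also have "\<dots> = (\<integral>\<^sup>+t. (\<integral>\<^sup>+x. ennreal (s * t powr (s - 1)) * (indicator {0<..} t * indicator {p\<in>space (M \<Otimes>\<^sub>M lborel). ennreal (snd p) < F (fst p)} (x, t)) \<partial>M) \<partial>lborel)"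
    by (rule P.Fubini'[symmetric]) measurable
  also have "\<dots> = (\<integral>\<^sup>+t. ennreal (s * t powr (s - 1)) * indicator {0<..} t * emeasure M {x \<in> space M. ennreal t < F x} \<partial>lborel)"
  proof (rule nn_integral_cong)
    fix t :: real
    have "(\<integral>\<^sup>+x. ennreal (s * t powr (s - 1)) * (indicator {0<..} t * indicator {p\<in>space (M \<Otimes>\<^sub>M lborel). ennreal (snd p) < F (fst p)} (x, t)) \<partial>M)
      = (\<integral>\<^sup>+x. (ennreal (s * t powr (s - 1)) * indicator {0<..} t) * indicator {x \<in> space M. ennreal t < F x} x \<partial>M)"
      by (intro nn_integral_cong) (auto simp: space_pair_measure split: split_indicator)
    also have "\<dots> = ennreal (s * t powr (s - 1)) * indicator {0<..} t * emeasure M {x \<in> space M. ennreal t < F x}"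
      by (subst nn_integral_cmult_indicator) auto
    finally show "(\<integral>\<^sup>+x. ennreal (s * t powr (s - 1)) * (indicator {0<..} t * indicator {p\<in>space (M \<Otimes>\<^sub>M lborel). ennreal (snd p) < F (fst p)} (x, t)) \<partial>M) = \<dots>" .
  qed
  finally show ?thesis .
qed

section \<open>The strong maximal inequality\<close>

definition avg1 :: "real \<Rightarrow> (real \<Rightarrow> ennreal) \<Rightarrow> real \<Rightarrow> ennreal" where
  "avg1 a \<phi> x = ennreal (1 / (2 * a)) * (\<integral>\<^sup>+y. \<phi> y * indicator {x - a..x + a} y \<partial>lborel)"

lemma borel_measurable_avg1 [measurable (raw)]:
  assumes [measurable]: "case_prod \<phi> \<in> borel_measurable (M \<Otimes>\<^sub>M borel)" "f \<in> borel_measurable M"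
  shows "(\<lambda>u. avg1 a (\<phi> u) (f u)) \<in> borel_measurable M"
proof -
  have "(\<lambda>u. \<integral>\<^sup>+y. \<phi> u y * indicator {f u - a..f u + a} y \<partial>lborel) \<in> borel_measurable M"
    unfolding indicator_def atLeastAtMost_iff by measurable
  then show ?thesis unfolding avg1_def by measurable
qed

text \<open>Every point of the level set is the centre of an interval on which the integral of
  \<open>\<phi>\<close> exceeds \<open>l\<close> times the length. Vitali's covering lemma selects
  disjoint ones whose fivefold enlargements still cover the level set, and disjointness bounds the
  sum of the integrals. Finiteness of \<open>A\<close> bounds the radii.\<close>

lemma avg1_weak:
  assumes A: "finite A" "\<And>a. a \<in> A \<Longrightarrow> 0 < a" and \<phi> [measurable]: "\<phi> \<in> borel_measurable borel" and l: "l > 0"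
  shows "ennreal l * emeasure lborel {x. \<exists>a\<in>A. ennreal l < avg1 a \<phi> x} \<le> 5 * (\<integral>\<^sup>+y. \<phi> y \<partial>lborel)"
proof -
  define E where "E = {x. \<exists>a\<in>A. ennreal l < avg1 a \<phi> x}"
  define K where "K = {p. snd p \<in> A \<and> ennreal l < avg1 (snd p) \<phi> (fst p)}"
  have E [measurable]: "E \<in> sets borel"
  proof -
    have "E = (\<Union>a\<in>A. {x \<in> space borel. ennreal l < avg1 a \<phi> x})" by (auto simp: E_def)
    also have "\<dots> \<in> sets borel" using A by (intro sets.finite_UN) measurable
    finally show ?thesis .
  qed
  have EK: "E \<subseteq> (\<Union>i\<in>K. cball (fst i) (snd i))"
    using A(2) by (force simp: E_def K_def)
  have rK: "0 < snd i \<and> snd i \<le> Max A" if "i \<in> K" for i using that A by (auto simp: K_def)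
  obtain C where C: "countable C" "C \<subseteq> K"
    "pairwise (\<lambda>i j. disjnt (cball (fst i) (snd i)) (cball (fst j) (snd j))) C"
    "E \<subseteq> (\<Union>i\<in>C. cball (fst i) (5 * snd i))"
    by (rule Vitali_covering_lemma_cballs[OF EK rK]) auto
  define X where "X i n = (if n \<in> to_nat_on C ` C then cball (fst (from_nat_into C n)) (i * snd (from_nat_into C n)) else {})"
    for i :: real and n
  have inv: "from_nat_into C n \<in> C" "to_nat_on C (from_nat_into C n) = n" if "n \<in> to_nat_on C ` C" for n
    using that C(1) by auto
  have Xm [measurable]: "X i n \<in> sets borel" for i n by (auto simp: X_def)
  have disj: "disjoint_family (X 1)"
    unfolding disjoint_family_on_def
  proof (intro ballI impI)
    fix m n :: nat assume mn: "m \<noteq> n"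
    show "X 1 m \<inter> X 1 n = {}"
    proof (cases "m \<in> to_nat_on C ` C \<and> n \<in> to_nat_on C ` C")
      case True
      then have "from_nat_into C m \<noteq> from_nat_into C n" using inv mn by metis
      then show ?thesis using C(3) inv True by (auto simp: X_def pairwise_def disjnt_def)
    qed (auto simp: X_def)
  qed
  have "emeasure lborel E \<le> emeasure lborel (\<Union>n. X 5 n)"
  proof (rule emeasure_mono)
    show "E \<subseteq> (\<Union>n. X 5 n)"
    proof
      fix x assume "x \<in> E"
      then obtain i where i: "i \<in> C" "x \<in> cball (fst i) (5 * snd i)" using C(4) by auto
      then have "x \<in> X 5 (to_nat_on C i)" using C(1) by (auto simp: X_def)
      then show "x \<in> (\<Union>n. X 5 n)" by blast
    qed
  qed measurable
  also have "\<dots> \<le> (\<Sum>n. emeasure lborel (X 5 n))"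
    by (intro emeasure_subadditive_countably) auto
  finally have 1: "emeasure lborel E \<le> (\<Sum>n. emeasure lborel (X 5 n))" .
  have 2: "ennreal l * emeasure lborel (X 5 n) \<le> 5 * emeasure (density lborel \<phi>) (X 1 n)" for n
  proof (cases "n \<in> to_nat_on C ` C")
    case True
    obtain x a where xa: "from_nat_into C n = (x, a)" by fastforce
    then have "(x, a) \<in> K" using inv(1)[OF True] C(2) by auto
    then have a: "a > 0" "ennreal l < avg1 a \<phi> x" using A by (auto simp: K_def)
    have X: "X i n = {x - i * a..x + i * a}" for i using True xa by (auto simp: X_def cball_eq_atLeastAtMost)
    have "ennreal (2 * a) * ennreal l \<le> ennreal (2 * a) * avg1 a \<phi> x"
      using a by (intro mult_left_mono) auto
    also have "\<dots> = (ennreal (2 * a) * ennreal (1 / (2 * a))) * (\<integral>\<^sup>+y. \<phi> y * indicator {x - a..x + a} y \<partial>lborel)"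
      unfolding avg1_def by (simp add: mult.assoc)
    also have "ennreal (2 * a) * ennreal (1 / (2 * a)) = 1" using a by (simp add: ennreal_mult[symmetric])
    finally have *: "ennreal (2 * a) * ennreal l \<le> (\<integral>\<^sup>+y. \<phi> y * indicator {x - a..x + a} y \<partial>lborel)" by simp
    have "ennreal l * emeasure lborel (X 5 n) = 5 * (ennreal (2 * a) * ennreal l)"
    proof -
      have "ennreal l * emeasure lborel (X 5 n) = ennreal (10 * a * l)"
        using a l by (simp add: X ennreal_mult[symmetric] mult_ac)
      also have "\<dots> = ennreal 5 * (ennreal (2 * a) * ennreal l)"
        using a l ennreal_mult[of 5 "2 * a * l"] ennreal_mult[of "2 * a" l] by (simp add: mult.assoc)
      finally show ?thesis by simp
    qed
    also have "\<dots> \<le> 5 * emeasure (density lborel \<phi>) (X 1 n)"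
      using * by (intro mult_left_mono) (auto simp: emeasure_density X)
    finally show ?thesis .
  qed (simp add: X_def)
  have "ennreal l * emeasure lborel E \<le> ennreal l * (\<Sum>n. emeasure lborel (X 5 n))"
    using 1 by (rule mult_left_mono) simp
  also have "\<dots> = (\<Sum>n. ennreal l * emeasure lborel (X 5 n))" by simp
  also have "\<dots> \<le> (\<Sum>n. 5 * emeasure (density lborel \<phi>) (X 1 n))" by (intro suminf_le 2) auto
  also have "\<dots> = 5 * (\<Sum>n. emeasure (density lborel \<phi>) (X 1 n))" by simp
  also have "(\<Sum>n. emeasure (density lborel \<phi>) (X 1 n)) = emeasure (density lborel \<phi>) (\<Union>n. X 1 n)"
    using disj by (intro suminf_emeasure) auto
  also have "\<dots> \<le> emeasure (density lborel \<phi>) UNIV" by (intro emeasure_mono) auto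
  also have "\<dots> = (\<integral>\<^sup>+y. \<phi> y \<partial>lborel)" by (subst emeasure_density) auto
  finally show ?thesis by (simp add: E_def mult_left_mono)
qed

text \<open>The 10 is the weak-type constant 5, doubled because levels are halved. The other factors
  come from integrating \<open>s * t powr (s - 2)\<close> up to twice the value of the
  function.\<close>

definition HL_const :: "real \<Rightarrow> real" where
  "HL_const s = 10 * (s / (s - 1)) * 2 powr (s - 1)"

lemma HL_const_nonneg: "s > 1 \<Longrightarrow> 0 \<le> HL_const s"
  by (simp add: HL_const_def)

text \<open>Values up to the level contribute at most the level to any average, so a larger average
  must come from the values above it.\<close>

lemma avg1_split:
  assumes a: "a > 0" and \<phi> [measurable]: "\<phi> \<in> borel_measurable borel"
  shows "avg1 a \<phi> x \<le> avg1 a (\<lambda>y. \<phi> y * indicator {y. ennreal l < \<phi> y} y) x + ennreal l"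
proof -
  have "avg1 a \<phi> x \<le> ennreal (1 / (2 * a)) * (\<integral>\<^sup>+y. \<phi> y * indicator {y. ennreal l < \<phi> y} y * indicator {x - a..x + a} y + ennreal l * indicator {x - a..x + a} y \<partial>lborel)"
    unfolding avg1_def by (intro mult_left_mono nn_integral_mono) (auto split: split_indicator)
  also have "\<dots> = avg1 a (\<lambda>y. \<phi> y * indicator {y. ennreal l < \<phi> y} y) x + ennreal (1 / (2 * a)) * (ennreal l * ennreal (2 * a))"
    using a by (subst nn_integral_add) (auto simp: avg1_def distrib_left nn_integral_cmult_indicator)
  also have "ennreal (1 / (2 * a)) * (ennreal l * ennreal (2 * a)) = (ennreal (1 / (2 * a)) * ennreal (2 * a)) * ennreal l"
    by (simp add: mult_ac)
  also have "\<dots> = ennreal l" using a by (simp add: ennreal_mult[symmetric])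
  finally show ?thesis .
qed

text \<open>Marcinkiewicz interpolation: at level \<open>t\<close> only the values above
  \<open>t / 2\<close> matter, and integrating the weak bound over the levels reassembles the power.
  The constant does not depend on \<open>A\<close>, so that later limits over growing families of
  rectangles are possible.\<close>

lemma avg1_strong:
  assumes A: "finite A" "\<And>a. a \<in> A \<Longrightarrow> 0 < a" and \<phi> [measurable]: "\<phi> \<in> borel_measurable borel" and s: "s > 1"
  shows "(\<integral>\<^sup>+x. ennreal_powr (SUP a\<in>A. avg1 a \<phi> x) s \<partial>lborel) \<le> ennreal (HL_const s) * (\<integral>\<^sup>+x. ennreal_powr (\<phi> x) s \<partial>lborel)"
proof -
  have [measurable]: "(\<lambda>x. SUP a\<in>A. avg1 a \<phi> x) \<in> borel_measurable borel"
    using A by (intro borel_measurable_SUP) (auto intro: countable_finite)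
  have weak: "ennreal t * emeasure lborel {x. ennreal t < (SUP a\<in>A. avg1 a \<phi> x)} \<le> 10 * (\<integral>\<^sup>+y. \<phi> y * indicator {y. ennreal (t / 2) < \<phi> y} y \<partial>lborel)"
    if t: "t > 0" for t
  proof -
    let ?\<psi> = "\<lambda>y. \<phi> y * indicator {y. ennreal (t/2) < \<phi> y} y"
    have "ennreal (t / 2) * emeasure lborel {x. ennreal t < (SUP a\<in>A. avg1 a \<phi> x)} \<le>
        ennreal (t / 2) * emeasure lborel {x. \<exists>a\<in>A. ennreal (t / 2) < avg1 a ?\<psi> x}"
    proof (intro mult_left_mono emeasure_mono subsetI CollectI)
      fix x assume "x \<in> {x. ennreal t < (SUP a\<in>A. avg1 a \<phi> x)}"
      then obtain a where a: "a \<in> A" "ennreal t < avg1 a \<phi> x" by (auto simp: less_SUP_iff)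
      have "ennreal (t / 2) + ennreal (t / 2) = ennreal t" using t by (simp add: ennreal_plus[symmetric] del: ennreal_plus)
      also have "\<dots> < avg1 a ?\<psi> x + ennreal (t / 2)"
        using a avg1_split[OF A(2)[OF a(1)] \<phi>, of x "t / 2"] by (rule_tac less_le_trans)
      finally have "ennreal (t / 2) < avg1 a ?\<psi> x"
        by (meson add_right_mono not_le)
      then show "\<exists>a\<in>A. ennreal (t / 2) < avg1 a ?\<psi> x" using a by blast
    next
      have "{x. \<exists>a\<in>A. ennreal (t / 2) < avg1 a ?\<psi> x} = (\<Union>a\<in>A. {x \<in> space borel. ennreal (t / 2) < avg1 a ?\<psi> x})" by auto
      also have "\<dots> \<in> sets borel" using A by (intro sets.finite_UN) measurable
      finally show "{x. \<exists>a\<in>A. ennreal (t / 2) < avg1 a ?\<psi> x} \<in> sets lborel" by simp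
    qed simp
    also have "\<dots> \<le> 5 * (\<integral>\<^sup>+y. ?\<psi> y \<partial>lborel)" using A t by (intro avg1_weak) auto
    finally have "2 * (ennreal (t / 2) * emeasure lborel {x. ennreal t < (SUP a\<in>A. avg1 a \<phi> x)}) \<le> 2 * (5 * (\<integral>\<^sup>+y. ?\<psi> y \<partial>lborel))"
      by (rule mult_left_mono) simp
    moreover have "2 * ennreal (t / 2) = ennreal t"
      using t ennreal_mult[of 2 "t / 2"] by simp
    ultimately show ?thesis by (simp add: mult.assoc[symmetric])
  qed
  have "(\<integral>\<^sup>+x. ennreal_powr (SUP a\<in>A. avg1 a \<phi> x) s \<partial>lborel)
    = (\<integral>\<^sup>+t. ennreal (s * t powr (s - 1)) * indicator {0<..} t * emeasure lborel {x \<in> space lborel. ennreal t < (SUP a\<in>A. avg1 a \<phi> x)} \<partial>lborel)"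
    using s by (intro nn_integral_layer_cake) (auto intro: lborel.sigma_finite_measure_axioms)
  also have "\<dots> \<le> (\<integral>\<^sup>+t. (\<integral>\<^sup>+y. ennreal (10 * s * t powr (s - 2)) * indicator {0<..} t * (\<phi> y * indicator {p. ennreal (fst p / 2) < \<phi> (snd p)} (t, y)) \<partial>lborel) \<partial>lborel)"
  proof (rule nn_integral_mono)
    fix t :: real
    show "ennreal (s * t powr (s - 1)) * indicator {0<..} t * emeasure lborel {x \<in> space lborel. ennreal t < (SUP a\<in>A. avg1 a \<phi> x)} \<le>
      (\<integral>\<^sup>+y. ennreal (10 * s * t powr (s - 2)) * indicator {0<..} t * (\<phi> y * indicator {p. ennreal (fst p / 2) < \<phi> (snd p)} (t, y)) \<partial>lborel)"
    proof (cases "t > 0")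
      case True
      have "t powr (s - 1) = t powr (s - 2) * t" using True powr_add[of t "s - 2" 1] by simp
      then have "ennreal (s * t powr (s - 1)) * emeasure lborel {x. ennreal t < (SUP a\<in>A. avg1 a \<phi> x)} =
        ennreal (s * t powr (s - 2)) * (ennreal t * emeasure lborel {x. ennreal t < (SUP a\<in>A. avg1 a \<phi> x)})"
        using True s by (simp add: ennreal_mult[symmetric] mult.assoc[symmetric])
      also have "\<dots> \<le> ennreal (s * t powr (s - 2)) * (10 * (\<integral>\<^sup>+y. \<phi> y * indicator {y. ennreal (t / 2) < \<phi> y} y \<partial>lborel))"
        using weak[OF True] by (rule mult_left_mono) simp
      also have "\<dots> = ennreal (10 * s * t powr (s - 2)) * (\<integral>\<^sup>+y. \<phi> y * indicator {y. ennreal (t / 2) < \<phi> y} y \<partial>lborel)"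
        using s ennreal_mult[of 10 "s * t powr (s - 2)"] by (simp add: mult_ac)
      also have "\<dots> = (\<integral>\<^sup>+y. ennreal (10 * s * t powr (s - 2)) * (\<phi> y * indicator {y. ennreal (t / 2) < \<phi> y} y) \<partial>lborel)"
        by (subst nn_integral_cmult) auto
      also have "\<dots> = (\<integral>\<^sup>+y. ennreal (10 * s * t powr (s - 2)) * indicator {0<..} t * (\<phi> y * indicator {p. ennreal (fst p / 2) < \<phi> (snd p)} (t, y)) \<partial>lborel)"
        using True by (intro nn_integral_cong) (auto split: split_indicator)
      finally show ?thesis using True by simp
    qed simp
  qed
  also have "\<dots> = (\<integral>\<^sup>+y. (\<integral>\<^sup>+t. ennreal (10 * s * t powr (s - 2)) * indicator {0<..} t * (\<phi> y * indicator {p. ennreal (fst p / 2) < \<phi> (snd p)} (t, y)) \<partial>lborel) \<partial>lborel)"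
    by (rule lborel_pair.Fubini') measurable
  also have "\<dots> = (\<integral>\<^sup>+y. ennreal (HL_const s) * ennreal_powr (\<phi> y) s \<partial>lborel)"
  proof (rule nn_integral_cong)
    fix y :: real
    have "(\<integral>\<^sup>+t. ennreal (10 * s * t powr (s - 2)) * indicator {0<..} t * (\<phi> y * indicator {p. ennreal (fst p / 2) < \<phi> (snd p)} (t, y)) \<partial>lborel)
      = (\<integral>\<^sup>+t. (\<phi> y * ennreal (10 * s / (s - 1))) * (ennreal ((s - 1) * t powr (s - 1 - 1)) * indicator {t. 0 < t \<and> ennreal t < 2 * \<phi> y} t) \<partial>lborel)"
    proof (rule nn_integral_cong)
      fix t :: real
      have "ennreal (t / 2) < \<phi> y \<longleftrightarrow> ennreal t < 2 * \<phi> y" if "t > 0"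
      proof (cases "\<phi> y")
        case (real r)
        then have "2 * \<phi> y = ennreal (2 * r)" by (simp add: ennreal_mult)
        with real that show ?thesis by (auto simp: ennreal_less_iff)
      qed (auto simp: ennreal_mult_top)
      moreover have "ennreal (10 * s * t powr (s - 2)) = ennreal (10 * s / (s - 1)) * ennreal ((s - 1) * t powr (s - 1 - 1))"
        using s by (subst ennreal_mult[symmetric]) auto
      ultimately show "ennreal (10 * s * t powr (s - 2)) * indicator {0<..} t * (\<phi> y * indicator {p. ennreal (fst p / 2) < \<phi> (snd p)} (t, y))
        = (\<phi> y * ennreal (10 * s / (s - 1))) * (ennreal ((s - 1) * t powr (s - 1 - 1)) * indicator {t. 0 < t \<and> ennreal t < 2 * \<phi> y} t)"
        by (auto split: split_indicator simp: mult_ac)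
    qed
    also have "\<dots> = (\<phi> y * ennreal (10 * s / (s - 1))) * ennreal_powr (2 * \<phi> y) (s - 1)"
      using s by (subst nn_integral_cmult, measurable, subst ennreal_powr_layer) auto
    also have "ennreal_powr (2 * \<phi> y) (s - 1) = ennreal (2 powr (s - 1)) * ennreal_powr (\<phi> y) (s - 1)"
      using ennreal_powr_ennreal[of 2 "s - 1"] by (simp add: ennreal_powr_mult)
    also have "(\<phi> y * ennreal (10 * s / (s - 1))) * (ennreal (2 powr (s - 1)) * ennreal_powr (\<phi> y) (s - 1))
      = (ennreal (10 * s / (s - 1)) * ennreal (2 powr (s - 1))) * (ennreal_powr (\<phi> y) 1 * ennreal_powr (\<phi> y) (s - 1))"
      by (simp add: mult_ac)
    also have "\<dots> = ennreal (HL_const s) * ennreal_powr (\<phi> y) s"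
      unfolding ennreal_powr_add using s by (simp add: ennreal_mult[symmetric] HL_const_def)
    finally show "(\<integral>\<^sup>+t. ennreal (10 * s * t powr (s - 2)) * indicator {0<..} t * (\<phi> y * indicator {p. ennreal (fst p / 2) < \<phi> (snd p)} (t, y)) \<partial>lborel)
      = ennreal (HL_const s) * ennreal_powr (\<phi> y) s" .
  qed
  also have "\<dots> = ennreal (HL_const s) * (\<integral>\<^sup>+y. ennreal_powr (\<phi> y) s \<partial>lborel)"
    by (subst nn_integral_cmult) auto
  finally show ?thesis .
qed

section \<open>Product structure of the plane and averages over rectangles\<close>

abbreviation pt :: "real \<Rightarrow> real \<Rightarrow> real^2" where "pt x y \<equiv> vector [x, y]"

lemma borel_measurable_pt [measurable (raw)]:
  assumes [measurable]: "f \<in> borel_measurable M" "g \<in> borel_measurable M"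
  shows "(\<lambda>x. pt (f x) (g x)) \<in> borel_measurable M"
proof -
  have "pt a b = a *\<^sub>R axis 1 1 + b *\<^sub>R axis 2 1" for a b
    by (simp add: vec_eq_iff forall_2 axis_def)
  then show ?thesis by simp
qed

lemma lborel_real2: "(lborel :: (real^2) measure) = distr (lborel \<Otimes>\<^sub>M lborel) borel (\<lambda>(x, y). pt x y)"
proof (rule lborel_eqI)
  fix l u :: "real^2" assume le: "\<And>b. b \<in> Basis \<Longrightarrow> l \<bullet> b \<le> u \<bullet> b"
  have le': "l $ 1 \<le> u $ 1" "l $ 2 \<le> u $ 2"
    using le[of "axis 1 1"] le[of "axis 2 1"] by (auto simp: inner_axis)
  have "(\<lambda>(x, y). pt x y) -` box l u \<inter> space (lborel \<Otimes>\<^sub>M lborel) = {l$1<..<u$1} \<times> {l$2<..<u$2}"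
    by (auto simp: mem_box_cart forall_2 space_pair_measure)
  then have "emeasure (distr (lborel \<Otimes>\<^sub>M lborel) borel (\<lambda>(x, y). pt x y)) (box l u)
    = emeasure lborel {l$1<..<u$1} * emeasure lborel {l$2<..<u$2}"
    by (subst emeasure_distr) (auto simp: lborel.emeasure_pair_measure_Times)
  also have "\<dots> = ennreal (\<Prod>b\<in>Basis. (u - l) \<bullet> b)"
    using le' by (simp add: ennreal_mult[symmetric] Basis_vec_def UNIV_2 prod.UNION_disjoint axis_eq_axis inner_axis)
  finally show "emeasure (distr (lborel \<Otimes>\<^sub>M lborel) borel (\<lambda>(x, y). pt x y)) (box l u) = ennreal (\<Prod>b\<in>Basis. (u - l) \<bullet> b)" .
qed simp

lemma nn_integral_real2:
  assumes [measurable]: "f \<in> borel_measurable borel"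
  shows "(\<integral>\<^sup>+w. f w \<partial>(lborel :: (real^2) measure)) = (\<integral>\<^sup>+x. (\<integral>\<^sup>+y. f (pt x y) \<partial>lborel) \<partial>lborel)"
    and "(\<integral>\<^sup>+w. f w \<partial>(lborel :: (real^2) measure)) = (\<integral>\<^sup>+y. (\<integral>\<^sup>+x. f (pt x y) \<partial>lborel) \<partial>lborel)"
proof -
  show *: "(\<integral>\<^sup>+w. f w \<partial>(lborel :: (real^2) measure)) = (\<integral>\<^sup>+x. (\<integral>\<^sup>+y. f (pt x y) \<partial>lborel) \<partial>lborel)"
    by (subst lborel_real2, subst nn_integral_distr)
      (auto simp: lborel.nn_integral_fst[symmetric] split_beta')
  show "(\<integral>\<^sup>+w. f w \<partial>(lborel :: (real^2) measure)) = (\<integral>\<^sup>+y. (\<integral>\<^sup>+x. f (pt x y) \<partial>lborel) \<partial>lborel)"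
    unfolding * by (rule lborel_pair.Fubini'[symmetric]) simp
qed

definition rkern :: "real^2 \<Rightarrow> real^2 \<Rightarrow> real" where
  "rkern v y = indicator (cbox (- v) v) y / (4 * (v $ 1) * (v $ 2))"

lemma borel_measurable_rkern [measurable]: "rkern v \<in> borel_measurable borel"
  unfolding rkern_def by measurable

definition avg2 :: "real^2 \<Rightarrow> (real^2 \<Rightarrow> ennreal) \<Rightarrow> real^2 \<Rightarrow> ennreal" where
  "avg2 v \<phi> x = (\<integral>\<^sup>+w. ennreal (rkern v (x - w)) * \<phi> w \<partial>lborel)"

lemma borel_measurable_avg2 [measurable (raw)]:
  assumes [measurable]: "\<phi> \<in> borel_measurable borel" "f \<in> borel_measurable M"
  shows "(\<lambda>u. avg2 v \<phi> (f u)) \<in> borel_measurable M"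
  unfolding avg2_def by measurable

text \<open>A rectangle is a product of intervals, so averaging over it is averaging in one
  coordinate after the other.\<close>

lemma avg2_eq:
  assumes v: "0 < v $ 1" "0 < v $ 2" and [measurable]: "\<phi> \<in> borel_measurable borel"
  shows "avg2 v \<phi> (pt x y) = avg1 (v $ 1) (\<lambda>u. avg1 (v $ 2) (\<lambda>w. \<phi> (pt u w)) y) x"
proof -
  have "avg2 v \<phi> (pt x y) = (\<integral>\<^sup>+a. (\<integral>\<^sup>+b. ennreal (rkern v (pt x y - pt a b)) * \<phi> (pt a b) \<partial>lborel) \<partial>lborel)"
    unfolding avg2_def by (subst nn_integral_real2) auto
  also have "\<dots> = (\<integral>\<^sup>+a. (\<integral>\<^sup>+b. ennreal (1 / (2 * v $ 1)) * (ennreal (1 / (2 * v $ 2)) * (\<phi> (pt a b) * indicator {y - v $ 2..y + v $ 2} b) * indicator {x - v $ 1..x + v $ 1} a) \<partial>lborel) \<partial>lborel)"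
  proof (intro nn_integral_cong)
    fix a b :: real
    have "rkern v (pt x y - pt a b) = (1 / (2 * v $ 1)) * (1 / (2 * v $ 2)) * indicator {y - v $ 2..y + v $ 2} b * indicator {x - v $ 1..x + v $ 1} a"
      by (auto simp: rkern_def mem_box_cart forall_2 split: split_indicator)
    then have "ennreal (rkern v (pt x y - pt a b)) = ennreal (1 / (2 * v $ 1)) * ennreal (1 / (2 * v $ 2)) * indicator {y - v $ 2..y + v $ 2} b * indicator {x - v $ 1..x + v $ 1} a"
      using v by (auto simp: ennreal_mult[symmetric] split: split_indicator)
    then show "ennreal (rkern v (pt x y - pt a b)) * \<phi> (pt a b) = ennreal (1 / (2 * v $ 1)) * (ennreal (1 / (2 * v $ 2)) * (\<phi> (pt a b) * indicator {y - v $ 2..y + v $ 2} b) * indicator {x - v $ 1..x + v $ 1} a)"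
      by (simp add: mult_ac)
  qed
  also have "\<dots> = (\<integral>\<^sup>+a. ennreal (1 / (2 * v $ 1)) * (avg1 (v $ 2) (\<lambda>w. \<phi> (pt a w)) y * indicator {x - v $ 1..x + v $ 1} a) \<partial>lborel)"
  proof (rule nn_integral_cong)
    fix a :: real
    let ?f = "\<lambda>b. \<phi> (pt a b) * indicator {y - v $ 2..y + v $ 2} b"
    have [measurable]: "?f \<in> borel_measurable lborel" by measurable
    show "(\<integral>\<^sup>+b. ennreal (1 / (2 * v $ 1)) * (ennreal (1 / (2 * v $ 2)) * ?f b * indicator {x - v $ 1..x + v $ 1} a) \<partial>lborel)
      = ennreal (1 / (2 * v $ 1)) * (avg1 (v $ 2) (\<lambda>w. \<phi> (pt a w)) y * indicator {x - v $ 1..x + v $ 1} a)"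
      unfolding avg1_def
      by (subst nn_integral_cmult, measurable, subst nn_integral_multc, measurable, subst nn_integral_cmult, measurable)
  qed
  also have "\<dots> = ennreal (1 / (2 * v $ 1)) * (\<integral>\<^sup>+a. avg1 (v $ 2) (\<lambda>w. \<phi> (pt a w)) y * indicator {x - v $ 1..x + v $ 1} a \<partial>lborel)"
    by (rule nn_integral_cmult) measurable
  also have "\<dots> = avg1 (v $ 1) (\<lambda>u. avg1 (v $ 2) (\<lambda>w. \<phi> (pt u w)) y) x"
    unfolding avg1_def[of "v $ 1"] ..
  finally show ?thesis .
qed

lemma avg1_mono:
  assumes "\<And>y. \<phi> y \<le> \<psi> y" shows "avg1 a \<phi> x \<le> avg1 a \<psi> x"
  unfolding avg1_def by (intro mult_left_mono nn_integral_mono mult_right_mono assms) auto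

text \<open>The maximal function over rectangles is dominated by the one-dimensional maximal
  function in the first coordinate applied to the one in the second. The side lengths thereby become
  independent of each other, and each coordinate costs a factor \<open>HL_const s\<close>.\<close>

lemma avg2_strong:
  assumes V: "finite V" "\<And>v. v \<in> V \<Longrightarrow> 0 < v $ 1 \<and> 0 < v $ 2" and \<phi> [measurable]: "\<phi> \<in> borel_measurable borel" and s: "s > 1"
  shows "(\<integral>\<^sup>+x. ennreal_powr (SUP v\<in>V. avg2 v \<phi> x) s \<partial>lborel) \<le> ennreal ((HL_const s)\<^sup>2) * (\<integral>\<^sup>+x. ennreal_powr (\<phi> x) s \<partial>lborel)"
proof -
  define A where "A = (\<lambda>v. v $ 1) ` V"
  define B where "B = (\<lambda>v. v $ 2) ` V"
  have A: "finite A" "\<And>a. a \<in> A \<Longrightarrow> 0 < a" and B: "finite B" "\<And>a. a \<in> B \<Longrightarrow> 0 < a"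
    using V by (auto simp: A_def B_def)
  define \<psi> where "\<psi> x y = (SUP b\<in>B. avg1 b (\<lambda>w. \<phi> (pt x w)) y)" for x y
  have \<psi> [measurable]: "(\<lambda>u. \<psi> (f u) (g u)) \<in> borel_measurable M"
    if [measurable]: "f \<in> borel_measurable M" "g \<in> borel_measurable M" for f g M
    unfolding \<psi>_def using B by (intro borel_measurable_SUP countable_finite) measurable
  have Vm [measurable]: "(\<lambda>x. SUP v\<in>V. avg2 v \<phi> x) \<in> borel_measurable borel"
    using V by (intro borel_measurable_SUP countable_finite) measurable
  have le: "(SUP v\<in>V. avg2 v \<phi> (pt x y)) \<le> (SUP a\<in>A. avg1 a (\<lambda>u. \<psi> u y) x)" for x y
  proof (rule SUP_least)
    fix v assume v: "v \<in> V"
    have "avg2 v \<phi> (pt x y) = avg1 (v $ 1) (\<lambda>u. avg1 (v $ 2) (\<lambda>w. \<phi> (pt u w)) y) x"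
      using V v by (intro avg2_eq) auto
    also have "\<dots> \<le> avg1 (v $ 1) (\<lambda>u. \<psi> u y) x"
      unfolding \<psi>_def using v by (intro avg1_mono SUP_upper) (auto simp: B_def)
    also have "\<dots> \<le> (SUP a\<in>A. avg1 a (\<lambda>u. \<psi> u y) x)"
      using v by (intro SUP_upper) (auto simp: A_def)
    finally show "avg2 v \<phi> (pt x y) \<le> (SUP a\<in>A. avg1 a (\<lambda>u. \<psi> u y) x)" .
  qed
  have "(\<integral>\<^sup>+x. ennreal_powr (SUP v\<in>V. avg2 v \<phi> x) s \<partial>lborel) = (\<integral>\<^sup>+y. (\<integral>\<^sup>+x. ennreal_powr (SUP v\<in>V. avg2 v \<phi> (pt x y)) s \<partial>lborel) \<partial>lborel)"
    by (rule nn_integral_real2) measurable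
  also have "\<dots> \<le> (\<integral>\<^sup>+y. (\<integral>\<^sup>+x. ennreal_powr (SUP a\<in>A. avg1 a (\<lambda>u. \<psi> u y) x) s \<partial>lborel) \<partial>lborel)"
    using s le by (intro nn_integral_mono ennreal_powr_mono) auto
  also have "\<dots> \<le> (\<integral>\<^sup>+y. ennreal (HL_const s) * (\<integral>\<^sup>+x. ennreal_powr (\<psi> x y) s \<partial>lborel) \<partial>lborel)"
    by (intro nn_integral_mono avg1_strong A s) measurable
  also have "\<dots> = ennreal (HL_const s) * (\<integral>\<^sup>+y. (\<integral>\<^sup>+x. ennreal_powr (\<psi> x y) s \<partial>lborel) \<partial>lborel)"
    by (rule nn_integral_cmult) measurable
  also have "(\<integral>\<^sup>+y. (\<integral>\<^sup>+x. ennreal_powr (\<psi> x y) s \<partial>lborel) \<partial>lborel) = (\<integral>\<^sup>+x. (\<integral>\<^sup>+y. ennreal_powr (\<psi> x y) s \<partial>lborel) \<partial>lborel)"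
  proof -
    show ?thesis by (rule lborel_pair.Fubini') measurable
  qed
  also have "\<dots> \<le> (\<integral>\<^sup>+x. ennreal (HL_const s) * (\<integral>\<^sup>+y. ennreal_powr (\<phi> (pt x y)) s \<partial>lborel) \<partial>lborel)"
    unfolding \<psi>_def by (intro nn_integral_mono avg1_strong B s) measurable
  also have "\<dots> = ennreal (HL_const s) * (\<integral>\<^sup>+x. (\<integral>\<^sup>+y. ennreal_powr (\<phi> (pt x y)) s \<partial>lborel) \<partial>lborel)"
    by (rule nn_integral_cmult) measurable
  also have "(\<integral>\<^sup>+x. (\<integral>\<^sup>+y. ennreal_powr (\<phi> (pt x y)) s \<partial>lborel) \<partial>lborel) = (\<integral>\<^sup>+x. ennreal_powr (\<phi> x) s \<partial>lborel)"
    by (rule nn_integral_real2(1)[symmetric]) measurable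
  finally show ?thesis
    using HL_const_nonneg[OF s] by (simp add: mult_left_mono ennreal_mult power2_eq_square mult.assoc)
qed

section \<open>The Hausdorff-Young inequality\<close>

lemma integrable_pair_mult:
  fixes f :: "'a \<Rightarrow> complex" and g :: "'b \<Rightarrow> complex"
  assumes "sigma_finite_measure M" "sigma_finite_measure N" and f: "integrable M f" and g: "integrable N g"
  shows "integrable (M \<Otimes>\<^sub>M N) (\<lambda>p. f (fst p) * g (snd p))"
    and "(LINT p|(M \<Otimes>\<^sub>M N). f (fst p) * g (snd p)) = (LINT x|M. f x) * (LINT y|N. g y)"
proof -
  interpret M: sigma_finite_measure M by fact
  interpret N: sigma_finite_measure N by fact
  interpret pair_sigma_finite M N by unfold_locales
  have [measurable]: "f \<in> borel_measurable M" "g \<in> borel_measurable N" using f g by auto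
  show *: "integrable (M \<Otimes>\<^sub>M N) (\<lambda>p. f (fst p) * g (snd p))"
    by (rule Fubini_integrable) (use f g in \<open>auto simp: norm_mult\<close>)
  show "(LINT p|(M \<Otimes>\<^sub>M N). f (fst p) * g (snd p)) = (LINT x|M. f x) * (LINT y|N. g y)"
    using integral_fst'[OF *] by simp
qed

lemma nn_integral_lborel_affine:
  fixes f :: "'a::euclidean_space \<Rightarrow> ennreal"
  assumes c: "c \<noteq> 0" and [measurable]: "f \<in> borel_measurable borel"
  shows "(\<integral>\<^sup>+x. f x \<partial>lborel) = ennreal (\<bar>c\<bar> ^ DIM('a)) * (\<integral>\<^sup>+x. f (t + c *\<^sub>R x) \<partial>lborel)"
  by (subst lborel_affine[OF c, of t])
    (simp add: nn_integral_density nn_integral_distr nn_integral_cmult ennreal_power)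

lemma nn_integral_lborel_shift:
  fixes f :: "'a::euclidean_space \<Rightarrow> ennreal"
  assumes [measurable]: "f \<in> borel_measurable borel"
  shows "(\<integral>\<^sup>+x. f (x + t) \<partial>lborel) = (\<integral>\<^sup>+x. f x \<partial>lborel)" "(\<integral>\<^sup>+x. f (x - t) \<partial>lborel) = (\<integral>\<^sup>+x. f x \<partial>lborel)"
    "(\<integral>\<^sup>+x. f (t - x) \<partial>lborel) = (\<integral>\<^sup>+x. f x \<partial>lborel)"
  using nn_integral_lborel_affine[of 1 f t] nn_integral_lborel_affine[of 1 f "- t"]
    nn_integral_lborel_affine[of "-1" f t] by (auto simp: algebra_simps)

lemma integral_lborel_shift:
  fixes f :: "'a::euclidean_space \<Rightarrow> complex"
  assumes [measurable]: "f \<in> borel_measurable borel"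
  shows "(LINT x|lborel. f (x - t)) = (LINT x|lborel. f x)"
proof -
  have "lborel = distr lborel borel (\<lambda>x. - t + 1 *\<^sub>R x :: 'a)"
    by (subst (1) lborel_affine[of 1 "- t"]) (auto simp: density_1 one_ennreal_def[symmetric])
  then have *: "lborel = distr lborel borel (\<lambda>x. x - t :: 'a)" by simp
  show ?thesis by (subst (2) *, subst integral_distr) auto
qed

lemma borel_measurable_cnj [measurable]: "cnj \<in> borel_measurable borel"
  by (intro borel_measurable_continuous_onI continuous_intros)

section \<open>The Fourier transform of Borel functions\<close>

definition eker :: "real^2 \<Rightarrow> real^2 \<Rightarrow> complex" where
  "eker x u = exp (- (2 * complex_of_real pi * \<i> * complex_of_real (x \<bullet> u)))"

lemma norm_eker [simp]: "norm (eker x u) = 1"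
  unfolding eker_def by (simp add: norm_exp_eq_Re)

lemma borel_measurable_eker [measurable (raw)]:
  assumes [measurable]: "f \<in> borel_measurable M" "g \<in> borel_measurable M"
  shows "(\<lambda>x. eker (f x) (g x)) \<in> borel_measurable M"
proof -
  have "eker (f x) (g x) = exp (- (2 * complex_of_real pi * \<i> * complex_of_real (f x \<bullet> g x)))" for x by (simp add: eker_def)
  moreover have "(\<lambda>x. exp (- (2 * complex_of_real pi * \<i> * complex_of_real (f x \<bullet> g x)))) \<in> borel_measurable M"
    by (rule borel_measurable_continuous_on[where f = exp]) (auto intro: continuous_intros)
  ultimately show ?thesis by simp
qed

lemma eker_add: "eker (x + y) u = eker x u * eker y u"
  by (simp add: eker_def exp_add[symmetric] inner_add_left algebra_simps)

lemma eker_cnj: "cnj (eker x u) = eker (- x) u"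
  by (simp add: eker_def exp_cnj)

definition ft :: "(real^2 \<Rightarrow> complex) \<Rightarrow> real^2 \<Rightarrow> complex" where
  "ft F u = (LINT x|lborel. F x * eker x u)"

lemma borel_measurable_ft [measurable (raw)]:
  assumes [measurable]: "F \<in> borel_measurable borel" "f \<in> borel_measurable M"
  shows "(\<lambda>x. ft F (f x)) \<in> borel_measurable M"
  unfolding ft_def by measurable

lemma integrable_eker: "integrable lborel F \<Longrightarrow> integrable lborel (\<lambda>x. F x * eker x u)"
  by (rule Bochner_Integration.integrable_bound[of _ F]) (auto simp: norm_mult)

lemma norm_ft_le:
  assumes "integrable lborel F" shows "ennreal (norm (ft F u)) \<le> (\<integral>\<^sup>+x. ennreal (norm (F x)) \<partial>lborel)"
  unfolding ft_def using integral_norm_bound_ennreal[OF integrable_eker[OF assms]] by (simp add: norm_mult)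

section \<open>Plancherel's inequality by Gaussian summation\<close>

abbreviation snd2 :: "(real \<times> real) measure" where
  "snd2 \<equiv> std_normal_distribution \<Otimes>\<^sub>M std_normal_distribution"

lemma prob_snd: "prob_space std_normal_distribution"
  using prob_space_normal_density by auto

text \<open>The integral factors into two characteristic functions of the standard normal law; this
  is where the Fourier transform of a Gaussian comes from.\<close>

lemma gauss_char2:
  "(LINT p|snd2. eker (c *\<^sub>R x) (pt (fst p) (snd p))) = complex_of_real (exp (- ((2 * pi * c)\<^sup>2 * (norm x)\<^sup>2) / 2))"
proof -
  interpret prob_space std_normal_distribution by (rule prob_snd)
  have nx: "(norm x)\<^sup>2 = (x $ 1)\<^sup>2 + (x $ 2)\<^sup>2"
    unfolding power2_norm_eq_inner by (simp add: inner_vec_def sum_2 power2_eq_square)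
  have [simp]: "sigma_finite_measure std_normal_distribution" by unfold_locales
  have e: "eker (c *\<^sub>R x) (pt a b) = iexp ((- 2 * pi * c * x $ 1) * a) * iexp ((- 2 * pi * c * x $ 2) * b)" for a b
    by (simp add: eker_def exp_add[symmetric] inner_vec_def sum_2 algebra_simps)
  have int: "integrable std_normal_distribution (\<lambda>a. iexp (r * a))" for r
    by (rule integrable_const_bound[of _ 1]) auto
  have "(LINT p|snd2. eker (c *\<^sub>R x) (pt (fst p) (snd p))) = char std_normal_distribution (- 2 * pi * c * x $ 1) * char std_normal_distribution (- 2 * pi * c * x $ 2)"
    unfolding e char_def by (rule integrable_pair_mult(2)[OF _ _ int int]) simp_all
  also have "\<dots> = complex_of_real (exp (- ((2 * pi * c)\<^sup>2 * (norm x)\<^sup>2) / 2))"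
    unfolding char_std_normal_distribution of_real_mult[symmetric] exp_add[symmetric] nx
    by (simp add: power_mult_distrib algebra_simps add_divide_distrib)
  finally show ?thesis .
qed

lemma norm_pt2: "(norm (pt a b))\<^sup>2 = a\<^sup>2 + b\<^sup>2"
  unfolding power2_norm_eq_inner by (simp add: inner_vec_def sum_2 power2_eq_square)

lemma gauss_density2:
  assumes [measurable]: "f \<in> borel_measurable borel"
  shows "(\<integral>\<^sup>+p. f (pt (fst p) (snd p)) \<partial>snd2) = (\<integral>\<^sup>+u. ennreal (exp (- (norm u)\<^sup>2 / 2) / (2 * pi)) * f u \<partial>lborel)"
proof -
  interpret prob_space std_normal_distribution by (rule prob_snd)
  have "(\<integral>\<^sup>+p. f (pt (fst p) (snd p)) \<partial>snd2) = (\<integral>\<^sup>+a. (\<integral>\<^sup>+b. f (pt a b) \<partial>std_normal_distribution) \<partial>std_normal_distribution)"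
    by (subst nn_integral_fst[symmetric]) auto
  also have "\<dots> = (\<integral>\<^sup>+a. (\<integral>\<^sup>+b. ennreal (std_normal_density a) * (ennreal (std_normal_density b) * f (pt a b)) \<partial>lborel) \<partial>lborel)"
    by (simp add: nn_integral_density nn_integral_cmult)
  also have "\<dots> = (\<integral>\<^sup>+a. (\<integral>\<^sup>+b. ennreal (exp (- (norm (pt a b))\<^sup>2 / 2) / (2 * pi)) * f (pt a b) \<partial>lborel) \<partial>lborel)"
  proof (intro nn_integral_cong)
    fix a b :: real
    have "std_normal_density a * std_normal_density b = exp (- (norm (pt a b))\<^sup>2 / 2) / (2 * pi)"
      by (simp add: std_normal_density_def norm_pt2 exp_add[symmetric] diff_divide_distrib add_divide_distrib)
    then show "ennreal (std_normal_density a) * (ennreal (std_normal_density b) * f (pt a b)) = ennreal (exp (- (norm (pt a b))\<^sup>2 / 2) / (2 * pi)) * f (pt a b)"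
      by (simp add: mult.assoc[symmetric] ennreal_mult[symmetric])
  qed
  also have "\<dots> = (\<integral>\<^sup>+u. ennreal (exp (- (norm u)\<^sup>2 / 2) / (2 * pi)) * f u \<partial>lborel)"
    by (rule nn_integral_real2(1)[symmetric]) measurable
  finally show ?thesis .
qed

lemma gauss_total: "(\<integral>\<^sup>+u. ennreal (exp (- (norm (u :: real^2))\<^sup>2 / 2)) \<partial>lborel) = ennreal (2 * pi)"
proof -
  interpret prob_space std_normal_distribution by (rule prob_snd)
  interpret P: pair_prob_space std_normal_distribution std_normal_distribution by unfold_locales
  have "(\<integral>\<^sup>+u. ennreal (exp (- (norm (u :: real^2))\<^sup>2 / 2)) \<partial>lborel)
      = (\<integral>\<^sup>+u. ennreal (2 * pi) * (ennreal (exp (- (norm (u :: real^2))\<^sup>2 / 2) / (2 * pi)) * 1) \<partial>lborel)"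
    by (intro nn_integral_cong) (simp add: ennreal_mult[symmetric])
  also have "\<dots> = ennreal (2 * pi) * (\<integral>\<^sup>+p. 1 \<partial>snd2)"
    by (subst gauss_density2, simp) (rule nn_integral_cmult, measurable)
  also have "(\<integral>\<^sup>+p. 1 \<partial>snd2) = 1" by (simp add: P.emeasure_space_1)
  finally show ?thesis by simp
qed

lemma gauss_scaled:
  assumes c: "c > 0"
  shows "(\<integral>\<^sup>+y. ennreal (exp (- (norm ((2 * pi * c) *\<^sub>R (y::real^2)))\<^sup>2 / 2)) \<partial>lborel) = ennreal (1 / (2 * pi * c\<^sup>2))"
proof -
    have "ennreal (2 * pi) = ennreal ((2 * pi * c)\<^sup>2) * (\<integral>\<^sup>+y. ennreal (exp (- (norm ((2 * pi * c) *\<^sub>R (y::real^2)))\<^sup>2 / 2)) \<partial>lborel)"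
      using nn_integral_lborel_affine[of "2 * pi * c" "\<lambda>u::real^2. ennreal (exp (- (norm u)\<^sup>2 / 2))" 0] c
      unfolding gauss_total by simp
    then have "ennreal (1 / (2 * pi * c)\<^sup>2) * ennreal (2 * pi) = (ennreal (1 / (2 * pi * c)\<^sup>2) * ennreal ((2 * pi * c)\<^sup>2)) * (\<integral>\<^sup>+y. ennreal (exp (- (norm ((2 * pi * c) *\<^sub>R (y::real^2)))\<^sup>2 / 2)) \<partial>lborel)"
      by (simp add: mult.assoc)
    moreover have "ennreal (1 / (2 * pi * c)\<^sup>2) * ennreal ((2 * pi * c)\<^sup>2) = 1"
      using c by (subst ennreal_mult[symmetric]) auto
    moreover have "ennreal (1 / (2 * pi * c)\<^sup>2) * ennreal (2 * pi) = ennreal (1 / (2 * pi * c\<^sup>2))"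
      using c by (subst ennreal_mult[symmetric]) (auto simp: power2_eq_square field_simps)
    ultimately show ?thesis by simp
qed

text \<open>The squared modulus is a double integral in \<open>x\<close> and \<open>y\<close>;
  integrating the Gaussian first leaves a Gaussian kernel in \<open>x - y\<close>. Bounding
  \<open>norm (F x) * norm (F y)\<close> by half the sum of the squares, each half only sees the
  mass \<open>1 / (2 * pi * c\<^sup>2)\<close> of that kernel, as in Schur's test.\<close>

lemma plancherel_gauss:
  assumes F: "integrable lborel F" and c: "c > 0"
  shows "(\<integral>\<^sup>+p. ennreal ((norm (ft F (c *\<^sub>R pt (fst p) (snd p))))\<^sup>2) \<partial>snd2) \<le> ennreal (1 / (2 * pi * c\<^sup>2)) * (\<integral>\<^sup>+x. ennreal ((norm (F x))\<^sup>2) \<partial>lborel)"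
proof -
  interpret prob_space std_normal_distribution by (rule prob_snd)
  interpret P: pair_prob_space std_normal_distribution std_normal_distribution by unfold_locales
  have sfP: "sigma_finite_measure snd2" by (rule P.sigma_finite_measure_axioms)
  interpret R: pair_sigma_finite snd2 "lborel \<Otimes>\<^sub>M lborel :: ((real^2) \<times> (real^2)) measure" by unfold_locales
  have Fm [measurable]: "F \<in> borel_measurable borel" using F by auto
  let ?Q = "lborel \<Otimes>\<^sub>M lborel :: ((real^2) \<times> (real^2)) measure"
  let ?U = "\<lambda>p. pt (fst p) (snd p)"
  let ?H = "\<lambda>p q. (F (fst q) * cnj (F (snd q))) * eker (c *\<^sub>R (fst q - snd q)) (?U p)"
  have sq: "ft F (c *\<^sub>R u) * cnj (ft F (c *\<^sub>R u)) = (LINT q|?Q. (F (fst q) * cnj (F (snd q))) * eker (c *\<^sub>R (fst q - snd q)) u)" for u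
  proof -
    have "ft F (c *\<^sub>R u) * cnj (ft F (c *\<^sub>R u)) = (LINT x|lborel. F x * eker x (c *\<^sub>R u)) * (LINT y|lborel. cnj (F y * eker y (c *\<^sub>R u)))"
      by (simp add: ft_def del: complex_cnj_mult)
    also have "\<dots> = (LINT q|?Q. (F (fst q) * eker (fst q) (c *\<^sub>R u)) * cnj (F (snd q) * eker (snd q) (c *\<^sub>R u)))"
      by (subst integrable_pair_mult(2)) (auto intro: integrable_eker F sigma_finite_lborel simp del: complex_cnj_mult)
    also have "\<dots> = (LINT q|?Q. (F (fst q) * cnj (F (snd q))) * eker (c *\<^sub>R (fst q - snd q)) u)"
    proof (rule Bochner_Integration.integral_cong[OF refl])
      fix q :: "(real^2) \<times> (real^2)"
      have "eker (fst q) (c *\<^sub>R u) * cnj (eker (snd q) (c *\<^sub>R u)) = eker (c *\<^sub>R (fst q - snd q)) u"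
        by (simp add: eker_cnj eker_add[symmetric]) (simp add: eker_def)
      then show "(F (fst q) * eker (fst q) (c *\<^sub>R u)) * cnj (F (snd q) * eker (snd q) (c *\<^sub>R u)) = (F (fst q) * cnj (F (snd q))) * eker (c *\<^sub>R (fst q - snd q)) u"
        by (simp add: mult_ac)
    qed
    finally show ?thesis .
  qed
  have intFF: "integrable ?Q (\<lambda>q. F (fst q) * cnj (F (snd q)))"
    by (rule integrable_pair_mult(1)) (auto intro: F sigma_finite_lborel)
  have "integrable (snd2 \<Otimes>\<^sub>M ?Q) (\<lambda>r. 1 * (F (fst (snd r)) * cnj (F (snd (snd r)))))"
    using integrable_pair_mult(1)[OF sfP _ _ intFF, of "\<lambda>_. 1"] by (simp add: lborel_prod sigma_finite_lborel)
  moreover have "case_prod ?H \<in> borel_measurable (snd2 \<Otimes>\<^sub>M ?Q)"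
    unfolding split_beta' by measurable
  ultimately have intH: "integrable (snd2 \<Otimes>\<^sub>M ?Q) (case_prod ?H)"
    by (rule Bochner_Integration.integrable_bound) (simp add: norm_mult split_beta')
  have intS: "integrable snd2 (\<lambda>p. LINT q|?Q. ?H p q)" using R.integrable_fst[OF intH] .
  have "integrable snd2 (\<lambda>p. complex_of_real ((norm (ft F (c *\<^sub>R ?U p)))\<^sup>2))"
    using intS unfolding sq[symmetric] complex_norm_square[symmetric] .
  then have intN: "integrable snd2 (\<lambda>p. (norm (ft F (c *\<^sub>R ?U p)))\<^sup>2)"
    unfolding complex_of_real_integrable_eq .
  have "complex_of_real (LINT p|snd2. (norm (ft F (c *\<^sub>R ?U p)))\<^sup>2) = (LINT p|snd2. complex_of_real ((norm (ft F (c *\<^sub>R ?U p)))\<^sup>2))"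
    by (rule integral_complex_of_real[symmetric])
  also have "\<dots> = (LINT p|snd2. (LINT q|?Q. ?H p q))"
    unfolding sq[symmetric] complex_norm_square[symmetric] ..
  also have "\<dots> = (LINT q|?Q. (LINT p|snd2. ?H p q))"
    by (rule R.Fubini_integral[OF intH, symmetric])
  also have "\<dots> = (LINT q|?Q. (F (fst q) * cnj (F (snd q))) * complex_of_real (exp (- ((2 * pi * c)\<^sup>2 * (norm (fst q - snd q))\<^sup>2) / 2)))"
    by (simp only: integral_mult_right_zero gauss_char2)
  finally have main: "complex_of_real (LINT p|snd2. (norm (ft F (c *\<^sub>R ?U p)))\<^sup>2) = \<dots>" .
  have "(\<integral>\<^sup>+p. ennreal ((norm (ft F (c *\<^sub>R ?U p)))\<^sup>2) \<partial>snd2) = ennreal (LINT p|snd2. (norm (ft F (c *\<^sub>R ?U p)))\<^sup>2)"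
    by (rule nn_integral_eq_integral[OF intN]) simp
  also have "\<dots> = ennreal (norm (complex_of_real (LINT p|snd2. (norm (ft F (c *\<^sub>R ?U p)))\<^sup>2)))"
    by simp
  also have "\<dots> \<le> (\<integral>\<^sup>+q. ennreal (norm ((F (fst q) * cnj (F (snd q))) * complex_of_real (exp (- ((2 * pi * c)\<^sup>2 * (norm (fst q - snd q))\<^sup>2) / 2)))) \<partial>?Q)"
    unfolding main
    by (intro integral_norm_bound_ennreal Bochner_Integration.integrable_bound[OF intFF]) (auto simp: norm_mult intro!: mult_left_le)
  also have "\<dots> \<le> (\<integral>\<^sup>+q. (ennreal (1/2) * (ennreal ((norm (F (fst q)))\<^sup>2) * ennreal (exp (- (norm ((2 * pi * c) *\<^sub>R (fst q - snd q)))\<^sup>2 / 2))))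
       + (ennreal (1/2) * (ennreal ((norm (F (snd q)))\<^sup>2) * ennreal (exp (- (norm ((2 * pi * c) *\<^sub>R (fst q - snd q)))\<^sup>2 / 2)))) \<partial>?Q)"
  proof (rule nn_integral_mono)
    fix q :: "(real^2) \<times> (real^2)"
    define E where "E = exp (- (norm ((2 * pi * c) *\<^sub>R (fst q - snd q)))\<^sup>2 / 2)"
    have E: "exp (- ((2 * pi * c)\<^sup>2 * (norm (fst q - snd q))\<^sup>2) / 2) = E" "E \<ge> 0"
      using c by (auto simp: E_def power_mult_distrib)
    have h: "ennreal (1/2) * (ennreal a * ennreal E) = ennreal (1/2 * (a * E))" if "a \<ge> 0" for a
      using ennreal_mult[of "1/2" "a * E"] ennreal_mult[of a E] that E(2) by simp
    have "norm (F (fst q)) * norm (F (snd q)) * E \<le> (1/2 * (norm (F (fst q)))\<^sup>2 + 1/2 * (norm (F (snd q)))\<^sup>2) * E"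
      using sum_squares_bound[of "norm (F (fst q))" "norm (F (snd q))"] E(2) by (intro mult_right_mono) auto
    then show "ennreal (norm ((F (fst q) * cnj (F (snd q))) * complex_of_real (exp (- ((2 * pi * c)\<^sup>2 * (norm (fst q - snd q))\<^sup>2) / 2)))) \<le>
       (ennreal (1/2) * (ennreal ((norm (F (fst q)))\<^sup>2) * ennreal (exp (- (norm ((2 * pi * c) *\<^sub>R (fst q - snd q)))\<^sup>2 / 2))))
       + (ennreal (1/2) * (ennreal ((norm (F (snd q)))\<^sup>2) * ennreal (exp (- (norm ((2 * pi * c) *\<^sub>R (fst q - snd q)))\<^sup>2 / 2))))"
      unfolding E E_def[symmetric] h[OF zero_le_power2]
      by (subst ennreal_plus[symmetric]) (use E(2) in \<open>auto simp: norm_mult algebra_simps intro!: ennreal_leI simp del: ennreal_plus\<close>)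
  qed
  also have "\<dots> = (\<integral>\<^sup>+q. (ennreal (1/2) * (ennreal ((norm (F (fst q)))\<^sup>2) * ennreal (exp (- (norm ((2 * pi * c) *\<^sub>R (fst q - snd q)))\<^sup>2 / 2)))) \<partial>?Q)
      + (\<integral>\<^sup>+q. (ennreal (1/2) * (ennreal ((norm (F (snd q)))\<^sup>2) * ennreal (exp (- (norm ((2 * pi * c) *\<^sub>R (fst q - snd q)))\<^sup>2 / 2)))) \<partial>?Q)"
    by (rule nn_integral_add) measurable
  also have "(\<integral>\<^sup>+q. (ennreal (1/2) * (ennreal ((norm (F (fst q)))\<^sup>2) * ennreal (exp (- (norm ((2 * pi * c) *\<^sub>R (fst q - snd q)))\<^sup>2 / 2)))) \<partial>?Q)
     = ennreal (1/2) * ((\<integral>\<^sup>+x. ennreal ((norm (F x))\<^sup>2) \<partial>lborel) * ennreal (1 / (2 * pi * c\<^sup>2)))" (is "_ = ?half")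
  proof -
    have "(\<integral>\<^sup>+y. ennreal (1/2) * (ennreal ((norm (F x))\<^sup>2) * ennreal (exp (- (norm ((2 * pi * c) *\<^sub>R (x - y)))\<^sup>2 / 2))) \<partial>lborel)
      = ennreal (1/2) * (ennreal ((norm (F x))\<^sup>2) * ennreal (1 / (2 * pi * c\<^sup>2)))" (is "?L x = _") for x
    proof -
      have "(\<integral>\<^sup>+y. ennreal (exp (- (norm ((2 * pi * c) *\<^sub>R (x - y)))\<^sup>2 / 2)) \<partial>lborel) = (\<integral>\<^sup>+y. ennreal (exp (- (norm ((2 * pi * c) *\<^sub>R (y::real^2)))\<^sup>2 / 2)) \<partial>lborel)"
        by (rule nn_integral_lborel_shift(3)[where f = "\<lambda>y. ennreal (exp (- (norm ((2 * pi * c) *\<^sub>R y))\<^sup>2 / 2))"]) measurable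
      also have "\<dots> = ennreal (1 / (2 * pi * c\<^sup>2))" by (rule gauss_scaled[OF c])
      finally have e: "(\<integral>\<^sup>+y. ennreal (exp (- (norm ((2 * pi * c) *\<^sub>R (x - y)))\<^sup>2 / 2)) \<partial>lborel) = ennreal (1 / (2 * pi * c\<^sup>2))" .
      have "?L x = ennreal (1/2) * (ennreal ((norm (F x))\<^sup>2) * (\<integral>\<^sup>+y. ennreal (exp (- (norm ((2 * pi * c) *\<^sub>R (x - y)))\<^sup>2 / 2)) \<partial>lborel))"
        by (subst nn_integral_cmult, measurable, subst nn_integral_cmult, measurable)
      then show ?thesis unfolding e .
    qed
    note inner = this
    have "(\<integral>\<^sup>+q. (ennreal (1/2) * (ennreal ((norm (F (fst q)))\<^sup>2) * ennreal (exp (- (norm ((2 * pi * c) *\<^sub>R (fst q - snd q)))\<^sup>2 / 2)))) \<partial>?Q)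
      = (\<integral>\<^sup>+x. (\<integral>\<^sup>+y. ennreal (1/2) * (ennreal ((norm (F x))\<^sup>2) * ennreal (exp (- (norm ((2 * pi * c) *\<^sub>R (x - y)))\<^sup>2 / 2))) \<partial>lborel) \<partial>lborel)"
      by (subst lborel.nn_integral_fst[symmetric]) simp_all
    also have "\<dots> = ?half"
      unfolding inner by (subst nn_integral_cmult, measurable, subst nn_integral_multc, measurable)
    finally show ?thesis .
  qed
  also have "(\<integral>\<^sup>+q. (ennreal (1/2) * (ennreal ((norm (F (snd q)))\<^sup>2) * ennreal (exp (- (norm ((2 * pi * c) *\<^sub>R (fst q - snd q)))\<^sup>2 / 2)))) \<partial>?Q) = ?half"
  proof -
    have "(\<integral>\<^sup>+x. ennreal (1/2) * (ennreal ((norm (F y))\<^sup>2) * ennreal (exp (- (norm ((2 * pi * c) *\<^sub>R (x - y)))\<^sup>2 / 2))) \<partial>lborel)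
      = ennreal (1/2) * (ennreal ((norm (F y))\<^sup>2) * ennreal (1 / (2 * pi * c\<^sup>2)))" (is "?L y = _") for y
    proof -
      have "(\<integral>\<^sup>+x. ennreal (exp (- (norm ((2 * pi * c) *\<^sub>R (x - y)))\<^sup>2 / 2)) \<partial>lborel) = (\<integral>\<^sup>+y. ennreal (exp (- (norm ((2 * pi * c) *\<^sub>R (y::real^2)))\<^sup>2 / 2)) \<partial>lborel)"
        by (rule nn_integral_lborel_shift(2)[where f = "\<lambda>y. ennreal (exp (- (norm ((2 * pi * c) *\<^sub>R y))\<^sup>2 / 2))"]) measurable
      also have "\<dots> = ennreal (1 / (2 * pi * c\<^sup>2))" by (rule gauss_scaled[OF c])
      finally have e: "(\<integral>\<^sup>+x. ennreal (exp (- (norm ((2 * pi * c) *\<^sub>R (x - y)))\<^sup>2 / 2)) \<partial>lborel) = ennreal (1 / (2 * pi * c\<^sup>2))" .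
      have "?L y = ennreal (1/2) * (ennreal ((norm (F y))\<^sup>2) * (\<integral>\<^sup>+x. ennreal (exp (- (norm ((2 * pi * c) *\<^sub>R (x - y)))\<^sup>2 / 2)) \<partial>lborel))"
        by (subst nn_integral_cmult, measurable, subst nn_integral_cmult, measurable)
      then show ?thesis unfolding e .
    qed
    note inner = this
    have "(\<integral>\<^sup>+q. (ennreal (1/2) * (ennreal ((norm (F (snd q)))\<^sup>2) * ennreal (exp (- (norm ((2 * pi * c) *\<^sub>R (fst q - snd q)))\<^sup>2 / 2)))) \<partial>?Q)
      = (\<integral>\<^sup>+y. (\<integral>\<^sup>+x. ennreal (1/2) * (ennreal ((norm (F y))\<^sup>2) * ennreal (exp (- (norm ((2 * pi * c) *\<^sub>R (x - y)))\<^sup>2 / 2))) \<partial>lborel) \<partial>lborel)"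
      by (subst lborel_pair.nn_integral_snd[symmetric]) simp_all
    also have "\<dots> = ?half"
      unfolding inner by (subst nn_integral_cmult, measurable, subst nn_integral_multc, measurable)
    finally show ?thesis .
  qed
  also have "?half + ?half = ennreal (1 / (2 * pi * c\<^sup>2)) * (\<integral>\<^sup>+x. ennreal ((norm (F x))\<^sup>2) \<partial>lborel)"
    unfolding distrib_right[symmetric] using ennreal_plus[of "1/2" "1/2"] by (simp add: mult.commute del: ennreal_plus)
  finally show ?thesis .
qed


text \<open>Gaussian weights of growing width tend to 1, and Fatou's lemma removes them. The width
  \<open>c\<close> cancels against the mass of the kernel in
  \<open>plancherel_gauss\<close>.\<close>

lemma plancherel_le:
  assumes F: "integrable lborel F"
  shows "(\<integral>\<^sup>+u. ennreal ((norm (ft F u))\<^sup>2) \<partial>lborel) \<le> (\<integral>\<^sup>+x. ennreal ((norm (F x))\<^sup>2) \<partial>lborel)" (is "_ \<le> ?B")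
proof -
  have Fm [measurable]: "F \<in> borel_measurable borel" using F by auto
  define G where "G n u = ennreal (exp (- (norm ((1 / real (Suc n)) *\<^sub>R u))\<^sup>2 / 2)) * ennreal ((norm (ft F u))\<^sup>2)" for n :: nat and u :: "real^2"
  have Gm: "G n \<in> borel_measurable borel" for n unfolding G_def by measurable
  have Gle: "(\<integral>\<^sup>+u. G n u \<partial>lborel) \<le> ?B" for n
  proof -
    define c where "c = real (Suc n)"
    have c: "c > 0" by (simp add: c_def)
    have "(\<integral>\<^sup>+u. G n u \<partial>lborel) = ennreal (c\<^sup>2) * (\<integral>\<^sup>+u. G n (0 + c *\<^sub>R u) \<partial>lborel)"
      using nn_integral_lborel_affine[of c "G n" 0] c Gm[of n] by simp
    also have "(\<integral>\<^sup>+u. G n (0 + c *\<^sub>R u) \<partial>lborel) = (\<integral>\<^sup>+u. ennreal (2 * pi) * (ennreal (exp (- (norm u)\<^sup>2 / 2) / (2 * pi)) * ennreal ((norm (ft F (c *\<^sub>R u)))\<^sup>2)) \<partial>lborel)"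
    proof (rule nn_integral_cong)
      fix u :: "real^2"
      have cn: "(1 / real (Suc n)) *\<^sub>R (0 + c *\<^sub>R u) = u" using c by (simp add: c_def del: of_nat_Suc)
      show "G n (0 + c *\<^sub>R u) = ennreal (2 * pi) * (ennreal (exp (- (norm u)\<^sup>2 / 2) / (2 * pi)) * ennreal ((norm (ft F (c *\<^sub>R u)))\<^sup>2))"
        unfolding G_def cn mult.assoc[symmetric] by (subst ennreal_mult[symmetric]) auto
    qed
    also have "\<dots> = ennreal (2 * pi) * (\<integral>\<^sup>+u. ennreal (exp (- (norm u)\<^sup>2 / 2) / (2 * pi)) * ennreal ((norm (ft F (c *\<^sub>R u)))\<^sup>2) \<partial>lborel)"
      by (rule nn_integral_cmult) measurable
    also have "\<dots> = ennreal (2 * pi) * (\<integral>\<^sup>+p. ennreal ((norm (ft F (c *\<^sub>R pt (fst p) (snd p))))\<^sup>2) \<partial>snd2)"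
      by (subst gauss_density2) auto
    also have "ennreal (c\<^sup>2) * \<dots> \<le> ennreal (c\<^sup>2) * (ennreal (2 * pi) * (ennreal (1 / (2 * pi * c\<^sup>2)) * ?B))"
      by (intro mult_left_mono plancherel_gauss F c) auto
    also have "\<dots> = (ennreal (c\<^sup>2) * ennreal (2 * pi) * ennreal (1 / (2 * pi * c\<^sup>2))) * ?B"
      by (simp only: mult.assoc)
    also have "ennreal (c\<^sup>2) * ennreal (2 * pi) * ennreal (1 / (2 * pi * c\<^sup>2)) = 1"
      using c by (simp add: ennreal_mult[symmetric])
    finally show ?thesis by simp
  qed
  have "(\<integral>\<^sup>+u. ennreal ((norm (ft F u))\<^sup>2) \<partial>lborel) = (\<integral>\<^sup>+u. liminf (\<lambda>n. G n u) \<partial>lborel)"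
  proof (rule nn_integral_cong)
    fix u :: "real^2"
    have "(\<lambda>n. 1 / real (Suc n)) \<longlonglongrightarrow> 0"
      using LIMSEQ_inverse_real_of_nat by (simp add: inverse_eq_divide)
    then have "(\<lambda>n. exp (- (norm ((1 / real (Suc n)) *\<^sub>R u))\<^sup>2 / 2)) \<longlonglongrightarrow> exp (- (norm ((0::real) *\<^sub>R u))\<^sup>2 / 2)"
      by (intro tendsto_intros) auto
    then have "(\<lambda>n. ennreal (exp (- (norm ((1 / real (Suc n)) *\<^sub>R u))\<^sup>2 / 2) * (norm (ft F u))\<^sup>2)) \<longlonglongrightarrow> ennreal (exp (- (norm ((0::real) *\<^sub>R u))\<^sup>2 / 2) * (norm (ft F u))\<^sup>2)"
      by (intro tendsto_ennrealI tendsto_mult tendsto_const)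
    then have "(\<lambda>n. G n u) \<longlonglongrightarrow> ennreal 1 * ennreal ((norm (ft F u))\<^sup>2)"
      unfolding G_def by (subst (asm) (1 2) ennreal_mult) auto
    then show "ennreal ((norm (ft F u))\<^sup>2) = liminf (\<lambda>n. G n u)"
      using lim_imp_Liminf[of sequentially "\<lambda>n. G n u"] by simp
  qed
  also have "\<dots> \<le> liminf (\<lambda>n. \<integral>\<^sup>+u. G n u \<partial>lborel)"
    by (rule nn_integral_liminf) (simp add: G_def)
  also have "\<dots> \<le> ?B"
    using Gle by (intro Liminf_le) (auto intro: always_eventually)
  finally show ?thesis .
qed

section \<open>Interpolation between the L^1 bound and Plancherel\<close>

lemma ft_diff:
  assumes "integrable lborel F" "integrable lborel G"
  shows "ft (\<lambda>x. F x - G x) u = ft F u - ft G u"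
  unfolding ft_def by (subst Bochner_Integration.integral_diff[symmetric]) (auto intro: integrable_eker assms simp: left_diff_distrib)

text \<open>\<open>F\<close> is cut at height \<open>h\<close>. The transform of the high part is at
  most \<open>\<tau> / 2\<close> everywhere, so where the whole transform exceeds
  \<open>\<tau>\<close> that of the low part is at least \<open>\<tau> / 2\<close>; Chebyshev's
  inequality and Plancherel finish.\<close>

lemma hausdorff_young_weak:
  assumes F: "integrable lborel F" and h: "h > 0" and \<tau>: "\<tau> > 0"
    and small: "(\<integral>\<^sup>+x. ennreal (norm (F x)) * indicator {x. h < norm (F x)} x \<partial>lborel) \<le> ennreal (\<tau> / 2)"
  shows "emeasure lborel {u. \<tau> < norm (ft F u)} \<le> ennreal (4 / \<tau>\<^sup>2) * (\<integral>\<^sup>+x. ennreal ((norm (F x))\<^sup>2) * indicator {x. norm (F x) \<le> h} x \<partial>lborel)"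
proof -
  have Fm [measurable]: "F \<in> borel_measurable borel" using F by auto
  define F1 where "F1 x = (if h < norm (F x) then F x else 0)" for x
  define F2 where "F2 x = (if h < norm (F x) then 0 else F x)" for x
  have [measurable]: "F1 \<in> borel_measurable borel" "F2 \<in> borel_measurable borel"
    unfolding F1_def F2_def by measurable
  have int: "integrable lborel F1" "integrable lborel F2"
    by (rule Bochner_Integration.integrable_bound[OF F]; simp add: F1_def F2_def)+
  have eq: "ft F2 u = ft F u - ft F1 u" for u
    by (subst ft_diff[symmetric, OF F int(1)]) (auto simp: F1_def F2_def intro!: arg_cong[where f = "\<lambda>F. ft F u"])
  have b1: "norm (ft F1 u) \<le> \<tau> / 2" for u
  proof -
    have "ennreal (norm (ft F1 u)) \<le> (\<integral>\<^sup>+x. ennreal (norm (F1 x)) \<partial>lborel)" by (rule norm_ft_le[OF int(1)])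
    also have "\<dots> = (\<integral>\<^sup>+x. ennreal (norm (F x)) * indicator {x. h < norm (F x)} x \<partial>lborel)"
      by (intro nn_integral_cong) (auto simp: F1_def)
    also note small
    finally show ?thesis using \<tau> by (simp add: ennreal_le_iff)
  qed
  have "ennreal ((\<tau> / 2)\<^sup>2) * emeasure lborel {u. \<tau> < norm (ft F u)} = (\<integral>\<^sup>+u. ennreal ((\<tau> / 2)\<^sup>2) * indicator {u. \<tau> < norm (ft F u)} u \<partial>lborel)"
    by (subst nn_integral_cmult_indicator) auto
  also have "\<dots> \<le> (\<integral>\<^sup>+u. ennreal ((norm (ft F2 u))\<^sup>2) \<partial>lborel)"
  proof (intro nn_integral_mono)
    fix u :: "real^2"
    show "ennreal ((\<tau> / 2)\<^sup>2) * indicator {u. \<tau> < norm (ft F u)} u \<le> ennreal ((norm (ft F2 u))\<^sup>2)"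
    proof (cases "\<tau> < norm (ft F u)")
      case True
      have "norm (ft F u) - norm (ft F1 u) \<le> norm (ft F2 u)" unfolding eq by (rule norm_triangle_ineq2)
      with True b1[of u] have "\<tau> / 2 \<le> norm (ft F2 u)" by simp
      then have "(\<tau> / 2)\<^sup>2 \<le> (norm (ft F2 u))\<^sup>2" using \<tau> by (intro power_mono) auto
      then show ?thesis using True by (simp add: ennreal_leI)
    qed simp
  qed
  also have "\<dots> \<le> (\<integral>\<^sup>+x. ennreal ((norm (F2 x))\<^sup>2) \<partial>lborel)" by (rule plancherel_le[OF int(2)])
  also have "\<dots> = (\<integral>\<^sup>+x. ennreal ((norm (F x))\<^sup>2) * indicator {x. norm (F x) \<le> h} x \<partial>lborel)"
    by (intro nn_integral_cong) (auto simp: F2_def)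
  finally have *: "ennreal ((\<tau> / 2)\<^sup>2) * emeasure lborel {u. \<tau> < norm (ft F u)} \<le> \<dots>" .
  have "emeasure lborel {u. \<tau> < norm (ft F u)} = ennreal (4 / \<tau>\<^sup>2) * (ennreal ((\<tau> / 2)\<^sup>2) * emeasure lborel {u. \<tau> < norm (ft F u)})"
  proof -
    have "ennreal (4 / \<tau>\<^sup>2) * ennreal ((\<tau> / 2)\<^sup>2) = 1"
      using \<tau> by (subst ennreal_mult[symmetric]) (auto simp: power_divide)
    then show ?thesis by (simp only: mult.assoc[symmetric]) simp
  qed
  also have "\<dots> \<le> ennreal (4 / \<tau>\<^sup>2) * (\<integral>\<^sup>+x. ennreal ((norm (F x))\<^sup>2) * indicator {x. norm (F x) \<le> h} x \<partial>lborel)"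
    using * by (rule mult_left_mono) simp
  finally show ?thesis .
qed

text \<open>The 4 comes from Chebyshev's inequality at height \<open>\<tau> / 2\<close>, the other
  factors from an integral of \<open>t * \<tau> powr (t - 3)\<close> from 0, which converges for
  \<open>t > 2\<close>. Real interpolation does not give the sharp constant.\<close>

definition HY_const :: "real \<Rightarrow> real" where
  "HY_const t = 4 * (t / (t - 2)) * 2 powr (t - 2)"

lemma HY_const_nonneg: "t > 2 \<Longrightarrow> 0 \<le> HY_const t"
  by (simp add: HY_const_def)

text \<open>Real interpolation: the height at which \<open>F\<close> is cut varies with the level
  \<open>\<tau>\<close> of the transform, and the weak estimates are summed over the levels by the
  layer cake formula.\<close>

lemma hausdorff_young:
  assumes F: "integrable lborel F" and s: "1 < s" "s < 2" and t: "t = s / (s - 1)"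
  shows "(\<integral>\<^sup>+u. ennreal_powr (ennreal (norm (ft F u))) t \<partial>lborel)
     \<le> ennreal (HY_const t) * ennreal_powr (\<integral>\<^sup>+x. ennreal_powr (ennreal (norm (F x))) s \<partial>lborel) (t - 1)"
    (is "?L \<le> _ * ennreal_powr ?N _")
proof -
  have Fm [measurable]: "F \<in> borel_measurable borel" using F by auto
  have t2: "t > 2" using s by (simp add: t field_simps)
  have st: "(s - 1) * (t - 2) = 2 - s" "t - 1 = 1 / (s - 1)" using s by (auto simp: t field_simps)
  consider "?N = 0" | "?N = top" | N where "?N = ennreal N" "N > 0"
    by (cases ?N) (auto simp: less_le)
  then show ?thesis
  proof cases
    case 1
    then have "AE x in lborel. F x = 0" by (subst (asm) nn_integral_0_iff_AE) auto
    then have "ft F u = 0" for u unfolding ft_def by (subst integral_cong_AE[where g = "\<lambda>_. 0"]) auto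
    then show ?thesis by simp
  next
    case 2
    then show ?thesis using t2 by (simp add: ennreal_mult_top HY_const_def)
  next
    case (3 N)
    \<comment> \<open>The height solves \<open>N * h \<tau> powr (1 - s) = \<tau> / 2\<close>, so
      that the part of \<open>F\<close> above it has L^1 norm at most
      \<open>\<tau> / 2\<close>.\<close>
    define h where "h \<tau> = (2 * N / \<tau>) powr (1 / (s - 1))" for \<tau>
    have weak: "emeasure lborel {u. \<tau> < norm (ft F u)} \<le> ennreal (4 / \<tau>\<^sup>2) * (\<integral>\<^sup>+x. ennreal ((norm (F x))\<^sup>2) * indicator {x. norm (F x) \<le> h \<tau>} x \<partial>lborel)"
      if \<tau>: "\<tau> > 0" for \<tau>
    proof (rule hausdorff_young_weak[OF F _ \<tau>])
      show h: "h \<tau> > 0" using \<tau> 3 by (simp add: h_def)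
      have hp: "h \<tau> powr (1 - s) = \<tau> / (2 * N)"
      proof -
        have "h \<tau> powr (1 - s) = (2 * N / \<tau>) powr (- 1)"
          unfolding h_def powr_powr using s by (intro arg_cong2[where f = "(powr)"]) (auto simp: field_simps)
        then show ?thesis using \<tau> 3 by (simp add: powr_minus)
      qed
      have "(\<integral>\<^sup>+x. ennreal (norm (F x)) * indicator {x. h \<tau> < norm (F x)} x \<partial>lborel) \<le> (\<integral>\<^sup>+x. ennreal (h \<tau> powr (1 - s)) * ennreal_powr (ennreal (norm (F x))) s \<partial>lborel)"
      proof (intro nn_integral_mono)
        fix x
        show "ennreal (norm (F x)) * indicator {x. h \<tau> < norm (F x)} x \<le> ennreal (h \<tau> powr (1 - s)) * ennreal_powr (ennreal (norm (F x))) s"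
        proof (cases "h \<tau> < norm (F x)")
          case True
          then have "norm (F x) = norm (F x) powr (1 - s) * norm (F x) powr s" using h by (simp add: powr_add[symmetric])
          also have "\<dots> \<le> h \<tau> powr (1 - s) * norm (F x) powr s"
            using True h s by (intro mult_right_mono powr_mono2') auto
          finally show ?thesis using True by (simp add: ennreal_mult[symmetric] ennreal_leI)
        qed simp
      qed
      also have "\<dots> = ennreal (h \<tau> powr (1 - s)) * ennreal N"
        unfolding 3(1)[symmetric] by (rule nn_integral_cmult) measurable
      also have "\<dots> = ennreal (\<tau> / 2)" using 3 \<tau> unfolding hp by (simp add: ennreal_mult[symmetric])
      finally show "(\<integral>\<^sup>+x. ennreal (norm (F x)) * indicator {x. h \<tau> < norm (F x)} x \<partial>lborel) \<le> ennreal (\<tau> / 2)" .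
    qed
    let ?k = "\<lambda>x. 2 * N * norm (F x) powr (1 - s)"
    \<comment> \<open>For fixed \<open>x\<close> the condition on the height is an upper bound on
      the level, so after Tonelli the integral over the levels is a power integral from 0.\<close>
    have hk: "norm (F x) \<le> h \<tau> \<longleftrightarrow> \<tau> \<le> ?k x" if "\<tau> > 0" "norm (F x) > 0" for \<tau> x
    proof -
      have "norm (F x) \<le> h \<tau> \<longleftrightarrow> norm (F x) powr (s - 1) \<le> h \<tau> powr (s - 1)"
        using that s 3 by (simp add: powr_less_mono2 h_def linorder_not_less[symmetric])
          (meson linorder_not_less powr_less_mono2 powr_mono2 less_eq_real_def diff_gt_0_iff_gt norm_ge_zero powr_ge_zero)
      also have "h \<tau> powr (s - 1) = 2 * N / \<tau>" using s 3 that by (simp add: h_def powr_powr)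
      also have "norm (F x) powr (s - 1) \<le> 2 * N / \<tau> \<longleftrightarrow> \<tau> \<le> ?k x"
      proof -
        define Q where "Q = norm (F x) powr (s - 1)"
        have Q: "Q > 0" using that by (simp add: Q_def)
        have eq: "norm (F x) powr (1 - s) = 1 / Q" unfolding Q_def powr_minus_divide[symmetric] by simp
        show ?thesis unfolding Q_def[symmetric] eq using Q that by (simp add: field_simps)
      qed
      finally show ?thesis .
    qed
    have "?L = (\<integral>\<^sup>+\<tau>. ennreal (t * \<tau> powr (t - 1)) * indicator {0<..} \<tau> * emeasure lborel {x \<in> space lborel. ennreal \<tau> < ennreal (norm (ft F x))} \<partial>lborel)"
      using t2 by (intro nn_integral_layer_cake sigma_finite_lborel) auto
    also have "\<dots> \<le> (\<integral>\<^sup>+\<tau>. (\<integral>\<^sup>+x. ennreal (4 * t * \<tau> powr (t - 3)) * indicator {0<..} \<tau> * (ennreal ((norm (F x))\<^sup>2) * indicator {p. norm (F (snd p)) \<le> h (fst p)} (\<tau>, x)) \<partial>lborel) \<partial>lborel)"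
    proof (rule nn_integral_mono)
      fix \<tau> :: real
      show "ennreal (t * \<tau> powr (t - 1)) * indicator {0<..} \<tau> * emeasure lborel {x \<in> space lborel. ennreal \<tau> < ennreal (norm (ft F x))} \<le>
        (\<integral>\<^sup>+x. ennreal (4 * t * \<tau> powr (t - 3)) * indicator {0<..} \<tau> * (ennreal ((norm (F x))\<^sup>2) * indicator {p. norm (F (snd p)) \<le> h (fst p)} (\<tau>, x)) \<partial>lborel)"
      proof (cases "\<tau> > 0")
        case True
        have e: "{x \<in> space lborel. ennreal \<tau> < ennreal (norm (ft F x))} = {x. \<tau> < norm (ft F x)}" using True by (auto simp: ennreal_less_iff)
        have "ennreal (t * \<tau> powr (t - 1)) * emeasure lborel {x. \<tau> < norm (ft F x)} \<le> ennreal (t * \<tau> powr (t - 1)) * (ennreal (4 / \<tau>\<^sup>2) * (\<integral>\<^sup>+x. ennreal ((norm (F x))\<^sup>2) * indicator {x. norm (F x) \<le> h \<tau>} x \<partial>lborel))"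
          by (intro mult_left_mono weak True) auto
        also have "\<dots> = (ennreal (t * \<tau> powr (t - 1)) * ennreal (4 / \<tau>\<^sup>2)) * (\<integral>\<^sup>+x. ennreal ((norm (F x))\<^sup>2) * indicator {x. norm (F x) \<le> h \<tau>} x \<partial>lborel)"
          by (simp only: mult.assoc)
        also have "ennreal (t * \<tau> powr (t - 1)) * ennreal (4 / \<tau>\<^sup>2) = ennreal (4 * t * \<tau> powr (t - 3))"
        proof -
          have "\<tau> powr (t - 1) = \<tau> powr (t - 3) * \<tau>\<^sup>2" using True powr_add[of \<tau> "t - 3" 2] by simp
          then show ?thesis using True t2 by (subst ennreal_mult[symmetric]) auto
        qed
        also have "ennreal (4 * t * \<tau> powr (t - 3)) * (\<integral>\<^sup>+x. ennreal ((norm (F x))\<^sup>2) * indicator {x. norm (F x) \<le> h \<tau>} x \<partial>lborel)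
          = (\<integral>\<^sup>+x. ennreal (4 * t * \<tau> powr (t - 3)) * (ennreal ((norm (F x))\<^sup>2) * indicator {x. norm (F x) \<le> h \<tau>} x) \<partial>lborel)"
          by (rule nn_integral_cmult[symmetric]) measurable
        also have "\<dots> = (\<integral>\<^sup>+x. ennreal (4 * t * \<tau> powr (t - 3)) * indicator {0<..} \<tau> * (ennreal ((norm (F x))\<^sup>2) * indicator {p. norm (F (snd p)) \<le> h (fst p)} (\<tau>, x)) \<partial>lborel)"
          using True by (intro nn_integral_cong) (auto split: split_indicator)
        finally show ?thesis using True e by simp
      qed simp
    qed
    also have "\<dots> = (\<integral>\<^sup>+x. (\<integral>\<^sup>+\<tau>. ennreal (4 * t * \<tau> powr (t - 3)) * indicator {0<..} \<tau> * (ennreal ((norm (F x))\<^sup>2) * indicator {p. norm (F (snd p)) \<le> h (fst p)} (\<tau>, x)) \<partial>lborel) \<partial>lborel)"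
    proof -
      have [measurable]: "h \<in> borel_measurable borel" unfolding h_def by measurable
      show ?thesis by (rule lborel_pair.Fubini') measurable
    qed
    also have "\<dots> = (\<integral>\<^sup>+x. ennreal (HY_const t * N powr (t - 2)) * ennreal_powr (ennreal (norm (F x))) s \<partial>lborel)"
    proof (rule nn_integral_cong)
      fix x
      show "(\<integral>\<^sup>+\<tau>. ennreal (4 * t * \<tau> powr (t - 3)) * indicator {0<..} \<tau> * (ennreal ((norm (F x))\<^sup>2) * indicator {p. norm (F (snd p)) \<le> h (fst p)} (\<tau>, x)) \<partial>lborel)
        = ennreal (HY_const t * N powr (t - 2)) * ennreal_powr (ennreal (norm (F x))) s"
      proof (cases "norm (F x) = 0")
        case True then show ?thesis by simp
      next
        case False
        then have Fx: "norm (F x) > 0" by simp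
        have "(\<integral>\<^sup>+\<tau>. ennreal (4 * t * \<tau> powr (t - 3)) * indicator {0<..} \<tau> * (ennreal ((norm (F x))\<^sup>2) * indicator {p. norm (F (snd p)) \<le> h (fst p)} (\<tau>, x)) \<partial>lborel)
          = (\<integral>\<^sup>+\<tau>. ennreal (4 * t * (norm (F x))\<^sup>2) * (ennreal (\<tau> powr (t - 3)) * indicator {0<..<?k x} \<tau>) \<partial>lborel)"
        proof (rule nn_integral_cong_AE)
          have "AE \<tau> in lborel. \<tau> \<noteq> ?k x" by (rule AE_lborel_singleton)
          then show "AE \<tau> in lborel. ennreal (4 * t * \<tau> powr (t - 3)) * indicator {0<..} \<tau> * (ennreal ((norm (F x))\<^sup>2) * indicator {p. norm (F (snd p)) \<le> h (fst p)} (\<tau>, x))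
            = ennreal (4 * t * (norm (F x))\<^sup>2) * (ennreal (\<tau> powr (t - 3)) * indicator {0<..<?k x} \<tau>)"
          proof eventually_elim
            case (elim \<tau>)
            show ?case
            proof (cases "\<tau> > 0 \<and> norm (F x) \<le> h \<tau>")
              case True
              then have "\<tau> < ?k x" using hk[of \<tau> x] Fx elim by simp
              have "ennreal (4 * t * \<tau> powr (t - 3)) * ennreal ((norm (F x))\<^sup>2) = ennreal (4 * t * (norm (F x))\<^sup>2) * ennreal (\<tau> powr (t - 3))"
                using t2 by (subst (1 2) ennreal_mult[symmetric]) (auto simp: mult_ac)
              then show ?thesis using True \<open>\<tau> < ?k x\<close> by simp
            next
              case False
              then show ?thesis using hk[of \<tau> x] Fx by (auto split: split_indicator)
            qed
          qed
        qed
        also have "\<dots> = ennreal (4 * t * (norm (F x))\<^sup>2) * ennreal (?k x powr (t - 2) / (t - 2))"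
          using nn_integral_powr_from_0[of "t - 3" "?k x"] t2 3 by (subst nn_integral_cmult) auto
        also have "\<dots> = ennreal (HY_const t * N powr (t - 2)) * ennreal_powr (ennreal (norm (F x))) s"
        proof -
          have "norm (F x) powr s = norm (F x) powr 2 * norm (F x) powr ((1 - s) * (t - 2))"
            unfolding powr_add[symmetric] using st(1) by (intro arg_cong2[where f = "(powr)"]) (auto simp: algebra_simps)
          then have "4 * t * (norm (F x))\<^sup>2 * (?k x powr (t - 2) / (t - 2)) = HY_const t * N powr (t - 2) * norm (F x) powr s"
            using 3 Fx by (simp add: HY_const_def powr_mult powr_powr)
          then show ?thesis using t2 3 HY_const_nonneg[OF t2] by (simp add: ennreal_mult[symmetric])
        qed
        finally show ?thesis .
      qed
    qed
    also have "\<dots> = ennreal (HY_const t * N powr (t - 2)) * ennreal N"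
      unfolding 3(1)[symmetric] by (rule nn_integral_cmult) measurable
    also have "\<dots> = ennreal (HY_const t) * ennreal_powr ?N (t - 1)"
    proof -
      have "N powr (t - 1) = N powr (t - 2) * N" using 3 powr_add[of N "t - 2" 1] by simp
      then show ?thesis using 3 HY_const_nonneg[OF t2] by (simp add: ennreal_mult[symmetric])
    qed
    finally show ?thesis .
  qed
qed

text \<open>The convolution theorem for a self-convolution. It trades the exponent
  \<open>2 * t\<close> for a transform against the exponent \<open>t\<close> for the transform of
  the convolution.\<close>

lemma ft_square:
  assumes \<mu>: "integrable lborel \<mu>"
  defines "c \<equiv> (\<lambda>w. LINT x|lborel. \<mu> x * \<mu> (w - x))"
  shows "integrable lborel c" "(ft \<mu> u)\<^sup>2 = ft c u"
proof -
  have [measurable]: "\<mu> \<in> borel_measurable borel" using \<mu> by auto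
  have shift: "(\<integral>\<^sup>+w. ennreal (norm (\<mu> (w - x))) \<partial>lborel) = (\<integral>\<^sup>+w. ennreal (norm (\<mu> w)) \<partial>lborel)" for x
    by (rule nn_integral_lborel_shift(2)[where f = "\<lambda>w. ennreal (norm (\<mu> w))"]) measurable
  have int2: "integrable lborel (\<lambda>w. \<mu> (w - x))" for x
    using \<mu> unfolding integrable_iff_bounded shift by simp
  have INT: "integrable (lborel \<Otimes>\<^sub>M lborel) (\<lambda>(x, w). \<mu> x * \<mu> (w - x))"
  proof (rule lborel_pair.Fubini_integrable)
    have e: "(LINT w|lborel. norm (\<mu> (w - x))) = (LINT w|lborel. norm (\<mu> w))" for x
      using shift[of x] by (simp add: integral_eq_nn_integral)
    have "integrable lborel (\<lambda>x. norm (\<mu> x) * (LINT w|lborel. norm (\<mu> w)))" using \<mu> by simp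
    then show "integrable lborel (\<lambda>x. LINT w|lborel. norm (case (x, w) of (x, w) \<Rightarrow> \<mu> x * \<mu> (w - x)))"
      by (simp add: norm_mult e)
  qed (use int2 in auto)
  then have INT': "integrable (lborel \<Otimes>\<^sub>M lborel) (case_prod (\<lambda>x w. \<mu> x * \<mu> (w - x)))" .
  show "integrable lborel c" unfolding c_def by (rule lborel_pair.integrable_snd[OF INT'])
  have INTe: "integrable (lborel \<Otimes>\<^sub>M lborel) (case_prod (\<lambda>x w. \<mu> x * \<mu> (w - x) * eker w u))"
    by (rule Bochner_Integration.integrable_bound[OF INT']) (auto simp: norm_mult split_beta')
  have "ft c u = (LINT w|lborel. (LINT x|lborel. \<mu> x * \<mu> (w - x) * eker w u))"
    unfolding ft_def c_def by simp
  also have "\<dots> = (LINT x|lborel. (LINT w|lborel. \<mu> x * \<mu> (w - x) * eker w u))"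
    by (rule lborel_pair.Fubini_integral[OF INTe])
  also have "\<dots> = (LINT x|lborel. \<mu> x * eker x u * ft \<mu> u)"
  proof (rule Bochner_Integration.integral_cong[OF refl])
    fix x :: "real^2"
    have "(LINT w|lborel. \<mu> x * \<mu> (w - x) * eker w u) = (LINT w|lborel. \<mu> x * eker x u * (\<mu> (w - x) * eker (w - x) u))"
    proof (rule Bochner_Integration.integral_cong[OF refl])
      fix w
      have "eker w u = eker x u * eker (w - x) u" using eker_add[of x "w - x" u] by simp
      then show "\<mu> x * \<mu> (w - x) * eker w u = \<mu> x * eker x u * (\<mu> (w - x) * eker (w - x) u)" by simp
    qed
    also have "\<dots> = \<mu> x * eker x u * (LINT w|lborel. \<mu> (w - x) * eker (w - x) u)"
      by (rule integral_mult_right_zero)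
    also have "(LINT w|lborel. \<mu> (w - x) * eker (w - x) u) = ft \<mu> u"
      unfolding ft_def by (rule integral_lborel_shift[where f = "\<lambda>w. \<mu> w * eker w u"]) measurable
    finally show "(LINT w|lborel. \<mu> x * \<mu> (w - x) * eker w u) = \<mu> x * eker x u * ft \<mu> u" .
  qed
  also have "\<dots> = (ft \<mu> u)\<^sup>2"
    unfolding integral_mult_left_zero by (simp add: ft_def power2_eq_square)
  finally show "(ft \<mu> u)\<^sup>2 = ft c u" ..
qed

section \<open>The Hardy-Littlewood-Sobolev inequality\<close>

lemma nn_integral_even:
  assumes [measurable]: "f \<in> borel_measurable borel"
  shows "(\<integral>\<^sup>+v. f \<bar>v\<bar> \<partial>lborel) = 2 * (\<integral>\<^sup>+v. f v * indicator {0<..} v \<partial>(lborel :: real measure))"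
proof -
  have "(\<integral>\<^sup>+v. f \<bar>v\<bar> \<partial>lborel) = (\<integral>\<^sup>+v. f v * indicator {0<..} v + f (- v) * indicator {0<..} (- v) \<partial>(lborel :: real measure))"
  proof (rule nn_integral_cong_AE)
    have "AE v in lborel. v \<noteq> (0::real)" by (rule AE_lborel_singleton)
    then show "AE v in lborel. f \<bar>v\<bar> = f v * indicator {0<..} v + f (- v) * indicator {0<..} (- v)"
      by eventually_elim (auto split: split_indicator)
  qed
  also have "\<dots> = (\<integral>\<^sup>+v. f v * indicator {0<..} v \<partial>lborel) + (\<integral>\<^sup>+v. f (- v) * indicator {0<..} (- v) \<partial>(lborel :: real measure))"
    by (rule nn_integral_add) measurable
  also have "(\<integral>\<^sup>+v. f (- v) * indicator {0<..} (- v) \<partial>(lborel :: real measure)) = (\<integral>\<^sup>+v. f v * indicator {0<..} v \<partial>lborel)"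
    using nn_integral_lborel_shift(3)[of "\<lambda>v. f v * indicator {0<..} v" 0] by simp
  finally show ?thesis by (simp add: mult_2)
qed

text \<open>The summands are the near and the far contribution in \<open>HLS_inner\<close>; the
  leading 2 pays for the symmetrisation in \<open>HLS_diag\<close>.\<close>

definition HLS_const :: "real \<Rightarrow> real" where
  "HLS_const \<alpha> = 2 * (2 / (1 - \<alpha>) + 2 powr (\<alpha> / 2))"

text \<open>The points with \<open>G y \<le> G x\<close> are split at distance \<open>\<rho>\<close> from \<open>u x\<close>; the near part is estimated with
  \<open>G y \<le> G x\<close>, the far part by Hoelder's inequality, and \<open>\<rho> = (\<integral> G powr a) * G x powr - a\<close> balances the two.\<close>

lemma HLS_inner:
  fixes u G :: "'a \<Rightarrow> real"
  assumes [measurable]: "u \<in> borel_measurable M" "G \<in> borel_measurable M"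
    and G: "\<And>x. 0 \<le> G x" and \<alpha>: "0 < \<alpha>" "\<alpha> < 1" and a: "a = 2 / (2 - \<alpha>)"
    and push: "\<And>c \<Theta>. \<Theta> \<in> borel_measurable borel \<Longrightarrow> (\<integral>\<^sup>+x. \<Theta> (u x - c) \<partial>M) \<le> (\<integral>\<^sup>+v. \<Theta> v \<partial>(lborel :: real measure))"
    and N: "(\<integral>\<^sup>+x. ennreal (G x powr a) \<partial>M) = ennreal N" "N > 0"
    and g: "g > 0"
  shows "(\<integral>\<^sup>+y. ennreal (G y * \<bar>u y - c\<bar> powr - \<alpha>) * indicator {y. G y \<le> g} y \<partial>M)
     \<le> ennreal ((2 / (1 - \<alpha>) + 2 powr (\<alpha> / 2)) * N powr (1 - \<alpha>) * g powr (a * \<alpha> / 2))"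
proof -
  define \<rho> where "\<rho> = N * g powr - a"
  have \<rho>: "\<rho> > 0" using N g by (simp add: \<rho>_def)
  have a1: "a > 1" "1 / a = 1 - \<alpha> / 2" using \<alpha> by (auto simp: a field_simps)
  have near: "(\<integral>\<^sup>+v. ennreal (\<bar>v\<bar> powr - \<alpha>) * indicator {..<\<rho>} \<bar>v\<bar> \<partial>lborel) = ennreal (2 / (1 - \<alpha>) * \<rho> powr (1 - \<alpha>))"
  proof -
    have "(\<integral>\<^sup>+v. ennreal (\<bar>v\<bar> powr - \<alpha>) * indicator {..<\<rho>} \<bar>v\<bar> \<partial>lborel) = 2 * (\<integral>\<^sup>+v. ennreal (v powr - \<alpha>) * indicator {..<\<rho>} v * indicator {0<..} v \<partial>lborel)"
      by (rule nn_integral_even) measurable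
    also have "(\<integral>\<^sup>+v. ennreal (v powr - \<alpha>) * indicator {..<\<rho>} v * indicator {0<..} v \<partial>lborel) = (\<integral>\<^sup>+v. ennreal (v powr - \<alpha>) * indicator {0<..<\<rho>} v \<partial>lborel)"
      by (intro nn_integral_cong) (auto split: split_indicator)
    also have "\<dots> = ennreal (\<rho> powr (- \<alpha> + 1) / (- \<alpha> + 1))"
      using \<alpha> \<rho> by (intro nn_integral_powr_from_0) auto
    also have "2 * \<dots> = ennreal (2 / (1 - \<alpha>) * \<rho> powr (1 - \<alpha>))"
      using ennreal_mult[of 2 "\<rho> powr (1 - \<alpha>) / (1 - \<alpha>)"] \<alpha> by simp
    finally show ?thesis .
  qed
  have far: "(\<integral>\<^sup>+v. ennreal (\<bar>v\<bar> powr - 2) * indicator {\<rho>..} \<bar>v\<bar> \<partial>lborel) = ennreal (2 / \<rho>)"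
  proof -
    have "(\<integral>\<^sup>+v. ennreal (\<bar>v\<bar> powr - 2) * indicator {\<rho>..} \<bar>v\<bar> \<partial>lborel) = 2 * (\<integral>\<^sup>+v. ennreal (v powr - 2) * indicator {\<rho>..} v * indicator {0<..} v \<partial>lborel)"
      by (rule nn_integral_even) measurable
    also have "(\<integral>\<^sup>+v. ennreal (v powr - 2) * indicator {\<rho>..} v * indicator {0<..} v \<partial>lborel) = (\<integral>\<^sup>+v. ennreal (v powr - 2) * indicator {\<rho>..} v \<partial>lborel)"
      using \<rho> by (intro nn_integral_cong) (auto split: split_indicator)
    also have "\<dots> = ennreal (\<rho> powr (- 2 + 1) / (- (- 2) - 1))"
      using \<rho> by (intro nn_integral_powr_to_inf) auto
    also have "2 * \<dots> = ennreal (2 / \<rho>)"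
      using ennreal_mult[of 2 "1 / \<rho>"] \<rho> by (simp add: powr_minus divide_inverse)
    finally show ?thesis .
  qed
  have "(\<integral>\<^sup>+y. ennreal (G y * \<bar>u y - c\<bar> powr - \<alpha>) * indicator {y. G y \<le> g} y \<partial>M) \<le>
    (\<integral>\<^sup>+y. ennreal g * (ennreal (\<bar>u y - c\<bar> powr - \<alpha>) * indicator {..<\<rho>} \<bar>u y - c\<bar>)
        + ennreal (G y) * (ennreal (\<bar>u y - c\<bar> powr - \<alpha>) * indicator {\<rho>..} \<bar>u y - c\<bar>) \<partial>M)"
    using G g by (intro nn_integral_mono)
      (auto split: split_indicator simp: ennreal_mult[symmetric] intro!: ennreal_leI mult_right_mono)
  also have "\<dots> = (\<integral>\<^sup>+y. ennreal g * (ennreal (\<bar>u y - c\<bar> powr - \<alpha>) * indicator {..<\<rho>} \<bar>u y - c\<bar>) \<partial>M)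
        + (\<integral>\<^sup>+y. ennreal (G y) * (ennreal (\<bar>u y - c\<bar> powr - \<alpha>) * indicator {\<rho>..} \<bar>u y - c\<bar>) \<partial>M)"
    by (rule nn_integral_add) measurable
  also have "\<dots> \<le> ennreal (2 / (1 - \<alpha>) * N powr (1 - \<alpha>) * g powr (a * \<alpha> / 2)) + ennreal (2 powr (\<alpha> / 2) * N powr (1 - \<alpha>) * g powr (a * \<alpha> / 2))"
  proof (rule add_mono)
    have "(\<integral>\<^sup>+y. ennreal g * (ennreal (\<bar>u y - c\<bar> powr - \<alpha>) * indicator {..<\<rho>} \<bar>u y - c\<bar>) \<partial>M)
      = ennreal g * (\<integral>\<^sup>+y. (ennreal (\<bar>u y - c\<bar> powr - \<alpha>) * indicator {..<\<rho>} \<bar>u y - c\<bar>) \<partial>M)"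
      by (rule nn_integral_cmult) measurable
    also have "\<dots> \<le> ennreal g * ennreal (2 / (1 - \<alpha>) * \<rho> powr (1 - \<alpha>))"
      unfolding near[symmetric] by (intro mult_left_mono push[where \<Theta> = "\<lambda>v. ennreal (\<bar>v\<bar> powr - \<alpha>) * indicator {..<\<rho>} \<bar>v\<bar>"]) auto
    also have "\<dots> = ennreal (2 / (1 - \<alpha>) * N powr (1 - \<alpha>) * g powr (a * \<alpha> / 2))"
    proof -
      have "g * \<rho> powr (1 - \<alpha>) = N powr (1 - \<alpha>) * (g powr 1 * g powr (- a * (1 - \<alpha>)))"
        using N g by (simp add: \<rho>_def powr_mult powr_powr)
      also have "g powr 1 * g powr (- a * (1 - \<alpha>)) = g powr (a * \<alpha> / 2)"
        unfolding powr_add[symmetric] using \<alpha> by (intro arg_cong2[where f = "(powr)"]) (auto simp: a field_simps)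
      finally have e: "g * \<rho> powr (1 - \<alpha>) = N powr (1 - \<alpha>) * g powr (a * \<alpha> / 2)" .
      have "ennreal g * ennreal (2 / (1 - \<alpha>) * \<rho> powr (1 - \<alpha>)) = ennreal (2 / (1 - \<alpha>) * (g * \<rho> powr (1 - \<alpha>)))"
        using g \<alpha> by (subst ennreal_mult[symmetric]) (auto simp: mult_ac)
      then show ?thesis unfolding e by (simp add: mult.assoc)
    qed
    finally show "(\<integral>\<^sup>+y. ennreal g * (ennreal (\<bar>u y - c\<bar> powr - \<alpha>) * indicator {..<\<rho>} \<bar>u y - c\<bar>) \<partial>M)
      \<le> ennreal (2 / (1 - \<alpha>) * N powr (1 - \<alpha>) * g powr (a * \<alpha> / 2))" .
    \<comment> \<open>The exponent conjugate to \<open>a\<close> is \<open>2 / \<alpha>\<close>. It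
      turns the kernel into \<open>\<bar>v\<bar> powr - 2\<close>, whose tails beyond
      \<open>\<rho>\<close> have integral \<open>2 / \<rho>\<close>.\<close>
    have b: "2 / \<alpha> > 1" "1 / a + 1 / (2 / \<alpha>) = 1" using \<alpha> a1 by auto
    have "(\<integral>\<^sup>+y. ennreal (G y) * (ennreal (\<bar>u y - c\<bar> powr - \<alpha>) * indicator {\<rho>..} \<bar>u y - c\<bar>) \<partial>M)
      \<le> ennreal_powr (\<integral>\<^sup>+y. ennreal_powr (ennreal (G y)) a \<partial>M) (1 / a)
         * ennreal_powr (\<integral>\<^sup>+y. ennreal_powr (ennreal (\<bar>u y - c\<bar> powr - \<alpha>) * indicator {\<rho>..} \<bar>u y - c\<bar>) (2 / \<alpha>) \<partial>M) (1 / (2 / \<alpha>))"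
      by (rule nn_integral_Holder[OF _ _ a1(1) b]) measurable
    also have "\<dots> \<le> ennreal (N powr (1 / a)) * ennreal ((2 / \<rho>) powr (\<alpha> / 2))"
    proof (rule mult_mono)
      show "ennreal_powr (\<integral>\<^sup>+y. ennreal_powr (ennreal (G y)) a \<partial>M) (1 / a) \<le> ennreal (N powr (1 / a))"
        using G N by simp
      have "(\<integral>\<^sup>+y. ennreal_powr (ennreal (\<bar>u y - c\<bar> powr - \<alpha>) * indicator {\<rho>..} \<bar>u y - c\<bar>) (2 / \<alpha>) \<partial>M)
        = (\<integral>\<^sup>+y. ennreal (\<bar>u y - c\<bar> powr - 2) * indicator {\<rho>..} \<bar>u y - c\<bar> \<partial>M)"
        using \<alpha> by (intro nn_integral_cong) (auto split: split_indicator simp: powr_powr)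
      also have "\<dots> \<le> ennreal (2 / \<rho>)"
        unfolding far[symmetric] by (intro push[where \<Theta> = "\<lambda>v. ennreal (\<bar>v\<bar> powr - 2) * indicator {\<rho>..} \<bar>v\<bar>"]) auto
      finally have "ennreal_powr (\<integral>\<^sup>+y. ennreal_powr (ennreal (\<bar>u y - c\<bar> powr - \<alpha>) * indicator {\<rho>..} \<bar>u y - c\<bar>) (2 / \<alpha>) \<partial>M) (1 / (2 / \<alpha>))
        \<le> ennreal_powr (ennreal (2 / \<rho>)) (1 / (2 / \<alpha>))"
        using \<alpha> by (intro ennreal_powr_mono) auto
      then show "ennreal_powr (\<integral>\<^sup>+y. ennreal_powr (ennreal (\<bar>u y - c\<bar> powr - \<alpha>) * indicator {\<rho>..} \<bar>u y - c\<bar>) (2 / \<alpha>) \<partial>M) (1 / (2 / \<alpha>))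
        \<le> ennreal ((2 / \<rho>) powr (\<alpha> / 2))" using \<rho> by simp
    qed auto
    also have "\<dots> = ennreal (2 powr (\<alpha> / 2) * N powr (1 - \<alpha>) * g powr (a * \<alpha> / 2))"
    proof -
      have "(2 / \<rho>) powr (\<alpha> / 2) = 2 powr (\<alpha> / 2) * (N powr - (\<alpha> / 2) * g powr (a * \<alpha> / 2))"
      proof -
        have "2 / \<rho> = 2 * (N powr - 1 * g powr a)"
          using N g by (simp add: \<rho>_def powr_minus field_simps)
        then have "(2 / \<rho>) powr (\<alpha> / 2) = 2 powr (\<alpha> / 2) * ((N powr - 1) powr (\<alpha> / 2) * (g powr a) powr (\<alpha> / 2))"
          by (simp only: powr_mult)
        also have "\<dots> = 2 powr (\<alpha> / 2) * (N powr (- 1 * (\<alpha> / 2)) * g powr (a * (\<alpha> / 2)))"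
          by (simp only: powr_powr)
        finally show ?thesis by simp
      qed
      moreover have "N powr (1 / a) * N powr - (\<alpha> / 2) = N powr (1 - \<alpha>)"
        unfolding powr_add[symmetric] a1(2) by (intro arg_cong2[where f = "(powr)"]) auto
      ultimately show ?thesis by (simp add: ennreal_mult[symmetric] mult_ac)
    qed
    finally show "(\<integral>\<^sup>+y. ennreal (G y) * (ennreal (\<bar>u y - c\<bar> powr - \<alpha>) * indicator {\<rho>..} \<bar>u y - c\<bar>) \<partial>M)
      \<le> ennreal (2 powr (\<alpha> / 2) * N powr (1 - \<alpha>) * g powr (a * \<alpha> / 2))" .
  qed
  also have "\<dots> = ennreal ((2 / (1 - \<alpha>) + 2 powr (\<alpha> / 2)) * N powr (1 - \<alpha>) * g powr (a * \<alpha> / 2))"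
    using \<alpha> by (subst ennreal_plus[symmetric]) (auto simp: algebra_simps)
  finally show ?thesis .
qed

text \<open>By symmetry the pairs with \<open>G y \<le> G x\<close> suffice, at the cost of a factor
  2, and \<open>1 + a * \<alpha> / 2 = a\<close> makes \<open>G x\<close> times the inner bound a
  multiple of \<open>G x powr a\<close>. The assumption \<open>push\<close> says that
  \<open>u\<close> maps \<open>M\<close> to a measure dominated by Lebesgue measure, so kernels in
  \<open>u\<close> are integrated over the line without inverting \<open>u\<close>.\<close>

lemma HLS_diag:
  fixes u G :: "'a \<Rightarrow> real"
  assumes sf: "sigma_finite_measure M" and m [measurable]: "u \<in> borel_measurable M" "G \<in> borel_measurable M"
    and G: "\<And>x. 0 \<le> G x" and \<alpha>: "0 < \<alpha>" "\<alpha> < 1" and a: "a = 2 / (2 - \<alpha>)"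
    and push: "\<And>c \<Theta>. \<Theta> \<in> borel_measurable borel \<Longrightarrow> (\<integral>\<^sup>+x. \<Theta> (u x - c) \<partial>M) \<le> (\<integral>\<^sup>+v. \<Theta> v \<partial>(lborel :: real measure))"
  shows "(\<integral>\<^sup>+x. (\<integral>\<^sup>+y. ennreal (G x * G y * \<bar>u y - u x\<bar> powr - \<alpha>) \<partial>M) \<partial>M)
    \<le> ennreal (HLS_const \<alpha>) * ennreal_powr (\<integral>\<^sup>+x. ennreal (G x powr a) \<partial>M) (2 - \<alpha>)"
    (is "?L \<le> _ * ennreal_powr ?N _")
proof -
  interpret sigma_finite_measure M by fact
  interpret P: pair_sigma_finite M M by unfold_locales
  have c: "HLS_const \<alpha> > 0" using \<alpha> by (simp add: HLS_const_def add_pos_pos)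
  have a1: "a > 1" using \<alpha> by (auto simp: a field_simps)
  consider "?N = 0" | "?N = top" | N where "?N = ennreal N" "N > 0"
    by (cases ?N) (auto simp: less_le)
  then show ?thesis
  proof cases
    case 1
    then have "AE x in M. G x = 0" using G by (subst (asm) nn_integral_0_iff_AE) (auto simp: powr_def split: if_splits)
    then have "AE x in M. (\<integral>\<^sup>+y. ennreal (G x * G y * \<bar>u y - u x\<bar> powr - \<alpha>) \<partial>M) = 0"
      by eventually_elim simp
    then have "?L = 0" by (subst nn_integral_0_iff_AE) auto
    then show ?thesis by simp
  next
    case 2
    then show ?thesis using c by (simp add: ennreal_mult_top)
  next
    case (3 N)
    define K where "K = (\<integral>\<^sup>+x. (\<integral>\<^sup>+y. ennreal (G x * G y * \<bar>u y - u x\<bar> powr - \<alpha>) * indicator {p. G (snd p) \<le> G (fst p)} (x, y) \<partial>M) \<partial>M)"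
    have "?L \<le> (\<integral>\<^sup>+x. (\<integral>\<^sup>+y. ennreal (G x * G y * \<bar>u y - u x\<bar> powr - \<alpha>) * indicator {p. G (snd p) \<le> G (fst p)} (x, y)
       + ennreal (G y * G x * \<bar>u x - u y\<bar> powr - \<alpha>) * indicator {p. G (snd p) \<le> G (fst p)} (y, x) \<partial>M) \<partial>M)"
      by (intro nn_integral_mono) (auto split: split_indicator simp: abs_minus_commute mult.commute)
    also have "\<dots> = (\<integral>\<^sup>+x. (\<integral>\<^sup>+y. ennreal (G x * G y * \<bar>u y - u x\<bar> powr - \<alpha>) * indicator {p. G (snd p) \<le> G (fst p)} (x, y) \<partial>M)
       + (\<integral>\<^sup>+y. ennreal (G y * G x * \<bar>u x - u y\<bar> powr - \<alpha>) * indicator {p. G (snd p) \<le> G (fst p)} (y, x) \<partial>M) \<partial>M)"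
      by (intro nn_integral_cong nn_integral_add) measurable
    also have "\<dots> = K + (\<integral>\<^sup>+x. (\<integral>\<^sup>+y. ennreal (G y * G x * \<bar>u x - u y\<bar> powr - \<alpha>) * indicator {p. G (snd p) \<le> G (fst p)} (y, x) \<partial>M) \<partial>M)"
      unfolding K_def by (rule nn_integral_add) measurable
    also have "(\<integral>\<^sup>+x. (\<integral>\<^sup>+y. ennreal (G y * G x * \<bar>u x - u y\<bar> powr - \<alpha>) * indicator {p. G (snd p) \<le> G (fst p)} (y, x) \<partial>M) \<partial>M) = K"
      unfolding K_def by (rule P.Fubini') measurable
    finally have LK: "?L \<le> 2 * K" by (simp add: mult_2)
    let ?c = "(2 / (1 - \<alpha>) + 2 powr (\<alpha> / 2)) * N powr (1 - \<alpha>)"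
    have c0: "?c \<ge> 0" using \<alpha> by simp
    have "K \<le> (\<integral>\<^sup>+x. ennreal ?c * ennreal (G x powr a) \<partial>M)"
      unfolding K_def
    proof (rule nn_integral_mono)
      fix x
      show "(\<integral>\<^sup>+y. ennreal (G x * G y * \<bar>u y - u x\<bar> powr - \<alpha>) * indicator {p. G (snd p) \<le> G (fst p)} (x, y) \<partial>M) \<le> ennreal ?c * ennreal (G x powr a)"
      proof (cases "G x = 0")
        case False
        then have g: "G x > 0" using G[of x] by simp
        have "(\<integral>\<^sup>+y. ennreal (G x * G y * \<bar>u y - u x\<bar> powr - \<alpha>) * indicator {p. G (snd p) \<le> G (fst p)} (x, y) \<partial>M)
          = (\<integral>\<^sup>+y. ennreal (G x) * (ennreal (G y * \<bar>u y - u x\<bar> powr - \<alpha>) * indicator {y. G y \<le> G x} y) \<partial>M)"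
          using G by (intro nn_integral_cong) (auto split: split_indicator simp: ennreal_mult[symmetric] mult_ac)
        also have "\<dots> = ennreal (G x) * (\<integral>\<^sup>+y. (ennreal (G y * \<bar>u y - u x\<bar> powr - \<alpha>) * indicator {y. G y \<le> G x} y) \<partial>M)"
          by (rule nn_integral_cmult) measurable
        also have "\<dots> \<le> ennreal (G x) * ennreal (?c * G x powr (a * \<alpha> / 2))"
          by (intro mult_left_mono HLS_inner[OF m G \<alpha> a push 3 g]) auto
        also have "\<dots> = ennreal ?c * ennreal (G x powr a)"
        proof -
          have "G x powr a = G x powr 1 * G x powr (a * \<alpha> / 2)"
            unfolding powr_add[symmetric] using \<alpha> by (intro arg_cong2[where f = "(powr)"]) (auto simp: a field_simps)
          then have e: "G x powr a = G x * G x powr (a * \<alpha> / 2)" using g by simp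
          have "ennreal (G x) * ennreal (?c * G x powr (a * \<alpha> / 2)) = ennreal (G x * (?c * G x powr (a * \<alpha> / 2)))"
            using c0 g by (intro ennreal_mult[symmetric] mult_nonneg_nonneg[OF c0]) auto
          also have "\<dots> = ennreal (?c * (G x * G x powr (a * \<alpha> / 2)))" by (simp add: mult_ac)
          also have "\<dots> = ennreal ?c * ennreal (G x * G x powr (a * \<alpha> / 2))" using c0 g by (intro ennreal_mult) auto
          finally show ?thesis unfolding e .
        qed
        finally show ?thesis .
      qed simp
    qed
    also have "\<dots> = ennreal ?c * ennreal N"
      unfolding 3(1)[symmetric] by (rule nn_integral_cmult) measurable
    finally have "?L \<le> 2 * (ennreal ?c * ennreal N)"
      using LK by (meson mult_left_mono order_trans zero_le)
    also have "\<dots> = ennreal (HLS_const \<alpha>) * ennreal_powr ?N (2 - \<alpha>)"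
    proof -
      have "N powr (2 - \<alpha>) = N powr (1 - \<alpha>) * N" using 3 powr_add[of N "1 - \<alpha>" 1] by simp
      then have "2 * (?c * N) = HLS_const \<alpha> * N powr (2 - \<alpha>)" by (simp add: HLS_const_def)
      moreover have "2 * (ennreal ?c * ennreal N) = ennreal (2 * (?c * N))"
        using c0 3 ennreal_mult[of 2 "?c * N"] ennreal_mult[of ?c N] by simp
      ultimately show ?thesis using 3 c by (simp add: ennreal_mult)
    qed
    finally show ?thesis .
  qed
qed

text \<open>Equality holds with the image of \<open>S\<close> as domain on the right; extending the
  integral to the whole plane spares any description of that image. If the right-hand side is
  finite, absolute integrability is available.\<close>

lemma nn_integral_change_of_variables_le:
  fixes g :: "real^2 \<Rightarrow> real^2" and \<Theta> :: "real^2 \<Rightarrow> real"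
  assumes S: "S \<in> sets lebesgue"
    and der: "\<And>x. x \<in> S \<Longrightarrow> (g has_derivative g' x) (at x within S)"
    and inj: "inj_on g S" and \<Theta> [measurable]: "\<Theta> \<in> borel_measurable borel" and \<Theta>0: "\<And>x. 0 \<le> \<Theta> x"
  shows "(\<integral>\<^sup>+x. ennreal (\<bar>det (matrix (g' x))\<bar> * \<Theta> (g x)) * indicator S x \<partial>lebesgue) \<le> (\<integral>\<^sup>+x. ennreal (\<Theta> x) \<partial>lborel)"
proof (cases "(\<integral>\<^sup>+x. ennreal (\<Theta> x) \<partial>lborel) = \<infinity>")
  case False
  have "integrable lborel \<Theta>" using False \<Theta>0 by (intro integrableI_nonneg) (auto simp: less_top)
  then have int: "integrable lebesgue \<Theta>" by (subst integrable_completion) auto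
  have gS: "g ` S \<in> sets lebesgue"
    using S der by (intro differentiable_image_in_sets_lebesgue) (auto simp: differentiable_on_def differentiable_def)
  have abs: "\<Theta> absolutely_integrable_on (g ` S)"
    unfolding set_integrable_def by (rule integrable_mult_indicator[OF gS int])
  have *: "(\<lambda>x. \<bar>det (matrix (g' x))\<bar> * \<Theta> (g x)) absolutely_integrable_on S \<and>
           integral S (\<lambda>x. \<bar>det (matrix (g' x))\<bar> * \<Theta> (g x)) = integral (g ` S) \<Theta>"
  proof -
    \<comment> \<open>The integrand is regarded as \<open>real^1\<close> valued, because the change
      of variables theorem is about vector valued functions.\<close>
    have "(\<lambda>x. \<bar>det (matrix (g' x))\<bar> *\<^sub>R (vec (\<Theta> (g x)) :: real^1)) absolutely_integrable_on S \<and>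
           integral S (\<lambda>x. \<bar>det (matrix (g' x))\<bar> *\<^sub>R (vec (\<Theta> (g x)) :: real^1)) = vec (integral (g ` S) \<Theta>)"
      using abs by (subst has_absolute_integral_change_of_variables[OF S der inj])
        (auto simp: absolutely_integrable_on_1_iff integral_on_1_eq)
    then show ?thesis by (simp add: absolutely_integrable_on_1_iff integral_on_1_eq)
  qed
  have "(\<integral>\<^sup>+x. ennreal (\<bar>det (matrix (g' x))\<bar> * \<Theta> (g x)) * indicator S x \<partial>lebesgue)
      = (\<integral>\<^sup>+x. ennreal (indicator S x *\<^sub>R (\<bar>det (matrix (g' x))\<bar> * \<Theta> (g x))) \<partial>lebesgue)"
    by (intro nn_integral_cong) (auto split: split_indicator)
  also have "\<dots> = ennreal (integral S (\<lambda>x. \<bar>det (matrix (g' x))\<bar> * \<Theta> (g x)))"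
    using * \<Theta>0 by (subst nn_integral_eq_integral)
      (auto simp: set_integrable_def set_lebesgue_integral_def set_lebesgue_integral_eq_integral(2)[symmetric] intro!: AE_I2)
  also have "\<dots> = ennreal (LINT x|lebesgue. indicator (g ` S) x *\<^sub>R \<Theta> x)"
    using * set_lebesgue_integral_eq_integral(2)[OF abs] by (simp add: set_lebesgue_integral_def)
  also have "\<dots> \<le> ennreal (LINT x|lebesgue. \<Theta> x)"
    using abs int \<Theta>0 by (intro ennreal_leI integral_mono) (auto simp: set_integrable_def split: split_indicator)
  also have "\<dots> = (\<integral>\<^sup>+x. ennreal (\<Theta> x) \<partial>lebesgue)"
    using int \<Theta>0 by (intro nn_integral_eq_integral[symmetric]) auto
  also have "\<dots> = (\<integral>\<^sup>+x. ennreal (\<Theta> x) \<partial>lborel)" by (rule nn_integral_completion)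
  finally show ?thesis .
qed simp

lemma nn_integral_change_of_variables_1_le:
  fixes g :: "real \<Rightarrow> real" and \<Theta> :: "real \<Rightarrow> real"
  assumes S: "S \<in> sets lebesgue"
    and der: "\<And>x. x \<in> S \<Longrightarrow> (g has_field_derivative g' x) (at x within S)"
    and inj: "inj_on g S" and \<Theta> [measurable]: "\<Theta> \<in> borel_measurable borel" and \<Theta>0: "\<And>x. 0 \<le> \<Theta> x"
  shows "(\<integral>\<^sup>+x. ennreal (\<bar>g' x\<bar> * \<Theta> (g x)) * indicator S x \<partial>lebesgue) \<le> (\<integral>\<^sup>+x. ennreal (\<Theta> x) \<partial>lborel)"
proof (cases "(\<integral>\<^sup>+x. ennreal (\<Theta> x) \<partial>lborel) = \<infinity>")
  case False
  have "integrable lborel \<Theta>" using False \<Theta>0 by (intro integrableI_nonneg) (auto simp: less_top)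
  then have int: "integrable lebesgue \<Theta>" by (subst integrable_completion) auto
  have gS: "g ` S \<in> sets lebesgue"
    using S der by (intro differentiable_image_in_sets_lebesgue)
      (auto simp: differentiable_on_def differentiable_def has_field_derivative_def)
  have abs: "\<Theta> absolutely_integrable_on (g ` S)"
    unfolding set_integrable_def by (rule integrable_mult_indicator[OF gS int])
  have *: "(\<lambda>x. \<bar>g' x\<bar> * \<Theta> (g x)) absolutely_integrable_on S \<and>
           integral S (\<lambda>x. \<bar>g' x\<bar> * \<Theta> (g x)) = integral (g ` S) \<Theta>"
    using abs by (subst has_absolute_integral_change_of_variables_1'[OF S der inj]) auto
  have "(\<integral>\<^sup>+x. ennreal (\<bar>g' x\<bar> * \<Theta> (g x)) * indicator S x \<partial>lebesgue)
      = (\<integral>\<^sup>+x. ennreal (indicator S x *\<^sub>R (\<bar>g' x\<bar> * \<Theta> (g x))) \<partial>lebesgue)"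
    by (intro nn_integral_cong) (auto split: split_indicator)
  also have "\<dots> = ennreal (integral S (\<lambda>x. \<bar>g' x\<bar> * \<Theta> (g x)))"
    using * \<Theta>0 by (subst nn_integral_eq_integral)
      (auto simp: set_integrable_def set_lebesgue_integral_def set_lebesgue_integral_eq_integral(2)[symmetric] intro!: AE_I2)
  also have "\<dots> = ennreal (LINT x|lebesgue. indicator (g ` S) x *\<^sub>R \<Theta> x)"
    using * set_lebesgue_integral_eq_integral(2)[OF abs] by (simp add: set_lebesgue_integral_def)
  also have "\<dots> \<le> ennreal (LINT x|lebesgue. \<Theta> x)"
    using abs int \<Theta>0 by (intro ennreal_leI integral_mono) (auto simp: set_integrable_def split: split_indicator)
  also have "\<dots> = (\<integral>\<^sup>+x. ennreal (\<Theta> x) \<partial>lebesgue)"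
    using int \<Theta>0 by (intro nn_integral_eq_integral[symmetric]) auto
  also have "\<dots> = (\<integral>\<^sup>+x. ennreal (\<Theta> x) \<partial>lborel)" by (rule nn_integral_completion)
  finally show ?thesis .
qed simp

section \<open>The extension operator of a piece of a convex curve\<close>

lemma det2_eq: "det2 a b = a $ 1 * b $ 2 - a $ 2 * b $ 1"
  by (simp add: det2_def det_2)

lemma inner_real2: "(a :: real^2) \<bullet> b = a $ 1 * b $ 1 + a $ 2 * b $ 2"
  by (simp add: inner_vec_def sum_2)

lemma bounded_bilinear_det2: "bounded_bilinear det2"
proof (rule bounded_bilinear.intro)
  show "\<exists>K. \<forall>a b. norm (det2 a b) \<le> norm a * norm b * K"
  proof (intro exI allI)
    fix a b :: "real^2"
    have c: "\<bar>x $ i\<bar> \<le> norm x" for x :: "real^2" and i by (rule component_le_norm_cart)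
    have "\<bar>a $ 1 * b $ 2\<bar> \<le> norm a * norm b" "\<bar>a $ 2 * b $ 1\<bar> \<le> norm a * norm b"
      unfolding abs_mult by (intro mult_mono c; simp)+
    then show "norm (det2 a b) \<le> norm a * norm b * 2" by (simp add: det2_eq)
  qed
qed (simp_all add: det2_eq algebra_simps)

lemmas det2_simps = bounded_bilinear.add_left[OF bounded_bilinear_det2] bounded_bilinear.add_right[OF bounded_bilinear_det2]
  bounded_bilinear.diff_left[OF bounded_bilinear_det2] bounded_bilinear.diff_right[OF bounded_bilinear_det2]
  bounded_bilinear.scaleR_left[OF bounded_bilinear_det2] bounded_bilinear.scaleR_right[OF bounded_bilinear_det2]
  bounded_bilinear.minus_left[OF bounded_bilinear_det2] bounded_bilinear.minus_right[OF bounded_bilinear_det2]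
  bounded_bilinear.zero_left[OF bounded_bilinear_det2] bounded_bilinear.zero_right[OF bounded_bilinear_det2]

lemma borel_measurable_vec_nth' [measurable (raw)]:
  fixes f :: "'a \<Rightarrow> real^'n"
  assumes "f \<in> borel_measurable M" shows "(\<lambda>x. f x $ i) \<in> borel_measurable M"
  by (rule measurable_compose[OF assms]) (intro borel_measurable_continuous_onI continuous_intros)

lemma borel_measurable_det2 [measurable (raw)]:
  assumes [measurable]: "f \<in> borel_measurable M" "g \<in> borel_measurable M"
  shows "(\<lambda>x. det2 (f x) (g x)) \<in> borel_measurable M"
  unfolding det2_eq by measurable

text \<open>Up to the factor \<open>norm e\<close>, the numbers \<open>e \<bullet> a\<close> and
  \<open>det2 e a\<close> are the coordinates of \<open>a\<close> with respect to the direction of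
  \<open>e\<close> and its rotation by a right angle; the left-hand side is the determinant in these
  coordinates.\<close>

lemma det2_inner_identity: "(e \<bullet> a) * det2 e b - (e \<bullet> b) * det2 e a = (e \<bullet> e) * det2 a b"
  by (simp add: det2_eq inner_real2 algebra_simps)

text \<open>The change of variables lemmas concern real valued test functions. Truncation of
  \<open>\<Theta>\<close> at \<open>n\<close> and monotone convergence extend their consequences to
  test functions with infinite values, such as powers of maximal functions.\<close>

lemma nn_integral_le_realI:
  fixes f :: "'a \<Rightarrow> 'b::topological_space"
  assumes f: "f \<in> measurable M borel" and \<Theta> [measurable]: "\<Theta> \<in> borel_measurable borel"
    and le: "\<And>\<theta>::'b \<Rightarrow> real. \<theta> \<in> borel_measurable borel \<Longrightarrow> (\<And>v. 0 \<le> \<theta> v) \<Longrightarrow> (\<integral>\<^sup>+x. ennreal (\<theta> (f x)) \<partial>M) \<le> C * (\<integral>\<^sup>+v. ennreal (\<theta> v) \<partial>N)"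
    and N [measurable_cong]: "sets N = sets borel"
  shows "(\<integral>\<^sup>+x. \<Theta> (f x) \<partial>M) \<le> C * (\<integral>\<^sup>+v. \<Theta> v \<partial>N)"
proof -
  note f [measurable]
  define \<theta> where "\<theta> n v = enn2real (min (\<Theta> v) (of_nat n))" for n v
  have e: "ennreal (\<theta> n v) = min (\<Theta> v) (of_nat n)" for n v
    unfolding \<theta>_def by (rule ennreal_enn2real) (simp add: min_less_iff_disj of_nat_less_top)
  have mono: "ennreal (\<theta> n v) \<le> ennreal (\<theta> k v)" if "n \<le> k" for n k v
    unfolding e using that by (intro min.mono) auto
  have [measurable]: "\<theta> n \<in> borel_measurable borel" for n unfolding \<theta>_def by measurable
  have SUP: "(SUP n. ennreal (\<theta> n v)) = \<Theta> v" for v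
  proof -
    have "(SUP n. min (\<Theta> v) (of_nat n)) = min (\<Theta> v) (SUP n. of_nat n)"
      unfolding inf_min[symmetric] by (rule inf_SUP[symmetric])
    then show ?thesis by (simp add: e ennreal_SUP_of_nat_eq_top)
  qed
  have "(\<integral>\<^sup>+x. \<Theta> (f x) \<partial>M) = (\<integral>\<^sup>+x. (SUP n. ennreal (\<theta> n (f x))) \<partial>M)" by (simp add: SUP)
  also have "\<dots> = (SUP n. \<integral>\<^sup>+x. ennreal (\<theta> n (f x)) \<partial>M)"
    by (intro nn_integral_monotone_convergence_SUP)
      (auto simp: incseq_def le_fun_def mono)
  also have "\<dots> \<le> C * (\<integral>\<^sup>+v. \<Theta> v \<partial>N)"
  proof (rule SUP_least)
    fix n
    have "(\<integral>\<^sup>+x. ennreal (\<theta> n (f x)) \<partial>M) \<le> C * (\<integral>\<^sup>+v. ennreal (\<theta> n v) \<partial>N)"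
      by (rule le) (auto simp: \<theta>_def[of n])
    also have "\<dots> \<le> C * (\<integral>\<^sup>+v. \<Theta> v \<partial>N)"
      by (intro mult_left_mono nn_integral_mono) (auto simp: e)
    finally show "(\<integral>\<^sup>+x. ennreal (\<theta> n (f x)) \<partial>M) \<le> C * (\<integral>\<^sup>+v. \<Theta> v \<partial>N)" .
  qed
  finally show ?thesis .
qed

text \<open>A part of a convex curve on which the tangent \<open>d\<close> stays in the half plane \<open>e \<bullet> d > 0\<close>: in the
  coordinates \<open>e \<bullet> z\<close> and \<open>det2 e z\<close> it lies on the graph of a convex function with slope \<open>m\<close>.\<close>

locale arc_piece =
  fixes S :: "real set" and z d d' :: "real \<Rightarrow> real^2" and \<kappa> :: "real \<Rightarrow> real" and e :: "real^2"
  assumes S [measurable]: "S \<in> sets borel"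
    and z [measurable]: "z \<in> borel_measurable borel" and d [measurable]: "d \<in> borel_measurable borel"
    and \<kappa> [measurable]: "\<kappa> \<in> borel_measurable borel"
    and e: "norm e = 1"
    and der_z: "\<And>t. t \<in> S \<Longrightarrow> (z has_vector_derivative d t) (at t)"
    and der_d: "\<And>t. t \<in> S \<Longrightarrow> (d has_vector_derivative d' t) (at t)"
    and \<kappa>_eq: "\<And>t. t \<in> S \<Longrightarrow> \<kappa> t = det2 (d t) (d' t)"
    and \<kappa>_pos: "\<And>t. t \<in> S \<Longrightarrow> 0 < \<kappa> t"
    and d_pos: "\<And>t. t \<in> S \<Longrightarrow> 0 < e \<bullet> d t"
    and supp: "\<And>s t. 0 \<le> det2 (d t) (z s - z t)"
    and inj: "inj_on z S"
begin

definition "w t = e \<bullet> d t"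
definition "m t = det2 e (d t) / w t"
definition "x t = e \<bullet> z t"

lemma ee: "e \<bullet> e = 1" using e by (simp add: norm_eq_1)

lemma measurable_wmx [measurable]: "w \<in> borel_measurable borel" "m \<in> borel_measurable borel" "x \<in> borel_measurable borel"
  unfolding w_def m_def x_def by measurable

lemma w_pos: "t \<in> S \<Longrightarrow> 0 < w t"
  using d_pos by (simp add: w_def)

text \<open>The curve lies to the left of its tangent at \<open>t\<close>; divided by
  \<open>w t\<close> this is the subgradient inequality. The condition is \<open>0 < w t\<close> and
  not membership in \<open>S\<close>, so that it also covers parameters outside \<open>S\<close>, as
  in \<open>m_less\<close>.\<close>

lemma slope_le:
  assumes "0 < w t" shows "m t * (x s - x t) \<le> det2 e (z s) - det2 e (z t)"
proof -
  have "0 \<le> (e \<bullet> d t) * det2 e (z s - z t) - (e \<bullet> (z s - z t)) * det2 e (d t)"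
    using supp[of t s] by (simp add: det2_inner_identity ee)
  then show ?thesis using assms by (simp add: m_def w_def x_def field_simps det2_simps inner_diff_right)
qed

text \<open>The two subgradient inequalities at \<open>s\<close> and \<open>t\<close> are
  added.\<close>

lemma m_mono: "0 < w s \<Longrightarrow> 0 < w t \<Longrightarrow> x s < x t \<Longrightarrow> m s \<le> m t"
proof -
  assume "0 < w s" "0 < w t" and lt: "x s < x t"
  then have "m s * (x t - x s) \<le> m t * (x t - x s)"
    using slope_le[of s t] slope_le[of t s] by (simp add: algebra_simps)
  then show ?thesis using lt by simp
qed

text \<open>Equal abscissas and the subgradient inequality in both directions give equal ordinates,
  and a vector whose two coordinates relative to \<open>e\<close> vanish is zero.\<close>

lemma x_inj: assumes "s \<in> S" "t \<in> S" "x s = x t" shows "s = t"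
proof -
  have "det2 e (z s - z t) = 0" "e \<bullet> (z s - z t) = 0"
    using slope_le[OF w_pos, of t s] slope_le[OF w_pos, of s t] assms
    by (auto simp: det2_simps x_def inner_diff_right)
  then have "(z s - z t) \<bullet> (z s - z t) = 0"
  proof -
    assume a: "det2 e (z s - z t) = 0" "e \<bullet> (z s - z t) = 0"
    have "(det2 e v)\<^sup>2 + (e \<bullet> v)\<^sup>2 = (e \<bullet> e) * (v \<bullet> v)" for v
      by (simp add: det2_eq inner_real2 algebra_simps power2_eq_square)
    from this[of "z s - z t"] show ?thesis unfolding a ee by simp
  qed
  then show ?thesis using inj assms by (auto dest: inj_onD)
qed

text \<open>In the quotient rule the numerator reduces to \<open>det2 (d t) (d' t)\<close> by
  \<open>det2_inner_identity\<close>, because \<open>e\<close> is a unit vector.\<close>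

lemma m_deriv: assumes t: "t \<in> S" shows "(m has_real_derivative \<kappa> t / (w t)\<^sup>2) (at t)"
proof -
  have w: "(w has_real_derivative e \<bullet> d' t) (at t)"
    unfolding w_def has_real_derivative_iff_has_vector_derivative
    by (rule bounded_linear.has_vector_derivative[OF bounded_linear_inner_right der_d[OF t]])
  have p: "((\<lambda>t. det2 e (d t)) has_real_derivative det2 e (d' t)) (at t)"
    unfolding has_real_derivative_iff_has_vector_derivative
    by (rule bounded_linear.has_vector_derivative[OF bounded_bilinear.bounded_linear_right[OF bounded_bilinear_det2] der_d[OF t]])
  have "(m has_real_derivative (det2 e (d' t) * w t - det2 e (d t) * (e \<bullet> d' t)) / (w t * w t)) (at t)"
    unfolding m_def using w_pos[OF t] by (intro DERIV_divide p w) auto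
  moreover have "det2 e (d' t) * w t - det2 e (d t) * (e \<bullet> d' t) = \<kappa> t"
    using det2_inner_identity[of e "d t" "d' t"] by (simp add: \<kappa>_eq[OF t] ee w_def mult.commute)
  ultimately show ?thesis by (simp add: power2_eq_square)
qed

text \<open>Strictness comes from the positive derivative at \<open>s\<close>: slightly to the right
  of \<open>s\<close>, at a parameter \<open>u\<close> that may lie outside \<open>S\<close>, the
  slope has already grown, and \<open>m_mono\<close> compares \<open>u\<close> with
  \<open>t\<close>.\<close>

lemma m_less: assumes "s \<in> S" "t \<in> S" "x s < x t" shows "m s < m t"
proof (rule ccontr)
  assume "\<not> m s < m t"
  then have eq: "m t \<le> m s" by simp
  have "0 < \<kappa> s / (w s)\<^sup>2" using \<kappa>_pos[OF assms(1)] w_pos[OF assms(1)] by simp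
  then obtain \<delta> where \<delta>: "\<delta> > 0" "\<And>h. 0 < h \<Longrightarrow> h < \<delta> \<Longrightarrow> m s < m (s + h)"
    using DERIV_pos_inc_right[OF m_deriv[OF assms(1)]] by auto
  have cd: "isCont d s" using der_d[OF assms(1)] by (rule has_vector_derivative_continuous)
  have cz: "isCont z s" using der_z[OF assms(1)] by (rule has_vector_derivative_continuous)
  have "isCont w s" "isCont x s" unfolding w_def x_def using cd cz by (auto intro!: continuous_intros)
  then have "\<forall>\<^sub>F u in at s. 0 < w u" "\<forall>\<^sub>F u in at s. x u < x t"
    using w_pos[OF assms(1)] assms(3) by (auto simp: isCont_def order_tendsto_iff)
  then have "\<forall>\<^sub>F u in at_right s. 0 < w u \<and> x u < x t"
    by (auto simp: eventually_at_split eventually_conj)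
  moreover have "\<forall>\<^sub>F u in at_right s. u \<in> {s<..<s + \<delta>}" using \<delta>(1) by (intro eventually_at_right_real) simp
  ultimately have "\<forall>\<^sub>F u in at_right s. 0 < w u \<and> x u < x t \<and> u \<in> {s<..<s + \<delta>}" by eventually_elim auto
  then obtain u where u: "0 < w u" "x u < x t" "s < u" "u < s + \<delta>"
    using eventually_happens'[OF trivial_limit_at_right_real[of s]] by fastforce
  have "m s < m (s + (u - s))" using u by (intro \<delta>(2)) auto
  also have "\<dots> \<le> m t" using m_mono[of u t] u w_pos[OF assms(2)] by simp
  finally show False using eq by simp
qed

lemma m_inj: "inj_on m S"
proof (rule inj_onI)
  fix s t assume st: "s \<in> S" "t \<in> S" and eq: "m s = m t"
  then have "\<not> x s < x t" "\<not> x t < x s" using m_less[of s t] m_less[of t s] by auto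
  then show "s = t" using x_inj st by simp
qed

text \<open>The slope is taken as the new variable; the density is its derivative. This supplies the
  assumption \<open>push\<close> of \<open>HLS_diag\<close>.\<close>

lemma m_push:
  assumes \<Theta>: "\<Theta> \<in> borel_measurable borel"
  shows "(\<integral>\<^sup>+t. \<Theta> (m t - c) \<partial>density lborel (\<lambda>t. ennreal (indicator S t * (\<kappa> t / (w t)\<^sup>2)))) \<le> (\<integral>\<^sup>+v. \<Theta> v \<partial>lborel)"
proof -
  have "(\<integral>\<^sup>+t. ennreal (\<theta> (m t - c)) \<partial>density lborel (\<lambda>t. ennreal (indicator S t * (\<kappa> t / (w t)\<^sup>2)))) \<le> 1 * (\<integral>\<^sup>+v. ennreal (\<theta> v) \<partial>lborel)"
    if [measurable]: "\<theta> \<in> borel_measurable borel" and \<theta>0: "\<And>v. 0 \<le> \<theta> v" for \<theta> :: "real \<Rightarrow> real"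
  proof -
    have "(\<integral>\<^sup>+t. ennreal (\<theta> (m t - c)) \<partial>density lborel (\<lambda>t. ennreal (indicator S t * (\<kappa> t / (w t)\<^sup>2))))
      = (\<integral>\<^sup>+t. ennreal (\<bar>\<kappa> t / (w t)\<^sup>2\<bar> * \<theta> (m t - c)) * indicator S t \<partial>lborel)"
      using \<kappa>_pos \<theta>0 by (subst nn_integral_density)
        (auto intro!: nn_integral_cong simp: ennreal_mult[symmetric] less_imp_le split: split_indicator)
    also have "\<dots> = (\<integral>\<^sup>+t. ennreal (\<bar>\<kappa> t / (w t)\<^sup>2\<bar> * \<theta> (m t - c)) * indicator S t \<partial>lebesgue)"
      by (rule nn_integral_completion[symmetric])
    also have "\<dots> \<le> (\<integral>\<^sup>+v. ennreal (\<theta> v) \<partial>lborel)"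
    proof (rule nn_integral_change_of_variables_1_le[where g = "\<lambda>t. m t - c"])
      fix t assume "t \<in> S"
      then show "((\<lambda>t. m t - c) has_real_derivative \<kappa> t / (w t)\<^sup>2) (at t within S)"
        using DERIV_diff[OF has_field_derivative_at_within[OF m_deriv] DERIV_const[of c]] by simp
    qed (use m_inj \<theta>0 in \<open>auto simp: inj_on_def\<close>)
    finally show ?thesis by simp
  qed
  then have "(\<integral>\<^sup>+t. \<Theta> (m t - c) \<partial>density lborel (\<lambda>t. ennreal (indicator S t * (\<kappa> t / (w t)\<^sup>2)))) \<le> 1 * (\<integral>\<^sup>+v. \<Theta> v \<partial>lborel)"
    by (intro nn_integral_le_realI[where f = "\<lambda>t. m t - c", OF _ \<Theta>]) auto
  then show ?thesis by simp
qed

text \<open>On \<open>S\<close> this is the Jacobian of the sum map, see \<open>J_eq\<close>.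
  Written with slopes, it separates into factors of one variable and a difference, the form to which
  the Hardy-Littlewood-Sobolev inequality applies.\<close>

definition "J s t = w s * w t * \<bar>m t - m s\<bar>"

lemma J_measurable [measurable]: "(\<lambda>p. J (fst p) (snd p)) \<in> borel_measurable (borel \<Otimes>\<^sub>M borel)"
  unfolding J_def by measurable

lemma J_eq: assumes "s \<in> S" "t \<in> S" shows "J s t = \<bar>det2 (d s) (d t)\<bar>"
proof -
  have "w s * w t * (m t - m s) = det2 (d s) (d t)"
    using w_pos[OF assms(1)] w_pos[OF assms(2)] det2_inner_identity[of e "d s" "d t"] by (simp add: m_def w_def field_simps ee)
  moreover have "J s t = \<bar>w s * w t * (m t - m s)\<bar>"
    using w_pos[OF assms(1)] w_pos[OF assms(2)] by (simp add: J_def abs_mult)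
  ultimately show ?thesis by simp
qed

lemma J_pos: assumes "s \<in> S" "t \<in> S" "s \<noteq> t" shows "0 < J s t"
proof -
  have "m t \<noteq> m s" using inj_onD[OF m_inj, of t s] assms by auto
  then show ?thesis unfolding J_def using w_pos[OF assms(1)] w_pos[OF assms(2)] by (intro mult_pos_pos) auto
qed

text \<open>If two different pairs had the same sum, one would be nested in the other. The secant
  from the outer to the inner left point has slope at most \<open>m s'\<close>, the one on the right
  has slope at least \<open>m t'\<close>, and equal sums make the two slopes equal, although
  \<open>m s' < m t'\<close>.\<close>

lemma sum_inj:
  assumes S4: "s \<in> S" "t \<in> S" "s' \<in> S" "t' \<in> S" and lt: "x s < x t" "x s' < x t'" and eq: "z s + z t = z s' + z t'"
  shows "s = s'"
proof -
  have ge: "x s' \<le> x s"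
    if S4: "s \<in> S" "t \<in> S" "s' \<in> S" "t' \<in> S" and lt: "x s' < x t'" and eq: "z s + z t = z s' + z t'" for s t s' t'
  proof (rule ccontr)
    assume "\<not> x s' \<le> x s"
    then have del: "x s < x s'" by simp
    have X: "x t - x t' = x s' - x s" using arg_cong[OF eq, of "\<lambda>v. e \<bullet> v"] by (simp add: x_def inner_add_right)
    have Y: "det2 e (z t) - det2 e (z t') = det2 e (z s') - det2 e (z s)"
      using arg_cong[OF eq, of "\<lambda>v. det2 e v"] by (simp add: det2_simps)
    have "m t' * (x s' - x s) \<le> det2 e (z t) - det2 e (z t')"
      using slope_le[OF w_pos[OF S4(4)], of t] X by simp
    moreover have "det2 e (z s') - det2 e (z s) \<le> m s' * (x s' - x s)"
      using slope_le[OF w_pos[OF S4(3)], of s] by (simp add: algebra_simps)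
    ultimately have "m t' * (x s' - x s) \<le> m s' * (x s' - x s)" using Y by simp
    then have "m t' \<le> m s'" using del by simp
    then show False using m_less[OF S4(3,4) lt] by simp
  qed
  have "x s = x s'" using ge[OF S4 lt(2) eq] ge[OF S4(3,4,1,2) lt(1) eq[symmetric]] by simp
  then show ?thesis using x_inj S4 by simp
qed

text \<open>The order \<open>x s < x t\<close> makes the sum map injective by
  \<open>sum_inj\<close>, and the determinant of its derivative is
  \<open>det2 (d s) (d t)\<close>.\<close>

lemma sum_push_half:
  assumes [measurable]: "\<theta> \<in> borel_measurable borel" and \<theta>0: "\<And>v. 0 \<le> \<theta> v"
  shows "(\<integral>\<^sup>+s. (\<integral>\<^sup>+t. ennreal (indicator S s * indicator S t * (if x s < x t then 1 else 0) * J s t * \<theta> (z s + z t)) \<partial>lborel) \<partial>lborel)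
    \<le> (\<integral>\<^sup>+v. ennreal (\<theta> v) \<partial>lborel)"
proof -
  define A where "A = {p :: real^2. p $ 1 \<in> S \<and> p $ 2 \<in> S \<and> x (p $ 1) < x (p $ 2)}"
  define g where "g p = z (p $ 1) + z (p $ 2)" for p :: "real^2"
  define g' where "g' p h = h $ 1 *\<^sub>R d (p $ 1) + h $ 2 *\<^sub>R d (p $ 2)" for p h :: "real^2"
  have A [measurable]: "A \<in> sets borel"
  proof -
    have "A = {p \<in> space borel. p $ 1 \<in> S \<and> p $ 2 \<in> S \<and> x (p $ 1) < x (p $ 2)}" by (simp add: A_def)
    also have "\<dots> \<in> sets borel" by measurable
    finally show ?thesis .
  qed
  have det: "det (matrix (g' p)) = det2 (d (p $ 1)) (d (p $ 2))" for p
    by (simp add: g'_def matrix_def det_2 det2_eq axis_def)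
  have "(\<integral>\<^sup>+s. (\<integral>\<^sup>+t. ennreal (indicator S s * indicator S t * (if x s < x t then 1 else 0) * J s t * \<theta> (z s + z t)) \<partial>lborel) \<partial>lborel)
    = (\<integral>\<^sup>+s. (\<integral>\<^sup>+t. ennreal (\<bar>det (matrix (g' (pt s t)))\<bar> * \<theta> (g (pt s t))) * indicator A (pt s t) \<partial>lborel) \<partial>lborel)"
    by (intro nn_integral_cong) (auto simp: A_def g_def det J_eq split: split_indicator)
  also have "\<dots> = (\<integral>\<^sup>+p. ennreal (\<bar>det (matrix (g' p))\<bar> * \<theta> (g p)) * indicator A p \<partial>lborel)"
    by (rule nn_integral_real2(1)[symmetric]) (simp add: det g_def)
  also have "\<dots> = (\<integral>\<^sup>+p. ennreal (\<bar>det (matrix (g' p))\<bar> * \<theta> (g p)) * indicator A p \<partial>lebesgue)"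
    by (rule nn_integral_completion[symmetric])
  also have "\<dots> \<le> (\<integral>\<^sup>+v. ennreal (\<theta> v) \<partial>lborel)"
  proof (rule nn_integral_change_of_variables_le)
    show "A \<in> sets lebesgue" using A by simp
    show "inj_on g A"
    proof (rule inj_onI)
      fix p q assume pq: "p \<in> A" "q \<in> A" "g p = g q"
      then have 1: "p $ 1 = q $ 1" by (intro sum_inj[of "p $ 1" "p $ 2" "q $ 1" "q $ 2"]) (auto simp: A_def g_def)
      then have "z (p $ 2) = z (q $ 2)" using pq by (simp add: g_def)
      then have "p $ 2 = q $ 2" using inj pq by (auto simp: A_def dest: inj_onD)
      with 1 show "p = q" by (simp add: vec_eq_iff forall_2)
    qed
    fix p assume p: "p \<in> A"
    have comp: "((\<lambda>p. z (p $ i)) has_derivative (\<lambda>h. h $ i *\<^sub>R d (p $ i))) (at p within A)" if "p $ i \<in> S" for i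
    proof -
      have "(z has_derivative (\<lambda>h. h *\<^sub>R d (p $ i))) (at (p $ i))"
        using der_z[OF that] by (simp add: has_vector_derivative_def)
      moreover have "((\<lambda>p. p $ i) has_derivative (\<lambda>h. h $ i)) (at p within A)"
        by (rule bounded_linear_imp_has_derivative[OF bounded_linear_vec_nth])
      ultimately show ?thesis
        using has_derivative_in_compose[of "\<lambda>p. p $ i" "\<lambda>h. h $ i" p A z "\<lambda>h. h *\<^sub>R d (p $ i)"]
        by (blast intro: has_derivative_at_withinI)
    qed
    show "(g has_derivative g' p) (at p within A)"
      unfolding g_def g'_def using p by (intro has_derivative_add comp) (auto simp: A_def)
  qed (use \<theta>0 in auto)
  finally show ?thesis .
qed

text \<open>The two possible orders of \<open>x s\<close> and \<open>x t\<close> account for the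
  factor 2; on the diagonal \<open>J\<close> vanishes.\<close>

lemma sum_push:
  assumes [measurable]: "\<theta> \<in> borel_measurable borel" and \<theta>0: "\<And>v. 0 \<le> \<theta> v"
  shows "(\<integral>\<^sup>+s. (\<integral>\<^sup>+t. ennreal (indicator S s * indicator S t * J s t * \<theta> (z s + z t)) \<partial>lborel) \<partial>lborel)
    \<le> 2 * (\<integral>\<^sup>+v. ennreal (\<theta> v) \<partial>lborel)"
proof -
  let ?h = "\<lambda>s t. ennreal (indicator S s * indicator S t * (if x s < x t then 1 else 0) * J s t * \<theta> (z s + z t))"
  have "(\<integral>\<^sup>+s. (\<integral>\<^sup>+t. ennreal (indicator S s * indicator S t * J s t * \<theta> (z s + z t)) \<partial>lborel) \<partial>lborel)
    \<le> (\<integral>\<^sup>+s. (\<integral>\<^sup>+t. ?h s t + ?h t s \<partial>lborel) \<partial>lborel)"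
  proof (intro nn_integral_mono)
    fix s t
    show "ennreal (indicator S s * indicator S t * J s t * \<theta> (z s + z t)) \<le> ?h s t + ?h t s"
    proof (cases "s \<in> S \<and> t \<in> S")
      case True
      consider "x s < x t" | "x t < x s" | "s = t" using x_inj True by fastforce
      then show ?thesis
        by cases (auto simp: True J_def mult_ac add.commute abs_minus_commute)
    qed (auto split: split_indicator)
  qed
  also have "\<dots> = (\<integral>\<^sup>+s. (\<integral>\<^sup>+t. ?h s t \<partial>lborel) + (\<integral>\<^sup>+t. ?h t s \<partial>lborel) \<partial>lborel)"
    by (intro nn_integral_cong nn_integral_add) (simp_all add: J_def)
  also have "\<dots> = (\<integral>\<^sup>+s. (\<integral>\<^sup>+t. ?h s t \<partial>lborel) \<partial>lborel) + (\<integral>\<^sup>+s. (\<integral>\<^sup>+t. ?h t s \<partial>lborel) \<partial>lborel)"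
    unfolding J_def by (rule nn_integral_add) measurable
  also have "(\<integral>\<^sup>+s. (\<integral>\<^sup>+t. ?h t s \<partial>lborel) \<partial>lborel) = (\<integral>\<^sup>+s. (\<integral>\<^sup>+t. ?h s t \<partial>lborel) \<partial>lborel)"
    unfolding J_def by (rule lborel_pair.Fubini') measurable
  finally have "(\<integral>\<^sup>+s. (\<integral>\<^sup>+t. ennreal (indicator S s * indicator S t * J s t * \<theta> (z s + z t)) \<partial>lborel) \<partial>lborel)
    \<le> 2 * (\<integral>\<^sup>+s. (\<integral>\<^sup>+t. ?h s t \<partial>lborel) \<partial>lborel)" by (simp add: mult_2)
  also have "\<dots> \<le> 2 * (\<integral>\<^sup>+v. ennreal (\<theta> v) \<partial>lborel)"
    by (intro mult_left_mono sum_push_half \<theta>0) auto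
  finally show ?thesis .
qed

section \<open>The energy estimate with the affine weight\<close>

definition "dens t = indicator S t * \<kappa> t powr (1 / 3)"

lemma dens_measurable [measurable]: "dens \<in> borel_measurable borel"
  unfolding dens_def by measurable

lemma dens_nonneg: "0 \<le> dens t"
  by (simp add: dens_def)

text \<open>With respect to the measure with density \<open>\<kappa> / w\<^sup>2\<close>, which the
  slope maps below Lebesgue measure, the integrand is \<open>G s * G t\<close> times a power of the
  slope difference. In \<open>G powr a\<close> with \<open>a = 2 / (3 - r)\<close> the exponent of
  \<open>w\<close> is 2 and that of \<open>\<kappa>\<close> is -2/3. Multiplied by the density,
  \<open>w\<close> disappears and \<open>\<kappa> powr (1 / 3)\<close> is left: this cancellation is
  what singles out the affine weight.\<close>

lemma energy_le:
  assumes r: "1 < r" "r < 2" and h [measurable]: "h \<in> borel_measurable borel" and h0: "\<And>t. 0 \<le> h t"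
  shows "(\<integral>\<^sup>+s. (\<integral>\<^sup>+t. ennreal ((h s * dens s * (h t * dens t)) powr r * J s t powr (1 - r)) \<partial>lborel) \<partial>lborel)
    \<le> ennreal (HLS_const (r - 1)) * ennreal_powr (\<integral>\<^sup>+t. ennreal (h t powr (2 * r / (3 - r)) * dens t) \<partial>lborel) (3 - r)"
proof -
  define \<rho> where "\<rho> t = indicator S t * (\<kappa> t / (w t)\<^sup>2)" for t
  define G where "G t = h t powr r * \<kappa> t powr ((r - 3) / 3) * \<bar>w t\<bar> powr (3 - r)" for t
  define M where "M = density lborel (\<lambda>t. ennreal (\<rho> t))"
  define a where "a = 2 / (2 - (r - 1))"
  have [measurable]: "\<rho> \<in> borel_measurable borel" "G \<in> borel_measurable borel" unfolding \<rho>_def G_def by measurable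
  have \<rho>0: "0 \<le> \<rho> t" for t using \<kappa>_pos[of t] by (auto simp: \<rho>_def less_imp_le split: split_indicator)
  have G0: "0 \<le> G t" for t by (simp add: G_def)
  have Mm: "f \<in> borel_measurable M \<longleftrightarrow> f \<in> borel_measurable borel" for f :: "real \<Rightarrow> real" by (simp add: M_def)
  have sfM: "sigma_finite_measure M"
    unfolding M_def by (subst sigma_finite_measure.sigma_finite_iff_density_finite[OF sigma_finite_lborel]) auto
  have int: "(\<integral>\<^sup>+t. f t \<partial>M) = (\<integral>\<^sup>+t. ennreal (\<rho> t) * f t \<partial>lborel)" if "f \<in> borel_measurable borel" for f
    unfolding M_def using that by (subst nn_integral_density) auto
  have "(\<integral>\<^sup>+s. (\<integral>\<^sup>+t. ennreal ((h s * dens s * (h t * dens t)) powr r * J s t powr (1 - r)) \<partial>lborel) \<partial>lborel)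
    = (\<integral>\<^sup>+s. (\<integral>\<^sup>+t. ennreal (\<rho> s) * (ennreal (\<rho> t) * ennreal (G s * G t * \<bar>m t - m s\<bar> powr - (r - 1))) \<partial>lborel) \<partial>lborel)"
  proof (intro nn_integral_cong)
    fix s t :: real
    have "(h s * dens s * (h t * dens t)) powr r * J s t powr (1 - r) = \<rho> s * (\<rho> t * (G s * G t * \<bar>m t - m s\<bar> powr - (r - 1)))"
    proof (cases "s \<in> S \<and> t \<in> S")
      case True
      have k: "(h t * dens t) powr r = h t powr r * \<kappa> t powr (r / 3)" if "t \<in> S" for t
        using that h0 \<kappa>_pos[OF that] by (simp add: dens_def powr_mult powr_powr)
      have \<rho>G: "\<rho> t * G t = (h t * dens t) powr r * w t powr (1 - r)" if t: "t \<in> S" for t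
      proof -
        have "\<kappa> t powr (r / 3) = \<kappa> t powr 1 * \<kappa> t powr ((r - 3) / 3)"
          unfolding powr_add[symmetric] by (intro arg_cong2[where f = "(powr)"]) (auto simp: diff_divide_distrib)
        moreover have "w t powr (1 - r) = w t powr (- 2) * w t powr (3 - r)"
          unfolding powr_add[symmetric] by simp
        moreover have "w t powr (- 2) = 1 / (w t)\<^sup>2" using w_pos[OF t] by (simp add: powr_minus divide_inverse)
        ultimately have "(h t * dens t) powr r * w t powr (1 - r) = h t powr r * (\<kappa> t * \<kappa> t powr ((r - 3) / 3)) * (1 / (w t)\<^sup>2 * w t powr (3 - r))"
          using \<kappa>_pos[OF t] by (simp only: k[OF t]) simp
        also have "\<dots> = \<rho> t * G t" using t w_pos[OF t] by (simp add: \<rho>_def G_def)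
        finally show ?thesis ..
      qed
      have "J s t powr (1 - r) = w s powr (1 - r) * w t powr (1 - r) * \<bar>m t - m s\<bar> powr - (r - 1)"
        unfolding J_def powr_mult using w_pos True by (simp add: powr_mult)
      moreover have "(h s * dens s * (h t * dens t)) powr r = (h s * dens s) powr r * (h t * dens t) powr r"
        by (rule powr_mult)
      ultimately have "(h s * dens s * (h t * dens t)) powr r * J s t powr (1 - r) = (\<rho> s * G s) * (\<rho> t * G t) * \<bar>m t - m s\<bar> powr - (r - 1)"
        using \<rho>G True by (simp add: mult_ac)
      then show ?thesis by (simp add: mult_ac)
    qed (use r in \<open>auto simp: dens_def \<rho>_def\<close>)
    then show "ennreal ((h s * dens s * (h t * dens t)) powr r * J s t powr (1 - r))
      = ennreal (\<rho> s) * (ennreal (\<rho> t) * ennreal (G s * G t * \<bar>m t - m s\<bar> powr - (r - 1)))"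
      using \<rho>0 G0 by (simp add: ennreal_mult)
  qed
  also have "\<dots> = (\<integral>\<^sup>+s. ennreal (\<rho> s) * (\<integral>\<^sup>+t. ennreal (\<rho> t) * ennreal (G s * G t * \<bar>m t - m s\<bar> powr - (r - 1)) \<partial>lborel) \<partial>lborel)"
    by (intro nn_integral_cong nn_integral_cmult) measurable
  also have "\<dots> = (\<integral>\<^sup>+s. (\<integral>\<^sup>+t. ennreal (G s * G t * \<bar>m t - m s\<bar> powr - (r - 1)) \<partial>M) \<partial>M)"
    by (simp add: int)
  also have "\<dots> \<le> ennreal (HLS_const (r - 1)) * ennreal_powr (\<integral>\<^sup>+t. ennreal (G t powr a) \<partial>M) (2 - (r - 1))"
  proof (rule HLS_diag[OF sfM])
    fix c and \<Theta> :: "real \<Rightarrow> ennreal" assume "\<Theta> \<in> borel_measurable borel"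
    then show "(\<integral>\<^sup>+t. \<Theta> (m t - c) \<partial>M) \<le> (\<integral>\<^sup>+v. \<Theta> v \<partial>lborel)"
      unfolding M_def \<rho>_def by (rule m_push)
  qed (use r G0 in \<open>auto simp: Mm a_def\<close>)
  also have "(\<integral>\<^sup>+t. ennreal (G t powr a) \<partial>M) = (\<integral>\<^sup>+t. ennreal (h t powr (2 * r / (3 - r)) * dens t) \<partial>lborel)"
  proof (subst int, simp, rule nn_integral_cong)
    fix t
    have "\<rho> t * G t powr a = h t powr (2 * r / (3 - r)) * dens t"
    proof (cases "t \<in> S")
      case True
      have "a * r = 2 * r / (3 - r)" "(r - 3) / 3 * a = - (2 / 3)" "(3 - r) * a = 2" using r by (auto simp: a_def field_simps)
      then have "G t powr a = h t powr (2 * r / (3 - r)) * \<kappa> t powr (- (2 / 3)) * (w t)\<^sup>2"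
        using w_pos[OF True] by (simp add: G_def powr_mult powr_powr mult.commute)
      moreover have "\<kappa> t * \<kappa> t powr (- (2 / 3)) = \<kappa> t powr (1 / 3)"
        using powr_add[of "\<kappa> t" 1 "- (2 / 3)"] \<kappa>_pos[OF True] by simp
      ultimately show ?thesis using True w_pos[OF True] by (simp add: \<rho>_def dens_def)
    qed (simp add: \<rho>_def dens_def)
    then show "ennreal (\<rho> t) * ennreal (G t powr a) = ennreal (h t powr (2 * r / (3 - r)) * dens t)"
      using \<rho>0 by (simp add: ennreal_mult[symmetric])
  qed
  finally show ?thesis by simp
qed

text \<open>The factors \<open>J powr (- 1 / r')\<close> and \<open>J powr (1 / r')\<close> are
  inserted before Hoelder's inequality. The first factor becomes the energy, the second an integral
  over the plane by the change of variables. On \<open>S\<close> the insertion is valid off the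
  diagonal, where \<open>J\<close> is positive, and the diagonal is a null set.\<close>

lemma bilinear_le:
  assumes r: "1 < r" "r < 2" and h [measurable]: "h \<in> borel_measurable borel" and h0: "\<And>t. 0 \<le> h t"
    and \<Theta> [measurable]: "\<Theta> \<in> borel_measurable borel"
  shows "(\<integral>\<^sup>+s. (\<integral>\<^sup>+t. ennreal (h s * dens s) * ennreal (h t * dens t) * \<Theta> (z s + z t) \<partial>lborel) \<partial>lborel)
    \<le> ennreal (HLS_const (r - 1) powr (1 / r) * 2 powr (1 - 1 / r))
      * ennreal_powr (\<integral>\<^sup>+t. ennreal (h t powr (2 * r / (3 - r)) * dens t) \<partial>lborel) ((3 - r) / r)
      * ennreal_powr (\<integral>\<^sup>+v. ennreal_powr (\<Theta> v) (r / (r - 1)) \<partial>lborel) (1 - 1 / r)"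
    (is "_ \<le> _ * ennreal_powr ?Y _ * ennreal_powr ?T _")
proof -
  define r' where "r' = r / (r - 1)"
  have r': "r' > 1" "1 / r + 1 / r' = 1" "1 / r' = 1 - 1 / r" "r > 0" "- (1 / r') * r = 1 - r"
    using r by (auto simp: r'_def field_simps)
  define f where "f p = ennreal (h (fst p) * dens (fst p) * (h (snd p) * dens (snd p)) * J (fst p) (snd p) powr - (1 / r'))" for p
  define g where "g p = ennreal (indicator S (fst p) * indicator S (snd p) * J (fst p) (snd p) powr (1 / r')) * \<Theta> (z (fst p) + z (snd p))" for p
  have fm [measurable]: "f \<in> borel_measurable (lborel \<Otimes>\<^sub>M lborel)" unfolding f_def J_def by measurable
  have gm [measurable]: "g \<in> borel_measurable (lborel \<Otimes>\<^sub>M lborel)" unfolding g_def J_def by measurable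
  have J0: "J s t \<ge> 0" if "s \<in> S" "t \<in> S" for s t using that w_pos by (simp add: J_def less_imp_le)
  have "(\<integral>\<^sup>+s. (\<integral>\<^sup>+t. ennreal (h s * dens s) * ennreal (h t * dens t) * \<Theta> (z s + z t) \<partial>lborel) \<partial>lborel)
    = (\<integral>\<^sup>+s. (\<integral>\<^sup>+t. f (s, t) * g (s, t) \<partial>lborel) \<partial>lborel)"
  proof (rule nn_integral_cong, rule nn_integral_cong_AE)
    fix s :: real
    have "AE t in lborel. t \<noteq> s" by (rule AE_lborel_singleton)
    then show "AE t in lborel. ennreal (h s * dens s) * ennreal (h t * dens t) * \<Theta> (z s + z t) = f (s, t) * g (s, t)"
    proof eventually_elim
      case (elim t)
      show ?case
      proof (cases "s \<in> S \<and> t \<in> S")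
        case True
        then have J: "J s t > 0" using J_pos elim by auto
        have "f (s, t) * ennreal (indicator S s * indicator S t * J s t powr (1 / r')) = ennreal (h s * dens s * (h t * dens t))"
          unfolding f_def using True J h0 dens_nonneg
          by (simp add: ennreal_mult[symmetric] powr_add[symmetric] mult.assoc)
        then have "f (s, t) * g (s, t) = ennreal (h s * dens s * (h t * dens t)) * \<Theta> (z s + z t)"
          by (simp add: g_def mult.assoc[symmetric])
        then show ?thesis using h0 dens_nonneg by (simp add: ennreal_mult)
      qed (auto simp: dens_def f_def g_def)
    qed
  qed
  also have "\<dots> = (\<integral>\<^sup>+p. f p * g p \<partial>(lborel \<Otimes>\<^sub>M lborel))"
    by (rule lborel.nn_integral_fst) measurable
  also have "\<dots> \<le> ennreal_powr (\<integral>\<^sup>+p. ennreal_powr (f p) r \<partial>(lborel \<Otimes>\<^sub>M lborel)) (1 / r)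
     * ennreal_powr (\<integral>\<^sup>+p. ennreal_powr (g p) r' \<partial>(lborel \<Otimes>\<^sub>M lborel)) (1 / r')"
    by (rule nn_integral_Holder[OF fm gm r(1) r'(1,2)])
  also have "\<dots> \<le> ennreal_powr (ennreal (HLS_const (r - 1)) * ennreal_powr ?Y (3 - r)) (1 / r) * ennreal_powr (2 * ?T) (1 / r')"
  proof (intro mult_mono ennreal_powr_mono)
    have "(\<integral>\<^sup>+p. ennreal_powr (f p) r \<partial>(lborel \<Otimes>\<^sub>M lborel)) = (\<integral>\<^sup>+s. (\<integral>\<^sup>+t. ennreal_powr (f (s, t)) r \<partial>lborel) \<partial>lborel)"
      by (rule lborel.nn_integral_fst[symmetric]) measurable
    also have "\<dots> = (\<integral>\<^sup>+s. (\<integral>\<^sup>+t. ennreal ((h s * dens s * (h t * dens t)) powr r * J s t powr (1 - r)) \<partial>lborel) \<partial>lborel)"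
      using h0 dens_nonneg r'(5)
      by (intro nn_integral_cong) (simp add: f_def powr_mult[of "h _ * dens _ * _" "_ powr _"] powr_powr)
    also note energy_le[OF r h h0]
    finally show "(\<integral>\<^sup>+p. ennreal_powr (f p) r \<partial>(lborel \<Otimes>\<^sub>M lborel)) \<le> ennreal (HLS_const (r - 1)) * ennreal_powr ?Y (3 - r)" .
    have "(\<integral>\<^sup>+p. ennreal_powr (g p) r' \<partial>(lborel \<Otimes>\<^sub>M lborel)) = (\<integral>\<^sup>+p. ennreal (indicator S (fst p) * indicator S (snd p) * J (fst p) (snd p)) * ennreal_powr (\<Theta> (z (fst p) + z (snd p))) r' \<partial>(lborel \<Otimes>\<^sub>M lborel))"
      using r'(1) J0 by (intro nn_integral_cong) (auto simp: g_def ennreal_powr_mult powr_powr powr_mult split: split_indicator)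
    also have "\<dots> \<le> 2 * (\<integral>\<^sup>+v. ennreal_powr (\<Theta> v) r' \<partial>lborel)"
    proof -
      define Q where "Q = density (lborel \<Otimes>\<^sub>M lborel) (\<lambda>p. ennreal (indicator S (fst p) * indicator S (snd p) * J (fst p) (snd p)))"
      have jm [measurable]: "(\<lambda>p. ennreal (indicator S (fst p) * indicator S (snd p) * J (fst p) (snd p))) \<in> borel_measurable (lborel \<Otimes>\<^sub>M lborel)"
        unfolding J_def by measurable
      have zm: "(\<lambda>p. z (fst p) + z (snd p)) \<in> measurable Q borel" unfolding Q_def by simp
      have "(\<integral>\<^sup>+p. ennreal_powr (\<Theta> (z (fst p) + z (snd p))) r' \<partial>Q) \<le> 2 * (\<integral>\<^sup>+v. ennreal_powr (\<Theta> v) r' \<partial>lborel)"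
      proof (rule nn_integral_le_realI[OF zm])
        fix \<theta> :: "real^2 \<Rightarrow> real" assume \<theta> [measurable]: "\<theta> \<in> borel_measurable borel" and \<theta>0: "\<And>v. 0 \<le> \<theta> v"
        have "(\<integral>\<^sup>+p. ennreal (\<theta> (z (fst p) + z (snd p))) \<partial>Q)
          = (\<integral>\<^sup>+p. ennreal (indicator S (fst p) * indicator S (snd p) * J (fst p) (snd p)) * ennreal (\<theta> (z (fst p) + z (snd p))) \<partial>(lborel \<Otimes>\<^sub>M lborel))"
          unfolding Q_def by (rule nn_integral_density) measurable
        also have "\<dots> = (\<integral>\<^sup>+s. (\<integral>\<^sup>+t. ennreal (indicator S s * indicator S t * J s t) * ennreal (\<theta> (z s + z t)) \<partial>lborel) \<partial>lborel)"
          by (subst lborel.nn_integral_fst[symmetric]) auto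
        also have "\<dots> = (\<integral>\<^sup>+s. (\<integral>\<^sup>+t. ennreal (indicator S s * indicator S t * J s t * \<theta> (z s + z t)) \<partial>lborel) \<partial>lborel)"
          using J0 \<theta>0 by (intro nn_integral_cong) (auto simp: ennreal_mult split: split_indicator)
        also have "\<dots> \<le> 2 * (\<integral>\<^sup>+v. ennreal (\<theta> v) \<partial>lborel)" by (rule sum_push[OF \<theta> \<theta>0])
        finally show "(\<integral>\<^sup>+p. ennreal (\<theta> (z (fst p) + z (snd p))) \<partial>Q) \<le> 2 * (\<integral>\<^sup>+v. ennreal (\<theta> v) \<partial>lborel)" .
      qed auto
      then show ?thesis unfolding Q_def by (subst (asm) nn_integral_density) auto
    qed
    finally show "(\<integral>\<^sup>+p. ennreal_powr (g p) r' \<partial>(lborel \<Otimes>\<^sub>M lborel)) \<le> 2 * ?T" by (simp add: r'_def)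
  qed (use r r' in auto)
  also have "\<dots> = ennreal (HLS_const (r - 1) powr (1 / r) * 2 powr (1 - 1 / r)) * ennreal_powr ?Y ((3 - r) / r) * ennreal_powr ?T (1 - 1 / r)"
  proof -
    have c: "HLS_const (r - 1) \<ge> 0" using r by (simp add: HLS_const_def)
    have 2: "ennreal_powr 2 (1 - 1 / r) = ennreal (2 powr (1 - 1 / r))"
      using ennreal_powr_ennreal[of 2 "1 - 1 / r"] by simp
    show ?thesis using c r by (simp add: ennreal_powr_mult ennreal_powr_powr 2 ennreal_mult mult_ac r'(3))
  qed
  finally show ?thesis .
qed

end

text \<open>A self-improving estimate is divided by \<open>Z\<close> to the power
  \<open>1 - \<theta>\<close>. This requires \<open>Z\<close> to be finite, and truncations secure
  that before each use.\<close>

lemma ennreal_absorb: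
  assumes Z: "Z < top" "Z \<le> B * ennreal_powr Z (1 - \<theta>)" and \<theta>: "0 < \<theta>"
  shows "ennreal_powr Z \<theta> \<le> B"
proof -
  obtain c where c: "Z = ennreal c" "c \<ge> 0" using Z(1) by (cases Z) auto
  show ?thesis
  proof (cases "c = 0")
    case False
    then have "c > 0" using c by simp
    have "ennreal (c powr \<theta>) = ennreal (c powr (\<theta> - 1)) * Z"
      using \<open>c > 0\<close> c powr_add[of c "\<theta> - 1" 1] by (simp add: ennreal_mult[symmetric])
    also have "\<dots> \<le> ennreal (c powr (\<theta> - 1)) * (B * ennreal (c powr (1 - \<theta>)))"
      using Z(2) c by (intro mult_left_mono) auto
    also have "\<dots> = (ennreal (c powr (\<theta> - 1)) * ennreal (c powr (1 - \<theta>))) * B" by (simp add: mult_ac)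
    also have "ennreal (c powr (\<theta> - 1)) * ennreal (c powr (1 - \<theta>)) = 1"
      using \<open>c > 0\<close> by (subst ennreal_mult[symmetric]) (auto simp: powr_add[symmetric])
    finally show ?thesis using c by simp
  qed (use c in auto)
qed

section \<open>Averaging kernels with rectangles chosen along the curve\<close>

lemma rkern_eq: "rkern v y = (if \<bar>y $ 1\<bar> \<le> v $ 1 \<and> \<bar>y $ 2\<bar> \<le> v $ 2 then 1 else 0) / (4 * v $ 1 * v $ 2)"
  by (auto simp: rkern_def mem_box_cart forall_2 abs_le_iff split: split_indicator)

lemma borel_measurable_rkern2 [measurable (raw)]:
  assumes [measurable]: "f \<in> borel_measurable M" "g \<in> borel_measurable M"
  shows "(\<lambda>x. rkern (f x) (g x)) \<in> borel_measurable M"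
  unfolding rkern_eq by measurable

lemma rkern_nonneg: "0 < v $ 1 \<Longrightarrow> 0 < v $ 2 \<Longrightarrow> 0 \<le> rkern v y"
  by (simp add: rkern_eq)

lemma rkern_le: "0 < v $ 1 \<Longrightarrow> 0 < v $ 2 \<Longrightarrow> rkern v y \<le> 1 / (4 * v $ 1 * v $ 2)"
  by (auto simp: rkern_eq divide_right_mono)

lemma rkern_total:
  assumes v: "0 < v $ 1" "0 < v $ 2"
  shows "(\<integral>\<^sup>+w. ennreal (rkern v (x - w)) \<partial>lborel) = 1"
proof -
  have "(\<integral>\<^sup>+w. ennreal (rkern v (x - w)) \<partial>lborel) = avg2 v (\<lambda>_. 1) (pt (x $ 1) (x $ 2))"
    by (simp add: avg2_def vec_eq_iff forall_2 cong: arg_cong[where f = "rkern v"])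
      (intro nn_integral_cong arg_cong[where f = ennreal] arg_cong[where f = "rkern v"], simp add: vec_eq_iff forall_2)
  also have "\<dots> = avg1 (v $ 1) (\<lambda>u. avg1 (v $ 2) (\<lambda>w. 1) (x $ 2)) (x $ 1)"
    using v by (rule avg2_eq) simp
  also have "\<dots> = 1"
  proof -
    have "avg1 a (\<lambda>_. 1) t = 1" if "a > 0" for a t
      using that by (simp add: avg1_def ennreal_mult[symmetric])
    then show ?thesis using v by simp
  qed
  finally show ?thesis .
qed

definition MV :: "(real^2) set \<Rightarrow> (real^2 \<Rightarrow> ennreal) \<Rightarrow> real^2 \<Rightarrow> ennreal" where
  "MV V \<phi> x = (SUP v\<in>V. avg2 v \<phi> x)"

lemma borel_measurable_MV [measurable (raw)]:
  assumes "finite V" and [measurable]: "\<phi> \<in> borel_measurable borel" "f \<in> borel_measurable M"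
  shows "(\<lambda>x. MV V \<phi> (f x)) \<in> borel_measurable M"
  unfolding MV_def using assms(1) by (intro borel_measurable_SUP countable_finite) auto

text \<open>The factors are those of the energy estimate, of the two orders in
  \<open>sum_push\<close>, and of two strong maximal inequalities with the exponent conjugate to
  \<open>r\<close>.\<close>

definition ext_const :: "real \<Rightarrow> real" where
  "ext_const r = HLS_const (r - 1) powr (1 / r) * 2 powr (1 - 1 / r) * (((HL_const (r / (r - 1)))\<^sup>2) powr (1 - 1 / r) * ((HL_const (r / (r - 1)))\<^sup>2) powr (1 - 1 / r))"

lemma ext_const_nonneg: "0 \<le> ext_const r" by (simp add: ext_const_def)

text \<open>Averages over rectangles chosen along the curve: \<open>V\<close> is a finite family of half side lengths and \<open>sel\<close>
  a measurable choice from it.\<close>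

locale arc_kernel = arc_piece +
  fixes V :: "(real^2) set" and sel :: "real \<Rightarrow> real^2"
  assumes V: "finite V" "\<And>v. v \<in> V \<Longrightarrow> 0 < v $ 1 \<and> 0 < v $ 2"
    and sel [measurable]: "sel \<in> borel_measurable borel" and sel_V: "\<And>t. sel t \<in> V"
    and dens_fin: "(\<integral>\<^sup>+t. ennreal (dens t) \<partial>lborel) < top"
begin

definition k :: "real \<Rightarrow> real^2 \<Rightarrow> real" where "k t v = rkern (sel t) (z t - v)"

lemma k_measurable [measurable (raw)]:
  assumes [measurable]: "f \<in> borel_measurable M" "g \<in> borel_measurable M"
  shows "(\<lambda>x. k (f x) (g x)) \<in> borel_measurable M"
  unfolding k_def by measurable

lemma k_nonneg: "0 \<le> k t v"
  unfolding k_def using V(2)[OF sel_V] by (intro rkern_nonneg) auto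

lemma k_total: "(\<integral>\<^sup>+v. ennreal (k t v) \<partial>lborel) = 1"
  unfolding k_def using V(2)[OF sel_V] by (intro rkern_total) auto

text \<open>A crude bound that depends on the rectangles. It enters arguments about finiteness only,
  never a final constant.\<close>

definition kmax :: real where "kmax = (\<Sum>v\<in>V. 1 / (4 * v $ 1 * v $ 2))"

lemma k_le: "k t v \<le> kmax"
proof -
  have "k t v \<le> 1 / (4 * sel t $ 1 * sel t $ 2)"
    unfolding k_def using V(2)[OF sel_V] by (intro rkern_le) auto
  also have "\<dots> \<le> kmax"
    unfolding kmax_def using V sel_V[of t]
    by (intro member_le_sum[where f = "\<lambda>v. 1 / (4 * v $ 1 * v $ 2)"]) (auto simp: less_imp_le)
  finally show ?thesis .
qed

text \<open>The density of the curve measure with weight \<open>h\<close>, after the mass at each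
  point has been spread over the rectangle chosen there. It dominates the modulus of
  \<open>\<mu>\<close> in \<open>extension_le\<close>.\<close>

definition mm :: "(real \<Rightarrow> real) \<Rightarrow> real^2 \<Rightarrow> ennreal" where
  "mm h v = (\<integral>\<^sup>+t. ennreal (h t * dens t) * ennreal (k t v) \<partial>lborel)"

lemma mm_measurable [measurable (raw)]:
  assumes [measurable]: "h \<in> borel_measurable borel" "g \<in> borel_measurable M"
  shows "(\<lambda>x. mm h (g x)) \<in> borel_measurable M"
  unfolding mm_def by measurable

lemma mm_total:
  assumes [measurable]: "h \<in> borel_measurable borel"
  shows "(\<integral>\<^sup>+v. mm h v \<partial>lborel) = (\<integral>\<^sup>+t. ennreal (h t * dens t) \<partial>lborel)"
proof -
  have "(\<integral>\<^sup>+v. mm h v \<partial>lborel) = (\<integral>\<^sup>+t. (\<integral>\<^sup>+v. ennreal (h t * dens t) * ennreal (k t v) \<partial>lborel) \<partial>lborel)"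
    unfolding mm_def by (rule lborel_pair.Fubini') measurable
  also have "\<dots> = (\<integral>\<^sup>+t. ennreal (h t * dens t) * (\<integral>\<^sup>+v. ennreal (k t v) \<partial>lborel) \<partial>lborel)"
    by (intro nn_integral_cong nn_integral_cmult) measurable
  finally show ?thesis by (simp add: k_total)
qed

lemma mm_le:
  assumes [measurable]: "h \<in> borel_measurable borel"
  shows "mm h v \<le> ennreal kmax * (\<integral>\<^sup>+t. ennreal (h t * dens t) \<partial>lborel)"
proof -
  have "mm h v \<le> (\<integral>\<^sup>+t. ennreal kmax * ennreal (h t * dens t) \<partial>lborel)"
    unfolding mm_def by (intro nn_integral_mono) (auto simp: mult.commute intro!: mult_right_mono ennreal_leI k_le)
  also have "\<dots> = ennreal kmax * (\<integral>\<^sup>+t. ennreal (h t * dens t) \<partial>lborel)"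
    by (rule nn_integral_cmult) measurable
  finally show ?thesis .
qed

definition F :: "(real \<Rightarrow> real) \<Rightarrow> real^2 \<Rightarrow> ennreal" where
  "F h W = (\<integral>\<^sup>+v. mm h v * mm h (W - v) \<partial>lborel)"

lemma F_measurable [measurable (raw)]:
  assumes [measurable]: "h \<in> borel_measurable borel" "g \<in> borel_measurable M"
  shows "(\<lambda>x. F h (g x)) \<in> borel_measurable M"
  unfolding F_def by measurable

text \<open>Since \<open>F h\<close> is a self-convolution, the left-hand side integrates
  \<open>\<phi> (v + u)\<close> against two kernels of mass one centred at curve points. Integrating
  out one kernel averages \<open>\<phi>\<close> over a rectangle that depends on the point; the
  supremum over \<open>V\<close> removes this dependence. Doing so for both variables gives the
  twofold maximal function at \<open>z s + z t\<close>.\<close>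

lemma F_test:
  assumes h [measurable]: "h \<in> borel_measurable borel" and \<phi> [measurable]: "\<phi> \<in> borel_measurable borel"
  shows "(\<integral>\<^sup>+W. F h W * \<phi> W \<partial>lborel) \<le> (\<integral>\<^sup>+s. (\<integral>\<^sup>+t. ennreal (h s * dens s) * ennreal (h t * dens t) * MV V (MV V \<phi>) (z s + z t) \<partial>lborel) \<partial>lborel)"
proof -
  note V(1) [measurable]
  have MVm [measurable]: "MV V \<psi> \<in> borel_measurable borel" if "\<psi> \<in> borel_measurable borel" for \<psi>
    using borel_measurable_MV[OF V(1) that measurable_ident_sets[OF refl]] by simp
  have avg: "(\<integral>\<^sup>+v. ennreal (k t v) * \<psi> (y + v) \<partial>lborel) \<le> MV V \<psi> (y + z t)" if [measurable]: "\<psi> \<in> borel_measurable borel" for \<psi> y t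
  proof -
    have "(\<integral>\<^sup>+v. ennreal (k t v) * \<psi> (y + v) \<partial>lborel) = (\<integral>\<^sup>+v. ennreal (rkern (sel t) (y + z t - (v + y))) * \<psi> (v + y) \<partial>lborel)"
      by (simp add: k_def add.commute)
    also have "\<dots> = avg2 (sel t) \<psi> (y + z t)"
      unfolding avg2_def by (rule nn_integral_lborel_shift(1)[where f = "\<lambda>v. ennreal (rkern (sel t) (y + z t - v)) * \<psi> v"]) measurable
    also have "\<dots> \<le> MV V \<psi> (y + z t)" unfolding MV_def by (rule SUP_upper[OF sel_V])
    finally show ?thesis .
  qed
  let ?H = "\<lambda>t. ennreal (h t * dens t)"
  have "(\<integral>\<^sup>+W. F h W * \<phi> W \<partial>lborel) = (\<integral>\<^sup>+W. (\<integral>\<^sup>+v. mm h v * mm h (W - v) * \<phi> W \<partial>lborel) \<partial>lborel)"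
    unfolding F_def by (intro nn_integral_cong nn_integral_multc[symmetric]) measurable
  also have "\<dots> = (\<integral>\<^sup>+v. (\<integral>\<^sup>+W. mm h v * mm h (W - v) * \<phi> W \<partial>lborel) \<partial>lborel)"
    by (rule lborel_pair.Fubini') measurable
  also have "\<dots> = (\<integral>\<^sup>+v. (\<integral>\<^sup>+u. mm h v * mm h u * \<phi> (v + u) \<partial>lborel) \<partial>lborel)"
  proof (rule nn_integral_cong)
    fix v :: "real^2"
    show "(\<integral>\<^sup>+W. mm h v * mm h (W - v) * \<phi> W \<partial>lborel) = (\<integral>\<^sup>+u. mm h v * mm h u * \<phi> (v + u) \<partial>lborel)"
      using nn_integral_lborel_shift(2)[of "\<lambda>u. mm h v * mm h u * \<phi> (v + u)" v] by simp
  qed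
  also have "\<dots> = (\<integral>\<^sup>+v. mm h v * (\<integral>\<^sup>+u. mm h u * \<phi> (v + u) \<partial>lborel) \<partial>lborel)"
    by (intro nn_integral_cong) (simp add: nn_integral_cmult mult.assoc)
  also have "\<dots> \<le> (\<integral>\<^sup>+v. mm h v * (\<integral>\<^sup>+t. ?H t * MV V \<phi> (v + z t) \<partial>lborel) \<partial>lborel)"
  proof (intro nn_integral_mono mult_left_mono)
    fix v :: "real^2"
    have "(\<integral>\<^sup>+u. mm h u * \<phi> (v + u) \<partial>lborel) = (\<integral>\<^sup>+u. (\<integral>\<^sup>+t. ?H t * ennreal (k t u) * \<phi> (v + u) \<partial>lborel) \<partial>lborel)"
      unfolding mm_def by (intro nn_integral_cong nn_integral_multc[symmetric]) measurable
    also have "\<dots> = (\<integral>\<^sup>+t. (\<integral>\<^sup>+u. ?H t * ennreal (k t u) * \<phi> (v + u) \<partial>lborel) \<partial>lborel)"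
      by (rule lborel_pair.Fubini') measurable
    also have "\<dots> = (\<integral>\<^sup>+t. ?H t * (\<integral>\<^sup>+u. ennreal (k t u) * \<phi> (v + u) \<partial>lborel) \<partial>lborel)"
      by (intro nn_integral_cong) (simp add: nn_integral_cmult mult.assoc)
    also have "\<dots> \<le> (\<integral>\<^sup>+t. ?H t * MV V \<phi> (v + z t) \<partial>lborel)"
      by (intro nn_integral_mono mult_left_mono avg) auto
    finally show "(\<integral>\<^sup>+u. mm h u * \<phi> (v + u) \<partial>lborel) \<le> (\<integral>\<^sup>+t. ?H t * MV V \<phi> (v + z t) \<partial>lborel)" .
  qed simp
  also have "\<dots> = (\<integral>\<^sup>+v. (\<integral>\<^sup>+s. ?H s * ennreal (k s v) * (\<integral>\<^sup>+t. ?H t * MV V \<phi> (v + z t) \<partial>lborel) \<partial>lborel) \<partial>lborel)"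
    unfolding mm_def by (intro nn_integral_cong nn_integral_multc[symmetric]) measurable
  also have "\<dots> = (\<integral>\<^sup>+s. (\<integral>\<^sup>+v. ?H s * ennreal (k s v) * (\<integral>\<^sup>+t. ?H t * MV V \<phi> (v + z t) \<partial>lborel) \<partial>lborel) \<partial>lborel)"
    by (rule lborel_pair.Fubini') measurable
  also have "\<dots> = (\<integral>\<^sup>+s. (\<integral>\<^sup>+v. (\<integral>\<^sup>+t. ?H s * ?H t * (ennreal (k s v) * MV V \<phi> (z t + v)) \<partial>lborel) \<partial>lborel) \<partial>lborel)"
  proof (intro nn_integral_cong)
    fix s :: real and v :: "real^2"
    show "?H s * ennreal (k s v) * (\<integral>\<^sup>+t. ?H t * MV V \<phi> (v + z t) \<partial>lborel) = (\<integral>\<^sup>+t. ?H s * ?H t * (ennreal (k s v) * MV V \<phi> (z t + v)) \<partial>lborel)"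
      by (subst nn_integral_cmult[symmetric], measurable) (simp add: mult_ac add.commute)
  qed
  also have "\<dots> = (\<integral>\<^sup>+s. (\<integral>\<^sup>+t. (\<integral>\<^sup>+v. ?H s * ?H t * (ennreal (k s v) * MV V \<phi> (z t + v)) \<partial>lborel) \<partial>lborel) \<partial>lborel)"
    by (intro nn_integral_cong lborel_pair.Fubini') measurable
  also have "\<dots> = (\<integral>\<^sup>+s. (\<integral>\<^sup>+t. ?H s * ?H t * (\<integral>\<^sup>+v. ennreal (k s v) * MV V \<phi> (z t + v) \<partial>lborel) \<partial>lborel) \<partial>lborel)"
    by (intro nn_integral_cong nn_integral_cmult) measurable
  also have "\<dots> \<le> (\<integral>\<^sup>+s. (\<integral>\<^sup>+t. ?H s * ?H t * MV V (MV V \<phi>) (z t + z s) \<partial>lborel) \<partial>lborel)"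
    by (intro nn_integral_mono mult_left_mono avg) auto
  finally show ?thesis by (simp add: add.commute)
qed

text \<open>Duality with the extremal test function \<open>F h\<close> to the power
  \<open>r - 1\<close>: its conjugate power is \<open>F h\<close> to the power \<open>r\<close>, so
  the quantity to be bounded reappears with an exponent below 1 and is absorbed. It is finite
  because \<open>F h\<close> is bounded and integrable.\<close>

lemma F_norm:
  assumes r: "1 < r" "r < 2" and h [measurable]: "h \<in> borel_measurable borel" and h0: "\<And>t. 0 \<le> h t" and hb: "\<And>t. h t \<le> hmax"
  shows "ennreal_powr (\<integral>\<^sup>+W. ennreal_powr (F h W) r \<partial>lborel) (1 / r)
    \<le> ennreal (ext_const r) * ennreal_powr (\<integral>\<^sup>+t. ennreal (h t powr (2 * r / (3 - r)) * dens t) \<partial>lborel) ((3 - r) / r)"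
    (is "ennreal_powr ?Z _ \<le> _ * ennreal_powr ?Y _")
proof (rule ennreal_absorb)
  have MVm: "MV V \<psi> \<in> borel_measurable borel" if "\<psi> \<in> borel_measurable borel" for \<psi>
    using borel_measurable_MV[OF V(1) that measurable_ident_sets[OF refl]] by simp
  define r' where "r' = r / (r - 1)"
  have r': "r' > 1" "r' * (r - 1) = r" using r by (auto simp: r'_def field_simps)
  let ?I = "\<integral>\<^sup>+t. ennreal (h t * dens t) \<partial>lborel"
  have "?I \<le> (\<integral>\<^sup>+t. ennreal hmax * ennreal (dens t) \<partial>lborel)"
    using h0 hb dens_nonneg by (intro nn_integral_mono) (auto simp: ennreal_mult[symmetric] order_trans[OF h0 hb] intro!: ennreal_leI mult_right_mono)
  also have "\<dots> = ennreal hmax * (\<integral>\<^sup>+t. ennreal (dens t) \<partial>lborel)" by (rule nn_integral_cmult) measurable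
  also have "\<dots> < top" using dens_fin by (simp add: ennreal_mult_less_top)
  finally have I: "?I < top" .
  have Fle: "F h W \<le> ennreal kmax * ?I * ?I" for W
  proof -
    have "F h W \<le> (\<integral>\<^sup>+v. mm h v * (ennreal kmax * ?I) \<partial>lborel)"
      unfolding F_def by (intro nn_integral_mono mult_left_mono mm_le) auto
    also have "\<dots> = ?I * (ennreal kmax * ?I)" by (subst nn_integral_multc) (auto simp: mm_total)
    finally show ?thesis by (simp add: mult_ac)
  qed
  have Ftot: "(\<integral>\<^sup>+W. F h W \<partial>lborel) = ?I * ?I"
  proof -
    have "(\<integral>\<^sup>+W. F h W \<partial>lborel) = (\<integral>\<^sup>+v. (\<integral>\<^sup>+W. mm h v * mm h (W - v) \<partial>lborel) \<partial>lborel)"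
      unfolding F_def by (rule lborel_pair.Fubini') measurable
    also have "\<dots> = (\<integral>\<^sup>+v. mm h v * ?I \<partial>lborel)"
      by (intro nn_integral_cong) (simp add: nn_integral_cmult nn_integral_lborel_shift(2)[of "mm h"] mm_total)
    finally show ?thesis by (simp add: nn_integral_multc mm_total)
  qed
  have "?Z \<le> (\<integral>\<^sup>+W. ennreal_powr (ennreal kmax * ?I * ?I) (r - 1) * F h W \<partial>lborel)"
  proof (intro nn_integral_mono)
    fix W
    have "ennreal_powr (F h W) r = ennreal_powr (F h W) (r - 1) * ennreal_powr (F h W) 1"
      unfolding ennreal_powr_add by simp
    also have "\<dots> \<le> ennreal_powr (ennreal kmax * ?I * ?I) (r - 1) * F h W"
      using r by (intro mult_mono ennreal_powr_mono Fle) auto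
    finally show "ennreal_powr (F h W) r \<le> ennreal_powr (ennreal kmax * ?I * ?I) (r - 1) * F h W" .
  qed
  also have "\<dots> = ennreal_powr (ennreal kmax * ?I * ?I) (r - 1) * (?I * ?I)"
    by (subst nn_integral_cmult) (auto simp: Ftot)
  also have "\<dots> < top" using I by (auto simp: ennreal_mult_less_top)
  finally show "?Z < top" .
  define \<phi> where "\<phi> W = ennreal_powr (F h W) (r - 1)" for W
  have \<phi> [measurable]: "\<phi> \<in> borel_measurable borel" unfolding \<phi>_def by measurable
  have "?Z = (\<integral>\<^sup>+W. F h W * \<phi> W \<partial>lborel)"
    using ennreal_powr_add[of "F h _" 1 "r - 1"] by (simp add: \<phi>_def)
  also have "\<dots> \<le> (\<integral>\<^sup>+s. (\<integral>\<^sup>+t. ennreal (h s * dens s) * ennreal (h t * dens t) * MV V (MV V \<phi>) (z s + z t) \<partial>lborel) \<partial>lborel)"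
    by (rule F_test) measurable
  also have "\<dots> \<le> ennreal (HLS_const (r - 1) powr (1 / r) * 2 powr (1 - 1 / r)) * ennreal_powr ?Y ((3 - r) / r)
      * ennreal_powr (\<integral>\<^sup>+v. ennreal_powr (MV V (MV V \<phi>) v) (r / (r - 1)) \<partial>lborel) (1 - 1 / r)"
    by (rule bilinear_le[OF r h h0 MVm[OF MVm[OF \<phi>]]])
  also have "\<dots> \<le> ennreal (HLS_const (r - 1) powr (1 / r) * 2 powr (1 - 1 / r)) * ennreal_powr ?Y ((3 - r) / r)
      * ennreal_powr (ennreal ((HL_const r')\<^sup>2) * (ennreal ((HL_const r')\<^sup>2) * ?Z)) (1 - 1 / r)"
  proof (intro mult_left_mono ennreal_powr_mono)
    have "(\<integral>\<^sup>+v. ennreal_powr (MV V (MV V \<phi>) v) r' \<partial>lborel) \<le> ennreal ((HL_const r')\<^sup>2) * (\<integral>\<^sup>+v. ennreal_powr (MV V \<phi> v) r' \<partial>lborel)"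
      unfolding MV_def[of V "MV V \<phi>"] by (rule avg2_strong[OF V MVm[OF \<phi>] r'(1)])
    also have "\<dots> \<le> ennreal ((HL_const r')\<^sup>2) * (ennreal ((HL_const r')\<^sup>2) * (\<integral>\<^sup>+v. ennreal_powr (\<phi> v) r' \<partial>lborel))"
      unfolding MV_def by (intro mult_left_mono avg2_strong[OF V \<phi> r'(1)]) auto
    also have "(\<integral>\<^sup>+v. ennreal_powr (\<phi> v) r' \<partial>lborel) = ?Z"
      using r' by (simp add: \<phi>_def ennreal_powr_powr mult.commute)
    finally show "(\<integral>\<^sup>+v. ennreal_powr (MV V (MV V \<phi>) v) (r / (r - 1)) \<partial>lborel) \<le> ennreal ((HL_const r')\<^sup>2) * (ennreal ((HL_const r')\<^sup>2) * ?Z)"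
      unfolding r'_def .
  qed (use r in auto)
  also have "\<dots> = ennreal (ext_const r) * ennreal_powr ?Y ((3 - r) / r) * ennreal_powr ?Z (1 - 1 / r)"
    unfolding ext_const_def r'_def[symmetric]
    by (simp add: ennreal_powr_mult ennreal_mult mult_ac)
  finally show "?Z \<le> ennreal (ext_const r) * ennreal_powr ?Y ((3 - r) / r) * ennreal_powr ?Z (1 - 1 / r)" .
qed (use r in auto)

text \<open>The adjoint of the linearised averages: pairing \<open>ft f\<close> with this function
  is pairing the averages at the points \<open>z t\<close> with \<open>a\<close>, with weight
  \<open>dens\<close>.\<close>

definition \<mu> :: "(real^2 \<Rightarrow> complex) \<Rightarrow> (real \<Rightarrow> complex) \<Rightarrow> real^2 \<Rightarrow> complex" where
  "\<mu> g a v = g v * (LINT t|lborel. a t * complex_of_real (dens t) * complex_of_real (k t v))"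

text \<open>The square of the transform is the transform of a self-convolution, which
  \<open>F h\<close> dominates since \<open>norm (g v) \<le> 1\<close>. Hausdorff-Young and
  \<open>F_norm\<close> apply to it, and taking the square root halves the exponents.\<close>

lemma extension_le:
  assumes r: "1 < r" "r < 2" and h [measurable]: "h \<in> borel_measurable borel" and h0: "\<And>t. 0 \<le> h t" and hb: "\<And>t. h t \<le> hmax"
    and a [measurable]: "a \<in> borel_measurable borel" and ah: "\<And>t. norm (a t) \<le> h t"
    and g [measurable]: "g \<in> borel_measurable borel" and g1: "\<And>v. norm (g v) \<le> 1"
  shows "integrable lborel (\<mu> g a)"
    "ennreal_powr (\<integral>\<^sup>+u. ennreal_powr (ennreal (norm (ft (\<mu> g a) u))) (2 * (r / (r - 1))) \<partial>lborel) (1 / (2 * (r / (r - 1))))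
     \<le> ennreal (HY_const (r / (r - 1)) powr (1 / (2 * (r / (r - 1)))) * ext_const r powr (1 / 2))
       * ennreal_powr (\<integral>\<^sup>+t. ennreal (h t powr (2 * r / (3 - r)) * dens t) \<partial>lborel) ((3 - r) / (2 * r))"
     (is "_ \<le> _ * ennreal_powr ?Y _")
proof -
  define r' where "r' = r / (r - 1)"
  have r': "r' > 2" "r * (r' - 1) = r'" "r' > 0" using r by (auto simp: r'_def field_simps)
  let ?\<mu> = "\<mu> g a"
  have \<mu>m [measurable]: "?\<mu> \<in> borel_measurable borel" unfolding \<mu>_def by measurable
  have \<mu>le: "ennreal (norm (?\<mu> v)) \<le> mm h v" for v
  proof (cases "integrable lborel (\<lambda>t. a t * complex_of_real (dens t) * complex_of_real (k t v))")
    case True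
    have "ennreal (norm (?\<mu> v)) \<le> ennreal (norm (LINT t|lborel. a t * complex_of_real (dens t) * complex_of_real (k t v)))"
      using g1[of v] by (intro ennreal_leI) (auto simp: \<mu>_def norm_mult intro: mult_left_le_one_le)
    also have "\<dots> \<le> (\<integral>\<^sup>+t. ennreal (norm (a t * complex_of_real (dens t) * complex_of_real (k t v))) \<partial>lborel)"
      by (rule integral_norm_bound_ennreal[OF True])
    also have "\<dots> \<le> mm h v"
      unfolding mm_def using k_nonneg dens_nonneg ah h0
      by (intro nn_integral_mono) (auto simp: norm_mult ennreal_mult[symmetric] intro!: ennreal_leI mult_right_mono)
    finally show ?thesis .
  qed (simp add: \<mu>_def not_integrable_integral_eq)
  let ?I = "\<integral>\<^sup>+t. ennreal (h t * dens t) \<partial>lborel"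
  have "?I \<le> (\<integral>\<^sup>+t. ennreal hmax * ennreal (dens t) \<partial>lborel)"
    using h0 hb dens_nonneg by (intro nn_integral_mono) (auto simp: ennreal_mult[symmetric] order_trans[OF h0 hb] intro!: ennreal_leI mult_right_mono)
  also have "\<dots> = ennreal hmax * (\<integral>\<^sup>+t. ennreal (dens t) \<partial>lborel)" by (rule nn_integral_cmult) measurable
  also have "\<dots> < top" using dens_fin by (simp add: ennreal_mult_less_top)
  finally have I: "?I < top" .
  show int: "integrable lborel ?\<mu>"
  proof (rule integrableI_bounded)
    have "(\<integral>\<^sup>+v. ennreal (norm (?\<mu> v)) \<partial>lborel) \<le> (\<integral>\<^sup>+v. mm h v \<partial>lborel)" by (intro nn_integral_mono \<mu>le)
    also have "\<dots> < \<infinity>" using I by (simp add: mm_total)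
    finally show "(\<integral>\<^sup>+v. ennreal (norm (?\<mu> v)) \<partial>lborel) < \<infinity>" .
  qed simp
  define c where "c W = (LINT v|lborel. ?\<mu> v * ?\<mu> (W - v))" for W
  have cm [measurable]: "c \<in> borel_measurable borel" unfolding c_def by measurable
  have cF: "ennreal (norm (c W)) \<le> F h W" for W
  proof (cases "integrable lborel (\<lambda>v. ?\<mu> v * ?\<mu> (W - v))")
    case True
    have "ennreal (norm (c W)) \<le> (\<integral>\<^sup>+v. ennreal (norm (?\<mu> v * ?\<mu> (W - v))) \<partial>lborel)"
      unfolding c_def by (rule integral_norm_bound_ennreal[OF True])
    also have "\<dots> \<le> F h W"
      unfolding F_def norm_mult by (intro nn_integral_mono) (auto simp: ennreal_mult intro!: mult_mono \<mu>le)
    finally show ?thesis .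
  qed (simp add: c_def not_integrable_integral_eq)
  have sq: "(ft ?\<mu> u)\<^sup>2 = ft c u" for u
    unfolding c_def by (rule ft_square(2)[OF int])
  have cint: "integrable lborel c"
    unfolding c_def by (rule ft_square(1)[OF int])
  have "(\<integral>\<^sup>+u. ennreal_powr (ennreal (norm (ft ?\<mu> u))) (2 * r') \<partial>lborel) = (\<integral>\<^sup>+u. ennreal_powr (ennreal (norm (ft c u))) r' \<partial>lborel)"
    unfolding sq[symmetric] norm_power by (intro nn_integral_cong) (auto simp: powr_powr powr_numeral[symmetric] simp del: powr_numeral)
  also have "\<dots> \<le> ennreal (HY_const r') * ennreal_powr (\<integral>\<^sup>+x. ennreal_powr (ennreal (norm (c x))) r \<partial>lborel) (r' - 1)"
    using r by (intro hausdorff_young cint) (auto simp: r'_def)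
  also have "\<dots> \<le> ennreal (HY_const r') * ennreal_powr (\<integral>\<^sup>+x. ennreal_powr (F h x) r \<partial>lborel) (r' - 1)"
    using r r' by (intro mult_left_mono ennreal_powr_mono nn_integral_mono cF) auto
  finally have "ennreal_powr (\<integral>\<^sup>+u. ennreal_powr (ennreal (norm (ft ?\<mu> u))) (2 * r') \<partial>lborel) (1 / (2 * r'))
     \<le> ennreal_powr (ennreal (HY_const r') * ennreal_powr (\<integral>\<^sup>+x. ennreal_powr (F h x) r \<partial>lborel) (r' - 1)) (1 / (2 * r'))"
    using r' by (intro ennreal_powr_mono) auto
  also have "\<dots> = ennreal (HY_const r' powr (1 / (2 * r'))) * ennreal_powr (ennreal_powr (\<integral>\<^sup>+x. ennreal_powr (F h x) r \<partial>lborel) (1 / r)) (1 / 2)"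
  proof -
    have "(r' - 1) * (1 / (2 * r')) = 1 / r * (1 / 2)" using r' r by (simp add: r'_def field_simps)
    then show ?thesis unfolding ennreal_powr_mult ennreal_powr_powr using HY_const_nonneg[OF r'(1)] by simp
  qed
  also have "\<dots> \<le> ennreal (HY_const r' powr (1 / (2 * r'))) * ennreal_powr (ennreal (ext_const r) * ennreal_powr ?Y ((3 - r) / r)) (1 / 2)"
    by (intro mult_left_mono ennreal_powr_mono F_norm[OF r h h0 hb]) auto
  also have "\<dots> = ennreal (HY_const r' powr (1 / (2 * r')) * ext_const r powr (1 / 2)) * ennreal_powr ?Y ((3 - r) / (2 * r))"
    unfolding ennreal_powr_mult ennreal_powr_powr using ext_const_nonneg[of r] by (simp add: ennreal_mult mult.assoc mult.commute[of 2])
  finally show "ennreal_powr (\<integral>\<^sup>+u. ennreal_powr (ennreal (norm (ft ?\<mu> u))) (2 * (r / (r - 1))) \<partial>lborel) (1 / (2 * (r / (r - 1))))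
     \<le> ennreal (HY_const (r / (r - 1)) powr (1 / (2 * (r / (r - 1)))) * ext_const r powr (1 / 2)) * ennreal_powr ?Y ((3 - r) / (2 * r))"
    unfolding r'_def .
qed

end

section \<open>The maximal operator on a piece\<close>

definition bavg :: "(real^2 \<Rightarrow> complex) \<Rightarrow> (real^2 \<Rightarrow> complex) \<Rightarrow> real^2 \<Rightarrow> real^2 \<Rightarrow> complex" where
  "bavg f g v x = (LINT w|lborel. ft f w * g w * complex_of_real (rkern v (x - w)))"

text \<open>The maximal operator after the substitution \<open>w = x - y\<close>, indexed by half
  side lengths; the dependence on \<open>x\<close> then sits in the kernel alone.\<close>

definition mop :: "(real^2 \<Rightarrow> complex) \<Rightarrow> (real^2 \<Rightarrow> complex) \<Rightarrow> real^2 \<Rightarrow> ennreal" where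
  "mop f g x = (SUP v\<in>{v. 0 < v $ 1 \<and> 0 < v $ 2}. ennreal (norm (bavg f g v x)))"

lemma borel_measurable_bavg [measurable (raw)]:
  assumes [measurable]: "f \<in> borel_measurable borel" "g \<in> borel_measurable borel" "x \<in> borel_measurable M"
  shows "(\<lambda>t. bavg f g v (x t)) \<in> borel_measurable M"
  unfolding bavg_def by measurable

lemma norm_ft_real_le:
  assumes "integrable lborel f" shows "norm (ft f u) \<le> (LINT x|lborel. norm (f x))"
  unfolding ft_def using integral_norm_bound[of lborel "\<lambda>x. f x * eker x u"] by (simp add: norm_mult)

lemma integrable_rkern:
  assumes "0 < v $ 1" "0 < v $ 2" shows "integrable lborel (\<lambda>w. rkern v (x - w))"
  using rkern_total[OF assms, of x] rkern_nonneg[OF assms] by (intro integrableI_nonneg) auto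

lemma norm_bavg_le:
  assumes f: "integrable lborel f" and g: "g \<in> borel_measurable borel" "\<And>v. norm (g v) \<le> 1"
    and v: "0 < v $ 1" "0 < v $ 2"
  shows "norm (bavg f g v x) \<le> (LINT x|lborel. norm (f x))" (is "_ \<le> ?B")
proof -
  have [measurable]: "f \<in> borel_measurable borel" "g \<in> borel_measurable borel" using f g by auto
  have le: "norm (ft f w * g w * complex_of_real (rkern v (x - w))) \<le> ?B * rkern v (x - w)" for w
  proof -
    have "norm (ft f w) * norm (g w) \<le> ?B * 1"
      by (intro mult_mono norm_ft_real_le f g(2)) auto
    then show ?thesis using rkern_nonneg[OF v, of "x - w"] by (simp add: norm_mult mult_right_mono)
  qed
  have int: "integrable lborel (\<lambda>w. ?B * rkern v (x - w))" using integrable_rkern[OF v] by simp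
  have "norm (bavg f g v x) \<le> (LINT w|lborel. norm (ft f w * g w * complex_of_real (rkern v (x - w))))"
    unfolding bavg_def by (rule integral_norm_bound)
  also have "\<dots> \<le> (LINT w|lborel. ?B * rkern v (x - w))"
    using le by (intro integral_mono int Bochner_Integration.integrable_bound[OF int]) (auto intro!: order_trans[OF le] abs_ge_self)
  also have "\<dots> = ?B"
    using rkern_total[OF v, of x] rkern_nonneg[OF v] by (simp add: integral_eq_nn_integral)
  finally show ?thesis .
qed

text \<open>The multiplication formula: Fubini's theorem together with the symmetry of
  \<open>eker\<close>.\<close>

lemma ft_duality:
  assumes f: "integrable lborel f" and \<mu>: "integrable lborel \<mu>"
  shows "(LINT w|lborel. ft f w * \<mu> w) = (LINT x|lborel. f x * ft \<mu> x)"
proof -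
  have [measurable]: "f \<in> borel_measurable borel" "\<mu> \<in> borel_measurable borel" using f \<mu> by auto
  have "integrable (lborel \<Otimes>\<^sub>M lborel) (\<lambda>p. f (fst p) * \<mu> (snd p))"
    by (rule integrable_pair_mult(1)[OF sigma_finite_lborel sigma_finite_lborel f \<mu>])
  then have int: "integrable (lborel \<Otimes>\<^sub>M lborel) (case_prod (\<lambda>x w. f x * eker x w * \<mu> w))"
    by (rule Bochner_Integration.integrable_bound) (auto simp: norm_mult split_beta')
  have "(LINT w|lborel. ft f w * \<mu> w) = (LINT w|lborel. (LINT x|lborel. f x * eker x w * \<mu> w))"
    unfolding ft_def by simp
  also have "\<dots> = (LINT x|lborel. (LINT w|lborel. f x * eker x w * \<mu> w))"
    by (rule lborel_pair.Fubini_integral[OF int])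
  also have "\<dots> = (LINT x|lborel. f x * ft \<mu> x)"
  proof (rule Bochner_Integration.integral_cong[OF refl])
    fix x
    have "(LINT w|lborel. f x * eker x w * \<mu> w) = (LINT w|lborel. f x * (\<mu> w * eker w x))"
      by (intro Bochner_Integration.integral_cong) (auto simp: eker_def inner_commute)
    also have "\<dots> = f x * ft \<mu> x" unfolding ft_def by (rule integral_mult_right_zero)
    finally show "(LINT w|lborel. f x * eker x w * \<mu> w) = f x * ft \<mu> x" .
  qed
  finally show ?thesis .
qed

text \<open>Rational side lengths suffice. They approximate a given rectangle from outside: since
  rectangles are closed, the indicators then converge at every point, and dominated convergence
  applies. A countable supremum is measurable and is an increasing limit of finite ones.\<close>

lemma mop_countable:
  assumes f: "integrable lborel f" and g: "g \<in> borel_measurable borel" "\<And>v. norm (g v) \<le> 1"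
  shows "\<exists>Q :: nat \<Rightarrow> real^2. (\<forall>n. 0 < Q n $ 1 \<and> 0 < Q n $ 2) \<and> (\<forall>x. mop f g x = (SUP n. ennreal (norm (bavg f g (Q n) x))))"
proof -
  have [measurable]: "f \<in> borel_measurable borel" "g \<in> borel_measurable borel" using f g by auto
  define D :: "(real^2) set" where "D = (\<lambda>(a, b). pt a b) ` (({0<..} \<inter> \<rat>) \<times> ({0<..} \<inter> \<rat>))"
  have D: "countable D" "D \<noteq> {}" "\<And>v. v \<in> D \<Longrightarrow> 0 < v $ 1 \<and> 0 < v $ 2"
  proof -
    show "countable D" unfolding D_def using countable_rat by (intro countable_image countable_SIGMA countable_Int2) auto
    have "(1 :: real) \<in> {0<..} \<inter> \<rat>" by simp
    then show "D \<noteq> {}" unfolding D_def by blast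
  qed (auto simp: D_def)
  define Q where "Q = from_nat_into D"
  have Q: "range Q = D" unfolding Q_def using D by (simp add: range_from_nat_into)
  have le: "ennreal (norm (bavg f g v x)) \<le> (SUP n. ennreal (norm (bavg f g (Q n) x)))" if v: "0 < v $ 1" "0 < v $ 2" for v x
  proof -
    have "\<exists>q\<in>\<rat>. a < q \<and> q < a + 1 / real (Suc n)" for a :: real and n
      by (rule Rats_dense_in_real) simp
    then obtain q where q: "\<And>a n. q a n \<in> \<rat>" "\<And>a n. a < q a n" "\<And>a n. q a n < a + 1 / real (Suc n)"
      by metis
    have qlim: "q a \<longlonglongrightarrow> a" for a
    proof (rule real_tendsto_sandwich[OF _ _ tendsto_const])
      have "(\<lambda>n. a + 1 / real (Suc n)) \<longlonglongrightarrow> a + 0"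
        by (intro tendsto_intros) (use LIMSEQ_inverse_real_of_nat in \<open>simp add: inverse_eq_divide\<close>)
      then show "(\<lambda>n. a + 1 / real (Suc n)) \<longlonglongrightarrow> a" by simp
    qed (use q in \<open>auto intro!: always_eventually less_imp_le\<close>)
    define V where "V n = pt (q (v $ 1) n) (q (v $ 2) n)" for n
    have VD: "V n \<in> D" for n
    proof -
      have "0 < q (v $ i) n" if "0 < v $ i" for i using q(2)[of "v $ i" n] that by linarith
      then show ?thesis unfolding V_def D_def using q(1) v by (auto intro!: image_eqI[of _ _ "(q (v $ 1) n, q (v $ 2) n)"])
    qed
    define B where "B = (LINT x|lborel. norm (f x))"
    have B: "norm (ft f w * g w) \<le> B" for w
      unfolding norm_mult B_def using mult_mono[OF norm_ft_real_le[OF f] g(2)] by simp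
    have ind: "(\<lambda>n. if \<bar>a\<bar> \<le> q b n then 1 else 0 :: real) \<longlonglongrightarrow> (if \<bar>a\<bar> \<le> b then 1 else 0)" for a b
    proof (cases "\<bar>a\<bar> \<le> b")
      case True
      then have "\<bar>a\<bar> \<le> q b n" for n using q(2)[of b n] by simp
      then show ?thesis using True by simp
    next
      case False
      then have "\<forall>\<^sub>F n in sequentially. q b n < \<bar>a\<bar>" using qlim[of b] by (auto simp: order_tendsto_iff)
      then have "\<forall>\<^sub>F n in sequentially. (if \<bar>a\<bar> \<le> q b n then 1 else 0 :: real) = 0" by eventually_elim auto
      then show ?thesis using False by (simp add: tendsto_eventually)
    qed
    have rk: "rkern u y = (if \<bar>y $ 1\<bar> \<le> u $ 1 then 1 else 0) * (if \<bar>y $ 2\<bar> \<le> u $ 2 then 1 else 0) / (4 * u $ 1 * u $ 2)" for u y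
      by (simp add: rkern_eq)
    have rkV: "rkern (V n) y = (if \<bar>y $ 1\<bar> \<le> q (v $ 1) n then 1 else 0) * (if \<bar>y $ 2\<bar> \<le> q (v $ 2) n then 1 else 0) / (4 * q (v $ 1) n * q (v $ 2) n)" for n y
      by (simp add: rkern_eq V_def)
    \<comment> \<open>All approximating side lengths exceed the given ones by less than 1, so one
      larger rectangle carries an integrable majorant.\<close>
    define W where "W = v + pt 1 1"
    have "(\<lambda>n. bavg f g (V n) x) \<longlonglongrightarrow> bavg f g v x"
      unfolding bavg_def
    proof (rule integral_dominated_convergence)
      have "emeasure lborel (cbox (x - W) (x + W)) < \<infinity>" by (rule emeasure_lborel_cbox_finite)
      then show "integrable lborel (\<lambda>w. B / (4 * v $ 1 * v $ 2) * indicator (cbox (x - W) (x + W)) w)"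
        by (intro integrable_mult_right integrable_real_indicator) auto
      show "AE w in lborel. (\<lambda>n. ft f w * g w * complex_of_real (rkern (V n) (x - w))) \<longlonglongrightarrow> ft f w * g w * complex_of_real (rkern v (x - w))"
        unfolding rkV rk[of v] by (intro AE_I2 tendsto_mult tendsto_const tendsto_of_real tendsto_divide ind qlim) (use v in simp)
      fix n
      show "AE w in lborel. norm (ft f w * g w * complex_of_real (rkern (V n) (x - w))) \<le> B / (4 * v $ 1 * v $ 2) * indicator (cbox (x - W) (x + W)) w"
      proof (rule AE_I2)
        fix w
        have qn: "q (v $ i) n \<le> v $ i + 1" for i
          using q(3)[of "v $ i" n] by (smt (verit) divide_le_eq_1 of_nat_0_le_iff of_nat_Suc)
        have "rkern (V n) (x - w) \<le> 1 / (4 * v $ 1 * v $ 2) * indicator (cbox (x - W) (x + W)) w"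
        proof (cases "\<bar>(x - w) $ 1\<bar> \<le> V n $ 1 \<and> \<bar>(x - w) $ 2\<bar> \<le> V n $ 2")
          case True
          then have "w \<in> cbox (x - W) (x + W)"
            using qn[of 1] qn[of 2] unfolding V_def W_def by (auto simp: mem_box_cart forall_2 abs_le_iff)
          moreover have "1 / (4 * V n $ 1 * V n $ 2) \<le> 1 / (4 * v $ 1 * v $ 2)"
            unfolding V_def using q(2)[of "v $ 1" n] q(2)[of "v $ 2" n] v by (intro divide_left_mono mult_mono mult_pos_pos) auto
          ultimately show ?thesis using True by (simp add: rkern_eq)
        qed (use v in \<open>auto simp: rkern_eq split: split_indicator\<close>)
        moreover have "0 \<le> rkern (V n) (x - w)" using D(3)[OF VD] by (intro rkern_nonneg) auto
        ultimately have "norm (ft f w * g w) * rkern (V n) (x - w) \<le> B * (1 / (4 * v $ 1 * v $ 2) * indicator (cbox (x - W) (x + W)) w)"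
          using B[of w] order_trans[OF norm_ge_zero B] by (intro mult_mono) auto
        then show "norm (ft f w * g w * complex_of_real (rkern (V n) (x - w))) \<le> B / (4 * v $ 1 * v $ 2) * indicator (cbox (x - W) (x + W)) w"
          using \<open>0 \<le> rkern (V n) (x - w)\<close> by (simp add: norm_mult)
      qed
    qed measurable
    then have lim: "(\<lambda>n. ennreal (norm (bavg f g (V n) x))) \<longlonglongrightarrow> ennreal (norm (bavg f g v x))"
      by (intro tendsto_ennrealI tendsto_norm)
    have bd: "ennreal (norm (bavg f g (V n) x)) \<le> (SUP n. ennreal (norm (bavg f g (Q n) x)))" for n
    proof -
      obtain k where "V n = Q k" using VD[of n] Q by blast
      then show ?thesis using SUP_upper[of k UNIV "\<lambda>n. ennreal (norm (bavg f g (Q n) x))"] by simp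
    qed
    show ?thesis using LIMSEQ_le_const2[OF lim] bd by blast
  qed
  have Qpos: "0 < Q n $ 1 \<and> 0 < Q n $ 2" for n using D(3) Q by blast
  have "mop f g x = (SUP n. ennreal (norm (bavg f g (Q n) x)))" for x
    unfolding mop_def
  proof (rule antisym)
      show "(SUP v\<in>{v. 0 < v $ 1 \<and> 0 < v $ 2}. ennreal (norm (bavg f g v x))) \<le> (SUP n. ennreal (norm (bavg f g (Q n) x)))"
        using le by (intro SUP_least) auto
      show "(SUP n. ennreal (norm (bavg f g (Q n) x))) \<le> (SUP v\<in>{v. 0 < v $ 1 \<and> 0 < v $ 2}. ennreal (norm (bavg f g v x)))"
        using Qpos by (intro SUP_least SUP_upper) blast
  qed
  then show ?thesis using Qpos by blast
qed

definition max_const :: "real \<Rightarrow> real" where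
  "max_const r = HY_const (r / (r - 1)) powr (1 / (2 * (r / (r - 1)))) * ext_const r powr (1 / 2)"

context arc_kernel
begin

text \<open>The linearised maximal operator is tested against \<open>a = A powr (q - 1)\<close> times the conjugate phase.\<close>

lemma linearized_maximal:
  assumes r: "1 < r" "r < 2" and p: "p > 1" "1 / p + 1 / (2 * (r / (r - 1))) = 1" and q: "q > 1" "2 * r / (3 - r) = q / (q - 1)"
    and f: "integrable lborel f" and g [measurable]: "g \<in> borel_measurable borel" and g1: "\<And>v. norm (g v) \<le> 1"
  shows "ennreal_powr (\<integral>\<^sup>+t. ennreal (dens t) * ennreal_powr (ennreal (norm (bavg f g (sel t) (z t)))) q \<partial>lborel) (1 / q)
    \<le> ennreal (max_const r) * ennreal_powr (\<integral>\<^sup>+x. ennreal_powr (ennreal (norm (f x))) p \<partial>lborel) (1 / p)"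
    (is "ennreal_powr ?Z _ \<le> _ * ?N")
proof -
  have fm [measurable]: "f \<in> borel_measurable borel" using f by auto
  define B where "B = (LINT x|lborel. norm (f x))"
  have B0: "0 \<le> B" by (simp add: B_def)
  define b where "b t = bavg f g (sel t) (z t)" for t
  have bm [measurable]: "b \<in> borel_measurable borel" unfolding b_def bavg_def by measurable
  have bB: "norm (b t) \<le> B" for t
    unfolding b_def B_def using V(2)[OF sel_V] by (intro norm_bavg_le f g g1) auto
  define h where "h t = norm (b t) powr (q - 1)" for t
  define a where "a t = complex_of_real (h t) * cnj (sgn (b t))" for t
  have [measurable]: "h \<in> borel_measurable borel" unfolding h_def by measurable
  have am [measurable]: "a \<in> borel_measurable borel" unfolding a_def sgn_div_norm by measurable
  have h: "0 \<le> h t" "h t \<le> B powr (q - 1)" "norm (a t) \<le> h t" for t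
    using bB q by (auto simp: h_def a_def norm_mult norm_sgn intro!: powr_mono2)
  have ab: "a t * b t = complex_of_real (norm (b t) powr q)" for t
  proof (cases "b t = 0")
    case False
    have "cnj (sgn (b t)) * b t = complex_of_real (norm (b t))"
      using False by (simp add: sgn_div_norm scaleR_conv_of_real mult.assoc complex_norm_square[symmetric] mult.commute[of "cnj _"] power2_eq_square)
    then have "a t * b t = complex_of_real (h t * norm (b t))" by (simp add: a_def mult.assoc)
    also have "h t * norm (b t) = norm (b t) powr q" using False powr_add[of "norm (b t)" "q - 1" 1] by (simp add: h_def)
    finally show ?thesis .
  qed (use q in \<open>simp add: a_def\<close>)
  have densint: "integrable lborel dens"
    using dens_fin dens_nonneg by (intro integrableI_nonneg) auto
  have adint: "integrable lborel (\<lambda>t. a t * complex_of_real (dens t))"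
  proof (rule Bochner_Integration.integrable_bound)
    show "integrable lborel (\<lambda>t. B powr (q - 1) * dens t)" using densint by simp
    show "AE t in lborel. norm (a t * complex_of_real (dens t)) \<le> norm (B powr (q - 1) * dens t)"
      using h dens_nonneg by (auto simp: norm_mult abs_mult intro!: mult_right_mono order_trans[OF h(3) h(2)])
  qed simp
  have ZY: "?Z = (\<integral>\<^sup>+t. ennreal (h t powr (2 * r / (3 - r)) * dens t) \<partial>lborel)"
  proof (rule nn_integral_cong)
    fix t
    have "h t powr (2 * r / (3 - r)) = norm (b t) powr q" unfolding h_def powr_powr q(2) using q(1) by simp
    then show "ennreal (dens t) * ennreal_powr (ennreal (norm (bavg f g (sel t) (z t)))) q = ennreal (h t powr (2 * r / (3 - r)) * dens t)"
      using dens_nonneg by (simp add: b_def[symmetric] ennreal_mult mult.commute)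
  qed
  have Zfin: "?Z < top"
  proof -
    have "?Z \<le> (\<integral>\<^sup>+t. ennreal (B powr q) * ennreal (dens t) \<partial>lborel)"
      using bB q by (intro nn_integral_mono, subst mult.commute) (auto simp: b_def[symmetric] intro!: mult_right_mono ennreal_leI powr_mono2)
    also have "\<dots> = ennreal (B powr q) * (\<integral>\<^sup>+t. ennreal (dens t) \<partial>lborel)" by (rule nn_integral_cmult) measurable
    also have "\<dots> < top" using dens_fin by (simp add: ennreal_mult_less_top)
    finally show ?thesis .
  qed
  define Zr where "Zr = (LINT t|lborel. norm (b t) powr q * dens t)"
  have Zeq: "?Z = ennreal Zr"
  proof -
    have e: "?Z = (\<integral>\<^sup>+t. ennreal (norm (b t) powr q * dens t) \<partial>lborel)"
      using dens_nonneg by (intro nn_integral_cong) (simp add: b_def[symmetric] ennreal_mult mult.commute)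
    have "integrable lborel (\<lambda>t. norm (b t) powr q * dens t)"
      using Zfin dens_nonneg unfolding e by (intro integrableI_nonneg) auto
    then show ?thesis unfolding e Zr_def using dens_nonneg by (intro nn_integral_eq_integral) auto
  qed
  have Zr0: "Zr \<ge> 0" unfolding Zr_def using dens_nonneg by (intro integral_nonneg_AE) auto
  note ext = extension_le[OF r _ h(1,2) am h(3) g g1]
  have \<mu>int: "integrable lborel (\<mu> g a)" by (rule ext(1)) measurable
  have \<mu>m [measurable]: "\<mu> g a \<in> borel_measurable borel" using \<mu>int by auto
  \<comment> \<open>Fubini's theorem is justified by the bound \<open>B\<close> for
    \<open>ft f\<close>, the unit mass of the kernels and the integrability of \<open>a\<close>
    times \<open>dens\<close>.\<close>
  have FUB: "integrable (lborel \<Otimes>\<^sub>M lborel) (case_prod (\<lambda>t w. a t * complex_of_real (dens t) * (ft f w * g w * complex_of_real (k t w))))"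
  proof (rule integrableI_bounded)
    have "(\<integral>\<^sup>+p. ennreal (norm ((case_prod (\<lambda>t w. a t * complex_of_real (dens t) * (ft f w * g w * complex_of_real (k t w)))) p)) \<partial>(lborel \<Otimes>\<^sub>M lborel))
      \<le> (\<integral>\<^sup>+p. ennreal B * (ennreal (norm (a (fst p) * complex_of_real (dens (fst p)))) * ennreal (k (fst p) (snd p))) \<partial>(lborel \<Otimes>\<^sub>M lborel))"
    proof (rule nn_integral_mono)
      fix p :: "real \<times> (real^2)"
      have "norm (ft f (snd p)) * norm (g (snd p)) \<le> B * 1"
        unfolding B_def by (intro mult_mono norm_ft_real_le f g1) auto
      then have "norm (a (fst p) * complex_of_real (dens (fst p))) * (norm (ft f (snd p)) * norm (g (snd p)) * k (fst p) (snd p)) \<le> norm (a (fst p) * complex_of_real (dens (fst p))) * (B * k (fst p) (snd p))"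
        using k_nonneg by (intro mult_left_mono mult_right_mono) auto
      then show "ennreal (norm ((case_prod (\<lambda>t w. a t * complex_of_real (dens t) * (ft f w * g w * complex_of_real (k t w)))) p))
        \<le> ennreal B * (ennreal (norm (a (fst p) * complex_of_real (dens (fst p)))) * ennreal (k (fst p) (snd p)))"
        using k_nonneg B0 by (simp add: split_beta' norm_mult ennreal_mult[symmetric] ennreal_leI mult_ac)
    qed
    also have "\<dots> = (\<integral>\<^sup>+t. (\<integral>\<^sup>+w. ennreal B * (ennreal (norm (a t * complex_of_real (dens t))) * ennreal (k t w)) \<partial>lborel) \<partial>lborel)"
      by (subst lborel.nn_integral_fst[symmetric]) auto
    also have "\<dots> = (\<integral>\<^sup>+t. ennreal B * ennreal (norm (a t * complex_of_real (dens t))) \<partial>lborel)"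
    proof (rule nn_integral_cong)
      fix t
      have "(\<integral>\<^sup>+w. ennreal B * (ennreal (norm (a t * complex_of_real (dens t))) * ennreal (k t w)) \<partial>lborel)
        = ennreal B * (ennreal (norm (a t * complex_of_real (dens t))) * (\<integral>\<^sup>+w. ennreal (k t w) \<partial>lborel))"
        by (subst nn_integral_cmult, measurable, subst nn_integral_cmult, measurable)
      then show "(\<integral>\<^sup>+w. ennreal B * (ennreal (norm (a t * complex_of_real (dens t))) * ennreal (k t w)) \<partial>lborel)
        = ennreal B * ennreal (norm (a t * complex_of_real (dens t)))" by (simp add: k_total)
    qed
    also have "\<dots> = ennreal B * (\<integral>\<^sup>+t. ennreal (norm (a t * complex_of_real (dens t))) \<partial>lborel)" by (rule nn_integral_cmult) measurable
    also have "\<dots> < \<infinity>" using adint by (simp add: integrable_iff_bounded ennreal_mult_less_top)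
    finally show "(\<integral>\<^sup>+p. ennreal (norm ((case_prod (\<lambda>t w. a t * complex_of_real (dens t) * (ft f w * g w * complex_of_real (k t w)))) p)) \<partial>(lborel \<Otimes>\<^sub>M lborel)) < \<infinity>" .
  qed (simp add: split_beta')
  have "complex_of_real Zr = (LINT t|lborel. complex_of_real (norm (b t) powr q * dens t))"
    unfolding Zr_def by (rule integral_complex_of_real[symmetric])
  also have "\<dots> = (LINT t|lborel. (LINT w|lborel. a t * complex_of_real (dens t) * (ft f w * g w * complex_of_real (k t w))))"
  proof (rule Bochner_Integration.integral_cong[OF refl])
    fix t
    have "(LINT w|lborel. a t * complex_of_real (dens t) * (ft f w * g w * complex_of_real (k t w))) = a t * complex_of_real (dens t) * b t"
      unfolding b_def bavg_def k_def by (rule integral_mult_right_zero)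
    also have "\<dots> = (a t * b t) * complex_of_real (dens t)" by (simp add: mult_ac)
    also have "\<dots> = complex_of_real (norm (b t) powr q * dens t)" by (simp add: ab)
    finally show "complex_of_real (norm (b t) powr q * dens t) = (LINT w|lborel. a t * complex_of_real (dens t) * (ft f w * g w * complex_of_real (k t w)))"
      by (rule sym)
  qed
  also have "\<dots> = (LINT w|lborel. (LINT t|lborel. a t * complex_of_real (dens t) * (ft f w * g w * complex_of_real (k t w))))"
    by (rule lborel_pair.Fubini_integral[OF FUB, symmetric])
  also have "\<dots> = (LINT w|lborel. ft f w * \<mu> g a w)"
  proof (rule Bochner_Integration.integral_cong[OF refl])
    fix w
    have "(LINT t|lborel. a t * complex_of_real (dens t) * (ft f w * g w * complex_of_real (k t w)))
      = (LINT t|lborel. (ft f w * g w) * (a t * complex_of_real (dens t) * complex_of_real (k t w)))"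
      by (intro Bochner_Integration.integral_cong) (auto simp: mult_ac)
    also have "\<dots> = (ft f w * g w) * (LINT t|lborel. a t * complex_of_real (dens t) * complex_of_real (k t w))"
      by (rule integral_mult_right_zero)
    finally show "(LINT t|lborel. a t * complex_of_real (dens t) * (ft f w * g w * complex_of_real (k t w))) = ft f w * \<mu> g a w"
      by (simp add: \<mu>_def mult.assoc)
  qed
  also have "\<dots> = (LINT x|lborel. f x * ft (\<mu> g a) x)" by (rule ft_duality[OF f \<mu>int])
  finally have dual: "complex_of_real Zr = (LINT x|lborel. f x * ft (\<mu> g a) x)" .
  have int: "integrable lborel (\<lambda>x. f x * ft (\<mu> g a) x)"
  proof (rule Bochner_Integration.integrable_bound)
    show "integrable lborel (\<lambda>x. norm (f x) * (LINT w|lborel. norm (\<mu> g a w)))" using f by simp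
    show "AE x in lborel. norm (f x * ft (\<mu> g a) x) \<le> norm (norm (f x) * (LINT w|lborel. norm (\<mu> g a w)))"
      using norm_ft_real_le[OF \<mu>int] by (auto simp: norm_mult abs_mult intro!: AE_I2 mult_left_mono order_trans[OF norm_ft_real_le[OF \<mu>int]])
  qed measurable
  have "?Z = ennreal (norm (LINT x|lborel. f x * ft (\<mu> g a) x))"
    unfolding Zeq dual[symmetric] using Zr0 by simp
  also have "\<dots> \<le> (\<integral>\<^sup>+x. ennreal (norm (f x * ft (\<mu> g a) x)) \<partial>lborel)" by (rule integral_norm_bound_ennreal[OF int])
  also have "\<dots> = (\<integral>\<^sup>+x. ennreal (norm (f x)) * ennreal (norm (ft (\<mu> g a) x)) \<partial>lborel)" by (simp add: norm_mult ennreal_mult)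
  \<comment> \<open>Hoelder's inequality in the plane: \<open>2 * (r / (r - 1))\<close> is conjugate
    to \<open>p\<close>, and it is also the exponent in which \<open>extension_le\<close> bounds the
    transform.\<close>
  also have "\<dots> \<le> ?N * ennreal_powr (\<integral>\<^sup>+x. ennreal_powr (ennreal (norm (ft (\<mu> g a) x))) (2 * (r / (r - 1))) \<partial>lborel) (1 / (2 * (r / (r - 1))))"
  proof (rule nn_integral_Holder[OF _ _ p(1) _ p(2)])
    have "r / (r - 1) > 1" using r by (simp add: field_simps)
    then show "1 < 2 * (r / (r - 1))" by simp
  qed measurable
  also have "\<dots> \<le> ?N * (ennreal (max_const r) * ennreal_powr ?Z ((3 - r) / (2 * r)))"
    unfolding ZY max_const_def by (intro mult_left_mono ext(2)) auto
  also have "(3 - r) / (2 * r) = 1 - 1 / q"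
  proof -
    have "(3 - r) / (2 * r) = 1 / (2 * r / (3 - r))" by simp
    also have "\<dots> = 1 - 1 / q" unfolding q(2) using q(1) by (simp add: field_simps)
    finally show ?thesis .
  qed
  finally have "?Z \<le> (ennreal (max_const r) * ?N) * ennreal_powr ?Z (1 - 1 / q)" by (simp add: mult_ac)
  then show ?thesis using Zfin q by (intro ennreal_absorb) auto
qed

end


section \<open>Limits to all rectangles and to non-integrable densities\<close>

context arc_piece
begin

text \<open>The supremum over finitely many rectangles is attained. Choosing the least index that
  attains it gives a measurable selection, to which the linearised estimate applies.\<close>

lemma finite_maximal:
  assumes r: "1 < r" "r < 2" and p: "p > 1" "1 / p + 1 / (2 * (r / (r - 1))) = 1" and q: "q > 1" "2 * r / (3 - r) = q / (q - 1)"
    and f: "integrable lborel f" and g [measurable]: "g \<in> borel_measurable borel" and g1: "\<And>v. norm (g v) \<le> 1"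
    and dens_fin: "(\<integral>\<^sup>+t. ennreal (dens t) \<partial>lborel) < top" and Q: "\<And>i. 0 < Q i $ 1 \<and> 0 < Q i $ 2"
  shows "ennreal_powr (\<integral>\<^sup>+t. ennreal (dens t) * ennreal_powr (SUP i\<in>{..n::nat}. ennreal (norm (bavg f g (Q i) (z t)))) q \<partial>lborel) (1 / q)
    \<le> ennreal (max_const r) * ennreal_powr (\<integral>\<^sup>+x. ennreal_powr (ennreal (norm (f x))) p \<partial>lborel) (1 / p)"
proof -
  have fm [measurable]: "f \<in> borel_measurable borel" using f by auto
  define P where "P i t \<longleftrightarrow> i \<le> n \<and> (\<forall>j\<in>{..n}. norm (bavg f g (Q j) (z t)) \<le> norm (bavg f g (Q i) (z t)))" for i t
  have ex: "\<exists>i. P i t" for t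
  proof -
    let ?A = "(\<lambda>j. norm (bavg f g (Q j) (z t))) ` {..n}"
    have "Max ?A \<in> ?A" by (rule Max_in) auto
    then obtain i where i': "Max ?A = norm (bavg f g (Q i) (z t))" "i \<in> {..n}" by (rule imageE)
    then have i: "i \<le> n" "Max ?A = norm (bavg f g (Q i) (z t))" by simp_all
    have "norm (bavg f g (Q j) (z t)) \<le> norm (bavg f g (Q i) (z t))" if "j \<le> n" for j
      unfolding i(2)[symmetric] using that by (intro Max_ge) auto
    then show ?thesis using i by (auto simp: P_def)
  qed
  define sel where "sel t = Q (LEAST i. P i t)" for t
  have Pl: "P (LEAST i. P i t) t" for t using ex by (rule LeastI_ex)
  have [measurable]: "Measurable.pred borel (\<lambda>t. P i t)" for i unfolding P_def by measurable
  have "(\<lambda>t. LEAST i. P i t) \<in> borel \<rightarrow>\<^sub>M count_space UNIV" by measurable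
  then have selm: "sel \<in> borel_measurable borel" unfolding sel_def by (rule measurable_compose) simp
  interpret K: arc_kernel S z d d' \<kappa> e "Q ` {..n}" sel
    using Q selm Pl dens_fin by unfold_locales (auto simp: sel_def P_def)
  have "(SUP i\<in>{..n}. ennreal (norm (bavg f g (Q i) (z t)))) = ennreal (norm (bavg f g (sel t) (z t)))" for t
    using Pl[of t] unfolding sel_def P_def by (intro antisym SUP_least SUP_upper2) (auto intro: ennreal_leI)
  then show ?thesis using K.linearized_maximal[OF r p q f g g1] by simp
qed

text \<open>Monotone convergence along an enumeration of the countable family from
  \<open>mop_countable\<close>; the bound does not depend on the number of rectangles.\<close>

lemma maximal_dens_fin:
  assumes r: "1 < r" "r < 2" and p: "p > 1" "1 / p + 1 / (2 * (r / (r - 1))) = 1" and q: "q > 1" "2 * r / (3 - r) = q / (q - 1)"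
    and f: "integrable lborel f" and g [measurable]: "g \<in> borel_measurable borel" and g1: "\<And>v. norm (g v) \<le> 1"
    and dens_fin: "(\<integral>\<^sup>+t. ennreal (dens t) \<partial>lborel) < top"
  shows "ennreal_powr (\<integral>\<^sup>+t. ennreal (dens t) * ennreal_powr (mop f g (z t)) q \<partial>lborel) (1 / q)
    \<le> ennreal (max_const r) * ennreal_powr (\<integral>\<^sup>+x. ennreal_powr (ennreal (norm (f x))) p \<partial>lborel) (1 / p)"
proof -
  have fm [measurable]: "f \<in> borel_measurable borel" using f by auto
  obtain Q :: "nat \<Rightarrow> real^2" where Q': "(\<forall>n. 0 < Q n $ 1 \<and> 0 < Q n $ 2) \<and> (\<forall>x. mop f g x = (SUP n. ennreal (norm (bavg f g (Q n) x))))"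
    using mop_countable[OF f g g1] ..
  note Q = Q'[THEN conjunct1, rule_format] Q'[THEN conjunct2, rule_format]
  define A where "A n t = (SUP i\<in>{..n}. ennreal (norm (bavg f g (Q i) (z t))))" for n :: nat and t
  have Am [measurable]: "A n \<in> borel_measurable borel" for n
    unfolding A_def by (intro borel_measurable_SUP countable_finite) auto
  have Ainc: "A n t \<le> A k t" if "n \<le> k" for n k t unfolding A_def using that by (intro SUP_subset_mono) auto
  have SUPA: "mop f g (z t) = (SUP n. A n t)" for t
    unfolding Q(2) A_def
  proof (intro antisym SUP_least)
    fix n show "ennreal (norm (bavg f g (Q n) (z t))) \<le> (SUP n. SUP i\<in>{..n}. ennreal (norm (bavg f g (Q i) (z t))))"
      by (rule SUP_upper2[of n], simp, rule SUP_upper) simp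
  next
    fix n i show "ennreal (norm (bavg f g (Q i) (z t))) \<le> (SUP n. ennreal (norm (bavg f g (Q n) (z t))))"
      by (rule SUP_upper) simp
  qed
  have "(\<integral>\<^sup>+t. ennreal (dens t) * ennreal_powr (mop f g (z t)) q \<partial>lborel) = (\<integral>\<^sup>+t. (SUP n. ennreal (dens t) * ennreal_powr (A n t) q) \<partial>lborel)"
    using q by (simp add: SUPA ennreal_powr_SUP SUP_mult_left_ennreal)
  also have "\<dots> = (SUP n. \<integral>\<^sup>+t. ennreal (dens t) * ennreal_powr (A n t) q \<partial>lborel)"
    using q by (intro nn_integral_monotone_convergence_SUP) (auto simp: incseq_def le_fun_def intro!: mult_left_mono ennreal_powr_mono Ainc)
  finally have "ennreal_powr (\<integral>\<^sup>+t. ennreal (dens t) * ennreal_powr (mop f g (z t)) q \<partial>lborel) (1 / q)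
    = (SUP n. ennreal_powr (\<integral>\<^sup>+t. ennreal (dens t) * ennreal_powr (A n t) q \<partial>lborel) (1 / q))"
    using q by (simp add: ennreal_powr_SUP)
  also have "\<dots> \<le> ennreal (max_const r) * ennreal_powr (\<integral>\<^sup>+x. ennreal_powr (ennreal (norm (f x))) p \<partial>lborel) (1 / p)"
    unfolding A_def by (intro SUP_least finite_maximal[OF r p q f g g1 dens_fin Q(1)])
  finally show ?thesis .
qed

text \<open>The restrictions of \<open>S\<close> to bounded parameters and bounded
  \<open>\<kappa>\<close> have integrable density and increase to \<open>S\<close>. They are again
  arc pieces, because all assumptions pass to Borel subsets.\<close>

lemma piece_maximal:
  assumes r: "1 < r" "r < 2" and p: "p > 1" "1 / p + 1 / (2 * (r / (r - 1))) = 1" and q: "q > 1" "2 * r / (3 - r) = q / (q - 1)"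
    and f: "integrable lborel f" and g [measurable]: "g \<in> borel_measurable borel" and g1: "\<And>v. norm (g v) \<le> 1"
  shows "ennreal_powr (\<integral>\<^sup>+t. ennreal (dens t) * ennreal_powr (mop f g (z t)) q \<partial>lborel) (1 / q)
    \<le> ennreal (max_const r) * ennreal_powr (\<integral>\<^sup>+x. ennreal_powr (ennreal (norm (f x))) p \<partial>lborel) (1 / p)"
proof -
  have fm [measurable]: "f \<in> borel_measurable borel" using f by auto
  obtain Q :: "nat \<Rightarrow> real^2" where Q': "(\<forall>n. 0 < Q n $ 1 \<and> 0 < Q n $ 2) \<and> (\<forall>x. mop f g x = (SUP n. ennreal (norm (bavg f g (Q n) x))))"
    using mop_countable[OF f g g1] ..
  note Q = Q'[THEN conjunct1, rule_format] Q'[THEN conjunct2, rule_format]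
  have mopm [measurable]: "(\<lambda>t. mop f g (z t)) \<in> borel_measurable borel" unfolding Q(2) by measurable
  define X where "X n = {t. \<bar>t\<bar> \<le> real n \<and> \<kappa> t \<le> real n}" for n
  have Xm [measurable]: "X n \<in> sets borel" for n unfolding X_def by measurable
  have ap: "arc_piece (S \<inter> X n) z d d' \<kappa> e" for n
  proof
    show "inj_on z (S \<inter> X n)" using inj by (rule inj_on_subset) auto
  qed (use e der_z der_d \<kappa>_eq \<kappa>_pos d_pos supp in auto)
  define D where "D n = arc_piece.dens (S \<inter> X n) \<kappa>" for n
  have D: "D n t = indicator (S \<inter> X n) t * \<kappa> t powr (1 / 3)" for n t
    unfolding D_def arc_piece.dens_def[OF ap] ..
  have Dm [measurable]: "D n \<in> borel_measurable borel" for n unfolding D by measurable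
  have Dinc: "D n t \<le> D k t" if "n \<le> k" for n k t
    using that by (auto simp: D X_def split: split_indicator)
  have SUPD: "ennreal (dens t) = (SUP n. ennreal (D n t))" for t
  proof (rule antisym)
    obtain n where "max \<bar>t\<bar> (\<kappa> t) \<le> real n" using real_arch_simple by blast
    then have "dens t = D n t" by (auto simp: D dens_def X_def split: split_indicator)
    then show "ennreal (dens t) \<le> (SUP n. ennreal (D n t))"
      using SUP_upper[of n UNIV "\<lambda>n. ennreal (D n t)"] by simp
    show "(SUP n. ennreal (D n t)) \<le> ennreal (dens t)"
      by (intro SUP_least ennreal_leI) (auto simp: D dens_def split: split_indicator)
  qed
  have fin: "(\<integral>\<^sup>+t. ennreal (D n t) \<partial>lborel) < top" for n
  proof -
    have "(\<integral>\<^sup>+t. ennreal (D n t) \<partial>lborel) \<le> (\<integral>\<^sup>+t. ennreal (real n powr (1 / 3)) * indicator {- real n..real n} t \<partial>lborel)"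
      using \<kappa>_pos by (intro nn_integral_mono) (auto simp: D X_def abs_le_iff less_imp_le split: split_indicator intro!: ennreal_leI powr_mono2)
    also have "\<dots> < top" by (subst nn_integral_cmult_indicator) (auto simp: ennreal_mult_less_top)
    finally show ?thesis .
  qed
  have "(\<integral>\<^sup>+t. ennreal (dens t) * ennreal_powr (mop f g (z t)) q \<partial>lborel) = (\<integral>\<^sup>+t. (SUP n. ennreal (D n t) * ennreal_powr (mop f g (z t)) q) \<partial>lborel)"
    by (simp add: SUPD SUP_mult_right_ennreal)
  also have "\<dots> = (SUP n. \<integral>\<^sup>+t. ennreal (D n t) * ennreal_powr (mop f g (z t)) q \<partial>lborel)"
    by (intro nn_integral_monotone_convergence_SUP) (auto simp: incseq_def le_fun_def intro!: mult_right_mono ennreal_leI Dinc)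
  finally have "ennreal_powr (\<integral>\<^sup>+t. ennreal (dens t) * ennreal_powr (mop f g (z t)) q \<partial>lborel) (1 / q)
    = (SUP n. ennreal_powr (\<integral>\<^sup>+t. ennreal (D n t) * ennreal_powr (mop f g (z t)) q \<partial>lborel) (1 / q))"
    using q by (simp add: ennreal_powr_SUP)
  also have "\<dots> \<le> ennreal (max_const r) * ennreal_powr (\<integral>\<^sup>+x. ennreal_powr (ennreal (norm (f x))) p \<partial>lborel) (1 / p)"
    using fin unfolding D_def by (intro SUP_least arc_piece.maximal_dens_fin[OF ap r p q f g g1])
  finally show ?thesis .
qed

end

section \<open>Differentiability of monotone functions\<close>

lemma Vitali_intervals:
  fixes S :: "real set" and K :: "(real \<times> real) set"
  assumes K: "\<And>u v. (u, v) \<in> K \<Longrightarrow> u < v"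
    and cov: "\<And>x \<delta>. x \<in> S \<Longrightarrow> 0 < \<delta> \<Longrightarrow> \<exists>u v. (u, v) \<in> K \<and> u \<le> x \<and> x \<le> v \<and> v - u < \<delta>"
  obtains C where "countable C" "C \<subseteq> K" "disjoint_family_on (\<lambda>(u, v). {u..v}) C" "negligible (S - (\<Union>(u, v)\<in>C. {u..v}))"
proof -
  let ?a = "\<lambda>(u, v). (u + v) / 2 :: real" and ?r = "\<lambda>(u, v). (v - u) / 2 :: real"
  have cb: "cball (?a i) (?r i) = (\<lambda>(u, v). {u..v}) i" for i
    by (cases i) (auto simp: cball_eq_atLeastAtMost field_simps)
  obtain C where "countable C" "C \<subseteq> K" "pairwise (\<lambda>i j. disjnt (cball (?a i) (?r i)) (cball (?a j) (?r j))) C"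
    "negligible (S - (\<Union>i\<in>C. cball (?a i) (?r i)))"
  proof (rule Vitali_covering_theorem_cballs[of K ?r S ?a])
    fix i assume "i \<in> K" then show "0 < ?r i" using K by (cases i) auto
  next
    fix x d :: real assume "x \<in> S" "0 < d"
    then obtain u v where "(u, v) \<in> K" "u \<le> x" "x \<le> v" "v - u < d" using cov by blast
    then show "\<exists>i. i \<in> K \<and> x \<in> cball (?a i) (?r i) \<and> ?r i < d"
      using K[of u v] unfolding cb by (intro exI[of _ "(u, v)"]) auto
  qed auto
  then show ?thesis
    unfolding cb by (intro that[of C]) (auto simp: pairwise_def disjnt_def disjoint_family_on_def)
qed

context
  fixes f :: "real \<Rightarrow> real"
  assumes mono_f: "\<And>x y. x \<le> y \<Longrightarrow> f x \<le> f y" and rc_f: "\<And>x. continuous (at_right x) f"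
begin

abbreviation "\<nu>f \<equiv> interval_measure f"

lemma emeasure_f: "u \<le> v \<Longrightarrow> emeasure \<nu>f {u<..v} = ennreal (f v - f u)"
  using mono_f rc_f by (intro emeasure_interval_measure_Ioc) auto

text \<open>One half of Lebesgue's argument: disjoint intervals in \<open>U\<close> of slope at most
  \<open>p\<close> cover almost all of \<open>S\<close>, and their total Stieltjes mass is at most
  \<open>p\<close> times the measure of \<open>U\<close>. Removing the countably many endpoints
  makes \<open>W\<close> open.\<close>

lemma slope_small:
  assumes U: "open U" "S \<subseteq> U" and p: "0 \<le> p"
    and cov: "\<And>x \<delta>. x \<in> S \<Longrightarrow> 0 < \<delta> \<Longrightarrow> \<exists>u v. u \<le> x \<and> x \<le> v \<and> u < v \<and> v - u < \<delta> \<and> f v - f u \<le> p * (v - u)"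
  obtains W where "open W" "W \<subseteq> U" "negligible (S - W)" "emeasure \<nu>f W \<le> ennreal p * emeasure lborel U"
proof -
  define K where "K = {(u, v). u < v \<and> {u..v} \<subseteq> U \<and> f v - f u \<le> p * (v - u)}"
  have "\<exists>u v. (u, v) \<in> K \<and> u \<le> x \<and> x \<le> v \<and> v - u < \<delta>" if x: "x \<in> S" and \<delta>: "0 < \<delta>" for x \<delta>
  proof -
    obtain e where e: "e > 0" "ball x e \<subseteq> U" using U x by (meson openE subsetD)
    obtain u v where uv: "u \<le> x" "x \<le> v" "u < v" "v - u < min \<delta> e" "f v - f u \<le> p * (v - u)"
      using cov[OF x, of "min \<delta> e"] \<delta> e by auto
    then have "{u..v} \<subseteq> ball x e" by (auto simp: dist_real_def)
    then show ?thesis using uv e by (intro exI[of _ u] exI[of _ v]) (auto simp: K_def)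
  qed
  then obtain C where C: "countable C" "C \<subseteq> K" "disjoint_family_on (\<lambda>(u, v). {u..v}) C" "negligible (S - (\<Union>(u, v)\<in>C. {u..v}))"
    using Vitali_intervals[of K S] unfolding K_def by (smt (verit) case_prodD mem_Collect_eq)
  define W where "W = (\<Union>(u, v)\<in>C. {u<..<v})"
  have dj: "disjoint_family_on (\<lambda>(u, v). {u<..v}) C"
    using C(3) by (fastforce simp: disjoint_family_on_def)
  show ?thesis
  proof (rule that)
    show "open W" unfolding W_def by (intro open_UN) auto
    show "W \<subseteq> U" unfolding W_def using C(2) by (fastforce simp: K_def)
    have "S - W \<subseteq> (S - (\<Union>(u, v)\<in>C. {u..v})) \<union> (fst ` C \<union> snd ` C)"
      unfolding W_def by force
    moreover have "negligible (fst ` C \<union> snd ` C)"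
      using C(1) by (simp add: negligible_iff_null_sets null_sets_completionI countable_imp_null_set_lborel)
    ultimately show "negligible (S - W)"
      using C(4) by (meson negligible_Un negligible_subset)
    have "emeasure \<nu>f W \<le> emeasure \<nu>f (\<Union>(u, v)\<in>C. {u<..v})"
      unfolding W_def using C(1) by (intro emeasure_mono) (fastforce, auto intro!: sets.countable_UN')
    also have "\<dots> = (\<integral>\<^sup>+i. emeasure \<nu>f ((\<lambda>(u, v). {u<..v}) i) \<partial>count_space C)"
      using C(1) dj by (intro emeasure_UN_countable) auto
    also have "\<dots> \<le> (\<integral>\<^sup>+i. ennreal p * emeasure lborel ((\<lambda>(u, v). {u<..v}) i) \<partial>count_space C)"
    proof (rule nn_integral_mono)
      fix i assume "i \<in> space (count_space C)"
      then obtain u v where i: "i = (u, v)" "u < v" "f v - f u \<le> p * (v - u)" using C(2) by (auto simp: K_def)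
      then show "emeasure \<nu>f ((\<lambda>(u, v). {u<..v}) i) \<le> ennreal p * emeasure lborel ((\<lambda>(u, v). {u<..v}) i)"
        using p by (simp add: emeasure_f ennreal_mult[symmetric] ennreal_leI)
    qed
    also have "\<dots> = ennreal p * (\<integral>\<^sup>+i. emeasure lborel ((\<lambda>(u, v). {u<..v}) i) \<partial>count_space C)"
      by (rule nn_integral_cmult) simp
    also have "(\<integral>\<^sup>+i. emeasure lborel ((\<lambda>(u, v). {u<..v}) i) \<partial>count_space C) = emeasure lborel (\<Union>(u, v)\<in>C. {u<..v})"
      using C(1) dj by (intro emeasure_UN_countable[symmetric]) auto
    also have "ennreal p * \<dots> \<le> ennreal p * emeasure lborel U"
      using C(2) U(1) by (intro mult_left_mono emeasure_mono) (fastforce simp: K_def, auto)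
    finally show "emeasure \<nu>f W \<le> ennreal p * emeasure lborel U" .
  qed
qed

text \<open>The other half, with intervals of slope at least \<open>q\<close> inside
  \<open>W\<close>. The outer measure appears because \<open>S\<close> is not known to be
  measurable. Half-open intervals are counted, since \<open>{u<..v}\<close> has Stieltjes mass
  exactly \<open>f v - f u\<close>.\<close>

lemma slope_large:
  assumes W: "open W" "S \<subseteq> W" and q: "0 < q"
    and cov: "\<And>x \<delta>. x \<in> S \<Longrightarrow> 0 < \<delta> \<Longrightarrow> \<exists>u v. u \<le> x \<and> x \<le> v \<and> u < v \<and> v - u < \<delta> \<and> q * (v - u) \<le> f v - f u"
  shows "ennreal q * outer_measure_of lebesgue S \<le> emeasure \<nu>f W"
proof -
  define K where "K = {(u, v). u < v \<and> {u..v} \<subseteq> W \<and> q * (v - u) \<le> f v - f u}"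
  have "\<exists>u v. (u, v) \<in> K \<and> u \<le> x \<and> x \<le> v \<and> v - u < \<delta>" if x: "x \<in> S" and \<delta>: "0 < \<delta>" for x \<delta>
  proof -
    obtain e where e: "e > 0" "ball x e \<subseteq> W" using W x by (meson openE subsetD)
    obtain u v where uv: "u \<le> x" "x \<le> v" "u < v" "v - u < min \<delta> e" "q * (v - u) \<le> f v - f u"
      using cov[OF x, of "min \<delta> e"] \<delta> e by auto
    then have "{u..v} \<subseteq> ball x e" by (auto simp: dist_real_def)
    then show ?thesis using uv e by (intro exI[of _ u] exI[of _ v]) (auto simp: K_def)
  qed
  then obtain C where C: "countable C" "C \<subseteq> K" "disjoint_family_on (\<lambda>(u, v). {u..v}) C" "negligible (S - (\<Union>(u, v)\<in>C. {u..v}))"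
    using Vitali_intervals[of K S] unfolding K_def by (smt (verit) case_prodD mem_Collect_eq)
  have dj: "disjoint_family_on (\<lambda>(u, v). {u<..v}) C"
    using C(3) by (fastforce simp: disjoint_family_on_def)
  define N where "N = S - (\<Union>(u, v)\<in>C. {u..v})"
  have N: "N \<in> null_sets lebesgue" using C(4) by (simp add: N_def negligible_iff_null_sets)
  have Cm: "(\<Union>(u, v)\<in>C. {u..v}) \<in> sets lborel" using C(1) by (auto intro!: sets.countable_UN')
  have "outer_measure_of lebesgue S \<le> emeasure lebesgue ((\<Union>(u, v)\<in>C. {u..v}) \<union> N)"
  proof -
    have "(\<Union>(u, v)\<in>C. {u..v}) \<union> N \<in> sets lebesgue" using Cm N by (intro sets.Un) auto
    moreover have "S \<subseteq> (\<Union>(u, v)\<in>C. {u..v}) \<union> N" by (auto simp: N_def)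
    ultimately show ?thesis unfolding outer_measure_of_def by (intro INF_lower) auto
  qed
  also have "\<dots> = emeasure lebesgue (\<Union>(u, v)\<in>C. {u..v})"
    using Cm N by (intro emeasure_Un_null_set) auto
  also have "\<dots> = emeasure lborel (\<Union>(u, v)\<in>C. {u..v})" using Cm by (simp add: emeasure_completion)
  also have "\<dots> = (\<integral>\<^sup>+i. emeasure lborel ((\<lambda>(u, v). {u..v}) i) \<partial>count_space C)"
    using C(1,3) by (intro emeasure_UN_countable) auto
  finally have "ennreal q * outer_measure_of lebesgue S \<le> ennreal q * (\<integral>\<^sup>+i. emeasure lborel ((\<lambda>(u, v). {u..v}) i) \<partial>count_space C)"
    by (rule mult_left_mono) simp
  also have "\<dots> = (\<integral>\<^sup>+i. ennreal q * emeasure lborel ((\<lambda>(u, v). {u..v}) i) \<partial>count_space C)"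
    by (rule nn_integral_cmult[symmetric]) simp
  also have "\<dots> \<le> (\<integral>\<^sup>+i. emeasure \<nu>f ((\<lambda>(u, v). {u<..v}) i) \<partial>count_space C)"
  proof (rule nn_integral_mono)
    fix i assume "i \<in> space (count_space C)"
    then obtain u v where i: "i = (u, v)" "u < v" "q * (v - u) \<le> f v - f u" using C(2) by (auto simp: K_def)
    then show "ennreal q * emeasure lborel ((\<lambda>(u, v). {u..v}) i) \<le> emeasure \<nu>f ((\<lambda>(u, v). {u<..v}) i)"
      using q by (simp add: emeasure_f ennreal_mult[symmetric] ennreal_leI)
  qed
  also have "\<dots> = emeasure \<nu>f (\<Union>(u, v)\<in>C. {u<..v})"
    using C(1) dj by (intro emeasure_UN_countable[symmetric]) auto
  also have "\<dots> \<le> emeasure \<nu>f W"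
    using C(2) W(1) by (intro emeasure_mono) (fastforce simp: K_def, auto)
  finally show ?thesis .
qed

text \<open>These properties make the upper derivative at \<open>x\<close> at least
  \<open>q\<close>, respectively the lower one at most \<open>p\<close>, where \<open>x\<close> may
  be an endpoint of the intervals.\<close>

definition "slopes_above q x \<longleftrightarrow> (\<forall>\<delta>>0. \<exists>u v. u \<le> x \<and> x \<le> v \<and> u < v \<and> v - u < \<delta> \<and> q * (v - u) \<le> f v - f u)"
definition "slopes_below p x \<longleftrightarrow> (\<forall>\<delta>>0. \<exists>u v. u \<le> x \<and> x \<le> v \<and> u < v \<and> v - u < \<delta> \<and> f v - f u \<le> p * (v - u))"

lemma outer_null: "outer_measure_of lebesgue S = 0 \<Longrightarrow> negligible (S :: real set)"
proof -
  assume 0: "outer_measure_of lebesgue S = 0"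
  obtain E where "E \<in> sets lebesgue" "S \<subseteq> E" "outer_measure_of lebesgue S = emeasure lebesgue E"
    using outer_measure_of_attain[of S lebesgue] by auto
  then show ?thesis using 0 by (metis negligible_iff_null_sets negligible_subset null_setsI)
qed

text \<open>The two covering estimates give \<open>q * c \<le> p * b\<close> for the outer measure
  \<open>c\<close> of the set and the measure \<open>b\<close> of any open set around it. Letting
  \<open>b\<close> tend to \<open>c\<close> yields \<open>q * c \<le> p * c\<close>, and
  \<open>c\<close> is finite, so \<open>c = 0\<close>.\<close>

lemma negligible_two_slopes:
  assumes pq: "p < q"
  shows "negligible {x \<in> {-real n<..<real n}. slopes_above q x \<and> slopes_below p x}" (is "negligible ?E")
proof (cases "0 \<le> p")
  case False
  have "\<not> slopes_below p x" for x
  proof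
    assume "slopes_below p x"
    then obtain u v where "u < v" "f v - f u \<le> p * (v - u)" unfolding slopes_below_def by (meson zero_less_one)
    moreover have "p * (v - u) < 0" using \<open>u < v\<close> False by (simp add: mult_neg_pos)
    ultimately show False using mono_f[of u v] by simp
  qed
  then show ?thesis by simp
next
  case p: True
  let ?c = "outer_measure_of lebesgue ?E"
  have cU: "ennreal q * ?c \<le> ennreal p * emeasure lebesgue B" if B: "B \<in> sets lebesgue" "?E \<subseteq> B" "open B" for B
  proof -
    obtain W where W: "open W" "W \<subseteq> B" "negligible (?E - W)" "emeasure \<nu>f W \<le> ennreal p * emeasure lborel B"
      using slope_small[OF B(3,2) p] unfolding slopes_below_def by blast
    have "?c = outer_measure_of lebesgue (?E \<inter> W)"
    proof (rule antisym)
      obtain D where D: "D \<in> sets lebesgue" "?E \<inter> W \<subseteq> D" "outer_measure_of lebesgue (?E \<inter> W) = emeasure lebesgue D"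
        using outer_measure_of_attain[of "?E \<inter> W" lebesgue] by auto
      have N: "?E - W \<in> null_sets lebesgue" using W(3) by (simp add: negligible_iff_null_sets)
      have "?c \<le> emeasure lebesgue (D \<union> (?E - W))"
        unfolding outer_measure_of_def using D N by (intro INF_lower) (auto intro!: sets.Un)
      also have "\<dots> = emeasure lebesgue D" using D N by (intro emeasure_Un_null_set) auto
      finally show "?c \<le> outer_measure_of lebesgue (?E \<inter> W)" using D by simp
    qed (auto intro: outer_measure_of_mono)
    then have "ennreal q * ?c = ennreal q * outer_measure_of lebesgue (?E \<inter> W)" by simp
    also have "\<dots> \<le> emeasure \<nu>f W"
      using pq p by (intro slope_large W(1)) (auto simp: slopes_above_def)
    also note W(4)
    finally show ?thesis using B by (simp add: emeasure_completion)
  qed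
  have fin: "?c < top"
  proof -
    have "?c \<le> emeasure lebesgue {- real n<..<real n}"
      unfolding outer_measure_of_def by (intro INF_lower) auto
    also have "\<dots> < top" by simp
    finally show ?thesis .
  qed
  obtain D where D: "D \<in> sets lebesgue" "?E \<subseteq> D" "?c = emeasure lebesgue D"
    using outer_measure_of_attain[of ?E lebesgue] by auto
  obtain c where c: "?c = ennreal c" "c \<ge> 0" using fin by (cases ?c) auto
  have "q * c \<le> p * (c + e)" if e: "e > 0" for e
  proof -
    obtain T where T: "open T" "D \<subseteq> T" "T - D \<in> lmeasurable" "emeasure lebesgue (T - D) < ennreal e"
      by (rule sets_lebesgue_outer_open[OF D(1) e])
    have "ennreal q * ennreal c \<le> ennreal p * emeasure lebesgue T"
      using cU[of T] T D c by auto
    also have "emeasure lebesgue T = emeasure lebesgue D + emeasure lebesgue (T - D)"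
      using T D by (subst plus_emeasure) (auto simp: Un_absorb1 fmeasurable_def)
    also have "ennreal p * \<dots> \<le> ennreal p * (ennreal c + ennreal e)"
      using T(4) D c by (intro mult_left_mono add_mono) auto
    finally have "ennreal (q * c) \<le> ennreal (p * (c + e))"
      using p c e pq by (simp add: ennreal_mult[symmetric] ennreal_plus[symmetric] del: ennreal_plus)
    then show ?thesis using p c e by (simp add: ennreal_le_iff)
  qed
  note le = this
  have "q * c \<le> p * c + e" if "e > 0" for e
  proof (cases "p = 0")
    case False
    then have "p > 0" using p by simp
    then show ?thesis using le[of "e / p"] that by (simp add: distrib_left)
  next
    case True
    then show ?thesis using le[of 1] that by simp
  qed
  then have "q * c \<le> p * c" by (rule field_le_epsilon)
  then have "c = 0" using pq c(2) by (auto simp: mult_le_cancel_right)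
  then show ?thesis using c by (intro outer_null) simp
qed

text \<open>The Stieltjes mass of a bounded interval is finite and yet at least \<open>q\<close>
  times the outer measure, for every \<open>q\<close>.\<close>

lemma negligible_infinite_slope:
  "negligible {x \<in> {-real n<..<real n}. \<forall>q. slopes_above q x}" (is "negligible ?E")
proof -
  let ?c = "outer_measure_of lebesgue ?E"
  have nu: "emeasure \<nu>f {-real n<..<real n} \<le> ennreal (f (real n) - f (- real n))"
  proof -
    have "emeasure \<nu>f {-real n<..<real n} \<le> emeasure \<nu>f {-real n<..real n}" by (intro emeasure_mono) auto
    then show ?thesis by (simp add: emeasure_f)
  qed
  have le: "ennreal q * ?c \<le> ennreal (f (real n) - f (- real n))" if "q > 0" for q
    by (rule order_trans[OF slope_large nu]) (use that in \<open>auto simp: slopes_above_def\<close>)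
  have "c = 0" if le: "\<And>q. q > 0 \<Longrightarrow> ennreal q * c \<le> ennreal D" and D: "D \<ge> 0" for c D
  proof (cases c)
    case (real r)
    show ?thesis
    proof (rule ccontr)
      assume "c \<noteq> 0"
      then have r: "r > 0" using real by (auto simp: less_le)
      have "ennreal ((D + 1) / r) * ennreal r \<le> ennreal D" using le[of "(D + 1) / r"] r D real by simp
      then have "ennreal (D + 1) \<le> ennreal D" using r D by (simp add: ennreal_mult[symmetric] del: ennreal_plus)
      then show False using D by (simp add: ennreal_le_iff del: ennreal_plus)
    qed
  next
    case top
    then show ?thesis using le[of 1] by (simp add: top_unique)
  qed
  from this[OF le] have "?c = 0" using mono_f[of "- real n" "real n"] by simp
  then show ?thesis by (rule outer_null)
qed

text \<open>The derivative is the infimum \<open>l\<close> of the \<open>q\<close> for which slopes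
  of at least \<open>q\<close> do not recur on short intervals. Recurring slopes strictly below
  \<open>l\<close> would contradict the second assumption, with two rationals chosen under
  \<open>l\<close>.\<close>

lemma differentiable_of_slopes:
  assumes fin: "\<not> (\<forall>q. slopes_above q x)" and two: "\<And>p q. p \<in> \<rat> \<Longrightarrow> q \<in> \<rat> \<Longrightarrow> p < q \<Longrightarrow> \<not> (slopes_above q x \<and> slopes_below p x)"
  shows "\<exists>l. (f has_real_derivative l) (at x)"
proof -
  define Q where "Q = {q. \<not> slopes_above q x}"
  have Qne: "Q \<noteq> {}" using fin by (auto simp: Q_def)
  have Qpos: "0 \<le> q" if "q \<in> Q" for q
  proof (rule ccontr)
    assume "\<not> 0 \<le> q"
    have "slopes_above q x" unfolding slopes_above_def
    proof (intro allI impI)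
      fix \<delta> :: real assume "\<delta> > 0"
      moreover have "q * (\<delta> / 2) \<le> f (x + \<delta> / 2) - f x"
        using mono_f[of x "x + \<delta> / 2"] \<open>\<delta> > 0\<close> \<open>\<not> 0 \<le> q\<close> by (smt (verit) half_gt_zero mult_neg_pos)
      ultimately show "\<exists>u v. u \<le> x \<and> x \<le> v \<and> u < v \<and> v - u < \<delta> \<and> q * (v - u) \<le> f v - f u"
        by (intro exI[of _ x] exI[of _ "x + \<delta> / 2"]) auto
    qed
    then show False using that by (simp add: Q_def)
  qed
  define l where "l = Inf Q"
  have up: "\<exists>\<delta>>0. \<forall>u v. u \<le> x \<and> x \<le> v \<and> u < v \<and> v - u < \<delta> \<longrightarrow> f v - f u \<le> (l + e) * (v - u)" if e: "e > 0" for e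
  proof -
    obtain q where q: "q \<in> Q" "q < l + e"
      using cInf_lessD[OF Qne, of "l + e"] e by (auto simp: l_def)
    then obtain \<delta> where \<delta>: "\<delta> > 0" "\<And>u v. u \<le> x \<and> x \<le> v \<and> u < v \<and> v - u < \<delta> \<Longrightarrow> f v - f u < q * (v - u)"
      by (auto simp: Q_def slopes_above_def not_le) (metis not_le)
    have "f v - f u \<le> (l + e) * (v - u)" if "u \<le> x \<and> x \<le> v \<and> u < v \<and> v - u < \<delta>" for u v
      using \<delta>(2)[OF that] mult_right_mono[of q "l + e" "v - u"] q that by linarith
    then show ?thesis using \<delta>(1) by blast
  qed
  have low: "\<exists>\<delta>>0. \<forall>u v. u \<le> x \<and> x \<le> v \<and> u < v \<and> v - u < \<delta> \<longrightarrow> (l - e) * (v - u) \<le> f v - f u" if e: "e > 0" for e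
  proof -
    obtain p where p: "p \<in> \<rat>" "l - e < p" "p < l" using Rats_dense_in_real[of "l - e" l] e by auto
    obtain q where q: "q \<in> \<rat>" "p < q" "q < l" using Rats_dense_in_real[of p l] p by auto
    have "bdd_below Q" using Qpos by (rule bdd_belowI)
    then have "q \<notin> Q" using q(3) cInf_lower[of q Q] by (auto simp: l_def)
    then have "\<not> slopes_below p x" using two[OF p(1) q(1,2)] by (simp add: Q_def)
    then obtain \<delta> where \<delta>: "\<delta> > 0" "\<And>u v. u \<le> x \<and> x \<le> v \<and> u < v \<and> v - u < \<delta> \<Longrightarrow> p * (v - u) < f v - f u"
      by (auto simp: slopes_below_def not_le) (metis not_le)
    have "(l - e) * (v - u) \<le> f v - f u" if "u \<le> x \<and> x \<le> v \<and> u < v \<and> v - u < \<delta>" for u v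
      using \<delta>(2)[OF that] mult_right_mono[of "l - e" p "v - u"] p that by linarith
    then show ?thesis using \<delta>(1) by blast
  qed
  have "(f has_real_derivative l) (at x)"
    unfolding DERIV_def
  proof (rule LIM_I)
    fix e :: real assume "e > 0"
    then have e: "e / 2 > 0" by simp
    obtain \<delta>1 where \<delta>1: "\<delta>1 > 0" "\<And>u v. u \<le> x \<and> x \<le> v \<and> u < v \<and> v - u < \<delta>1 \<Longrightarrow> f v - f u \<le> (l + e / 2) * (v - u)"
      using up[OF e] by blast
    obtain \<delta>2 where \<delta>2: "\<delta>2 > 0" "\<And>u v. u \<le> x \<and> x \<le> v \<and> u < v \<and> v - u < \<delta>2 \<Longrightarrow> (l - e / 2) * (v - u) \<le> f v - f u"
      using low[OF e] by blast
    show "\<exists>s>0. \<forall>h. h \<noteq> 0 \<and> norm (h - 0) < s \<longrightarrow> norm ((f (x + h) - f x) / h - l) < e"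
    proof (intro exI[of _ "min \<delta>1 \<delta>2"] conjI allI impI)
      fix h :: real assume h: "h \<noteq> 0 \<and> norm (h - 0) < min \<delta>1 \<delta>2"
      have "(l - e / 2) \<le> (f (x + h) - f x) / h \<and> (f (x + h) - f x) / h \<le> l + e / 2"
      proof (cases "h > 0")
        case True
        then show ?thesis using \<delta>1(2)[of x "x + h"] \<delta>2(2)[of x "x + h"] h by (simp add: field_simps)
      next
        case False
        then have "h < 0" using h by simp
        then show ?thesis using \<delta>1(2)[of "x + h" x] \<delta>2(2)[of "x + h" x] h by (simp add: field_simps)
      qed
      then show "norm ((f (x + h) - f x) / h - l) < e" using \<open>e > 0\<close> by (auto simp: abs_less_iff)
    qed (use \<delta>1 \<delta>2 in auto)
  qed
  then show ?thesis ..
qed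

text \<open>The exceptional set is a countable union over bounded intervals and pairs of rationals,
  so the two preceding kinds of negligible sets exhaust it.\<close>

theorem mono_differentiable_ae: "negligible {x. \<not> (\<exists>l. (f has_real_derivative l) (at x))}"
proof -
  have "{x. \<not> (\<exists>l. (f has_real_derivative l) (at x))} \<subseteq>
      (\<Union>n. {x \<in> {-real n<..<real n}. \<forall>q. slopes_above q x})
    \<union> (\<Union>n. \<Union>p\<in>\<rat>. \<Union>q\<in>{q\<in>\<rat>. p < q}. {x \<in> {-real n<..<real n}. slopes_above q x \<and> slopes_below p x})" (is "?L \<subseteq> ?R1 \<union> ?R2")
  proof
    fix x assume x: "x \<in> ?L"
    obtain n where n: "\<bar>x\<bar> < real n" using reals_Archimedean2 by blast
    then have xn: "x \<in> {-real n<..<real n}" by auto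
    show "x \<in> ?R1 \<union> ?R2"
    proof (cases "\<forall>q. slopes_above q x")
      case True then show ?thesis using xn by blast
    next
      case False
      then obtain p q where "p \<in> \<rat>" "q \<in> \<rat>" "p < q" "slopes_above q x \<and> slopes_below p x"
        using differentiable_of_slopes[of x] x by blast
      then show ?thesis using xn by blast
    qed
  qed
  moreover have "negligible ?R1"
    using negligible_infinite_slope by (intro negligible_countable_Union) blast+
  moreover have "negligible ?R2"
  proof (intro negligible_countable_Union)
    show "negligible X" if X: "X \<in> range (\<lambda>n. \<Union>p\<in>\<rat>. \<Union>q\<in>{q\<in>\<rat>. p < q}. {x \<in> {-real n<..<real n}. slopes_above q x \<and> slopes_below p x})" for X
    proof -
      obtain n where n: "X = (\<Union>p\<in>\<rat>. \<Union>q\<in>{q\<in>\<rat>. p < q}. {x \<in> {-real n<..<real n}. slopes_above q x \<and> slopes_below p x})"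
        using X by blast
      have "negligible (\<Union>q\<in>{q\<in>\<rat>. p < q}. {x \<in> {-real n<..<real n}. slopes_above q x \<and> slopes_below p x})" for p
        using negligible_two_slopes by (intro negligible_countable_Union countable_image countable_Collect countable_rat) blast+
      then show ?thesis unfolding n by (intro negligible_countable_Union countable_image countable_rat) blast+
    qed
  qed auto
  ultimately show ?thesis by (meson negligible_Un negligible_subset)
qed

end

section \<open>Arclength parametrizations of convex curves\<close>

text \<open>Strict one-sided differentiability: all chords over short intervals to the right of \<open>t\<close> are taken into account, not only
  those starting at \<open>t\<close>. Unlike plain one-sided differentiability it is inherited by the length function.\<close>

definition chords :: "real \<Rightarrow> (real \<times> real) filter" where
  "chords t = (INF \<delta>\<in>{0<..}. principal {(a, b). t \<le> a \<and> a < b \<and> b < t + \<delta>})"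

lemma eventually_chords: "eventually P (chords t) \<longleftrightarrow> (\<exists>\<delta>>0. \<forall>a b. t \<le> a \<longrightarrow> a < b \<longrightarrow> b < t + \<delta> \<longrightarrow> P (a, b))"
  unfolding chords_def
proof (subst eventually_INF_base)
  fix a b :: real assume "a \<in> {0<..}" "b \<in> {0<..}"
  then show "\<exists>x\<in>{0<..}. principal {(c, d). t \<le> c \<and> c < d \<and> d < t + x}
     \<le> inf (principal {(c, d). t \<le> c \<and> c < d \<and> d < t + a}) (principal {(c, d). t \<le> c \<and> c < d \<and> d < t + b})"
    by (intro bexI[of _ "min a b"]) auto
qed (auto simp: eventually_principal Bex_def)

lemma eventually_chordsI: "0 < \<delta> \<Longrightarrow> (\<And>a b. t \<le> a \<Longrightarrow> a < b \<Longrightarrow> b < t + \<delta> \<Longrightarrow> P (a, b)) \<Longrightarrow> eventually P (chords t)"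
  unfolding eventually_chords by blast

lemma chords_cont:
  fixes g :: "real \<Rightarrow> 'a::metric_space"
  assumes "continuous (at_right t) g"
  shows "((\<lambda>p. g (fst p)) \<longlongrightarrow> g t) (chords t)" "((\<lambda>p. g (snd p)) \<longlongrightarrow> g t) (chords t)"
proof -
  have "\<exists>\<delta>>0. \<forall>a. t \<le> a \<longrightarrow> a < t + \<delta> \<longrightarrow> dist (g a) (g t) < e" if "e > 0" for e
  proof -
    have "\<forall>\<^sub>F x in at_right t. dist (g x) (g t) < e" using assms that by (simp add: continuous_within tendsto_iff)
    then obtain b where b: "b > t" "\<And>y. t < y \<Longrightarrow> y < b \<Longrightarrow> dist (g y) (g t) < e"
      unfolding eventually_at_right_field by blast
    have "dist (g a) (g t) < e" if "t \<le> a" "a < t + (b - t)" for a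
      using that b(2)[of a] \<open>e > 0\<close> by (cases "a = t") auto
    then show ?thesis using b(1) by (intro exI[of _ "b - t"]) auto
  qed
  note * = this
  show "((\<lambda>p. g (fst p)) \<longlongrightarrow> g t) (chords t)" unfolding tendsto_iff eventually_chords
    using * by (metis (no_types, lifting) dual_order.strict_trans fst_conv)
  show "((\<lambda>p. g (snd p)) \<longlongrightarrow> g t) (chords t)" unfolding tendsto_iff eventually_chords
    using * by (metis (no_types, lifting) dual_order.trans less_imp_le snd_conv)
qed

definition quot :: "(real \<Rightarrow> 'a::real_normed_vector) \<Rightarrow> real \<times> real \<Rightarrow> 'a" where
  "quot g p = (1 / (snd p - fst p)) *\<^sub>R (g (snd p) - g (fst p))"

definition srd :: "(real \<Rightarrow> 'a::real_normed_vector) \<Rightarrow> real \<Rightarrow> 'a \<Rightarrow> bool" where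
  "srd g t D \<longleftrightarrow> (quot g \<longlongrightarrow> D) (chords t)"

lemma srd_iff:
  "srd g t D \<longleftrightarrow> (\<forall>e>0. \<exists>\<delta>>0. \<forall>a b. t \<le> a \<longrightarrow> a < b \<longrightarrow> b < t + \<delta> \<longrightarrow> norm (g b - g a - (b - a) *\<^sub>R D) \<le> e * (b - a))"
proof -
  have eq: "norm (quot g (a, b) - D) = norm (g b - g a - (b - a) *\<^sub>R D) / (b - a)" if "a < b" for a b
  proof -
    have "quot g (a, b) - D = (1 / (b - a)) *\<^sub>R (g b - g a - (b - a) *\<^sub>R D)"
      using that by (simp add: quot_def scaleR_diff_right)
    then show ?thesis using that by simp
  qed
  have le: "norm (quot g (a, b) - D) \<le> e \<longleftrightarrow> norm (g b - g a - (b - a) *\<^sub>R D) \<le> e * (b - a)" if "a < b" for a b e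
    unfolding eq[OF that] using that by (simp add: divide_le_eq)
  show ?thesis
    unfolding srd_def tendsto_iff eventually_chords dist_norm
  proof (intro iffI allI impI)
    fix e :: real assume "e > 0" and "\<forall>e>0. \<exists>\<delta>>0. \<forall>a b. t \<le> a \<longrightarrow> a < b \<longrightarrow> b < t + \<delta> \<longrightarrow> norm (quot g (a, b) - D) < e"
    then show "\<exists>\<delta>>0. \<forall>a b. t \<le> a \<longrightarrow> a < b \<longrightarrow> b < t + \<delta> \<longrightarrow> norm (g b - g a - (b - a) *\<^sub>R D) \<le> e * (b - a)"
      using le by (meson less_imp_le)
  next
    fix e :: real assume e: "e > 0" and "\<forall>e>0. \<exists>\<delta>>0. \<forall>a b. t \<le> a \<longrightarrow> a < b \<longrightarrow> b < t + \<delta> \<longrightarrow> norm (g b - g a - (b - a) *\<^sub>R D) \<le> e * (b - a)"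
    then obtain \<delta> where "\<delta> > 0" "\<And>a b. t \<le> a \<Longrightarrow> a < b \<Longrightarrow> b < t + \<delta> \<Longrightarrow> norm (g b - g a - (b - a) *\<^sub>R D) \<le> e / 2 * (b - a)"
      by (meson half_gt_zero)
    then show "\<exists>\<delta>>0. \<forall>a b. t \<le> a \<longrightarrow> a < b \<longrightarrow> b < t + \<delta> \<longrightarrow> norm (quot g (a, b) - D) < e"
      using le[of _ _ "e / 2"] e by (intro exI[of _ \<delta>]) (force intro: le_less_trans[of _ "e / 2"])
  qed
qed

lemma srd_at_right: assumes "srd g t D" shows "(g has_vector_derivative D) (at_right t)"
  unfolding has_vector_derivative_def has_derivative_within_alt
proof (intro conjI allI impI)
  fix e :: real assume "e > 0"
  then obtain \<delta> where \<delta>: "\<delta> > 0" "\<And>a b. t \<le> a \<Longrightarrow> a < b \<Longrightarrow> b < t + \<delta> \<Longrightarrow> norm (g b - g a - (b - a) *\<^sub>R D) \<le> e * (b - a)"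
    using assms unfolding srd_iff by blast
  then show "\<exists>d>0. \<forall>y\<in>{t<..}. norm (y - t) < d \<longrightarrow> norm (g y - g t - (y - t) *\<^sub>R D) \<le> e * norm (y - t)"
    by (intro exI[of _ \<delta>]) auto
qed (rule bounded_linear_scaleR_left)

lemma srd_cong:
  assumes "srd g t D" "\<epsilon> > 0" "\<And>s. t \<le> s \<Longrightarrow> s < t + \<epsilon> \<Longrightarrow> g s = h s" shows "srd h t D"
proof -
  have "eventually (\<lambda>p. quot g p = quot h p) (chords t)"
    using assms(2) by (rule eventually_chordsI) (simp add: quot_def assms(3))
  then show ?thesis using assms(1) unfolding srd_def by (rule Lim_transform_eventually[rotated])
qed

lemma srd_shift: assumes "srd g t D" shows "srd (\<lambda>s. g (s + c)) (t - c) D"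
  unfolding srd_iff
proof (intro allI impI)
  fix e :: real assume "e > 0"
  then obtain \<delta> where \<delta>: "\<delta> > 0" "\<And>a b. t \<le> a \<Longrightarrow> a < b \<Longrightarrow> b < t + \<delta> \<Longrightarrow> norm (g b - g a - (b - a) *\<^sub>R D) \<le> e * (b - a)"
    using assms unfolding srd_iff by blast
  have "norm (g (b + c) - g (a + c) - (b - a) *\<^sub>R D) \<le> e * (b - a)" if "t - c \<le> a" "a < b" "b < t - c + \<delta>" for a b
    using \<delta>(2)[of "a + c" "b + c"] that by simp
  then show "\<exists>\<delta>>0. \<forall>a b. t - c \<le> a \<longrightarrow> a < b \<longrightarrow> b < t - c + \<delta> \<longrightarrow> norm (g (b + c) - g (a + c) - (b - a) *\<^sub>R D) \<le> e * (b - a)"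
    using \<delta>(1) by blast
qed

text \<open>An increasing inner function carries chords to chords, and the quotients multiply;
  strictness keeps the denominators nonzero.\<close>

lemma srd_compose:
  assumes g: "srd g (\<phi> t) D" and \<phi>: "srd \<phi> t d" and c: "continuous (at_right t) \<phi>"
    and \<epsilon>: "\<epsilon> > 0" and mono: "\<And>a b. t \<le> a \<Longrightarrow> a < b \<Longrightarrow> b < t + \<epsilon> \<Longrightarrow> \<phi> a < \<phi> b"
  shows "srd (\<lambda>s. g (\<phi> s)) t (d *\<^sub>R D)"
proof -
  have lim: "filterlim (\<lambda>p. (\<phi> (fst p), \<phi> (snd p))) (chords (\<phi> t)) (chords t)"
    unfolding filterlim_iff
  proof (intro allI impI)
    fix P :: "real \<times> real \<Rightarrow> bool" assume "eventually P (chords (\<phi> t))"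
    then obtain \<delta> where \<delta>: "\<delta> > 0" "\<And>a b. \<phi> t \<le> a \<Longrightarrow> a < b \<Longrightarrow> b < \<phi> t + \<delta> \<Longrightarrow> P (a, b)"
      unfolding eventually_chords by blast
    have "eventually (\<lambda>p. dist (\<phi> (snd p)) (\<phi> t) < \<delta>) (chords t)" using chords_cont(2)[OF c] \<delta>(1) by (simp add: tendsto_iff)
    moreover have "eventually (\<lambda>p. \<phi> t \<le> \<phi> (fst p) \<and> \<phi> (fst p) < \<phi> (snd p)) (chords t)"
    proof (rule eventually_chordsI[OF \<epsilon>])
      fix a b assume ab: "t \<le> a" "a < b" "b < t + \<epsilon>"
      then show "\<phi> t \<le> \<phi> (fst (a, b)) \<and> \<phi> (fst (a, b)) < \<phi> (snd (a, b))"
        using mono[of t a] mono[of a b] by (cases "a = t") auto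
    qed
    ultimately show "eventually (\<lambda>p. P (\<phi> (fst p), \<phi> (snd p))) (chords t)"
      by eventually_elim (intro \<delta>(2), auto simp: dist_real_def)
  qed
  have "((\<lambda>p. quot \<phi> p *\<^sub>R quot g (\<phi> (fst p), \<phi> (snd p))) \<longlongrightarrow> d *\<^sub>R D) (chords t)"
    using \<phi> filterlim_compose[OF g[unfolded srd_def] lim] unfolding srd_def by (intro tendsto_scaleR)
  moreover have "eventually (\<lambda>p. quot \<phi> p *\<^sub>R quot g (\<phi> (fst p), \<phi> (snd p)) = quot (\<lambda>s. g (\<phi> s)) p) (chords t)"
  proof (rule eventually_chordsI[OF \<epsilon>])
    fix a b assume ab: "t \<le> a" "a < b" "b < t + \<epsilon>"
    then have "\<phi> b - \<phi> a \<noteq> 0" using mono[of a b] by simp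
    then show "quot \<phi> (a, b) *\<^sub>R quot g (\<phi> (fst (a, b)), \<phi> (snd (a, b))) = quot (\<lambda>s. g (\<phi> s)) (a, b)"
      by (simp add: quot_def)
  qed
  ultimately show ?thesis unfolding srd_def by (rule Lim_transform_eventually)
qed

lemma srd_scaleR:
  fixes k :: "real \<Rightarrow> real"
  assumes k: "srd k t k'" and g: "srd g t D" and ck: "continuous (at_right t) k" and cg: "continuous (at_right t) g"
  shows "srd (\<lambda>s. k s *\<^sub>R g s) t (k' *\<^sub>R g t + k t *\<^sub>R D)"
proof -
  have "((\<lambda>p. quot k p *\<^sub>R g (snd p) + k (fst p) *\<^sub>R quot g p) \<longlongrightarrow> k' *\<^sub>R g t + k t *\<^sub>R D) (chords t)"
    using k g chords_cont[OF ck] chords_cont[OF cg] unfolding srd_def by (intro tendsto_add tendsto_scaleR)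
  moreover have "(\<lambda>p. quot k p *\<^sub>R g (snd p) + k (fst p) *\<^sub>R quot g p) = quot (\<lambda>s. k s *\<^sub>R g s)"
    by (rule ext) (simp add: quot_def algebra_simps diff_divide_distrib)
  ultimately show ?thesis unfolding srd_def by simp
qed

lemma srd_inverse:
  fixes k :: "real \<Rightarrow> real"
  assumes k: "srd k t k'" and ck: "continuous (at_right t) k" and pos: "\<And>s. 0 < k s"
  shows "srd (\<lambda>s. 1 / k s) t (- k' / (k t)\<^sup>2)"
proof -
  have "((\<lambda>p. - quot k p / (k (fst p) * k (snd p))) \<longlongrightarrow> - k' / (k t * k t)) (chords t)"
    using k chords_cont[OF ck] pos[of t] unfolding srd_def by (intro tendsto_divide tendsto_minus tendsto_mult) auto
  moreover have "(\<lambda>p. - quot k p / (k (fst p) * k (snd p))) = quot (\<lambda>s. 1 / k s)"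
  proof
    fix p show "- quot k p / (k (fst p) * k (snd p)) = quot (\<lambda>s. 1 / k s) p"
      using pos[of "fst p"] pos[of "snd p"] by (simp add: quot_def divide_simps)
  qed
  ultimately show ?thesis unfolding srd_def by (simp add: power2_eq_square)
qed

lemma srd_C1:
  fixes k :: "real \<Rightarrow> real"
  assumes \<epsilon>: "\<epsilon> > 0" and der: "\<And>s. t \<le> s \<Longrightarrow> s < t + \<epsilon> \<Longrightarrow> (k has_real_derivative k' s) (at s)" and c: "continuous (at_right t) k'"
  shows "srd k t (k' t)"
  unfolding srd_def tendsto_iff
proof (intro allI impI)
  fix e :: real assume "e > 0"
  have "\<forall>\<^sub>F s in at_right t. dist (k' s) (k' t) < e" using c \<open>e > 0\<close> by (simp add: continuous_within tendsto_iff)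
  then obtain b0 where b0: "b0 > t" "\<And>y. t < y \<Longrightarrow> y < b0 \<Longrightarrow> dist (k' y) (k' t) < e"
    unfolding eventually_at_right_field by blast
  show "\<forall>\<^sub>F p in chords t. dist (quot k p) (k' t) < e"
  proof (rule eventually_chordsI[of "min \<epsilon> (b0 - t)"])
    fix a b assume ab: "t \<le> a" "a < b" "b < t + min \<epsilon> (b0 - t)"
    obtain s where s: "a < s" "s < b" "k b - k a = (b - a) * k' s"
      using MVT2[of a b k k'] der ab by auto
    have "quot k (a, b) = k' s" using ab s by (simp add: quot_def)
    then show "dist (quot k (a, b)) (k' t) < e" using b0(2)[of s] s ab by auto
  qed (use \<epsilon> b0 in auto)
qed

lemma srd_affine: "srd (\<lambda>s. e + s *\<^sub>R f) t f"
proof -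
  have "eventually (\<lambda>p. quot (\<lambda>s. e + s *\<^sub>R f) p = f) (chords t)"
    by (rule eventually_chordsI[of 1]) (auto simp: quot_def scaleR_diff_left[symmetric])
  then show ?thesis unfolding srd_def by (rule tendsto_eventually)
qed

text \<open>Chord slopes of a convex function increase in both endpoints. To the right of 0 they are
  at least the right derivative \<open>\<sigma>\<close> and at most the slope from \<open>b\<close>
  to a fixed \<open>\<eta>\<close>, which by continuity is near the slope from 0 to
  \<open>\<eta>\<close>, itself near \<open>\<sigma>\<close>.\<close>

lemma srd_convex:
  fixes H :: "real \<Rightarrow> real"
  assumes H: "convex_on UNIV H" and c: "isCont H 0"
  obtains \<sigma> where "srd H 0 \<sigma>" "\<And>\<tau>. H 0 + \<sigma> * \<tau> \<le> H \<tau>"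
proof -
  define sl where "sl a b = (H b - H a) / (b - a)" for a b
  have sw: "sl a b = (H a - H b) / (a - b)" for a b
    unfolding sl_def by (metis minus_diff_eq minus_divide_divide)
  have sl: "sl a b \<le> sl a c" "sl a c \<le> sl b c" if "a < b" "b < c" for a b c
    unfolding sw using convex_on_slope_le[OF H UNIV_I UNIV_I that] by auto
  define A where "A = sl 0 ` {0<..}"
  have Ab: "sl (-1) 0 \<le> y" if "y \<in> A" for y
  proof -
    obtain b where b: "b > 0" "y = sl 0 b" using \<open>y \<in> A\<close> by (auto simp: A_def)
    then show ?thesis using sl(1)[of "-1" 0 b] sl(2)[of "-1" 0 b] by simp
  qed
  then have Abd: "bdd_below A" by (rule bdd_belowI)
  have Ane: "A \<noteq> {}" by (auto simp: A_def)
  define \<sigma> where "\<sigma> = Inf A"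
  have low: "\<sigma> \<le> sl 0 b" if "b > 0" for b unfolding \<sigma>_def using that Abd by (intro cInf_lower) (auto simp: A_def)
  have low2: "sl (- b) 0 \<le> \<sigma>" if b: "b > 0" for b
    unfolding \<sigma>_def
  proof (rule cInf_greatest[OF Ane])
    fix y assume "y \<in> A"
    then obtain b' where b': "b' > 0" "y = sl 0 b'" by (auto simp: A_def)
    then show "sl (- b) 0 \<le> y" using sl(1)[of "-b" 0 b'] sl(2)[of "-b" 0 b'] b by simp
  qed
  have "srd H 0 \<sigma>"
    unfolding srd_def tendsto_iff
  proof (intro allI impI)
    fix e :: real assume e: "e > 0"
    then obtain \<eta> where \<eta>: "\<eta> > 0" "sl 0 \<eta> < \<sigma> + e"
      using cInf_lessD[OF Ane, of "\<sigma> + e"] by (auto simp: \<sigma>_def A_def)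
    have "isCont (\<lambda>s. sl s \<eta>) 0" unfolding sl_def using c \<eta> by (intro continuous_intros) auto
    then have "\<forall>\<^sub>F s in at 0. sl s \<eta> < \<sigma> + e" using \<eta>(2) by (auto simp: isCont_def order_tendsto_iff)
    then obtain d where d: "d > 0" "\<And>s. s \<noteq> 0 \<Longrightarrow> \<bar>s\<bar> < d \<Longrightarrow> sl s \<eta> < \<sigma> + e"
      unfolding eventually_at by (auto simp: dist_real_def)
    show "\<forall>\<^sub>F p in chords 0. dist (quot H p) \<sigma> < e"
    proof (rule eventually_chordsI[of "min d \<eta>"])
      fix a b :: real assume ab: "0 \<le> a" "a < b" "b < 0 + min d \<eta>"
      have q: "quot H (a, b) = sl a b" by (simp add: quot_def sl_def)
      have "\<sigma> \<le> sl a b"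
        using low[of b] sl(2)[of 0 a b] ab by (cases "a = 0") auto
      moreover have "sl a b < \<sigma> + e"
        using sl(1)[of a b \<eta>] sl(2)[of a b \<eta>] d(2)[of b] ab by auto
      ultimately show "dist (quot H (a, b)) \<sigma> < e" unfolding q by (simp add: dist_real_def)
    qed (use d \<eta> in auto)
  qed
  moreover have "H 0 + \<sigma> * \<tau> \<le> H \<tau>" for \<tau>
  proof -
    consider "\<tau> > 0" | "\<tau> = 0" | "\<tau> < 0" by linarith
    then show ?thesis
    proof cases
      case 1 then show ?thesis using low[of \<tau>] by (simp add: sl_def field_simps)
    next
      case 3 then show ?thesis using low2[of "- \<tau>"] by (simp add: sl_def field_simps)
    qed simp
  qed
  ultimately show ?thesis by (rule that)
qed

section \<open>Length of curves\<close>

fun elen :: "(real \<Rightarrow> 'a::metric_space) \<Rightarrow> real list \<Rightarrow> ennreal" where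
  "elen f [] = 0" | "elen f [x] = 0" | "elen f (x # y # r) = ennreal (dist (f x) (f y)) + elen f (y # r)"

lemma elen_eq: "(\<Sum>i<length ts - 1. ennreal (dist (f (ts ! i)) (f (ts ! Suc i)))) = elen f ts"
proof (induction f ts rule: elen.induct)
  case (3 f x y r)
  have "(\<Sum>i<Suc (length r). ennreal (dist (f ((x # y # r) ! i)) (f ((x # y # r) ! Suc i))))
    = ennreal (dist (f x) (f y)) + (\<Sum>i<length r. ennreal (dist (f ((y # r) ! i)) (f ((y # r) ! Suc i))))"
    by (subst sum.lessThan_Suc_shift) simp
  then show ?case using 3 by simp
qed simp_all

lemma curve_length_elen: "curve_length f a b = (SUP ts\<in>{ts. sorted ts \<and> set ts \<subseteq> {a..b}}. elen f ts)"
  unfolding curve_length_def elen_eq ..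

lemma elen_le_curve_length: "sorted ts \<Longrightarrow> set ts \<subseteq> {a..b} \<Longrightarrow> elen f ts \<le> curve_length f a b"
  unfolding curve_length_elen by (intro SUP_upper) auto

lemma dist_le_curve_length: "a \<le> s \<Longrightarrow> s \<le> t \<Longrightarrow> t \<le> b \<Longrightarrow> ennreal (dist (f s) (f t)) \<le> curve_length f a b"
  using elen_le_curve_length[of "[s, t]" a b f] by simp

lemma elen_append_ge: "elen f ts + elen f us \<le> elen f (ts @ us)"
proof (induction f ts rule: elen.induct)
  case (2 f x) then show ?case by (cases us) auto
qed (auto simp: add.assoc add_left_mono)

text \<open>By the triangle inequality, inserting the point \<open>c\<close> does not shorten a
  chain.\<close>

lemma elen_append_le: "elen f (ts @ us) \<le> elen f (ts @ [c]) + elen f (c # us)"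
proof (induction f ts rule: elen.induct)
  case (1 f) then show ?case by (cases us) auto
next
  case (2 f x)
  show ?case
  proof (cases us)
    case (Cons y r)
    have "ennreal (dist (f x) (f y)) \<le> ennreal (dist (f x) (f c)) + ennreal (dist (f c) (f y))"
      by (subst ennreal_plus[symmetric]) (auto intro!: ennreal_leI dist_triangle simp del: ennreal_plus)
    then show ?thesis using Cons by (simp add: add.assoc[symmetric] add_right_mono)
  qed simp
qed (auto simp: add.assoc add_left_mono)

lemma elen_map: "elen f (map \<phi> ts) = elen (\<lambda>x. f (\<phi> x)) ts"
  by (induction "\<lambda>x. f (\<phi> x)" ts rule: elen.induct) auto

text \<open>A chain is split at \<open>b\<close>, with \<open>b\<close> inserted, for one
  inequality; chains on both sides of \<open>b\<close> are concatenated for the other.\<close>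

lemma curve_length_add:
  assumes "a \<le> b" "b \<le> c" shows "curve_length f a c = curve_length f a b + curve_length f b c"
proof (rule antisym)
  show "curve_length f a c \<le> curve_length f a b + curve_length f b c"
    unfolding curve_length_elen[of f a c]
  proof (rule SUP_least)
    fix ts assume "ts \<in> {ts. sorted ts \<and> set ts \<subseteq> {a..c}}"
    then have ts: "sorted ts" "set ts \<subseteq> {a..c}" by auto
    define t1 where "t1 = takeWhile (\<lambda>x. x \<le> b) ts"
    define t2 where "t2 = dropWhile (\<lambda>x. x \<le> b) ts"
    have t12: "ts = t1 @ t2" by (simp add: t1_def t2_def)
    have s: "sorted t1" "sorted t2" using ts(1) unfolding t12 by (auto simp: sorted_append)
    have t1: "set t1 \<subseteq> {a..b}" 
    proof
      fix x assume "x \<in> set t1"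
      then have "x \<in> set ts \<and> x \<le> b" unfolding t1_def by (rule set_takeWhileD)
      then show "x \<in> {a..b}" using ts(2) by auto
    qed
    have t2: "b < y" if "y \<in> set t2" for y
    proof (cases t2)
      case (Cons z r)
      then have "b < z" using hd_dropWhile[of "\<lambda>x. x \<le> b" ts] by (auto simp: t2_def)
      then show ?thesis using s(2) that Cons by auto
    qed (use that in auto)
    have t2': "set t2 \<subseteq> {b..c}"
    proof
      fix y assume y: "y \<in> set t2"
      then have "y \<in> {a..c}" using ts(2) unfolding t12 by auto
      then show "y \<in> {b..c}" using t2[OF y] by auto
    qed
    have "elen f ts \<le> elen f (t1 @ [b]) + elen f (b # t2)" unfolding t12 by (rule elen_append_le)
    also have "\<dots> \<le> curve_length f a b + curve_length f b c"
      using s t1 t2' t2 assms by (intro add_mono elen_le_curve_length) (auto simp: sorted_append intro: less_imp_le)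
    finally show "elen f ts \<le> curve_length f a b + curve_length f b c" .
  qed
  have "curve_length f a b + curve_length f b c =
     (SUP ts\<in>{ts. sorted ts \<and> set ts \<subseteq> {a..b}}. SUP us\<in>{ts. sorted ts \<and> set ts \<subseteq> {b..c}}. elen f ts + elen f us)"
  proof -
    have ne: "{ts. sorted ts \<and> set ts \<subseteq> {u..v::real}} \<noteq> {}" for u v by (auto intro: exI[of _ "[]"])
    show ?thesis unfolding curve_length_elen
      by (subst ennreal_SUP_add_left[OF ne, symmetric], subst ennreal_SUP_add_right[OF ne, symmetric]) simp
  qed
  also have "\<dots> \<le> curve_length f a c"
  proof (intro SUP_least)
    fix ts us assume "ts \<in> {ts. sorted ts \<and> set ts \<subseteq> {a..b}}" "us \<in> {ts. sorted ts \<and> set ts \<subseteq> {b..c}}"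
    then have "sorted (ts @ us)" "set (ts @ us) \<subseteq> {a..c}" using assms by (fastforce simp: sorted_append)+
    then show "elen f ts + elen f us \<le> curve_length f a c"
      by (intro order_trans[OF elen_append_ge] elen_le_curve_length)
  qed
  finally show "curve_length f a b + curve_length f b c \<le> curve_length f a c" .
qed

lemma curve_length_lipschitz:
  assumes L: "0 \<le> L" and lip: "\<And>s t. a \<le> s \<Longrightarrow> s \<le> t \<Longrightarrow> t \<le> b \<Longrightarrow> dist (f s) (f t) \<le> L * (t - s)"
  shows "curve_length f a b \<le> ennreal (L * (b - a))"
proof -
  have *: "sorted (x # ts) \<Longrightarrow> set (x # ts) \<subseteq> {a..b} \<Longrightarrow> elen f (x # ts) \<le> ennreal (L * (b - x))" for x ts
  proof (induction ts arbitrary: x)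
    case (Cons y ts)
    have xy: "a \<le> x" "x \<le> y" "y \<le> b" using Cons.prems by auto
    have "elen f (x # y # ts) \<le> ennreal (L * (y - x)) + ennreal (L * (b - y))"
      using Cons xy lip by (auto intro!: add_mono ennreal_leI)
    also have "\<dots> = ennreal (L * (b - x))"
      using xy L mult_nonneg_nonneg[OF L, of "y - x"] mult_nonneg_nonneg[OF L, of "b - y"]
      by (subst ennreal_plus[symmetric]) (auto simp: algebra_simps simp del: ennreal_plus)
    finally show ?case .
  qed simp
  show ?thesis unfolding curve_length_elen
  proof (rule SUP_least)
    fix ts assume "ts \<in> {ts. sorted ts \<and> set ts \<subseteq> {a..b}}"
    then have ts: "sorted ts" "set ts \<subseteq> {a..b}" by auto
    show "elen f ts \<le> ennreal (L * (b - a))"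
    proof (cases ts)
      case (Cons x r)
      have "elen f ts \<le> ennreal (L * (b - x))" using *[of x r] ts Cons by simp
      also have "\<dots> \<le> ennreal (L * (b - a))" using ts Cons L by (intro ennreal_leI mult_left_mono) auto
      finally show ?thesis .
    qed simp
  qed
qed

text \<open>Chains for the composition are mapped to chains for \<open>f\<close>. If
  \<open>\<phi>\<close> has a monotone inverse, applying this to the inverse as well gives
  equality.\<close>

lemma curve_length_reparam_le:
  assumes mono: "\<And>s t. a \<le> s \<Longrightarrow> s \<le> t \<Longrightarrow> t \<le> b \<Longrightarrow> \<phi> s \<le> \<phi> t"
  shows "curve_length (\<lambda>s. f (\<phi> s)) a b \<le> curve_length f (\<phi> a) (\<phi> b)"
  unfolding curve_length_elen[of "\<lambda>s. f (\<phi> s)"]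
proof (rule SUP_least)
  fix ts assume "ts \<in> {ts. sorted ts \<and> set ts \<subseteq> {a..b}}"
  then have ts: "sorted ts" "set ts \<subseteq> {a..b}" by auto
  have "sorted (map \<phi> ts)"
    unfolding sorted_map
  proof (rule sorted_wrt_mono_rel[OF _ ts(1)])
    fix x y assume "x \<in> set ts" "y \<in> set ts" "x \<le> y"
    moreover from this have "x \<in> {a..b}" "y \<in> {a..b}" using ts(2) by blast+
    ultimately show "\<phi> x \<le> \<phi> y" using mono[of x y] by auto
  qed
  moreover have "set (map \<phi> ts) \<subseteq> {\<phi> a..\<phi> b}" using ts(2) mono by auto
  ultimately show "elen (\<lambda>s. f (\<phi> s)) ts \<le> curve_length f (\<phi> a) (\<phi> b)"
    unfolding elen_map[symmetric] by (rule elen_le_curve_length)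
qed

lemma curve_length_cong:
  assumes "\<And>s. a \<le> s \<Longrightarrow> s \<le> b \<Longrightarrow> f s = g s" shows "curve_length f a b = curve_length g a b"
proof -
  have "elen f ts = elen g ts" if "set ts \<subseteq> {a..b}" for ts
    using that assms by (induction f ts rule: elen.induct) auto
  then show ?thesis unfolding curve_length_elen by (intro SUP_cong) auto
qed

lemma abs_cos_sin_diff: "\<bar>cos a - cos b\<bar> \<le> \<bar>a - b\<bar>" "\<bar>sin a - sin b\<bar> \<le> \<bar>a - (b::real)\<bar>"
proof -
  have "norm (cos a - cos b) \<le> 1 * norm (a - b)"
    by (rule field_differentiable_bound[of UNIV cos "\<lambda>x. - sin x"]) (auto intro!: derivative_eq_intros)
  then show "\<bar>cos a - cos b\<bar> \<le> \<bar>a - b\<bar>" by simp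
  have "norm (sin a - sin b) \<le> 1 * norm (a - b)"
    by (rule field_differentiable_bound[of UNIV sin cos]) (auto intro!: derivative_eq_intros)
  then show "\<bar>sin a - sin b\<bar> \<le> \<bar>a - b\<bar>" by simp
qed

section \<open>Polar parametrization of the boundary of a convex body\<close>

definition circ :: "real \<Rightarrow> real^2" where "circ \<theta> = pt (cos \<theta>) (sin \<theta>)"

lemma norm_circ [simp]: "norm (circ \<theta>) = 1"
  using norm_pt2[of "cos \<theta>" "sin \<theta>"] by (simp add: circ_def power2_eq_1_iff) (use norm_ge_zero in \<open>smt (verit)\<close>)

lemma circ_lipschitz: "norm (circ a - circ b) \<le> 2 * \<bar>a - b\<bar>"
proof -
  have "circ a - circ b = pt (cos a - cos b) 0 + pt 0 (sin a - sin b)"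
    by (simp add: circ_def vec_eq_iff forall_2)
  then have "norm (circ a - circ b) \<le> norm (pt (cos a - cos b) 0) + norm (pt 0 (sin a - sin b))"
    by (simp add: norm_triangle_ineq)
  moreover have "norm (pt x 0) = \<bar>x\<bar>" "norm (pt 0 x) = \<bar>x\<bar>" for x
    using norm_pt2[of x 0] norm_pt2[of 0 x] by (auto simp: power2_eq_iff abs_if split: if_splits) (smt (verit) norm_ge_zero)+
  ultimately show ?thesis using abs_cos_sin_diff[of a b] by simp
qed

text \<open>The inner and outer radii yield Lipschitz constants for the gauge and for the polar
  parametrization, which make the boundary rectifiable.\<close>

locale gauge_body =
  fixes B :: "(real^2) set" and \<rho> R :: real
  assumes oB: "open B" and cB: "convex B" and \<rho>: "0 < \<rho>" and inner: "ball 0 \<rho> \<subseteq> B" and outer: "B \<subseteq> ball 0 R"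
begin

lemma zero_B: "0 \<in> B" using inner \<rho> by auto

lemma R_pos: "0 < R" using outer zero_B by auto

text \<open>The Minkowski functional of \<open>B\<close>.\<close>

definition G :: "real^2 \<Rightarrow> real" where "G x = Inf {r. 0 < r \<and> (1 / r) *\<^sub>R x \<in> B}"

lemma shrink_B: "x \<in> B \<Longrightarrow> 0 \<le> t \<Longrightarrow> t \<le> 1 \<Longrightarrow> t *\<^sub>R x \<in> B"
  using convexD[OF cB, of x 0 t "1 - t"] zero_B by simp

lemma G_set: "bdd_below {r. 0 < r \<and> (1 / r) *\<^sub>R x \<in> B}" "{r. 0 < r \<and> (1 / r) *\<^sub>R x \<in> B} \<noteq> {}"
proof -
  show "bdd_below {r. 0 < r \<and> (1 / r) *\<^sub>R x \<in> B}" by (rule bdd_belowI[of _ 0]) auto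
  define r where "r = norm x / \<rho> + 1"
  have r: "r > 0" using \<rho> by (simp add: r_def add_nonneg_pos)
  have "norm ((1 / r) *\<^sub>R x) < \<rho>" using r \<rho> by (simp add: r_def field_simps)
  then show "{r. 0 < r \<and> (1 / r) *\<^sub>R x \<in> B} \<noteq> {}" using r inner by (auto intro!: exI[of _ r])
qed

lemma G_nonneg: "0 \<le> G x"
  unfolding G_def using G_set(2) by (rule cInf_greatest) auto

text \<open>One direction shrinks towards the origin. The other uses that \<open>B\<close> is open:
  the scaled point can be pushed outwards a little, which puts the infimum strictly below
  \<open>s\<close>.\<close>

lemma G_less: assumes s: "0 < s" shows "G x < s \<longleftrightarrow> (1 / s) *\<^sub>R x \<in> B"
proof
  assume "G x < s"
  then obtain r where r: "0 < r" "(1 / r) *\<^sub>R x \<in> B" "r < s"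
    using cInf_lessD[OF G_set(2)] unfolding G_def by blast
  have "(r / s) *\<^sub>R ((1 / r) *\<^sub>R x) \<in> B" using r s by (intro shrink_B[OF r(2)]) auto
  then show "(1 / s) *\<^sub>R x \<in> B" using r by simp
next
  assume x: "(1 / s) *\<^sub>R x \<in> B"
  obtain e where e: "e > 0" "ball ((1 / s) *\<^sub>R x) e \<subseteq> B" using oB x by (meson openE)
  define y where "y = (1 / s) *\<^sub>R x"
  define t where "t = 1 + e / (2 * (norm y + 1))"
  have t: "t > 1" using e by (simp add: t_def add_nonneg_pos)
  have "dist y (t *\<^sub>R y) = e / (2 * (norm y + 1)) * norm y"
  proof -
    have "y - t *\<^sub>R y = (- (e / (2 * (norm y + 1)))) *\<^sub>R y" by (simp add: t_def scaleR_add_left)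
    then show ?thesis using e by (simp add: dist_norm)
  qed
  also have "\<dots> < e"
  proof -
    have "e * norm y < e * (2 * (norm y + 1))" using e by (intro mult_strict_left_mono) (auto intro: add_nonneg_pos)
    then show ?thesis by (simp add: divide_less_eq add_nonneg_pos)
  qed
  finally have "t *\<^sub>R y \<in> B" using e(2) by (auto simp: y_def)
  then have "(1 / (s / t)) *\<^sub>R x \<in> B" using t s by (simp add: y_def)
  then have "G x \<le> s / t" unfolding G_def using s t by (intro cInf_lower G_set(1)) auto
  also have "\<dots> < s" using s t by (simp add: divide_less_eq)
  finally show "G x < s" .
qed

lemma eq_by_less: "0 \<le> u \<Longrightarrow> 0 \<le> v \<Longrightarrow> (\<And>s. 0 < s \<Longrightarrow> u < s \<longleftrightarrow> v < s) \<Longrightarrow> u = (v::real)"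
  by (metis less_irrefl linorder_cases order_le_less_trans)

lemma G_scale: assumes a: "0 \<le> a" shows "G (a *\<^sub>R x) = a * G x"
proof (cases "a = 0")
  case True
  have "G 0 = 0" using G_nonneg G_less[of _ 0] zero_B by (intro eq_by_less) auto
  then show ?thesis using True by simp
next
  case False
  then have a: "a > 0" using a by simp
  show ?thesis
  proof (rule eq_by_less)
    fix s :: real assume s: "s > 0"
    have "G (a *\<^sub>R x) < s \<longleftrightarrow> (1 / (s / a)) *\<^sub>R x \<in> B" using G_less[OF s] by simp
    also have "\<dots> \<longleftrightarrow> G x < s / a" using s a by (intro G_less[symmetric]) simp
    finally show "G (a *\<^sub>R x) < s \<longleftrightarrow> a * G x < s" using a by (simp add: field_simps)
  qed (use a G_nonneg in auto)
qed

lemma G_add: "G (x + y) \<le> G x + G y"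
proof (rule field_le_epsilon)
  fix e :: real assume e: "e > 0"
  define s where "s = G x + e / 2"
  define t where "t = G y + e / 2"
  have st: "s > 0" "t > 0" using e G_nonneg by (auto simp: s_def t_def add_nonneg_pos)
  have "G x < s" "G y < t" using e by (auto simp: s_def t_def)
  then have "(1 / s) *\<^sub>R x \<in> B" "(1 / t) *\<^sub>R y \<in> B"
    using G_less st by blast+
  then have "(s / (s + t)) *\<^sub>R ((1 / s) *\<^sub>R x) + (t / (s + t)) *\<^sub>R ((1 / t) *\<^sub>R y) \<in> B"
    using st by (intro convexD[OF cB]) (auto simp: add_divide_distrib[symmetric])
  then have "(1 / (s + t)) *\<^sub>R (x + y) \<in> B" using st by (simp add: scaleR_add_right)
  then have "G (x + y) < s + t" using G_less[of "s + t"] st by simp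
  then show "G (x + y) \<le> G x + G y + e" by (simp add: s_def t_def)
qed

lemma G_upper: "G x \<le> norm x / \<rho>"
proof (rule field_le_epsilon)
  fix e :: real assume e: "e > 0"
  define s where "s = norm x / \<rho> + e"
  have s: "s > 0" using e \<rho> by (simp add: s_def add_nonneg_pos)
  have "norm ((1 / s) *\<^sub>R x) < \<rho>" using s \<rho> e by (simp add: s_def field_simps)
  then have "(1 / s) *\<^sub>R x \<in> B" using inner by auto
  then have "G x < s" using G_less[OF s] by blast
  then show "G x \<le> norm x / \<rho> + e" by (simp add: s_def)
qed

lemma G_lower: "norm x \<le> R * G x"
proof (rule field_le_epsilon)
  fix e :: real assume e: "e > 0"
  define s where "s = G x + e / R"
  have s: "s > 0" using e R_pos G_nonneg by (simp add: s_def add_nonneg_pos)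
  have "G x < s" using e R_pos by (simp add: s_def)
  then have "(1 / s) *\<^sub>R x \<in> B" using G_less[OF s] by blast
  then have "norm ((1 / s) *\<^sub>R x) < R" using outer by auto
  then have "norm x < R * s" using s by (simp add: field_simps)
  then show "norm x \<le> R * G x + e" using R_pos by (simp add: s_def distrib_left)
qed

lemma G_pos: "x \<noteq> 0 \<Longrightarrow> 0 < G x"
  using G_lower[of x] R_pos G_nonneg[of x] by (smt (verit) mult_eq_0_iff zero_less_norm_iff)

lemma G_lipschitz: "\<bar>G x - G y\<bar> \<le> norm (x - y) / \<rho>"
  using G_add[of "x - y" y] G_add[of "y - x" x] G_upper[of "x - y"] G_upper[of "y - x"]
  by (simp add: norm_minus_commute)

lemma G_continuous: "continuous_on UNIV G"
proof (rule continuous_onI)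
  fix x :: "real^2" and e :: real assume e: "e > 0"
  have "dist (G y) (G x) \<le> e" if "dist y x < e * \<rho>" for y
    using G_lipschitz[of y x] that \<rho> by (simp add: dist_norm divide_less_eq) (smt (verit) divide_le_eq)
  then show "\<exists>d>0. \<forall>y\<in>UNIV. dist y x < d \<longrightarrow> dist (G y) (G x) \<le> e"
    using e \<rho> by (intro exI[of _ "e * \<rho>"]) auto
qed

lemma mem_B: "x \<in> B \<longleftrightarrow> G x < 1" using G_less[of 1 x] by simp

lemma frontier_B: "frontier B = {x. G x = 1}"
proof -
  have "closure B = {x. G x \<le> 1}"
  proof
    have "closed {x. G x \<le> 1}"
      using continuous_closed_preimage[OF G_continuous, of "{..1}"] by (simp add: vimage_def)
    then show "closure B \<subseteq> {x. G x \<le> 1}" using mem_B by (intro closure_minimal) (auto intro: less_imp_le)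
    show "{x. G x \<le> 1} \<subseteq> closure B"
    proof
      fix x assume "x \<in> {x. G x \<le> 1}"
      then have x: "G x \<le> 1" by simp
      have "(\<lambda>n. (1 - 1 / real (Suc n)) *\<^sub>R x) \<longlonglongrightarrow> (1 - 0) *\<^sub>R x"
        using LIMSEQ_inverse_real_of_nat by (intro tendsto_intros) (simp add: inverse_eq_divide)
      moreover have "(1 - 1 / real (Suc n)) *\<^sub>R x \<in> B" for n
      proof -
        have n: "0 \<le> 1 - 1 / real (Suc n)" "1 - 1 / real (Suc n) < 1" by auto
        then have "(1 - 1 / real (Suc n)) * G x \<le> (1 - 1 / real (Suc n)) * 1" using x by (intro mult_left_mono)
        then have "G ((1 - 1 / real (Suc n)) *\<^sub>R x) < 1" unfolding G_scale[OF n(1)] mult_1_right using n(2) by (rule le_less_trans)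
        then show ?thesis unfolding mem_B .
      qed
      ultimately show "x \<in> closure B" unfolding closure_sequential by (intro exI[of _ "\<lambda>n. (1 - 1 / real (Suc n)) *\<^sub>R x"]) auto
    qed
  qed
  moreover have "interior B = B" using oB by (rule interior_open)
  ultimately show ?thesis unfolding frontier_def using mem_B by auto
qed

definition \<gamma> :: "real \<Rightarrow> real^2" where "\<gamma> \<theta> = (1 / G (circ \<theta>)) *\<^sub>R circ \<theta>"

lemma circ_nz: "circ \<theta> \<noteq> 0" using norm_circ[of \<theta>] by force

lemma G_circ: "1 / R \<le> G (circ \<theta>)" "0 < G (circ \<theta>)"
  using G_lower[of "circ \<theta>"] R_pos G_pos[OF circ_nz] by (auto simp: field_simps)

lemma \<gamma>_periodic: "\<gamma> (\<theta> + 2 * pi) = \<gamma> \<theta>" by (simp add: \<gamma>_def circ_def)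

lemma G_\<gamma>: "G (\<gamma> \<theta>) = 1" unfolding \<gamma>_def using G_circ[of \<theta>] by (subst G_scale) auto

lemma \<gamma>_eq_iff: "\<gamma> a = \<gamma> b \<longleftrightarrow> circ a = circ b"
proof
  assume "\<gamma> a = \<gamma> b"
  then have "norm (\<gamma> a) = norm (\<gamma> b)" by simp
  then have "G (circ a) = G (circ b)" using G_circ[of a] G_circ[of b] by (simp add: \<gamma>_def)
  then show "circ a = circ b" using \<open>\<gamma> a = \<gamma> b\<close> G_circ(2)[of b] by (simp add: \<gamma>_def)
qed (simp add: \<gamma>_def)

lemma circ_inj: assumes "circ a = circ b" "\<bar>a - b\<bar> < 2 * pi" shows "a = b"
proof -
  have "sin a = sin b \<and> cos a = cos b" using assms(1) by (auto simp: circ_def vec_eq_iff forall_2)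
  then obtain n :: int where n: "a = b + 2 * pi * n" using sin_cos_eq_iff by blast
  then have "\<bar>real_of_int n\<bar> < 1" using assms(2) by (simp add: abs_mult)
  then have "n = 0" by linarith
  then show ?thesis using n by simp
qed

lemma \<gamma>_inj: "\<gamma> a = \<gamma> b \<Longrightarrow> \<bar>a - b\<bar> < 2 * pi \<Longrightarrow> a = b"
  using \<gamma>_eq_iff circ_inj by blast

lemma \<gamma>_bij: "bij_betw \<gamma> {0..<2 * pi} (frontier B)"
  unfolding bij_betw_def
proof
  show "inj_on \<gamma> {0..<2 * pi}" by (intro inj_onI \<gamma>_inj) auto
  show "\<gamma> ` {0..<2 * pi} = frontier B"
  proof
    show "\<gamma> ` {0..<2 * pi} \<subseteq> frontier B" using G_\<gamma> by (auto simp: frontier_B)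
    show "frontier B \<subseteq> \<gamma> ` {0..<2 * pi}"
    proof
      fix x assume "x \<in> frontier B"
      then have x: "G x = 1" by (simp add: frontier_B)
      then have x0: "x \<noteq> 0" using G_scale[of 0 x] by auto
      define y where "y = (1 / norm x) *\<^sub>R x"
      have "(norm y)\<^sup>2 = 1" using x0 by (simp add: y_def)
      then have "(y $ 1)\<^sup>2 + (y $ 2)\<^sup>2 = 1"
        unfolding power2_norm_eq_inner by (simp add: inner_real2 power2_eq_square)
      then obtain t where t: "0 \<le> t" "t < 2 * pi" "y $ 1 = cos t" "y $ 2 = sin t" using sincos_total_2pi by metis
      then have yt: "circ t = y" by (simp add: circ_def vec_eq_iff forall_2)
      have "G y = 1 / norm x" unfolding y_def using x by (simp add: G_scale)
      then have "\<gamma> t = x" unfolding \<gamma>_def yt using x0 by (simp add: y_def)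
      then show "x \<in> \<gamma> ` {0..<2 * pi}" using t by auto
    qed
  qed
qed

definition "Lip = R * 2 + R * R * (2 / \<rho>)"

lemma Lip_nonneg: "0 \<le> Lip" using R_pos \<rho> by (simp add: Lip_def)

lemma \<gamma>_lipschitz: "dist (\<gamma> a) (\<gamma> b) \<le> Lip * \<bar>a - b\<bar>"
proof -
  let ?a = "G (circ a)" and ?b = "G (circ b)"
  have inv: "1 / ?a \<le> R" "1 / ?b \<le> R" using G_circ[of a] G_circ[of b] R_pos by (auto simp: field_simps)
  have "\<gamma> a - \<gamma> b = (1 / ?a) *\<^sub>R (circ a - circ b) + (1 / ?a - 1 / ?b) *\<^sub>R circ b"
    by (simp add: \<gamma>_def algebra_simps)
  then have "norm (\<gamma> a - \<gamma> b) \<le> (1 / ?a) * norm (circ a - circ b) + \<bar>1 / ?a - 1 / ?b\<bar>"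
    using norm_triangle_ineq[of "(1 / ?a) *\<^sub>R (circ a - circ b)" "(1 / ?a - 1 / ?b) *\<^sub>R circ b"] G_circ(2)[of a] by simp
  also have "\<dots> \<le> R * (2 * \<bar>a - b\<bar>) + R * R * (2 / \<rho> * \<bar>a - b\<bar>)"
  proof (rule add_mono)
    show "(1 / ?a) * norm (circ a - circ b) \<le> R * (2 * \<bar>a - b\<bar>)"
      using R_pos by (intro mult_mono inv circ_lipschitz) auto
    have "\<bar>1 / ?a - 1 / ?b\<bar> = (1 / ?a) * (1 / ?b) * \<bar>?b - ?a\<bar>"
    proof -
      have "1 / ?a - 1 / ?b = (1 / ?a) * (1 / ?b) * (?b - ?a)" using G_circ(2)[of a] G_circ(2)[of b] by (simp add: field_simps)
      then show ?thesis using G_circ(2)[of a] G_circ(2)[of b] by (simp only: abs_mult) simp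
    qed
    also have "\<dots> \<le> (R * R) * (2 / \<rho> * \<bar>a - b\<bar>)"
    proof (rule mult_mono)
      show "1 / ?a * (1 / ?b) \<le> R * R" using inv G_circ(2)[of b] R_pos by (intro mult_mono) auto
      have "\<bar>?b - ?a\<bar> \<le> norm (circ b - circ a) / \<rho>" by (rule G_lipschitz)
      also have "\<dots> \<le> 2 * \<bar>b - a\<bar> / \<rho>" using \<rho> by (intro divide_right_mono circ_lipschitz) auto
      finally show "\<bar>?b - ?a\<bar> \<le> 2 / \<rho> * \<bar>a - b\<bar>" by (simp add: abs_minus_commute)
    qed (use R_pos in auto)
    finally show "\<bar>1 / ?a - 1 / ?b\<bar> \<le> R * R * (2 / \<rho> * \<bar>a - b\<bar>)" .
  qed
  also have "\<dots> = Lip * \<bar>a - b\<bar>" by (simp add: Lip_def algebra_simps)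
  finally show ?thesis by (simp add: dist_norm)
qed

text \<open>With \<open>\<tau> = tan (s - \<theta>)\<close> the curve is
  \<open>e + \<tau> *\<^sub>R f\<close> divided by \<open>H \<tau>\<close>, and \<open>H\<close> is
  convex as the gauge on a line, so \<open>srd_convex\<close> makes the curve strictly
  differentiable. The subgradient of \<open>H\<close> at 0, extended homogeneously, is a linear
  functional below the gauge; this is the support property of the tangent.\<close>

lemma \<gamma>_srd:
  obtains D where "srd \<gamma> \<theta> D" "D \<noteq> 0" "\<And>w. w \<in> B \<Longrightarrow> 0 \<le> det2 D (w - \<gamma> \<theta>)"
proof -
  define e where "e = circ \<theta>"
  define f where "f = pt (- sin \<theta>) (cos \<theta>)"
  have ef: "e \<bullet> f = 0" "f \<bullet> f = 1" "det2 e f = 1" "e \<bullet> e = 1"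
    by (auto simp: e_def f_def circ_def inner_real2 det2_eq power2_eq_square[symmetric])
  define H where "H \<tau> = G (e + \<tau> *\<^sub>R f)" for \<tau>
  have nz: "e + \<tau> *\<^sub>R f \<noteq> 0" for \<tau>
  proof
    assume "e + \<tau> *\<^sub>R f = 0"
    then have "e \<bullet> (e + \<tau> *\<^sub>R f) = 0" by simp
    then show False using ef by (simp add: inner_add_right)
  qed
  then have Hpos: "0 < H \<tau>" for \<tau> unfolding H_def by (rule G_pos)
  have Hc: "continuous_on UNIV H"
    unfolding H_def by (intro continuous_on_compose2[OF G_continuous] continuous_intros) auto
  have cvx: "convex_on UNIV H"
  proof (rule convex_onI)
    fix t x y :: real assume t: "0 < t" "t < 1"
    have "e + ((1 - t) *\<^sub>R x + t *\<^sub>R y) *\<^sub>R f = (1 - t) *\<^sub>R (e + x *\<^sub>R f) + t *\<^sub>R (e + y *\<^sub>R f)"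
      by (simp add: algebra_simps)
    then have "H ((1 - t) *\<^sub>R x + t *\<^sub>R y) \<le> G ((1 - t) *\<^sub>R (e + x *\<^sub>R f)) + G (t *\<^sub>R (e + y *\<^sub>R f))"
      unfolding H_def by (metis G_add)
    then show "H ((1 - t) *\<^sub>R x + t *\<^sub>R y) \<le> (1 - t) * H x + t * H y" using t by (simp add: G_scale H_def)
  qed simp
  have Hcont: "isCont H \<tau>" for \<tau> using Hc by (simp add: continuous_on_eq_continuous_at)
  obtain \<sigma> where \<sigma>: "srd H 0 \<sigma>" "\<And>\<tau>. H 0 + \<sigma> * \<tau> \<le> H \<tau>" using srd_convex[OF cvx Hcont] by blast
  define P where "P \<tau> = (1 / H \<tau>) *\<^sub>R (e + \<tau> *\<^sub>R f)" for \<tau>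
  define D where "D = (- \<sigma> / (H 0)\<^sup>2) *\<^sub>R (e + 0 *\<^sub>R f) + (1 / H 0) *\<^sub>R f"
  have cr: "continuous (at_right 0) H" using Hcont[of 0] by (rule continuous_at_imp_continuous_at_within)
  have "srd P 0 D"
    unfolding P_def D_def
  proof (rule srd_scaleR[OF srd_inverse[OF \<sigma>(1) cr Hpos] srd_affine])
    show "continuous (at_right 0) (\<lambda>s. 1 / H s)" using cr Hpos[of 0] by (intro continuous_intros) auto
  qed (intro continuous_intros)
  define tn where "tn s = tan (s - \<theta>)" for s
  have cpos: "0 < cos (s - \<theta>)" if "\<theta> \<le> s" "s < \<theta> + pi / 2" for s using that by (intro cos_gt_zero_pi) auto
  have tn: "srd tn \<theta> (inverse ((cos (\<theta> - \<theta>))\<^sup>2))"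
  proof (rule srd_C1[where k' = "\<lambda>s. inverse ((cos (s - \<theta>))\<^sup>2)" and \<epsilon> = "pi / 2"])
    fix s assume s: "\<theta> \<le> s" "s < \<theta> + pi / 2"
    have "(tan has_real_derivative inverse ((cos (s - \<theta>))\<^sup>2)) (at (s - \<theta>))" using cpos[OF s] by (intro DERIV_tan) simp
    moreover have "((\<lambda>s. s - \<theta>) has_real_derivative 1) (at s)" by (auto intro!: derivative_eq_intros)
    ultimately show "(tn has_real_derivative inverse ((cos (s - \<theta>))\<^sup>2)) (at s)"
      unfolding tn_def using DERIV_chain2[of tan _ "\<lambda>s. s - \<theta>" s 1] by simp
  qed (auto intro!: continuous_intros)
  have tn0: "tn \<theta> = 0" by (simp add: tn_def)
  have "srd (\<lambda>s. P (tn s)) \<theta> (inverse ((cos (\<theta> - \<theta>))\<^sup>2) *\<^sub>R D)"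
  proof (rule srd_compose[OF _ tn, where \<epsilon> = "pi / 2"])
    show "srd P (tn \<theta>) D" unfolding tn0 by fact
    show "continuous (at_right \<theta>) tn" unfolding tn_def by (intro continuous_intros) simp
    show "tn a < tn b" if "\<theta> \<le> a" "a < b" "b < \<theta> + pi / 2" for a b
      unfolding tn_def using that by (intro tan_monotone) auto
  qed simp
  then have "srd (\<lambda>s. P (tn s)) \<theta> D" by simp
  then have "srd \<gamma> \<theta> D"
  proof (rule srd_cong[of _ _ _ "pi / 2"])
    fix s assume s: "\<theta> \<le> s" "s < \<theta> + pi / 2"
    let ?a = "s - \<theta>"
    have "cos s = cos ?a * cos \<theta> - sin ?a * sin \<theta>" "sin s = sin ?a * cos \<theta> + cos ?a * sin \<theta>"
      using cos_add[of ?a \<theta>] sin_add[of ?a \<theta>] by auto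
    then have c: "circ s = cos ?a *\<^sub>R (e + tn s *\<^sub>R f)"
      using cpos[OF s] by (simp add: circ_def e_def f_def tn_def tan_def vec_eq_iff forall_2 field_simps)
    have "\<gamma> s = (1 / (cos ?a * H (tn s))) *\<^sub>R (cos ?a *\<^sub>R (e + tn s *\<^sub>R f))"
      unfolding \<gamma>_def c H_def using cpos[OF s] by (simp add: G_scale)
    then show "P (tn s) = \<gamma> s" using cpos[OF s] by (simp add: P_def)
  qed simp
  moreover have "D \<noteq> 0"
  proof
    assume "D = 0"
    then have "D \<bullet> f = 0" by simp
    moreover have "D \<bullet> f = 1 / H 0" unfolding D_def by (simp add: inner_add_left inner_diff_left ef)
    ultimately show False using Hpos[of 0] by simp
  qed
  moreover have "0 \<le> det2 D (w - \<gamma> \<theta>)" if w: "w \<in> B" for w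
  proof -
    define w1 where "w1 = e \<bullet> w"
    define w2 where "w2 = f \<bullet> w"
    have wd: "w = w1 *\<^sub>R e + w2 *\<^sub>R f"
    proof -
      have "(e \<bullet> w) * e $ 1 + (f \<bullet> w) * f $ 1 = ((cos \<theta>)\<^sup>2 + (sin \<theta>)\<^sup>2) * w $ 1"
        "(e \<bullet> w) * e $ 2 + (f \<bullet> w) * f $ 2 = ((sin \<theta>)\<^sup>2 + (cos \<theta>)\<^sup>2) * w $ 2"
        by (simp_all add: e_def f_def circ_def inner_real2 algebra_simps power2_eq_square
              del: sin_cos_squared_add sin_cos_squared_add2 sin_cos_squared_add3)
      then show ?thesis by (simp add: w1_def w2_def vec_eq_iff forall_2)
    qed
    have "H 0 * w1 + \<sigma> * w2 \<le> G w"
    proof -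
      \<comment> \<open>A small multiple of \<open>w\<close> added to \<open>e\<close> stays on the
        positive side along \<open>e\<close>, where the gauge is given by \<open>H\<close>;
        subadditivity then removes \<open>e\<close> again.\<close>
      define s where "s = 1 / (2 * (\<bar>w1\<bar> + 1))"
      have s: "s > 0" by (simp add: s_def add_nonneg_pos)
      have "s * \<bar>w1\<bar> < 1" by (simp add: s_def divide_less_eq add_nonneg_pos)
      moreover have "s * (- \<bar>w1\<bar>) \<le> s * w1" using s by (intro mult_left_mono) auto
      ultimately have p: "1 + s * w1 > 0" by simp
      have "e + s *\<^sub>R w = (1 + s * w1) *\<^sub>R (e + (s * w2 / (1 + s * w1)) *\<^sub>R f)"
      proof -
        have "e + s *\<^sub>R w = (1 + s * w1) *\<^sub>R e + (s * w2) *\<^sub>R f" by (subst wd) (simp add: algebra_simps)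
        then show ?thesis using p by (simp only: scaleR_add_right scaleR_scaleR) simp
      qed
      then have "G (e + s *\<^sub>R w) = (1 + s * w1) * H (s * w2 / (1 + s * w1))"
        using p by (simp add: G_scale H_def)
      also have "\<dots> \<ge> (1 + s * w1) * (H 0 + \<sigma> * (s * w2 / (1 + s * w1)))"
        using p by (intro mult_left_mono \<sigma>(2)) auto
      also have "(1 + s * w1) * (H 0 + \<sigma> * (s * w2 / (1 + s * w1))) = H 0 + s * (H 0 * w1 + \<sigma> * w2)"
        using p by (simp add: field_simps)
      finally have "H 0 + s * (H 0 * w1 + \<sigma> * w2) \<le> G (e + s *\<^sub>R w)" .
      also have "\<dots> \<le> H 0 + s * G w" using G_add[of e "s *\<^sub>R w"] s by (simp add: G_scale H_def)
      finally show ?thesis using s by simp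
    qed
    also have "G w < 1" using w mem_B by simp
    finally have le: "H 0 * w1 + \<sigma> * w2 < 1" .
    have g: "\<gamma> \<theta> = (1 / H 0) *\<^sub>R e" by (simp add: \<gamma>_def H_def e_def)
    have "det2 f e = - det2 e f" by (simp add: det2_eq)
    then have fe: "det2 f e = -1" unfolding ef(3) .
    have fe': "det2 e e = 0" "det2 f f = 0" by (simp_all add: det2_eq)
    have "det2 D (w - \<gamma> \<theta>) = (1 / (H 0)\<^sup>2) * (1 - (H 0 * w1 + \<sigma> * w2))"
      unfolding D_def g by (subst wd) (use Hpos[of 0] in \<open>simp add: det2_simps fe fe' ef(3) field_simps power2_eq_square\<close>)
    then show ?thesis using le by simp
  qed
  ultimately show ?thesis by (rule that)
qed

section \<open>Passage from the polar angle to arclength\<close>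

definition len :: "real \<Rightarrow> real \<Rightarrow> real" where "len a b = enn2real (curve_length \<gamma> a b)"

lemma len: assumes "a \<le> b" shows "curve_length \<gamma> a b = ennreal (len a b)" "0 \<le> len a b" "len a b \<le> Lip * (b - a)"
proof -
  have le: "curve_length \<gamma> a b \<le> ennreal (Lip * (b - a))"
  proof (rule curve_length_lipschitz[OF Lip_nonneg])
    fix s t :: real assume "s \<le> t"
    then show "dist (\<gamma> s) (\<gamma> t) \<le> Lip * (t - s)" using \<gamma>_lipschitz[of s t] by (simp add: abs_minus_commute)
  qed
  then have "curve_length \<gamma> a b < top" by (rule le_less_trans) simp
  then show e: "curve_length \<gamma> a b = ennreal (len a b)" by (simp add: len_def)
  show "0 \<le> len a b" by (simp add: len_def)
  show "len a b \<le> Lip * (b - a)" using le assms Lip_nonneg unfolding e by (simp add: ennreal_le_iff)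
qed

lemma len_add: assumes "a \<le> b" "b \<le> c" shows "len a c = len a b + len b c"
proof -
  have "ennreal (len a c) = ennreal (len a b + len b c)"
    using curve_length_add[OF assms, of \<gamma>] assms len(1)[of a c] len(1)[of a b] len(1)[of b c] len(2)[of a b] len(2)[of b c]
    by (simp add: ennreal_plus)
  then show ?thesis using len(2)[of a c] len(2)[of a b] len(2)[of b c] assms by (simp del: ennreal_plus)
qed

lemma len_ge_dist: "a \<le> b \<Longrightarrow> dist (\<gamma> a) (\<gamma> b) \<le> len a b"
  using dist_le_curve_length[of a a b b \<gamma>] len[of a b] by (simp add: ennreal_le_iff)

lemma len_pos: assumes "a < b" shows "0 < len a b"
proof -
  \<comment> \<open>The endpoint is brought within one period, where injectivity makes the chord
    nonzero.\<close>
  define c where "c = min b (a + 1)"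
  have c: "a < c" "c \<le> b" "c - a < 2 * pi" using assms pi_gt3 by (auto simp: c_def)
  then have "\<gamma> a \<noteq> \<gamma> c" using \<gamma>_inj[of a c] by auto
  then have "0 < len a c" using len_ge_dist[of a c] c by (smt (verit) zero_less_dist_iff)
  then show ?thesis using len_add[of a c b] len(2)[of c b] c by simp
qed

lemma len_shift: "len (a + 2 * pi) (b + 2 * pi) = len a b"
proof -
  have "curve_length \<gamma> (a + 2 * pi) (b + 2 * pi) = curve_length \<gamma> a b"
  proof (rule antisym)
    have "curve_length (\<lambda>s. \<gamma> (s - 2 * pi)) (a + 2 * pi) (b + 2 * pi) \<le> curve_length \<gamma> (a + 2 * pi - 2 * pi) (b + 2 * pi - 2 * pi)"
      by (rule curve_length_reparam_le) simp
    moreover have "(\<lambda>s. \<gamma> (s - 2 * pi)) = \<gamma>" using \<gamma>_periodic[of "_ - 2 * pi"] by (simp add: fun_eq_iff)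
    ultimately show "curve_length \<gamma> (a + 2 * pi) (b + 2 * pi) \<le> curve_length \<gamma> a b" by simp
    have "curve_length (\<lambda>s. \<gamma> (s + 2 * pi)) a b \<le> curve_length \<gamma> (a + 2 * pi) (b + 2 * pi)"
      by (rule curve_length_reparam_le) simp
    then show "curve_length \<gamma> a b \<le> curve_length \<gamma> (a + 2 * pi) (b + 2 * pi)" by (simp add: \<gamma>_periodic)
  qed
  then show ?thesis by (simp add: len_def)
qed

text \<open>Signed length measured from the angle 0, defined on the whole line so that periodicity
  becomes a shift rule.\<close>

definition V :: "real \<Rightarrow> real" where "V \<theta> = (if 0 \<le> \<theta> then len 0 \<theta> else - len \<theta> 0)"

lemma V_diff: assumes "a \<le> b" shows "V b - V a = len a b"
  using len_add[of 0 a b] len_add[of a 0 b] len_add[of a b 0] len_add[of 0 0 0] assms by (auto simp: V_def)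

lemma V_less: "a < b \<Longrightarrow> V a < V b" using V_diff[of a b] len_pos[of a b] by simp

lemma V_strict_mono: "strict_mono V" by (rule strict_monoI) (rule V_less)

lemma V_lipschitz: "\<bar>V a - V b\<bar> \<le> Lip * \<bar>a - b\<bar>"
  using V_diff[of a b] V_diff[of b a] len(2,3)[of a b] len(2,3)[of b a] by (cases "a \<le> b") auto

lemma V_continuous: "continuous_on A V"
proof (rule continuous_onI)
  fix x e :: real assume e: "e > 0"
  have "dist (V y) (V x) \<le> e" if "dist y x < e / (Lip + 1)" for y
  proof -
    have "dist (V y) (V x) \<le> Lip * dist y x" using V_lipschitz[of y x] by (simp add: dist_real_def)
    also have "\<dots> \<le> (Lip + 1) * dist y x" by (intro mult_right_mono) auto
    also have "\<dots> \<le> e" using that Lip_nonneg by (simp add: field_simps)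
    finally show ?thesis .
  qed
  then show "\<exists>d>0. \<forall>y\<in>A. dist y x < d \<longrightarrow> dist (V y) (V x) \<le> e"
    using e Lip_nonneg by (intro exI[of _ "e / (Lip + 1)"]) auto
qed

lemma V_0: "V 0 = 0" using V_diff[of 0 0] len(3)[of 0 0] len(2)[of 0 0] by (simp add: V_def)

definition ell :: real where "ell = V (2 * pi)"

lemma ell_pos: "0 < ell" using V_less[of 0 "2 * pi"] pi_gt_zero by (simp add: ell_def V_0)

lemma V_shift: "V (\<theta> + 2 * pi) = V \<theta> + ell"
proof (cases "0 \<le> \<theta>")
  case True
  have "V (\<theta> + 2 * pi) - V (0 + 2 * pi) = len (0 + 2 * pi) (\<theta> + 2 * pi)" using True by (intro V_diff) simp
  then show ?thesis using V_diff[OF True] unfolding len_shift by (simp add: ell_def V_0)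
next
  case False
  have "V (0 + 2 * pi) - V (\<theta> + 2 * pi) = len (\<theta> + 2 * pi) (0 + 2 * pi)" using False by (intro V_diff) simp
  then show ?thesis using V_diff[of \<theta> 0] False unfolding len_shift by (simp add: ell_def V_0)
qed

lemma V_shift_n: "V (2 * pi * real n) = ell * real n" "V (- (2 * pi * real n)) = - (ell * real n)"
proof -
  show "V (2 * pi * real n) = ell * real n"
    by (induction n) (auto simp: V_0 V_shift distrib_left add.commute[of "2 * pi"])
  show "V (- (2 * pi * real n)) = - (ell * real n)"
  proof (induction n)
    case (Suc n)
    have "V (- (2 * pi * real (Suc n)) + 2 * pi) = V (- (2 * pi * real (Suc n))) + ell" by (rule V_shift)
    moreover have "- (2 * pi * real (Suc n)) + 2 * pi = - (2 * pi * real n)" by (simp add: algebra_simps)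
    ultimately show ?case using Suc by (simp add: algebra_simps)
  qed (simp add: V_0)
qed

lemma V_surj: "\<exists>x. V x = y"
proof -
  obtain n where n: "\<bar>y\<bar> / ell \<le> real n" using real_arch_simple by blast
  then have n': "\<bar>y\<bar> \<le> ell * real n" using ell_pos by (simp add: field_simps)
  have "\<exists>x. - (2 * pi * real n) \<le> x \<and> x \<le> 2 * pi * real n \<and> V x = y"
    by (rule IVT') (use n' V_continuous in \<open>auto simp: V_shift_n abs_le_iff\<close>)
  then show ?thesis by blast
qed

definition T :: "real \<Rightarrow> real" where "T = inv V"

lemma VT: "V (T y) = y"
proof -
  have "y \<in> range V" using V_surj[of y] by auto
  then show ?thesis unfolding T_def by (rule f_inv_into_f)
qed

lemma TV: "T (V x) = x" unfolding T_def using V_strict_mono by (intro inv_f_f strict_mono_imp_inj_on)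

lemma T_less: "a < b \<longleftrightarrow> T a < T b" using strict_mono_less[OF V_strict_mono, of "T a" "T b"] by (simp add: VT)

lemma T_isCont: "isCont T y"
proof -
  have "isCont V x" for x using V_continuous[of UNIV] by (simp add: continuous_on_eq_continuous_at)
  then have "isCont T (V (T y))" by (intro isCont_inverse_function[of 1 "T y" T V]) (auto simp: TV)
  then show ?thesis by (simp add: VT)
qed

lemma T_shift: "T (s + ell) = T s + 2 * pi"
  using V_shift[of "T s"] TV[of "T s + 2 * pi"] by (simp add: VT)

lemma T_bij: "bij_betw T {0..<ell} {0..<2 * pi}"
proof (rule bij_betw_imageI)
  show "inj_on T {0..<ell}" by (rule inj_on_inverseI[of _ V]) (simp add: VT)
  have iff: "T s \<in> {0..<2 * pi} \<longleftrightarrow> s \<in> {0..<ell}" for s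
    using T_less[of s 0] T_less[of s ell] TV[of 0] TV[of "2 * pi"] by (auto simp: V_0 ell_def)
  show "T ` {0..<ell} = {0..<2 * pi}"
  proof
    show "T ` {0..<ell} \<subseteq> {0..<2 * pi}" using iff by blast
    show "{0..<2 * pi} \<subseteq> T ` {0..<ell}"
    proof
      fix x assume "x \<in> {0..<2 * pi}"
      then have "V x \<in> {0..<ell}" using iff[of "V x"] by (simp only: TV)
      then show "x \<in> T ` {0..<ell}" using TV[of x] by (metis imageI)
    qed
  qed
qed

definition "zz s = \<gamma> (T s)"

lemma zz_length: assumes "s \<le> t" shows "curve_length zz s t = ennreal (t - s)"
proof -
  have mono: "T a \<le> T b" if "a \<le> b" for a b using T_less[of b a] that by linarith
  have "curve_length zz s t = curve_length \<gamma> (T s) (T t)"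
  proof (rule antisym)
    show "curve_length zz s t \<le> curve_length \<gamma> (T s) (T t)"
      unfolding zz_def by (rule curve_length_reparam_le) (rule mono)
    have "curve_length (\<lambda>\<theta>. zz (V \<theta>)) (T s) (T t) \<le> curve_length zz (V (T s)) (V (T t))"
    proof (rule curve_length_reparam_le)
      show "V a \<le> V b" if "a \<le> b" for a b using V_less[of a b] that by (cases "a = b") auto
    qed
    then show "curve_length \<gamma> (T s) (T t) \<le> curve_length zz s t" by (simp add: zz_def TV VT)
  qed
  also have "\<dots> = ennreal (len (T s) (T t))" using mono[OF assms] by (rule len(1))
  also have "len (T s) (T t) = t - s" using V_diff[OF mono[OF assms]] by (simp add: VT)
  finally show ?thesis .
qed

text \<open>Strict differentiability controls all chords over a short interval, hence every
  inscribed chain there and therefore the length. A plain right derivative at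
  \<open>\<theta>\<close> would control only chords starting at \<open>\<theta>\<close>.\<close>

lemma V_srd: assumes "srd \<gamma> \<theta> D" shows "srd V \<theta> (norm D)"
  unfolding srd_iff
proof (intro allI impI)
  fix e :: real assume e: "e > 0"
  then obtain \<delta> where \<delta>: "\<delta> > 0" "\<And>a b. \<theta> \<le> a \<Longrightarrow> a < b \<Longrightarrow> b < \<theta> + \<delta> \<Longrightarrow> norm (\<gamma> b - \<gamma> a - (b - a) *\<^sub>R D) \<le> e * (b - a)"
    using assms unfolding srd_iff by blast
  have "norm (V b - V a - (b - a) *\<^sub>R norm D) \<le> e * (b - a)" if ab: "\<theta> \<le> a" "a < b" "b < \<theta> + \<delta>" for a b
  proof -
    have close: "\<bar>dist (\<gamma> s) (\<gamma> t) - norm D * (t - s)\<bar> \<le> e * (t - s)" if "a \<le> s" "s \<le> t" "t \<le> b" for s t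
    proof (cases "s = t")
      case False
      then have "norm (\<gamma> t - \<gamma> s - (t - s) *\<^sub>R D) \<le> e * (t - s)" using that ab by (intro \<delta>(2)) auto
      moreover have "\<bar>norm (\<gamma> t - \<gamma> s) - norm ((t - s) *\<^sub>R D)\<bar> \<le> norm (\<gamma> t - \<gamma> s - (t - s) *\<^sub>R D)" by (rule norm_triangle_ineq3)
      ultimately show ?thesis using that by (simp add: dist_norm norm_minus_commute mult.commute)
    qed simp
    have "curve_length \<gamma> a b \<le> ennreal ((norm D + e) * (b - a))"
    proof (rule curve_length_lipschitz)
      fix s t assume "a \<le> s" "s \<le> t" "t \<le> b"
      from close[OF this] show "dist (\<gamma> s) (\<gamma> t) \<le> (norm D + e) * (t - s)" by (auto simp: abs_le_iff algebra_simps)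
    qed (use e in auto)
    then have "len a b \<le> (norm D + e) * (b - a)" using ab e len[of a b] by (simp add: ennreal_le_iff)
    moreover have "(norm D - e) * (b - a) \<le> len a b"
      using close[of a b] len_ge_dist[of a b] ab by (auto simp: abs_le_iff algebra_simps)
    ultimately show ?thesis using V_diff[of a b] ab by (simp add: abs_le_iff algebra_simps)
  qed
  then show "\<exists>\<delta>>0. \<forall>a b. \<theta> \<le> a \<longrightarrow> a < b \<longrightarrow> b < \<theta> + \<delta> \<longrightarrow> norm (V b - V a - (b - a) *\<^sub>R norm D) \<le> e * (b - a)"
    using \<delta>(1) by blast
qed

lemma T_srd: assumes "srd V (T s) d" "d \<noteq> 0" shows "srd T s (1 / d)"
proof -
  have lim: "filterlim (\<lambda>p. (T (fst p), T (snd p))) (chords (T s)) (chords s)"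
    unfolding filterlim_iff
  proof (intro allI impI)
    fix P :: "real \<times> real \<Rightarrow> bool" assume "eventually P (chords (T s))"
    then obtain \<delta> where \<delta>: "\<delta> > 0" "\<And>a b. T s \<le> a \<Longrightarrow> a < b \<Longrightarrow> b < T s + \<delta> \<Longrightarrow> P (a, b)"
      unfolding eventually_chords by blast
    show "eventually (\<lambda>p. P (T (fst p), T (snd p))) (chords s)"
    proof (rule eventually_chordsI[of "V (T s + \<delta>) - s"])
      show "0 < V (T s + \<delta>) - s" using V_less[of "T s" "T s + \<delta>"] \<delta>(1) by (simp add: VT)
      fix a b assume ab: "s \<le> a" "a < b" "b < s + (V (T s + \<delta>) - s)"
      then have "T b < T s + \<delta>" using T_less[of b "V (T s + \<delta>)"] by (simp add: TV)
      then show "P (T (fst (a, b)), T (snd (a, b)))"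
        using ab T_less[of a s] T_less[of a b] by (intro \<delta>(2)) (auto simp: not_less)
    qed
  qed
  have "((\<lambda>p. 1 / quot V (T (fst p), T (snd p))) \<longlongrightarrow> 1 / d) (chords s)"
    using filterlim_compose[OF assms(1)[unfolded srd_def] lim] assms(2) by (intro tendsto_divide tendsto_const)
  moreover have "(\<lambda>p. 1 / quot V (T (fst p), T (snd p))) = quot T"
    by (rule ext) (simp add: quot_def VT)
  ultimately show ?thesis unfolding srd_def by simp
qed

lemma zz_srd:
  obtains d where "srd zz s d" "norm d = 1" "\<And>w. w \<in> B \<Longrightarrow> 0 \<le> det2 d (w - zz s)"
proof -
  obtain D where D: "srd \<gamma> (T s) D" "D \<noteq> 0" "\<And>w. w \<in> B \<Longrightarrow> 0 \<le> det2 D (w - \<gamma> (T s))"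
    by (rule \<gamma>_srd[of "T s"]) auto
  have "srd T s (1 / norm D)" using V_srd[OF D(1)] D(2) by (intro T_srd) auto
  then have "srd zz s ((1 / norm D) *\<^sub>R D)"
    unfolding zz_def using T_less
    by (intro srd_compose[where \<phi> = T and g = \<gamma> and D = D and \<epsilon> = 1] D(1) continuous_at_imp_continuous_at_within[OF T_isCont]) auto
  moreover have "norm ((1 / norm D) *\<^sub>R D) = 1" using D(2) by simp
  moreover have "0 \<le> det2 ((1 / norm D) *\<^sub>R D) (w - zz s)" if "w \<in> B" for w
    unfolding zz_def det2_simps(5) real_scaleR_def using D(3)[OF that] by (intro mult_nonneg_nonneg) auto
  ultimately show ?thesis by (rule that)
qed

lemma zz_lipschitz: "dist (zz s) (zz t) \<le> \<bar>t - s\<bar>"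
proof -
  have *: "dist (zz s) (zz t) \<le> t - s" if "s \<le> t" for s t
    using dist_le_curve_length[of s s t t zz] zz_length[OF that] that by (simp add: ennreal_le_iff)
  show ?thesis using *[of s t] *[of t s] by (cases "s \<le> t") (auto simp: dist_commute)
qed

lemma zz_bij: "bij_betw zz {0..<ell} (frontier B)"
  using bij_betw_trans[OF T_bij \<gamma>_bij] by (simp add: zz_def[abs_def] comp_def)

end

theorem exists_ccw_arclength_param:
  fixes K :: "(real^2) set"
  assumes K: "convex K" "bounded K" "interior K \<noteq> {}"
  shows "\<exists>L z. ccw_arclength_param K L z \<and> (\<forall>t. \<exists>d. srd z t d \<and> norm d = 1)"
proof -
  obtain c where c: "c \<in> interior K" using K(3) by blast
  define B where "B = (\<lambda>x. x - c) ` interior K"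
  have oB: "open B" unfolding B_def by (intro open_translation_subtract) simp
  have cB: "convex B" unfolding B_def using K(1) by (simp add: convex_interior)
  have "0 \<in> B" using c by (auto simp: B_def)
  then obtain \<rho> where \<rho>: "\<rho> > 0" "ball 0 \<rho> \<subseteq> B" using oB by (meson openE)
  have "bounded B" unfolding B_def using K(2) by (intro bounded_translation_minus) (rule bounded_interior)
  then obtain R where R: "B \<subseteq> ball 0 R" using bounded_subset_ballD by blast
  interpret gauge_body B \<rho> R using oB cB \<rho> R by unfold_locales
  define z where "z s = c + zz s" for s
  have srd: "\<exists>d. srd z s d \<and> norm d = 1 \<and> (\<forall>w\<in>K. 0 \<le> det2 d (w - z s))" for s
  proof -
    obtain d where d: "srd zz s d" "norm d = 1" "\<And>w. w \<in> B \<Longrightarrow> 0 \<le> det2 d (w - zz s)" by (rule zz_srd[of s]) auto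
    have "srd z s d" using d(1) unfolding srd_def by (simp add: quot_def[abs_def] z_def)
    moreover have "0 \<le> det2 d (w - z s)" if w: "w \<in> K" for w
    proof -
      have "closed {w. 0 \<le> det2 d (w - z s)}"
      proof -
        have "continuous_on UNIV (\<lambda>w. det2 d (w - z s))" unfolding det2_eq by (intro continuous_intros)
        then show ?thesis using closed_Collect_le[of "\<lambda>_. 0" "\<lambda>w. det2 d (w - z s)"] by simp
      qed
      moreover have "interior K \<subseteq> {w. 0 \<le> det2 d (w - z s)}"
      proof
        fix x assume "x \<in> interior K"
        then have "x - c \<in> B" by (auto simp: B_def)
        from d(3)[OF this] show "x \<in> {w. 0 \<le> det2 d (w - z s)}" by (simp add: z_def diff_diff_eq)
      qed
      ultimately have "closure (interior K) \<subseteq> {w. 0 \<le> det2 d (w - z s)}" by (intro closure_minimal)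
      then show ?thesis using w closure_subset convex_closure_interior[OF K(1,3)] by blast
    qed
    ultimately show ?thesis using d(2) by blast
  qed
  have "frontier K = frontier (interior K)"
    unfolding frontier_def using convex_closure_interior[OF K(1,3)] by simp
  also have "\<dots> = (+) c ` frontier B"
  proof -
    have "interior K = (+) c ` B" by (auto simp: B_def image_image)
    then show ?thesis by (simp add: frontier_translation)
  qed
  finally have fr: "frontier K = (+) c ` frontier B" .
  have lip: "dist (z s) (z t) \<le> \<bar>t - s\<bar>" for s t using zz_lipschitz[of s t] by (simp add: z_def dist_norm)
  have "ccw_arclength_param K ell z"
    unfolding ccw_arclength_param_def
  proof (intro conjI allI impI)
    show "z (t + ell) = z t" for t by (simp add: z_def zz_def T_shift \<gamma>_periodic)
    show "continuous_on UNIV z"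
    proof (rule continuous_onI)
      fix x e :: real assume "e > 0"
      moreover have "dist (z y) (z x) \<le> e" if "dist y x < e" for y
        using lip[of y x] that by (simp add: dist_real_def abs_minus_commute[of x y])
      ultimately show "\<exists>d>0. \<forall>y\<in>UNIV. dist y x < d \<longrightarrow> dist (z y) (z x) \<le> e" by blast
    qed
    have "bij_betw ((+) c) (frontier B) (frontier K)" unfolding fr by (rule bij_betw_imageI) auto
    then have "bij_betw ((+) c \<circ> zz) {0..<ell} (frontier K)" using zz_bij by (rule bij_betw_trans[rotated])
    then show "bij_betw z {0..<ell} (frontier K)" by (simp add: z_def[abs_def] comp_def)
    show "curve_length z s t = ennreal (t - s)" if "s \<le> t" for s t
    proof -
      have "curve_length z s t = curve_length zz s t" by (simp add: curve_length_def z_def)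
      then show ?thesis using zz_length[OF that] by simp
    qed
    show "\<exists>d. (z has_vector_derivative d) (at_right t) \<and> (\<forall>w\<in>K. 0 \<le> det2 d (w - z t))" for t
      using srd[of t] srd_at_right by blast
  qed (rule ell_pos)
  then show ?thesis using srd by blast
qed

section \<open>Local uniqueness and regularity\<close>

text \<open>The points at which \<open>g\<close> has lost at most \<open>\<epsilon>\<close> per unit
  length form a closed set. Its supremum belongs to it, and a nonnegative right derivative there
  produces a further point unless the supremum is \<open>b\<close>.\<close>

lemma mono_of_right_deriv:
  fixes g :: "real \<Rightarrow> real"
  assumes ab: "a \<le> b" and c: "continuous_on {a..b} g"
    and der: "\<And>t. a \<le> t \<Longrightarrow> t < b \<Longrightarrow> \<exists>g'\<ge>0. (g has_real_derivative g') (at_right t)"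
  shows "g a \<le> g b"
proof (rule field_le_epsilon)
  fix e :: real assume e: "e > 0"
  define \<epsilon> where "\<epsilon> = e / (b - a + 1)"
  have \<epsilon>: "\<epsilon> > 0" "\<epsilon> * (b - a) \<le> e" using e ab by (auto simp: \<epsilon>_def field_simps)
  define A where "A = {x \<in> {a..b}. g a - \<epsilon> * (x - a) \<le> g x}"
  have "closed A" unfolding A_def using c by (intro continuous_on_closed_Collect_le continuous_intros) auto
  have A: "a \<in> A" "bdd_above A" "A \<subseteq> {a..b}" using ab by (auto simp: A_def)
  define s where "s = Sup A"
  have s: "s \<in> A" unfolding s_def using \<open>closed A\<close> A by (intro closed_contains_Sup) auto
  have "s = b"
  proof (rule ccontr)
    assume "s \<noteq> b"
    then have sb: "a \<le> s" "s < b" using s A(3) by auto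
    obtain g' where g': "g' \<ge> 0" "(g has_real_derivative g') (at_right s)" using der[OF sb] by blast
    have "((\<lambda>y. (g y - g s) / (y - s)) \<longlongrightarrow> g') (at_right s)"
      using g'(2) unfolding has_field_derivative_iff .
    then have "\<forall>\<^sub>F y in at_right s. - \<epsilon> < (g y - g s) / (y - s)" using g'(1) \<epsilon>(1) by (intro order_tendstoD) auto
    moreover have "\<forall>\<^sub>F y in at_right s. y \<in> {s<..<b}" using sb by (intro eventually_at_right_real)
    ultimately have "\<forall>\<^sub>F y in at_right s. - \<epsilon> < (g y - g s) / (y - s) \<and> y \<in> {s<..<b}" by eventually_elim simp
    then obtain y where y: "- \<epsilon> < (g y - g s) / (y - s)" "s < y" "y < b"
      using eventually_happens'[OF trivial_limit_at_right_real[of s]] by fastforce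
    then have "g s - \<epsilon> * (y - s) \<le> g y" by (simp add: field_simps)
    moreover have "g a - \<epsilon> * (s - a) \<le> g s" using s by (simp add: A_def)
    ultimately have "g a - \<epsilon> * (y - a) \<le> g y" by (simp add: algebra_simps)
    then have "y \<in> A" using y sb by (simp add: A_def)
    then have "y \<le> s" unfolding s_def using A(2) by (rule cSup_upper)
    then show False using y by simp
  qed
  then show "g a \<le> g b + e" using s \<epsilon>(2) by (simp add: A_def)
qed

text \<open>A ray from an interior point meets the frontier at most once: whatever lies strictly
  between \<open>w\<close> and a point of the closure is interior.\<close>

lemma segment_frontier_contra:
  fixes K :: "(real^2) set"
  assumes "convex K" "w \<in> interior K" "p \<in> frontier K" "q \<in> closure K" "1 < l" "q - w = l *\<^sub>R (p - w)"
  shows False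
proof -
  have "q = w + l *\<^sub>R (p - w)" using assms(6) by (simp add: algebra_simps)
  moreover have "w \<noteq> p" using assms(2,3) by (auto simp: frontier_def)
  moreover have "p = (1 - 1 / l) *\<^sub>R w + (1 / l) *\<^sub>R (w + l *\<^sub>R (p - w))"
    using assms(5) by (simp add: scaleR_diff_left scaleR_add_right scaleR_diff_right)
  ultimately have "p \<in> open_segment w q"
    unfolding in_segment using assms(5) by (intro conjI exI[of _ "1 / l"]) auto
  then have "p \<in> interior K" using in_interior_closure_convex_segment[OF assms(1,2,4)] by blast
  then show False using assms(3) by (auto simp: frontier_def)
qed

text \<open>An arbitrary admissible parametrization, because the measure is defined through an
  unspecified choice of one.\<close>

locale param =
  fixes K :: "(real^2) set" and L :: real and z :: "real \<Rightarrow> real^2"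
  assumes cK: "convex K" and par: "ccw_arclength_param K L z"
begin

lemma L_pos: "0 < L" and period: "z (t + L) = z t" and contz: "continuous_on A z"
  and bij: "bij_betw z {0..<L} (frontier K)" and length: "s \<le> t \<Longrightarrow> curve_length z s t = ennreal (t - s)"
  using par continuous_on_subset[of UNIV z A] unfolding ccw_arclength_param_def by auto

lemma lipschitz: "dist (z s) (z t) \<le> \<bar>t - s\<bar>"
proof -
  have *: "dist (z s) (z t) \<le> t - s" if "s \<le> t" for s t
    using dist_le_curve_length[of s s t t z] length[OF that] that by (simp add: ennreal_le_iff)
  show ?thesis using *[of s t] *[of t s] by (cases "s \<le> t") (auto simp: dist_commute)
qed

lemma period_int: "z (t + of_int k * L) = z t"
proof (induction k rule: int_induct[of _ 0])
  case (step1 i)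
  then show ?case using period[of "t + of_int i * L"] by (simp add: algebra_simps)
next
  case (step2 i)
  then show ?case using period[of "t + of_int (i - 1) * L"] by (simp add: algebra_simps)
qed simp

lemma reduce: obtains k :: int where "s + of_int k * L \<in> {c..<c + L}"
proof -
  define k where "k = - \<lfloor>(s - c) / L\<rfloor>"
  have "s + of_int k * L \<in> {c..<c + L}"
    using floor_divide_lower[OF L_pos, of "s - c"] floor_divide_upper[OF L_pos, of "s - c"]
    by (simp add: k_def algebra_simps)
  then show ?thesis by (rule that)
qed

lemma inj_z: assumes eq: "z s = z t" and lt: "\<bar>s - t\<bar> < L" shows "s = t"
proof -
  obtain k :: int where k: "s + of_int k * L \<in> {0..<0 + L}" by (rule reduce)
  obtain j :: int where j: "t + of_int j * L \<in> {0..<0 + L}" by (rule reduce)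
  have "z (s + of_int k * L) = z (t + of_int j * L)" using eq by (simp add: period_int)
  then have e: "s + of_int k * L = t + of_int j * L"
    using k j bij by (auto simp: bij_betw_def dest: inj_onD)
  then have "s - t = of_int (j - k) * L" by (simp add: algebra_simps)
  then have "\<bar>of_int (j - k) :: real\<bar> * L < 1 * L" using lt L_pos by (simp add: abs_mult)
  then have "\<bar>of_int (j - k) :: real\<bar> < 1" using L_pos by (simp only: mult_less_cancel_right_pos)
  then have "j = k" by linarith
  then show ?thesis using e by simp
qed

lemma z_frontier: "z t \<in> frontier K"
proof -
  obtain k :: int where "t + of_int k * L \<in> {0..<0 + L}" by (rule reduce)
  then have "z (t + of_int k * L) \<in> frontier K" using bij by (auto simp: bij_betw_def)
  then show ?thesis by (simp add: period_int)
qed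

lemma z_closure: "z t \<in> closure K" using z_frontier[of t] by (auto simp: frontier_def)

lemma frontier_z: assumes "p \<in> frontier K" obtains t where "c \<le> t" "t < c + L" "z t = p"
proof -
  have "p \<in> z ` {0..<L}" using assms bij by (simp add: bij_betw_def)
  then obtain s where s: "z s = p" by blast
  obtain k :: int where "s + of_int k * L \<in> {c..<c + L}" by (rule reduce)
  then show ?thesis using s by (intro that[of "s + of_int k * L"]) (auto simp: period_int)
qed

abbreviation "d \<equiv> right_deriv z"

lemma d_deriv: "(z has_vector_derivative d t) (at_right t)" and d_supp_K: "w \<in> K \<Longrightarrow> 0 \<le> det2 (d t) (w - z t)"
proof -
  obtain v where v: "(z has_vector_derivative v) (at_right t)" "\<forall>w\<in>K. 0 \<le> det2 v (w - z t)"
    using par unfolding ccw_arclength_param_def by blast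
  have "d t = v" unfolding right_deriv_def using v(1) by (intro vector_derivative_within) auto
  then show "(z has_vector_derivative d t) (at_right t)" "w \<in> K \<Longrightarrow> 0 \<le> det2 (d t) (w - z t)" using v by auto
qed

lemma d_supp: assumes "w \<in> closure K" shows "0 \<le> det2 (d t) (w - z t)"
proof -
  have "continuous_on UNIV (\<lambda>w. det2 (d t) (w - z t))" unfolding det2_eq by (intro continuous_intros)
  then have "closed {w. 0 \<le> det2 (d t) (w - z t)}" using closed_Collect_le[of "\<lambda>_. 0" "\<lambda>w. det2 (d t) (w - z t)"] by simp
  then have "closure K \<subseteq> {w. 0 \<le> det2 (d t) (w - z t)}" using d_supp_K by (intro closure_minimal) auto
  then show ?thesis using assms by blast
qed

text \<open>\<open>a s / b s\<close> is the tangent of the angle between \<open>z t0 - w\<close> and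
  \<open>z s - w\<close>. Its right derivative has the sign of \<open>det2 (d t) (w - z t)\<close>,
  which is nonnegative because \<open>w\<close> lies to the left of the tangent. Equal angles would
  put two frontier points on one ray from \<open>w\<close>.\<close>

lemma orientation:
  assumes w: "w \<in> interior K"
  shows "\<exists>\<delta>>0. \<delta> < L / 2 \<and> (\<forall>s s'. t0 - \<delta> < s \<longrightarrow> s < s' \<longrightarrow> s' < t0 + \<delta> \<longrightarrow> 0 < det2 (z s - w) (z s' - w))"
proof -
  define e where "e = z t0 - w"
  have e0: "e \<noteq> 0" using w z_frontier[of t0] by (auto simp: e_def frontier_def)
  define b where "b s = e \<bullet> (z s - w)" for s
  have cb: "continuous_on A b" for A unfolding b_def by (intro continuous_intros contz)
  have "b t0 > 0" using e0 by (simp add: b_def e_def[symmetric])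
  moreover have "isCont b t0" using cb[of UNIV] by (simp add: continuous_on_eq_continuous_at)
  ultimately have "\<forall>\<^sub>F s in at t0. 0 < b s" by (auto simp: isCont_def order_tendsto_iff)
  then obtain \<delta>1 where \<delta>1: "\<delta>1 > 0" "\<And>s. s \<noteq> t0 \<Longrightarrow> \<bar>s - t0\<bar> < \<delta>1 \<Longrightarrow> 0 < b s"
    unfolding eventually_at by (auto simp: dist_real_def)
  define \<delta> where "\<delta> = min \<delta>1 (L / 3)"
  have \<delta>: "\<delta> > 0" "\<delta> < L / 2" using \<delta>1(1) L_pos by (auto simp: \<delta>_def)
  have bpos: "0 < b s" if "t0 - \<delta> < s" "s < t0 + \<delta>" for s
  proof -
    have "\<delta> \<le> \<delta>1" by (simp add: \<delta>_def)
    then have "\<bar>s - t0\<bar> < \<delta>1" using that by linarith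
    then show ?thesis using \<delta>1(2)[of s] \<open>b t0 > 0\<close> by (cases "s = t0") auto
  qed
  define a where "a s = det2 e (z s - w)" for s
  have key: "(e \<bullet> e) * det2 (z s - w) (z s' - w) = b s * a s' - b s' * a s" for s s'
    unfolding a_def b_def by (rule det2_inner_identity[symmetric])
  have "0 < det2 (z s - w) (z s' - w)" if s: "t0 - \<delta> < s" "s < s'" "s' < t0 + \<delta>" for s s'
  proof -
    have "a s / b s \<le> a s' / b s'"
    proof (rule mono_of_right_deriv[where g = "\<lambda>s. a s / b s"])
      have "continuous_on {s..s'} a" unfolding a_def det2_eq by (intro continuous_intros contz)
      moreover have "b r \<noteq> 0" if "r \<in> {s..s'}" for r
        using bpos[of r] that s by auto
      ultimately show "continuous_on {s..s'} (\<lambda>s. a s / b s)" using cb by (intro continuous_on_divide ballI)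
      fix t assume t: "s \<le> t" "t < s'"
      have bt: "0 < b t" using bpos[of t] t s by simp
      have zd: "((\<lambda>s. z s - w) has_vector_derivative d t) (at_right t)"
        using has_vector_derivative_diff[OF d_deriv[of t] has_vector_derivative_const[of w]] by simp
      have "(b has_real_derivative e \<bullet> d t) (at_right t)"
        unfolding b_def has_real_derivative_iff_has_vector_derivative
        by (rule bounded_linear.has_vector_derivative[OF bounded_linear_inner_right zd])
      moreover have "(a has_real_derivative det2 e (d t)) (at_right t)"
        unfolding a_def has_real_derivative_iff_has_vector_derivative
        by (rule bounded_linear.has_vector_derivative[OF bounded_bilinear.bounded_linear_right[OF bounded_bilinear_det2] zd])
      ultimately have "((\<lambda>s. a s / b s) has_real_derivative (det2 e (d t) * b t - a t * (e \<bullet> d t)) / (b t * b t)) (at_right t)"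
        using bt by (intro DERIV_divide) auto
      moreover have "det2 e (d t) * b t - a t * (e \<bullet> d t) = (e \<bullet> e) * det2 (z t - w) (d t)"
        unfolding a_def b_def by (subst det2_inner_identity[symmetric]) (simp add: mult_ac)
      moreover have "det2 (z t - w) (d t) = det2 (d t) (w - z t)" by (simp add: det2_eq algebra_simps)
      moreover have "0 \<le> det2 (d t) (w - z t)" using w interior_subset by (intro d_supp_K) blast
      ultimately show "\<exists>g'\<ge>0. ((\<lambda>s. a s / b s) has_real_derivative g') (at_right t)"
        using bt by (intro exI[of _ "(e \<bullet> e) * det2 (z t - w) (d t) / (b t * b t)"]) auto
    qed (use s in simp)
    moreover have bs: "0 < b s" "0 < b s'" using bpos s by auto
    ultimately have "0 \<le> b s * a s' - b s' * a s" by (simp add: field_simps)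
    then have ge: "0 \<le> (e \<bullet> e) * det2 (z s - w) (z s' - w)" unfolding key .
    have "det2 (z s - w) (z s' - w) \<noteq> 0"
    proof
      assume 0: "det2 (z s - w) (z s' - w) = 0"
      \<comment> \<open>If the determinant vanishes, both coordinates of this combination relative
        to \<open>e\<close> are 0, so the two vectors are positive multiples of each other.\<close>
      define x where "x = b s *\<^sub>R (z s' - w) - b s' *\<^sub>R (z s - w)"
      have "e \<bullet> x = 0" by (simp add: x_def inner_diff_right b_def mult.commute)
      moreover have "det2 e x = 0" using key[of s s'] 0 by (simp add: x_def det2_simps a_def)
      moreover have "(det2 e x)\<^sup>2 + (e \<bullet> x)\<^sup>2 = (e \<bullet> e) * (x \<bullet> x)"
        by (simp add: det2_eq inner_real2 algebra_simps power2_eq_square)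
      ultimately have "x = 0" using e0 by simp
      then have eq: "z s' - w = (b s' / b s) *\<^sub>R (z s - w)" "z s - w = (b s / b s') *\<^sub>R (z s' - w)"
      proof -
        have h: "b s *\<^sub>R (z s' - w) = b s' *\<^sub>R (z s - w)" using \<open>x = 0\<close> by (simp add: x_def)
        show "z s' - w = (b s' / b s) *\<^sub>R (z s - w)"
          using arg_cong[OF h, of "\<lambda>v. (1 / b s) *\<^sub>R v"] bs by simp
        show "z s - w = (b s / b s') *\<^sub>R (z s' - w)"
          using arg_cong[OF h, of "\<lambda>v. (1 / b s') *\<^sub>R v"] bs by simp
      qed
      consider "b s' = b s" | "b s < b s'" | "b s' < b s" by linarith
      then show False
      proof cases
        case 1
        then have "z s = z s'" using eq bs by simp
        then have "s = s'" using s \<delta>(2) by (intro inj_z) auto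
        then show False using s by simp
      next
        case 2
        then show False using segment_frontier_contra[OF cK w z_frontier z_closure _ eq(1)] bs by simp
      next
        case 3
        then show False using segment_frontier_contra[OF cK w z_frontier z_closure _ eq(2)] bs by simp
      qed
    qed
    moreover have "0 < e \<bullet> e" using e0 by simp
    then have "0 \<le> det2 (z s - w) (z s' - w)" using ge by (meson mult_pos_neg not_less)
    ultimately show ?thesis by simp
  qed
  then show ?thesis using \<delta> by blast
qed

text \<open>The part of a period away from \<open>s0\<close> is a compact arc, and by injectivity it
  misses \<open>z s0\<close>.\<close>

lemma local_cover:
  assumes \<delta>: "0 < \<delta>" "\<delta> < L / 2"
  shows "\<exists>r>0. \<forall>p\<in>frontier K. dist p (z s0) < r \<longrightarrow> (\<exists>k. \<bar>k\<bar> < \<delta> \<and> p = z (s0 + k))"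
proof -
  define C where "C = z ` {s0 + \<delta>..s0 + L - \<delta>}"
  have "compact C" unfolding C_def by (intro compact_continuous_image contz) simp
  then have "open (- C)" by (simp add: compact_imp_closed open_Compl)
  moreover have "z s0 \<notin> C"
  proof
    assume "z s0 \<in> C"
    then obtain s where s: "s0 + \<delta> \<le> s" "s \<le> s0 + L - \<delta>" "z s0 = z s" by (auto simp: C_def)
    then have "s0 = s" using \<delta> by (intro inj_z) auto
    then show False using s \<delta> by simp
  qed
  ultimately obtain r where r: "r > 0" "ball (z s0) r \<subseteq> - C" by (meson ComplI openE)
  have "\<exists>k. \<bar>k\<bar> < \<delta> \<and> p = z (s0 + k)" if p: "p \<in> frontier K" "dist p (z s0) < r" for p
  proof -
    obtain t where t: "s0 - \<delta> \<le> t" "t < s0 - \<delta> + L" "z t = p" using frontier_z[OF p(1), of "s0 - \<delta>"] by blast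
    have "p \<notin> C" using r(2) p(2) by (auto simp: dist_commute)
    then have "t < s0 + \<delta>" using t by (force simp: C_def)
    moreover have "t \<noteq> s0 - \<delta>"
    proof
      assume "t = s0 - \<delta>"
      then have "t + L \<in> {s0 + \<delta>..s0 + L - \<delta>}" using \<delta> by simp
      then have "z (t + L) \<in> C" unfolding C_def by (rule imageI)
      then show False using \<open>p \<notin> C\<close> period[of t] t(3) by simp
    qed
    ultimately show ?thesis using t by (intro exI[of _ "t - s0"]) auto
  qed
  then show ?thesis using r(1) by blast
qed

end

text \<open>Near \<open>t0\<close> the first curve runs on the second frontier, where its points
  have parameters \<open>s0 + k h\<close>. Both curves turn around \<open>w\<close> in the same
  sense, so \<open>k\<close> is increasing. Chains on the first arc are therefore chains on the
  second, and its length is at most as large.\<close>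

lemma local_half:
  assumes p1: "param K1 L1 z1" and p2: "param K2 L2 z2" and w: "w \<in> interior K1" "w \<in> interior K2"
    and U: "open U" "frontier K1 \<inter> U \<subseteq> frontier K2" and eq: "z1 t0 = z2 s0" "z1 t0 \<in> U" and \<delta>: "0 < \<delta>"
  shows "\<exists>\<epsilon>>0. \<exists>k. k 0 = 0 \<and> (\<forall>h. \<bar>h\<bar> < \<epsilon> \<longrightarrow> \<bar>k h\<bar> < \<delta> \<and> z1 (t0 + h) = z2 (s0 + k h))
     \<and> (\<forall>h h'. - \<epsilon> < h \<longrightarrow> h < h' \<longrightarrow> h' < \<epsilon> \<longrightarrow> h' - h \<le> k h' - k h)"
proof -
  interpret P1: param K1 L1 z1 by fact
  interpret P2: param K2 L2 z2 by fact
  obtain \<delta>1 where \<delta>1: "\<delta>1 > 0" "\<delta>1 < L1 / 2" "\<And>s s'. t0 - \<delta>1 < s \<Longrightarrow> s < s' \<Longrightarrow> s' < t0 + \<delta>1 \<Longrightarrow> 0 < det2 (z1 s - w) (z1 s' - w)"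
    using P1.orientation[OF w(1), of t0] by blast
  obtain \<delta>2 where \<delta>2: "\<delta>2 > 0" "\<delta>2 < L2 / 2" "\<And>s s'. s0 - \<delta>2 < s \<Longrightarrow> s < s' \<Longrightarrow> s' < s0 + \<delta>2 \<Longrightarrow> 0 < det2 (z2 s - w) (z2 s' - w)"
    using P2.orientation[OF w(2), of s0] by blast
  define \<delta>' where "\<delta>' = min \<delta> \<delta>2"
  have \<delta>': "0 < \<delta>'" "\<delta>' < L2 / 2" using \<delta> \<delta>2 by (auto simp: \<delta>'_def)
  obtain r where r: "r > 0" "\<And>p. p \<in> frontier K2 \<Longrightarrow> dist p (z2 s0) < r \<Longrightarrow> \<exists>k. \<bar>k\<bar> < \<delta>' \<and> p = z2 (s0 + k)"
    using P2.local_cover[OF \<delta>', of s0] by blast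
  obtain u where u: "u > 0" "ball (z1 t0) u \<subseteq> U" using U(1) eq(2) by (meson openE)
  define \<epsilon> where "\<epsilon> = min \<delta>1 (min r u)"
  have \<epsilon>: "\<epsilon> > 0" using \<delta>1 r u by (simp add: \<epsilon>_def)
  have ex: "\<exists>k. \<bar>k\<bar> < \<delta>' \<and> z1 (t0 + h) = z2 (s0 + k)" if h: "\<bar>h\<bar> < \<epsilon>" for h
  proof -
    have dz: "dist (z1 (t0 + h)) (z1 t0) < min r u"
      using P1.lipschitz[of "t0 + h" t0] h by (simp add: \<epsilon>_def)
    then have "z1 (t0 + h) \<in> U" using u(2) by (auto simp: dist_commute)
    then have "z1 (t0 + h) \<in> frontier K2" using U(2) P1.z_frontier by blast
    then show ?thesis using r(2) dz eq by simp
  qed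
  define k where "k h = (if h = 0 then 0 else SOME k. \<bar>k\<bar> < \<delta>' \<and> z1 (t0 + h) = z2 (s0 + k))" for h
  have k: "\<bar>k h\<bar> < \<delta>'" "z1 (t0 + h) = z2 (s0 + k h)" if "\<bar>h\<bar> < \<epsilon>" for h
    using someI_ex[OF ex[OF that]] \<delta>'(1) eq by (auto simp: k_def)
  have kmono: "k h < k h'" if h: "- \<epsilon> < h" "h < h'" "h' < \<epsilon>" for h h'
  proof (rule ccontr)
    assume "\<not> k h < k h'"
    have hb: "\<bar>h\<bar> < \<epsilon>" "\<bar>h'\<bar> < \<epsilon>" using h by auto
    have "0 < det2 (z1 (t0 + h) - w) (z1 (t0 + h') - w)" using h by (intro \<delta>1(3)) (auto simp: \<epsilon>_def)
    then have pos: "0 < det2 (z2 (s0 + k h) - w) (z2 (s0 + k h') - w)" using k(2)[OF hb(1)] k(2)[OF hb(2)] by simp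
    have anti: "det2 a b = - det2 b a" "det2 a a = 0" for a b by (auto simp: det2_eq)
    show False
    proof (cases "k h = k h'")
      case True then show False using pos anti(2) by simp
    next
      case False
      then have "0 < det2 (z2 (s0 + k h') - w) (z2 (s0 + k h) - w)"
        using \<open>\<not> k h < k h'\<close> k(1)[OF hb(1)] k(1)[OF hb(2)] by (intro \<delta>2(3)) (auto simp: \<delta>'_def)
      then show False using pos anti(1)[of "z2 (s0 + k h) - w"] by simp
    qed
  qed
  have "h' - h \<le> k h' - k h" if h: "- \<epsilon> < h" "h < h'" "h' < \<epsilon>" for h h'
  proof -
    have "ennreal (h' - h) = curve_length z1 (t0 + h) (t0 + h')" using P1.length[of "t0 + h" "t0 + h'"] h by simp
    also have "\<dots> = curve_length (\<lambda>x. z2 (s0 + k (x - t0))) (t0 + h) (t0 + h')"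
    proof (rule curve_length_cong)
      fix s assume "t0 + h \<le> s" "s \<le> t0 + h'"
      then have "\<bar>s - t0\<bar> < \<epsilon>" using h by auto
      from k(2)[OF this] show "z1 s = z2 (s0 + k (s - t0))" by simp
    qed
    also have "\<dots> \<le> curve_length z2 (s0 + k (t0 + h - t0)) (s0 + k (t0 + h' - t0))"
    proof (rule curve_length_reparam_le[where \<phi> = "\<lambda>x. s0 + k (x - t0)"])
      fix s t assume st: "t0 + h \<le> s" "s \<le> t" "t \<le> t0 + h'"
      then show "s0 + k (s - t0) \<le> s0 + k (t - t0)"
        using kmono[of "s - t0" "t - t0"] h by (cases "s = t") auto
    qed
    also have "\<dots> = ennreal (k h' - k h)" using P2.length[of "s0 + k h" "s0 + k h'"] kmono[OF h] by simp
    finally show ?thesis using kmono[OF h] by (simp add: ennreal_le_iff)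
  qed
  moreover have "k 0 = 0" by (simp add: k_def)
  ultimately show ?thesis using \<epsilon> k unfolding \<delta>'_def by (intro exI[of _ \<epsilon>] conjI exI[of _ k]) auto
qed

text \<open>The correspondences in the two directions both expand distances, and
  \<open>j (k h) = h\<close>; so each of them is the identity near 0.\<close>

lemma local_unique:
  assumes p1: "param K1 L1 z1" and p2: "param K2 L2 z2" and w: "w \<in> interior K1" "w \<in> interior K2"
    and U: "open U" "frontier K1 \<inter> U = frontier K2 \<inter> U" and eq: "z1 t0 = z2 s0" "z1 t0 \<in> U"
  shows "\<exists>\<epsilon>>0. \<forall>h. \<bar>h\<bar> < \<epsilon> \<longrightarrow> z1 (t0 + h) = z2 (s0 + h)"
proof -
  interpret P1: param K1 L1 z1 by fact
  interpret P2: param K2 L2 z2 by fact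
  have L1: "0 < L1 / 2" using P1.L_pos by simp
  have U2: "frontier K2 \<inter> U \<subseteq> frontier K1" "frontier K1 \<inter> U \<subseteq> frontier K2" "z2 s0 \<in> U" using U(2) eq by auto
  from local_half[OF p2 p1 w(2,1) U(1) U2(1) eq(1)[symmetric] U2(3) L1]
  obtain \<epsilon>2 :: real and j :: "real \<Rightarrow> real" where j: "\<epsilon>2 > 0" "j 0 = 0"
    "\<forall>h. \<bar>h\<bar> < \<epsilon>2 \<longrightarrow> \<bar>j h\<bar> < L1 / 2 \<and> z2 (s0 + h) = z1 (t0 + j h)"
    "\<forall>h h'. - \<epsilon>2 < h \<longrightarrow> h < h' \<longrightarrow> h' < \<epsilon>2 \<longrightarrow> h' - h \<le> j h' - j h" by blast
  from local_half[OF p1 p2 w U(1) U2(2) eq j(1)]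
  obtain \<epsilon>1 :: real and k :: "real \<Rightarrow> real" where k: "\<epsilon>1 > 0" "k 0 = 0"
    "\<forall>h. \<bar>h\<bar> < \<epsilon>1 \<longrightarrow> \<bar>k h\<bar> < \<epsilon>2 \<and> z1 (t0 + h) = z2 (s0 + k h)"
    "\<forall>h h'. - \<epsilon>1 < h \<longrightarrow> h < h' \<longrightarrow> h' < \<epsilon>1 \<longrightarrow> h' - h \<le> k h' - k h" by blast
  note j3 = j(3)[rule_format] and j4 = j(4)[rule_format] and k3 = k(3)[rule_format] and k4 = k(4)[rule_format]
  have "z1 (t0 + h) = z2 (s0 + h)" if h: "\<bar>h\<bar> < min \<epsilon>1 (L1 / 2)" for h
  proof -
    have h1: "\<bar>h\<bar> < \<epsilon>1" "\<bar>h\<bar> < L1 / 2" using h by auto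
    have kh: "\<bar>k h\<bar> < \<epsilon>2" using k3[OF h1(1)] by blast
    have "z1 (t0 + h) = z1 (t0 + j (k h))" using k3[OF h1(1)] j3[OF kh] by simp
    moreover have "\<bar>j (k h)\<bar> < L1 / 2" using j3[OF kh] by blast
    ultimately have jk: "j (k h) = h" using P1.inj_z[of "t0 + h" "t0 + j (k h)"] h1(2) by linarith
    consider "h = 0" | "h > 0" | "h < 0" by linarith
    then have "k h = h"
    proof cases
      case 2
      then have "h \<le> k h" using k4[of 0 h] k(1,2) h1 by auto
      moreover have "k h \<le> h" using j4[of 0 "k h"] j(1,2) jk kh \<open>h \<le> k h\<close> 2 by auto
      ultimately show ?thesis by simp
    next
      case 3
      then have "- h \<le> - k h" using k4[of h 0] k(1,2) h1 by auto
      moreover have "- k h \<le> - h" using j4[of "k h" 0] j(1,2) jk kh \<open>- h \<le> - k h\<close> 3 by auto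
      ultimately show ?thesis by simp
    qed (use k in simp)
    then show ?thesis using k3[OF h1(1)] by simp
  qed
  then show ?thesis using k(1) L1 by (intro exI[of _ "min \<epsilon>1 (L1 / 2)"]) auto
qed

section \<open>Regularity of the right derivative\<close>

lemma right_deriv_seq:
  fixes g :: "real \<Rightarrow> 'a::real_normed_vector"
  assumes "(g has_vector_derivative D) (at_right t)"
  shows "(\<lambda>n. real (Suc n) *\<^sub>R (g (t + 1 / real (Suc n)) - g t)) \<longlonglongrightarrow> D"
proof (rule metric_LIMSEQ_I)
  fix e :: real assume e: "e > 0"
  obtain \<delta> where \<delta>: "\<delta> > 0" "\<forall>y\<in>{t<..}. norm (y - t) < \<delta> \<longrightarrow> norm (g y - g t - (y - t) *\<^sub>R D) \<le> e / 2 * norm (y - t)"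
    using assms e unfolding has_vector_derivative_def has_derivative_within_alt by (meson half_gt_zero)
  obtain N where N: "inverse (real (Suc N)) < \<delta>" using reals_Archimedean[OF \<delta>(1)] by blast
  have "dist (real (Suc n) *\<^sub>R (g (t + 1 / real (Suc n)) - g t)) D < e" if "n \<ge> N" for n
  proof -
    define h where "h = 1 / real (Suc n)"
    have h: "h > 0" "real (Suc n) = 1 / h" by (auto simp: h_def)
    have "h \<le> inverse (real (Suc N))" using that by (simp add: h_def field_simps)
    then have "h < \<delta>" using N by simp
    then have *: "norm (g (t + h) - g t - h *\<^sub>R D) \<le> e / 2 * h" using \<delta>(2)[rule_format, of "t + h"] h by simp
    have "(1 / h) *\<^sub>R (g (t + h) - g t) - D = (1 / h) *\<^sub>R (g (t + h) - g t - h *\<^sub>R D)"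
      using h by (simp add: scaleR_diff_right)
    then have "norm ((1 / h) *\<^sub>R (g (t + h) - g t) - D) = norm (g (t + h) - g t - h *\<^sub>R D) / h" using h by simp
    also have "\<dots> \<le> e / 2" using * h by (simp add: divide_le_eq)
    also have "\<dots> < e" using e by simp
    finally have "norm (real (Suc n) *\<^sub>R (g (t + h) - g t) - D) < e" unfolding h(2) .
    then show ?thesis unfolding dist_norm h_def .
  qed
  then show "\<exists>no. \<forall>n\<ge>no. dist (real (Suc n) *\<^sub>R (g (t + 1 / real (Suc n)) - g t)) D < e" by blast
qed

text \<open>On each bounded interval, the supremum of the points up to which \<open>N\<close> is
  negligible is again such a point and can be pushed further to the right. Right neighbourhoods are
  what right-continuity of the tangent provides.\<close>

lemma negligible_of_right_local:
  fixes N :: "real set"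
  assumes loc: "\<And>t. \<exists>u>t. negligible (N \<inter> {t..<u})"
  shows "negligible N"
proof -
  have int: "negligible (N \<inter> {a..b})" if ab: "a \<le> b" for a b
  proof -
    define A where "A = {x \<in> {a..b}. negligible (N \<inter> {a..x})}"
    have "negligible (N \<inter> {a..a})" by (rule negligible_subset[of "{a}"]) auto
    then have A: "a \<in> A" "bdd_above A" using ab by (auto simp: A_def)
    define s where "s = Sup A"
    have "s \<le> b" unfolding s_def using A(1) by (intro cSup_least) (auto simp: A_def)
    then have s: "a \<le> s" "s \<le> b" unfolding s_def using A by (auto intro: cSup_upper)
    have "negligible (\<Union>n. N \<inter> {a..s - inverse (real (Suc n))})"
    proof (intro negligible_countable_Union)
      show "negligible S" if S: "S \<in> range (\<lambda>n. N \<inter> {a..s - inverse (real (Suc n))})" for S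
      proof -
        obtain n where n: "S = N \<inter> {a..s - inverse (real (Suc n))}" using S by blast
        have "s - inverse (real (Suc n)) < Sup A" unfolding s_def[symmetric] by (simp del: of_nat_Suc)
        then obtain x where x: "x \<in> A" "s - inverse (real (Suc n)) < x" using less_cSup_iff[of A] A by blast
        have "negligible (N \<inter> {a..x})" using x(1) by (simp add: A_def)
        moreover have "S \<subseteq> N \<inter> {a..x}" unfolding n using x(2) by (intro Int_mono order_refl atLeastatMost_subset_iff[THEN iffD2]) linarith
        ultimately show ?thesis by (rule negligible_subset)
      qed
    qed auto
    then have "negligible ((\<Union>n. N \<inter> {a..s - inverse (real (Suc n))}) \<union> {s})" by (intro negligible_Un) auto
    then have ns: "negligible (N \<inter> {a..s})"
    proof (rule negligible_subset)
      show "N \<inter> {a..s} \<subseteq> (\<Union>n. N \<inter> {a..s - inverse (real (Suc n))}) \<union> {s}"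
      proof
        fix x assume x: "x \<in> N \<inter> {a..s}"
        show "x \<in> (\<Union>n. N \<inter> {a..s - inverse (real (Suc n))}) \<union> {s}"
        proof (cases "x = s")
          case False
          then have "0 < s - x" using x by simp
          then obtain n where "inverse (real (Suc n)) < s - x" using reals_Archimedean by blast
          then show ?thesis using x by (intro UnI1 UN_I[of n]) auto
        qed simp
      qed
    qed
    have "s = b"
    proof (rule ccontr)
      assume "s \<noteq> b"
      then have "s < b" using s by simp
      obtain u where u: "u > s" "negligible (N \<inter> {s..<u})" using loc by blast
      define x where "x = min b ((s + u) / 2)"
      have x: "s < x" "x \<le> b" "x < u" using u \<open>s < b\<close> by (auto simp: x_def min_def)
      have "negligible (N \<inter> {a..s} \<union> N \<inter> {s..<u})" using ns u(2) by (rule negligible_Un)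
      then have "negligible (N \<inter> {a..x})" by (rule negligible_subset) (use x in auto)
      then have "x \<in> A" using x s by (simp add: A_def)
      then have "x \<le> s" unfolding s_def using A(2) by (rule cSup_upper)
      then show False using x by simp
    qed
    then show ?thesis using ns by simp
  qed
  have "negligible (\<Union>n. N \<inter> {- real n..real n})"
    by (intro negligible_countable_Union) (auto intro!: int)
  then show ?thesis
  proof (rule negligible_subset)
    show "N \<subseteq> (\<Union>n. N \<inter> {- real n..real n})"
    proof
      fix x assume "x \<in> N"
      obtain n where "\<bar>x\<bar> \<le> real n" using real_arch_simple by blast
      then show "x \<in> (\<Union>n. N \<inter> {- real n..real n})" using \<open>x \<in> N\<close> by (intro UN_I[of n]) auto
    qed
  qed
qed

locale bounded_param = param +
  assumes bK: "bounded K" and iK: "interior K \<noteq> {}"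
begin

text \<open>The constructed parametrization has these properties everywhere, and by
  \<open>local_unique\<close> with the whole plane as \<open>U\<close> any other one is locally a
  shift of it.\<close>

lemma srd_d: "srd z t (d t)" and norm_d: "norm (d t) = 1"
proof -
  obtain L0 z0 where p0: "ccw_arclength_param K L0 z0" and s0: "\<forall>t. \<exists>D. srd z0 t D \<and> norm D = 1"
    using exists_ccw_arclength_param[OF cK bK iK] by blast
  interpret P0: param K L0 z0 using cK p0 by unfold_locales
  obtain s where s: "z0 s = z t" using P0.frontier_z[OF z_frontier[of t], of 0] by metis
  obtain w where w: "w \<in> interior K" using iK by blast
  have "\<exists>\<epsilon>>0. \<forall>h. \<bar>h\<bar> < \<epsilon> \<longrightarrow> z0 (s + h) = z (t + h)"
    by (rule local_unique[where U = UNIV, OF P0.param_axioms param_axioms w w]) (auto simp: s)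
  then obtain \<epsilon> where \<epsilon>: "0 < \<epsilon>" "\<And>h. \<bar>h\<bar> < \<epsilon> \<Longrightarrow> z0 (s + h) = z (t + h)" by blast
  obtain D where D: "srd z0 s D" "norm D = 1" using s0 by blast
  have "srd (\<lambda>x. z0 (x + (s - t))) t D" using srd_shift[OF D(1), of "s - t"] by simp
  then have *: "srd z t D" using \<epsilon>(1)
  proof (rule srd_cong)
    fix x assume "t \<le> x" "x < t + \<epsilon>"
    then show "z0 (x + (s - t)) = z x" using \<epsilon>(2)[of "x - t"] by (simp add: algebra_simps)
  qed
  have "d t = D" unfolding right_deriv_def using srd_at_right[OF *] by (intro vector_derivative_within) auto
  then show "srd z t (d t)" "norm (d t) = 1" using * D(2) by auto
qed

text \<open>Strict differentiability at \<open>t\<close> controls the short chords starting at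
  \<open>a\<close>, and these chords approximate \<open>d a\<close>.\<close>

lemma d_near: assumes e: "e > 0" shows "\<exists>\<delta>>0. \<forall>a. t \<le> a \<longrightarrow> a < t + \<delta> \<longrightarrow> norm (d a - d t) \<le> e"
proof -
  obtain \<delta> where \<delta>: "\<delta> > 0" "\<And>a b. t \<le> a \<Longrightarrow> a < b \<Longrightarrow> b < t + \<delta> \<Longrightarrow> norm (z b - z a - (b - a) *\<^sub>R d t) \<le> e * (b - a)"
    using srd_d[of t] e unfolding srd_iff by blast
  have "norm (d a - d t) \<le> e" if a: "t \<le> a" "a < t + \<delta>" for a
  proof (rule field_le_epsilon)
    fix \<eta> :: real assume "\<eta> > 0"
    then obtain \<delta>' where \<delta>': "\<delta>' > 0" "\<And>c b. a \<le> c \<Longrightarrow> c < b \<Longrightarrow> b < a + \<delta>' \<Longrightarrow> norm (z b - z c - (b - c) *\<^sub>R d a) \<le> \<eta> * (b - c)"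
      using srd_d[of a] unfolding srd_iff by blast
    obtain b where b: "a < b" "b < min (t + \<delta>) (a + \<delta>')" using dense[of a "min (t + \<delta>) (a + \<delta>')"] a \<delta>'(1) by auto
    have "(b - a) * norm (d a - d t) = norm ((b - a) *\<^sub>R (d a - d t))" using b by simp
    also have "(b - a) *\<^sub>R (d a - d t) = (z b - z a - (b - a) *\<^sub>R d t) - (z b - z a - (b - a) *\<^sub>R d a)"
      by (simp add: scaleR_diff_right)
    also have "norm \<dots> \<le> e * (b - a) + \<eta> * (b - a)"
      using norm_triangle_ineq4[of "z b - z a - (b - a) *\<^sub>R d t" "z b - z a - (b - a) *\<^sub>R d a"]
        \<delta>(2)[of a b] \<delta>'(2)[of a b] a b by simp
    also have "\<dots> = (b - a) * (e + \<eta>)" by (simp add: algebra_simps)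
    finally show "norm (d a - d t) \<le> e + \<eta>" using b by simp
  qed
  then show ?thesis using \<delta>(1) by blast
qed

lemma d_right_continuous: "continuous (at_right t) d"
proof -
  have "(d \<longlongrightarrow> d t) (at_right t)"
    unfolding tendsto_iff
  proof (intro allI impI)
    fix e :: real assume e: "e > 0"
    obtain \<delta> where \<delta>: "\<delta> > 0" "\<And>a. t \<le> a \<Longrightarrow> a < t + \<delta> \<Longrightarrow> norm (d a - d t) \<le> e / 2" using d_near[of "e / 2" t] e by auto
    have "dist (d a) (d t) < e" if "t < a" "a < t + \<delta>" for a
    proof -
      have "norm (d a - d t) \<le> e / 2" using that by (intro \<delta>(2)) auto
      then show ?thesis using e by (simp add: dist_norm)
    qed
    then show "\<forall>\<^sub>F a in at_right t. dist (d a) (d t) < e"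
      unfolding eventually_at_right_field using \<delta>(1) by (intro exI[of _ "t + \<delta>"]) auto
  qed
  then show ?thesis by (simp add: continuous_within)
qed

lemma borel_measurable_z: "z \<in> borel_measurable borel"
  by (intro borel_measurable_continuous_onI contz)

lemma borel_measurable_d: "d \<in> borel_measurable borel"
proof (rule borel_measurable_LIMSEQ_metric)
  note borel_measurable_z[measurable]
  show "(\<lambda>t. real (Suc n) *\<^sub>R (z (t + 1 / real (Suc n)) - z t)) \<in> borel_measurable borel" for n by measurable
  show "(\<lambda>n. real (Suc n) *\<^sub>R (z (t + 1 / real (Suc n)) - z t)) \<longlonglongrightarrow> d t" for t
    using d_deriv by (rule right_deriv_seq)
qed

text \<open>A mean value inequality that uses right derivatives only: the increment \<open>X\<close>
  of \<open>z s - s *\<^sub>R d t\<close> is paired with itself, so that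
  \<open>mono_of_right_deriv\<close> applies to a real function.\<close>

lemma z_vector_derivative:
  assumes c: "isCont d t"
  shows "(z has_vector_derivative d t) (at t)"
  unfolding has_vector_derivative_def has_derivative_within_alt
proof (intro conjI allI impI)
  fix e :: real assume "e > 0"
  then obtain \<delta> where \<delta>: "\<delta> > 0" "\<And>s. \<bar>s - t\<bar> < \<delta> \<Longrightarrow> norm (d s - d t) < e"
    using c unfolding continuous_at_eps_delta by (auto simp: dist_norm)
  have *: "norm (z b - z a - (b - a) *\<^sub>R d t) \<le> e * (b - a)" if ab: "t - \<delta> < a" "a < b" "b < t + \<delta>" for a b
  proof -
    define X where "X = z b - z a - (b - a) *\<^sub>R d t"
    have "e * norm X * a - X \<bullet> (z a - a *\<^sub>R d t) \<le> e * norm X * b - X \<bullet> (z b - b *\<^sub>R d t)"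
    proof (rule mono_of_right_deriv[where g = "\<lambda>s. e * norm X * s - X \<bullet> (z s - s *\<^sub>R d t)"])
      show "continuous_on {a..b} (\<lambda>s. e * norm X * s - X \<bullet> (z s - s *\<^sub>R d t))" by (intro continuous_intros contz)
      fix s assume s: "a \<le> s" "s < b"
      have "((\<lambda>s. z s - s *\<^sub>R d t) has_vector_derivative d s - 1 *\<^sub>R d t) (at_right s)"
        by (intro has_vector_derivative_diff d_deriv has_vector_derivative_scaleR DERIV_ident[THEN DERIV_subset]
              has_vector_derivative_const derivative_eq_intros) auto
      then have "((\<lambda>s. X \<bullet> (z s - s *\<^sub>R d t)) has_real_derivative X \<bullet> (d s - d t)) (at_right s)"
        unfolding has_real_derivative_iff_has_vector_derivative
        using bounded_linear.has_vector_derivative[OF bounded_linear_inner_right] by fastforce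
      then have "((\<lambda>s. e * norm X * s - X \<bullet> (z s - s *\<^sub>R d t)) has_real_derivative e * norm X - X \<bullet> (d s - d t)) (at_right s)"
        by (auto intro!: derivative_eq_intros)
      moreover have "X \<bullet> (d s - d t) \<le> norm X * norm (d s - d t)" by (rule norm_cauchy_schwarz)
      moreover have "norm X * norm (d s - d t) \<le> norm X * e" using less_imp_le[OF \<delta>(2)[of s]] s ab by (intro mult_left_mono) (auto simp: abs_less_iff)
      ultimately show "\<exists>g'\<ge>0. ((\<lambda>s. e * norm X * s - X \<bullet> (z s - s *\<^sub>R d t)) has_real_derivative g') (at_right s)"
        by (intro exI[of _ "e * norm X - X \<bullet> (d s - d t)"]) (auto simp: mult.commute)
    qed (use ab in simp)
    moreover have "X \<bullet> X = X \<bullet> (z b - b *\<^sub>R d t) - X \<bullet> (z a - a *\<^sub>R d t)"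
      unfolding inner_diff_right[symmetric] by (rule arg_cong[of _ _ "inner X"]) (simp add: X_def algebra_simps)
    ultimately have "norm X * norm X \<le> norm X * (e * (b - a))"
      by (simp add: power2_norm_eq_inner[symmetric] power2_eq_square algebra_simps)
    then show ?thesis using ab \<open>e > 0\<close> unfolding X_def[symmetric] by (cases "X = 0") auto
  qed
  have "norm (z y - z t - (y - t) *\<^sub>R d t) \<le> e * norm (y - t)" if "norm (y - t) < \<delta>" for y
  proof -
    consider "y = t" | "t < y" | "y < t" by linarith
    then show ?thesis
    proof cases
      case 2 then show ?thesis using *[of t y] that \<delta>(1) by simp
    next
      case 3
      have "z y - z t - (y - t) *\<^sub>R d t = - (z t - z y - (t - y) *\<^sub>R d t)" by (simp add: algebra_simps)
      then have "norm (z y - z t - (y - t) *\<^sub>R d t) = norm (z t - z y - (t - y) *\<^sub>R d t)" by (simp only: norm_minus_cancel)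
      then show ?thesis using *[of y t] 3 that \<delta>(1) by simp
    qed simp
  qed
  then show "\<exists>\<delta>>0. \<forall>y\<in>UNIV. norm (y - t) < \<delta> \<longrightarrow> norm (z y - z t - (y - t) *\<^sub>R d t) \<le> e * norm (y - t)"
    using \<delta>(1) by blast
qed (rule bounded_linear_scaleR_left)

text \<open>Just to the right of \<open>t0\<close> the tangent stays close to
  \<open>e = d t0\<close>, so its slope \<open>m\<close> relative to \<open>e\<close> is defined.
  Convexity makes \<open>m\<close> increasing, and it is right-continuous, hence differentiable
  almost everywhere; the unit tangent is a smooth function of its slope.\<close>

lemma d_differentiable_ae: "negligible {t. \<not> (\<exists>D. (d has_vector_derivative D) (at t))}" (is "negligible ?N")
proof (rule negligible_of_right_local)
  fix t0
  define e where "e = d t0"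
  have e1: "e \<bullet> e = 1" using norm_d[of t0] by (simp add: e_def norm_eq_1)
  obtain \<delta> where \<delta>: "\<delta> > 0" "\<And>a. t0 \<le> a \<Longrightarrow> a < t0 + \<delta> \<Longrightarrow> norm (d a - e) \<le> 1 / 2" unfolding e_def using d_near[of "1 / 2" t0] by auto
  have ed: "1 / 2 \<le> e \<bullet> d s" if "t0 \<le> s" "s < t0 + \<delta>" for s
  proof -
    have "\<bar>e \<bullet> (d s - e)\<bar> \<le> norm e * norm (d s - e)" by (rule Cauchy_Schwarz_ineq2)
    moreover have "norm e = 1" using norm_d by (simp add: e_def)
    ultimately show ?thesis using \<delta>(2)[OF that] e1 by (simp add: inner_diff_right)
  qed
  define m where "m s = det2 e (d s) / (e \<bullet> d s)" for s
  have m_mono: "m s \<le> m s'" if s: "t0 \<le> s" "s \<le> s'" "s' < t0 + \<delta>" for s s'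
  proof (cases "s = s'")
    case False
    then have lt: "s < s'" using s by simp
    have "e \<bullet> z s - s / 2 \<le> e \<bullet> z s' - s' / 2"
    proof (rule mono_of_right_deriv[where g = "\<lambda>s. e \<bullet> z s - s / 2"])
      show "continuous_on {s..s'} (\<lambda>s. e \<bullet> z s - s / 2)" by (intro continuous_intros contz) auto
      fix t assume t: "s \<le> t" "t < s'"
      have "((\<lambda>s. e \<bullet> z s) has_real_derivative e \<bullet> d t) (at_right t)"
        unfolding has_real_derivative_iff_has_vector_derivative
        by (rule bounded_linear.has_vector_derivative[OF bounded_linear_inner_right d_deriv])
      then have "((\<lambda>s. e \<bullet> z s - s / 2) has_real_derivative e \<bullet> d t - 1 / 2) (at_right t)"
        by (auto intro!: derivative_eq_intros)
      moreover have "0 \<le> e \<bullet> d t - 1 / 2" using ed[of t] t s by simp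
      ultimately show "\<exists>g'\<ge>0. ((\<lambda>s. e \<bullet> z s - s / 2) has_real_derivative g') (at_right t)" by blast
    qed (use s in simp)
    then have dx: "0 < e \<bullet> (z s' - z s)" using lt by (simp add: inner_diff_right)
    have p: "0 < e \<bullet> d s" "0 < e \<bullet> d s'" using ed[of s] ed[of s'] s by auto
    have "0 \<le> det2 (d s) (z s' - z s)" "0 \<le> det2 (d s') (z s - z s')" by (intro d_supp z_closure)+
    moreover have "det2 (d s') (z s - z s') = - det2 (d s') (z s' - z s)" by (simp add: det2_eq algebra_simps)
    ultimately have "det2 e (d s) * (e \<bullet> (z s' - z s)) \<le> det2 e (z s' - z s) * (e \<bullet> d s)"
      "det2 e (z s' - z s) * (e \<bullet> d s') \<le> det2 e (d s') * (e \<bullet> (z s' - z s))"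
      using det2_inner_identity[of e "d s" "z s' - z s"] det2_inner_identity[of e "d s'" "z s' - z s"] e1
      by (auto simp: mult.commute)
    then have "m s \<le> det2 e (z s' - z s) / (e \<bullet> (z s' - z s))" "det2 e (z s' - z s) / (e \<bullet> (z s' - z s)) \<le> m s'"
      unfolding m_def using dx p by (auto simp: divide_le_eq le_divide_eq pos_divide_le_eq pos_le_divide_eq)
    then show ?thesis by simp
  qed simp
  have m_cont: "(m \<longlongrightarrow> m s) (at_right s)" if "t0 \<le> s" "s < t0 + \<delta>" for s
    unfolding m_def
  proof (intro tendsto_divide tendsto_intros)
    show dt: "(d \<longlongrightarrow> d s) (at_right s)" using d_right_continuous[of s] by (simp add: continuous_within)
    show "((\<lambda>s. det2 e (d s)) \<longlongrightarrow> det2 e (d s)) (at_right s)"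
      by (rule bounded_linear.tendsto[OF bounded_bilinear.bounded_linear_right[OF bounded_bilinear_det2] dt])
    show "e \<bullet> d s \<noteq> 0" using ed[OF that] by simp
  qed
  define t1 where "t1 = t0 + \<delta> / 2"
  have t1: "t0 < t1" "t1 < t0 + \<delta>" using \<delta>(1) by (auto simp: t1_def)
  \<comment> \<open>The slope is extended by constants, to be monotone and right-continuous on the
    whole line.\<close>
  define F where "F s = m (max t0 (min s t1))" for s
  have F_eq: "F s = m s" if "t0 \<le> s" "s \<le> t1" for s using that by (simp add: F_def)
  have F_mono: "F s \<le> F s'" if "s \<le> s'" for s s'
    unfolding F_def by (rule m_mono) (use that t1 in auto)
  have F_cont: "continuous (at_right s) F" for s
  proof -
    consider "s < t0" | "t0 \<le> s" "s < t1" | "t1 \<le> s" by linarith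
    then have "(F \<longlongrightarrow> F s) (at_right s)"
    proof cases
      case 1
      then have "\<forall>\<^sub>F x in at_right s. F s = F x"
        unfolding eventually_at_right_field by (intro exI[of _ t0]) (auto simp: F_def)
      with tendsto_const show ?thesis by (rule Lim_transform_eventually)
    next
      case 2
      then have "\<forall>\<^sub>F x in at_right s. m x = F x"
        unfolding eventually_at_right_field by (intro exI[of _ t1]) (auto simp: F_def)
      moreover have "(m \<longlongrightarrow> F s) (at_right s)" using m_cont[of s] 2 t1 F_eq[of s] by simp
      ultimately show ?thesis by (rule Lim_transform_eventually[rotated])
    next
      case 3
      then have "\<forall>\<^sub>F x in at_right s. F s = F x"
        unfolding eventually_at_right_field by (intro exI[of _ "s + 1"]) (auto simp: F_def)
      with tendsto_const show ?thesis by (rule Lim_transform_eventually)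
    qed
    then show ?thesis by (simp add: continuous_within)
  qed
  have "negligible {s. \<not> (\<exists>l. (F has_real_derivative l) (at s))}" by (rule mono_differentiable_ae[OF F_mono F_cont])
  then have "negligible ({s. \<not> (\<exists>l. (F has_real_derivative l) (at s))} \<union> {t0})" by (intro negligible_Un) auto
  then have "negligible (?N \<inter> {t0..<t1})"
  proof (rule negligible_subset)
    show "?N \<inter> {t0..<t1} \<subseteq> {s. \<not> (\<exists>l. (F has_real_derivative l) (at s))} \<union> {t0}"
    proof (rule subsetI, rule ccontr)
      fix s assume s: "s \<in> ?N \<inter> {t0..<t1}" "s \<notin> {s. \<not> (\<exists>l. (F has_real_derivative l) (at s))} \<union> {t0}"
      then obtain l where l: "(F has_real_derivative l) (at s)" by blast
      have st: "t0 < s" "s < t1" using s by auto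
      \<comment> \<open>This is \<open>e\<close> rotated by a right angle. A unit vector with
        positive component along \<open>e\<close> is determined by its slope.\<close>
      define f :: "real^2" where "f = vector [- e $ 2, e $ 1]"
      have d_eq: "d r = (1 / sqrt (1 + (F r)\<^sup>2)) *\<^sub>R (e + F r *\<^sub>R f)" if r: "r \<in> {t0<..<t1}" for r
      proof -
        have pr: "0 < e \<bullet> d r" using ed[of r] r t1 by simp
        have Fr: "F r = det2 e (d r) / (e \<bullet> d r)" using F_eq[of r] r by (simp add: m_def)
        have ee: "e $ 1 * e $ 1 + e $ 2 * e $ 2 = 1" using e1 by (simp add: inner_real2)
        have "d r $ 1 = (e \<bullet> d r) * e $ 1 - det2 e (d r) * e $ 2" "d r $ 2 = (e \<bullet> d r) * e $ 2 + det2 e (d r) * e $ 1"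
          using arg_cong[OF ee, of "\<lambda>c. c * d r $ 1"] arg_cong[OF ee, of "\<lambda>c. c * d r $ 2"]
          by (auto simp: det2_eq inner_real2 algebra_simps)
        then have exp: "d r = (e \<bullet> d r) *\<^sub>R e + det2 e (d r) *\<^sub>R f"
          by (auto simp: vec_eq_iff forall_2 f_def)
        have "(e \<bullet> d r)\<^sup>2 + (det2 e (d r))\<^sup>2 = (e \<bullet> e) * (d r \<bullet> d r)"
          by (simp add: det2_eq inner_real2 algebra_simps power2_eq_square)
        moreover have "d r \<bullet> d r = 1" using norm_d[of r] by (simp add: norm_eq_1)
        ultimately have 1: "(e \<bullet> d r)\<^sup>2 + (det2 e (d r))\<^sup>2 = 1" using e1 by simp
        have "1 + (F r)\<^sup>2 = ((e \<bullet> d r)\<^sup>2 + (det2 e (d r))\<^sup>2) / (e \<bullet> d r)\<^sup>2"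
          using pr by (simp add: Fr power_divide add_divide_distrib)
        then have "1 + (F r)\<^sup>2 = (1 / (e \<bullet> d r))\<^sup>2" unfolding 1 by (simp add: power_divide)
        then have "sqrt (1 + (F r)\<^sup>2) = 1 / (e \<bullet> d r)" using pr by simp
        then have "(1 / sqrt (1 + (F r)\<^sup>2)) *\<^sub>R (e + F r *\<^sub>R f) = (e \<bullet> d r) *\<^sub>R e + det2 e (d r) *\<^sub>R f"
          using pr by (simp add: scaleR_add_right Fr)
        then show ?thesis using exp by simp
      qed
      define G where "G = (\<lambda>r. 1 / sqrt (1 + (F r)\<^sup>2))"
      have "0 < 1 + (F s)\<^sup>2" by (simp add: add_pos_nonneg)
      then have "(G has_real_derivative - (((2 * F s * l) / (2 * sqrt (1 + (F s)\<^sup>2))) / (sqrt (1 + (F s)\<^sup>2))\<^sup>2)) (at s)"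
        unfolding G_def by (auto intro!: derivative_eq_intros l simp: field_simps power2_eq_square)
      then obtain G' where G': "(G has_real_derivative G') (at s)" by blast
      have "((\<lambda>r. e + F r *\<^sub>R f) has_vector_derivative 0 + (F s *\<^sub>R 0 + l *\<^sub>R f)) (at s)"
        by (intro has_vector_derivative_add has_vector_derivative_scaleR has_vector_derivative_const l)
      then have "((\<lambda>r. G r *\<^sub>R (e + F r *\<^sub>R f)) has_vector_derivative G s *\<^sub>R (0 + (F s *\<^sub>R 0 + l *\<^sub>R f)) + G' *\<^sub>R (e + F s *\<^sub>R f)) (at s)"
        using G' by (intro has_vector_derivative_scaleR)
      then have "(d has_vector_derivative G s *\<^sub>R (0 + (F s *\<^sub>R 0 + l *\<^sub>R f)) + G' *\<^sub>R (e + F s *\<^sub>R f)) (at s)"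
        by (rule has_vector_derivative_transform_within_open[where S = "{t0<..<t1}"]) (use st d_eq in \<open>auto simp: G_def\<close>)
      then show False using s by blast
    qed
  qed
  then show "\<exists>u>t0. negligible (?N \<inter> {t0..<u})" using t1 by blast
qed

end

section \<open>Affine arclength measure\<close>

text \<open>Completeness of Lebesgue measure makes every subset of \<open>N\<close>
  measurable.\<close>

lemma measurable_lebesgue_negligible:
  assumes f: "f \<in> borel_measurable lebesgue" and N: "negligible N" and eq: "\<And>x. x \<notin> N \<Longrightarrow> f x = g x"
  shows "g \<in> borel_measurable (lebesgue :: 'a::euclidean_space measure)"
proof (rule measurableI)
  fix A :: "'b set" assume "A \<in> sets borel"
  then have "f -` A \<inter> space lebesgue \<in> sets lebesgue" using f by (rule measurable_sets[rotated])
  moreover have "N \<in> sets lebesgue" "g -` A \<inter> N \<in> sets lebesgue"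
    using N negligible_subset[OF N, of "g -` A \<inter> N"] by (auto dest: negligible_imp_sets)
  ultimately have "(f -` A \<inter> space lebesgue - N) \<union> (g -` A \<inter> N) \<in> sets lebesgue" by auto
  moreover have "(f -` A \<inter> space lebesgue - N) \<union> (g -` A \<inter> N) = g -` A \<inter> space lebesgue"
    using eq by fastforce
  ultimately show "g -` A \<inter> space lebesgue \<in> sets lebesgue" by simp
qed auto

lemma negligible_borel_cover:
  assumes "negligible (N :: 'a::euclidean_space set)"
  obtains N' where "N \<subseteq> N'" "N' \<in> sets borel" "N' \<in> null_sets lborel" "negligible N'"
proof -
  obtain N' where N': "N' \<in> null_sets lborel" "N \<subseteq> N'"
    using assms unfolding negligible_iff_null_sets null_sets_completion_iff2 by blast
  then have "negligible N'" unfolding negligible_iff_null_sets null_sets_completion_iff2 by blast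
  then show ?thesis using N' by (intro that[of N']) auto
qed

section \<open>Curvature off a null set and the covering by four pieces\<close>

context bounded_param
begin

definition "d' t = vector_derivative d (at t)"

text \<open>A limit along a sequence is Borel measurable in \<open>t\<close>. Off \<open>bad\<close>
  it agrees with the determinant in \<open>affine_density\<close>, see
  \<open>not_bad\<close>.\<close>

definition "\<kappa> t = det2 (d t) (lim (\<lambda>n. real (Suc n) *\<^sub>R (d (t + 1 / real (Suc n)) - d t)))"

definition "bad = {t. \<not> (\<exists>D. (d has_vector_derivative D) (at t))}"

lemma negligible_bad: "negligible bad" unfolding bad_def by (rule d_differentiable_ae)

lemma borel_measurable_\<kappa>: "\<kappa> \<in> borel_measurable borel"
proof -
  note borel_measurable_d [measurable]
  have [measurable]: "(\<lambda>t. lim (\<lambda>n. real (Suc n) *\<^sub>R (d (t + 1 / real (Suc n)) - d t))) \<in> borel_measurable borel"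
    by (rule borel_measurable_lim_metric) measurable
  show ?thesis unfolding \<kappa>_def[abs_def] det2_eq by measurable
qed

lemma not_bad:
  assumes "t \<notin> bad"
  shows "(d has_vector_derivative d' t) (at t)" "(z has_vector_derivative d t) (at t)" "\<kappa> t = det2 (d t) (d' t)"
    "affine_density z t = ennreal (root 3 (\<kappa> t))"
proof -
  obtain D where D: "(d has_vector_derivative D) (at t)" using assms by (auto simp: bad_def)
  have dD: "d' t = D" unfolding d'_def using D by (rule vector_derivative_at)
  show 1: "(d has_vector_derivative d' t) (at t)" unfolding dD by (rule D)
  show "(z has_vector_derivative d t) (at t)" using D by (intro z_vector_derivative has_vector_derivative_continuous)
  have "(\<lambda>n. real (Suc n) *\<^sub>R (d (t + 1 / real (Suc n)) - d t)) \<longlonglongrightarrow> d' t"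
    by (rule right_deriv_seq) (rule has_vector_derivative_at_within[OF 1])
  then show 2: "\<kappa> t = det2 (d t) (d' t)" unfolding \<kappa>_def by (simp add: limI)
  show "affine_density z t = ennreal (root 3 (\<kappa> t))" unfolding affine_density_def 2 d'_def ..
qed

lemma measurable_affine_density: "affine_density z \<in> borel_measurable lebesgue"
proof (rule measurable_lebesgue_negligible[OF _ negligible_bad])
  have "(\<lambda>t. ennreal (root 3 (\<kappa> t))) \<in> borel_measurable borel" using borel_measurable_\<kappa> by measurable
  then show "(\<lambda>t. ennreal (root 3 (\<kappa> t))) \<in> borel_measurable lebesgue" by (simp add: measurable_completion)
qed (simp add: not_bad)

text \<open>A Borel null set around \<open>bad\<close>, because the pieces have to be Borel
  sets.\<close>

definition bad' :: "real set" where
  "bad' = (SOME N. bad \<subseteq> N \<and> N \<in> sets borel \<and> N \<in> null_sets lborel)"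

lemma bad': "bad \<subseteq> bad'" "bad' \<in> sets borel" "bad' \<in> null_sets lborel"
proof -
  obtain N where "bad \<subseteq> N" "N \<in> sets borel" "N \<in> null_sets lborel" by (rule negligible_borel_cover[OF negligible_bad])
  then have "bad \<subseteq> bad' \<and> bad' \<in> sets borel \<and> bad' \<in> null_sets lborel"
    unfolding bad'_def by (intro someI[where P = "\<lambda>N. bad \<subseteq> N \<and> N \<in> sets borel \<and> N \<in> null_sets lborel"]) auto
  then show "bad \<subseteq> bad'" "bad' \<in> sets borel" "bad' \<in> null_sets lborel" by auto
qed

text \<open>Parameters with nonpositive \<open>\<kappa>\<close> are left out: off \<open>bad\<close>
  their density is 0, since \<open>ennreal\<close> sends negative reals to 0.\<close>

definition "piece e = {t \<in> {0..<L}. t \<notin> bad' \<and> 0 < \<kappa> t \<and> 0 < e \<bullet> d t}"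

lemma arc_piece: assumes "norm e = 1" shows "arc_piece (piece e) z d d' \<kappa> e"
proof
  note borel_measurable_d [measurable] borel_measurable_\<kappa> [measurable] bad'(2) [measurable]
  show "piece e \<in> sets borel" unfolding piece_def by measurable
  show "inj_on z (piece e)" by (rule inj_onI, rule inj_z) (auto simp: piece_def)
  show "0 \<le> det2 (d t) (z s - z t)" for s t by (rule d_supp[OF z_closure])
  fix t assume t: "t \<in> piece e"
  then have "t \<notin> bad" using bad' by (auto simp: piece_def)
  then show "(z has_vector_derivative d t) (at t)" "(d has_vector_derivative d' t) (at t)" "\<kappa> t = det2 (d t) (d' t)"
    using not_bad by auto
  show "0 < \<kappa> t" "0 < e \<bullet> d t" using t by (auto simp: piece_def)
qed (rule borel_measurable_z borel_measurable_d borel_measurable_\<kappa> assms)+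

text \<open>Every nonzero vector has a positive inner product with one of these four, so the four
  pieces exhaust the part of positive density up to a null set.\<close>

definition axes :: "(real^2) set" where "axes = {axis 1 1, - axis 1 1, axis 2 1, - axis 2 1}"

lemma axes: "finite axes" "card axes \<le> 4" "\<And>e. e \<in> axes \<Longrightarrow> norm e = 1"
  unfolding axes_def by (auto simp: card_insert_if norm_axis_1)

lemma in_piece: assumes "t \<in> {0..<L}" "t \<notin> bad'" "0 < \<kappa> t" shows "\<exists>e\<in>axes. t \<in> piece e"
proof -
  have "d t \<noteq> 0" using norm_d[of t] by force
  then have "d t $ 1 \<noteq> 0 \<or> d t $ 2 \<noteq> 0" by (auto simp: vec_eq_iff forall_2)
  then consider "0 < d t $ 1" | "d t $ 1 < 0" | "0 < d t $ 2" | "d t $ 2 < 0" by linarith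
  then have "\<exists>e\<in>axes. 0 < e \<bullet> d t" by cases (auto simp: axes_def inner_axis')
  then show ?thesis using assms by (auto simp: piece_def)
qed

text \<open>Almost every parameter with positive density lies in some piece, and overlaps of the
  pieces only enlarge the sum.\<close>

lemma nn_integral_density_le:
  assumes H [measurable]: "H \<in> borel_measurable borel"
  shows "(\<integral>\<^sup>+t. affine_density z t * H (z t) \<partial>lebesgue_on {0..<L})
    \<le> (\<Sum>e\<in>axes. \<integral>\<^sup>+t. ennreal (arc_piece.dens (piece e) \<kappa> t) * H (z t) \<partial>lborel)"
proof -
  note borel_measurable_z [measurable]
  have dens: "arc_piece.dens (piece e) \<kappa> t = indicator (piece e) t * \<kappa> t powr (1 / 3)" if "e \<in> axes" for e t
    by (rule arc_piece.dens_def[OF arc_piece[OF axes(3)[OF that]]])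
  have meas: "(\<lambda>t. ennreal (arc_piece.dens (piece e) \<kappa> t) * H (z t)) \<in> borel_measurable borel" if e: "e \<in> axes" for e
  proof -
    interpret A: arc_piece "piece e" z d d' \<kappa> e by (rule arc_piece[OF axes(3)[OF e]])
    show ?thesis unfolding dens[OF e] by measurable
  qed
  have "(\<integral>\<^sup>+t. affine_density z t * H (z t) \<partial>lebesgue_on {0..<L}) = (\<integral>\<^sup>+t. affine_density z t * H (z t) * indicator {0..<L} t \<partial>lebesgue)"
    by (rule nn_integral_restrict_space) auto
  also have "\<dots> \<le> (\<integral>\<^sup>+t. (\<Sum>e\<in>axes. ennreal (arc_piece.dens (piece e) \<kappa> t) * H (z t)) \<partial>lebesgue)"
  proof (rule nn_integral_mono_AE)
    have "AE t in lborel. t \<notin> bad'" using bad'(3) by (rule AE_not_in)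
    then have "AE t in lebesgue. t \<notin> bad'" by (rule AE_completion)
    then show "AE t in lebesgue. affine_density z t * H (z t) * indicator {0..<L} t
        \<le> (\<Sum>e\<in>axes. ennreal (arc_piece.dens (piece e) \<kappa> t) * H (z t))"
    proof eventually_elim
      case (elim t)
      then have "t \<notin> bad" using bad' by auto
      show ?case
      proof (cases "t \<in> {0..<L} \<and> 0 < \<kappa> t")
        case True
        then obtain e where e: "e \<in> axes" "t \<in> piece e" using in_piece[of t] elim by blast
        have "affine_density z t * H (z t) * indicator {0..<L} t = ennreal (arc_piece.dens (piece e) \<kappa> t) * H (z t)"
          using True e not_bad(4)[OF \<open>t \<notin> bad\<close>] by (simp add: dens root_powr_inverse)
        also have "\<dots> \<le> (\<Sum>e\<in>axes. ennreal (arc_piece.dens (piece e) \<kappa> t) * H (z t))"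
          using axes(1) e(1) by (intro member_le_sum) auto
        finally show ?thesis .
      next
        case False
        then have "affine_density z t * indicator {0..<L} t = 0"
          using not_bad(4)[OF \<open>t \<notin> bad\<close>] by (auto split: split_indicator intro!: ennreal_neg)
        then have "affine_density z t * H (z t) * indicator {0..<L} t = 0" by (auto split: split_indicator_asm)
        then show ?thesis by (simp only: zero_le)
      qed
    qed
  qed
  also have "\<dots> = (\<integral>\<^sup>+t. (\<Sum>e\<in>axes. ennreal (arc_piece.dens (piece e) \<kappa> t) * H (z t)) \<partial>lborel)"
    by (rule nn_integral_completion)
  also have "\<dots> = (\<Sum>e\<in>axes. \<integral>\<^sup>+t. ennreal (arc_piece.dens (piece e) \<kappa> t) * H (z t) \<partial>lborel)"
    using meas by (intro nn_integral_sum) auto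
  finally show ?thesis .
qed

lemma measurable_z_frontier: "z \<in> measurable (lebesgue_on {0..<L}) (restrict_space borel (frontier K))"
proof (rule measurable_restrict_space2)
  show "z \<in> space (lebesgue_on {0..<L}) \<rightarrow> frontier K" using z_frontier by auto
  have "z \<in> borel_measurable lebesgue" using borel_measurable_z by (simp add: measurable_completion)
  then show "z \<in> borel_measurable (lebesgue_on {0..<L})" by (rule measurable_restrict_space1)
qed

definition "curve_measure = distr (density (lebesgue_on {0..<L}) (affine_density z)) (restrict_space borel (frontier K)) z"

lemma nn_integral_curve_measure:
  assumes "H \<in> borel_measurable (restrict_space borel (frontier K))"
  shows "(\<integral>\<^sup>+x. H x \<partial>curve_measure) = (\<integral>\<^sup>+t. affine_density z t * H (z t) \<partial>lebesgue_on {0..<L})"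
proof -
  have m: "z \<in> measurable (density (lebesgue_on {0..<L}) (affine_density z)) (restrict_space borel (frontier K))"
    using measurable_z_frontier by (simp cong: measurable_cong_sets)
  have "(\<lambda>t. H (z t)) \<in> borel_measurable (lebesgue_on {0..<L})"
    using measurable_compose[OF measurable_z_frontier assms] .
  then have "(\<integral>\<^sup>+t. H (z t) \<partial>density (lebesgue_on {0..<L}) (affine_density z)) = (\<integral>\<^sup>+t. affine_density z t * H (z t) \<partial>lebesgue_on {0..<L})"
    by (rule nn_integral_density[OF measurable_restrict_space1[OF measurable_affine_density]])
  then show ?thesis unfolding curve_measure_def using nn_integral_distr[OF m, of H] assms by simp
qed

end

text \<open>Existence of a parametrization ensures that the pair chosen by \<open>SOME\<close> is
  one, so that \<open>bounded_param\<close> applies to it.\<close>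

lemma affine_arclength_compact_eq:
  assumes K: "convex K" "bounded K" "interior K \<noteq> {}"
  shows "\<exists>L z. bounded_param K L z \<and> affine_arclength_compact K = bounded_param.curve_measure K L z"
proof -
  obtain L0 z0 where p0: "ccw_arclength_param K L0 z0"
    using exists_ccw_arclength_param[OF K] by blast
  define Lz where "Lz = (SOME (L, z). ccw_arclength_param K L z)"
  have "case Lz of (L, z) \<Rightarrow> ccw_arclength_param K L z"
    unfolding Lz_def by (rule someI[where x = "(L0, z0)"]) (use p0 in simp)
  then obtain L z where Lz: "Lz = (L, z)" "ccw_arclength_param K L z" by (cases Lz) auto
  have bp: "bounded_param K L z" using K Lz(2) by unfold_locales
  have "affine_arclength_compact K = bounded_param.curve_measure K L z"
    unfolding affine_arclength_compact_def Lz_def[symmetric] Lz(1) bounded_param.curve_measure_def[OF bp] by simp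
  then show ?thesis using bp by blast
qed

lemma sets_affine_arclength_compact:
  assumes K: "convex K" "bounded K" "interior K \<noteq> {}"
  shows "sets (affine_arclength_compact K) = sets (restrict_space borel (frontier K))"
  unfolding affine_arclength_compact_def by (simp add: split_beta Let_def)

text \<open>\<open>piece_maximal\<close> bounds each of the four pieces with the same constant;
  their sum gives the factor 4.\<close>

lemma compact_maximal:
  assumes K: "convex K" "bounded K" "interior K \<noteq> {}"
    and r: "1 < r" "r < 2" and p: "p > 1" "1 / p + 1 / (2 * (r / (r - 1))) = 1" and q: "q > 1" "2 * r / (3 - r) = q / (q - 1)"
    and f: "integrable lborel f" and g: "g \<in> borel_measurable borel" and g1: "\<And>v. norm (g v) \<le> 1"
  shows "(\<integral>\<^sup>+x. ennreal_powr (mop f g x) q \<partial>affine_arclength_compact K)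
    \<le> 4 * ennreal_powr (ennreal (max_const r) * ennreal_powr (\<integral>\<^sup>+x. ennreal_powr (ennreal (norm (f x))) p \<partial>lborel) (1 / p)) q"
    (is "_ \<le> 4 * ennreal_powr ?B q")
proof -
  obtain L z where bp: "bounded_param K L z" and eq: "affine_arclength_compact K = bounded_param.curve_measure K L z"
    using affine_arclength_compact_eq[OF K] by blast
  interpret bounded_param K L z by (rule bp)
  have [measurable]: "f \<in> borel_measurable borel" "g \<in> borel_measurable borel" using f g by auto
  obtain Q :: "nat \<Rightarrow> real^2" where Q: "\<And>x. mop f g x = (SUP n. ennreal (norm (bavg f g (Q n) x)))"
    using mop_countable[OF f g g1] by blast
  have m: "(\<lambda>x. ennreal_powr (mop f g x) q) \<in> borel_measurable borel" unfolding Q by measurable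
  have "(\<integral>\<^sup>+x. ennreal_powr (mop f g x) q \<partial>affine_arclength_compact K)
    = (\<integral>\<^sup>+t. affine_density z t * ennreal_powr (mop f g (z t)) q \<partial>lebesgue_on {0..<L})"
    unfolding eq by (rule nn_integral_curve_measure[OF measurable_restrict_space1[OF m]])
  also have "\<dots> \<le> (\<Sum>e\<in>axes. \<integral>\<^sup>+t. ennreal (arc_piece.dens (piece e) \<kappa> t) * ennreal_powr (mop f g (z t)) q \<partial>lborel)"
    by (rule nn_integral_density_le[OF m])
  also have "\<dots> \<le> (\<Sum>e\<in>axes. ennreal_powr ?B q)"
  proof (rule sum_mono)
    fix e assume "e \<in> axes"
    then have "arc_piece (piece e) z d d' \<kappa> e" by (intro arc_piece axes)
    from arc_piece.piece_maximal[OF this r p q f g g1]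
    show "(\<integral>\<^sup>+t. ennreal (arc_piece.dens (piece e) \<kappa> t) * ennreal_powr (mop f g (z t)) q \<partial>lborel) \<le> ennreal_powr ?B q"
      using q(1) by (subst (asm) ennreal_powr_le_iff) auto
  qed
  also have "\<dots> = of_nat (card axes) * ennreal_powr ?B q" by simp
  also have "\<dots> \<le> of_nat 4 * ennreal_powr ?B q" using axes(2) by (intro mult_right_mono of_nat_mono) auto
  finally show ?thesis by simp
qed

section \<open>Locality of the affine arclength measure and truncation\<close>

lemma closure_Int_open_cong:
  assumes "open U" "A \<inter> U = B \<inter> U" shows "closure A \<inter> U = closure B \<inter> U"
proof -
  have "closure A \<inter> U \<subseteq> closure B" if "A \<inter> U = B \<inter> U" for A B
  proof -
    have "closure A \<inter> U \<subseteq> closure (U \<inter> A)" using open_Int_closure_subset[OF assms(1), of A] by blast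
    also have "\<dots> \<subseteq> closure B" using that by (intro closure_mono) blast
    finally show ?thesis .
  qed
  from this[of A B] this[of B A] show ?thesis using assms(2) by blast
qed

lemma frontier_Int_open_cong:
  assumes U: "open U" and eq: "A \<inter> U = B \<inter> U" shows "frontier A \<inter> U = frontier B \<inter> U"
proof -
  have "interior A \<inter> U = interior (A \<inter> U)" "interior B \<inter> U = interior (B \<inter> U)" using U by (simp_all add: interior_open)
  then have "interior A \<inter> U = interior B \<inter> U" using eq by simp
  then show ?thesis using closure_Int_open_cong[OF assms] unfolding frontier_def by blast
qed

lemma right_deriv_local:
  assumes "0 < \<epsilon>" and eq: "\<And>h. \<bar>h\<bar> < \<epsilon> \<Longrightarrow> z1 (t + h) = z2 (s + h)" and h: "\<bar>h\<bar> < \<epsilon>"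
    and d: "\<And>t. (z2 has_vector_derivative d2 t) (at_right t)" and d1: "\<And>t. (z1 has_vector_derivative d1 t) (at_right t)"
  shows "d1 (t + h) = (d2 (s + h) :: real^2)"
proof -
  have "((\<lambda>x. z2 (x + (s - t))) has_vector_derivative 1 *\<^sub>R d2 (s + h)) (at_right (t + h))"
  proof -
    have "((\<lambda>x. x + (s - t)) has_vector_derivative 1) (at_right (t + h))"
      by (auto intro!: derivative_eq_intros simp: has_real_derivative_iff_has_vector_derivative[symmetric])
    moreover have "(z2 has_vector_derivative d2 (s + h)) (at (t + h + (s - t)) within (\<lambda>x. x + (s - t)) ` {t + h<..})"
    proof -
      have sub: "(\<lambda>x. x + (s - t)) ` {t + h<..} \<subseteq> {s + h<..}" by auto
      have eq: "t + h + (s - t) = s + h" by simp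
      show ?thesis unfolding eq by (rule has_vector_derivative_within_subset[OF d sub])
    qed
    ultimately show ?thesis using vector_diff_chain_within[of "\<lambda>x. x + (s - t)" 1 "t + h" "{t + h<..}" z2] by (simp add: comp_def)
  qed
  \<comment> \<open>On the closed half line the derivative is the same, and the neighbourhood on
    which the two curves are compared includes the base point.\<close>
  then have "(z1 has_vector_derivative 1 *\<^sub>R d2 (s + h)) (at (t + h) within {t + h..})"
    unfolding at_within_Ici_at_right[symmetric]
  proof (rule has_vector_derivative_transform_within[of _ _ _ _ "\<epsilon> - \<bar>h\<bar>"])
    fix x assume "x \<in> {t + h..}" "dist x (t + h) < \<epsilon> - \<bar>h\<bar>"
    then have "\<bar>x - t\<bar> < \<epsilon>" by (simp add: dist_real_def)
    then show "z2 (x + (s - t)) = z1 x" using eq[of "x - t"] by (simp add: algebra_simps)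
  qed (use h eq[OF h] in \<open>auto simp: algebra_simps\<close>)
  then show ?thesis unfolding at_within_Ici_at_right using vector_derivative_unique_within[OF trivial_limit_at_right_real d1] by simp
qed

text \<open>A parameter \<open>t\<close> of the first curve with \<open>z1 t\<close> in
  \<open>E\<close> is sent to the parameter \<open>\<tau> t\<close> of the same point on the second.
  By \<open>local_unique\<close> this map is locally a translation on \<open>S\<close>: it has
  derivative 1 and preserves tangent and curvature. It is also injective there, so the change of
  variables inequality compares the two masses.\<close>

lemma curve_measure_le:
  assumes b1: "bounded_param K1 L1 z1" and b2: "bounded_param K2 L2 z2" and w: "w \<in> interior K1" "w \<in> interior K2"
    and U: "open U" "frontier K1 \<inter> U = frontier K2 \<inter> U" and E: "E \<in> sets borel" "E \<subseteq> frontier K1 \<inter> U"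
  shows "emeasure (bounded_param.curve_measure K1 L1 z1) E \<le> emeasure (bounded_param.curve_measure K2 L2 z2) E"
proof -
  interpret P1: bounded_param K1 L1 z1 by fact
  interpret P2: bounded_param K2 L2 z2 by fact
  note [measurable] = P1.borel_measurable_z P2.borel_measurable_z P1.bad'(2) P2.borel_measurable_\<kappa> E(1)
  have E2: "E \<subseteq> frontier K2 \<inter> U" using E(2) U(2) by simp
  have meas: "emeasure (bounded_param.curve_measure K L z) E = (\<integral>\<^sup>+t. affine_density z t * indicator E (z t) * indicator {0..<L} t \<partial>lebesgue)"
    if "bounded_param K L z" "E \<subseteq> frontier K" for K L z
  proof -
    interpret P: bounded_param K L z by fact
    have EK: "E \<in> sets (restrict_space borel (frontier K))"
      using E(1) that(2) by (subst sets_restrict_space_iff) (auto simp: frontier_closed)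
    then have "emeasure P.curve_measure E = (\<integral>\<^sup>+x. indicator E x \<partial>P.curve_measure)"
      by (subst nn_integral_indicator) (auto simp: P.curve_measure_def)
    also have "\<dots> = (\<integral>\<^sup>+t. affine_density z t * indicator E (z t) \<partial>lebesgue_on {0..<L})"
      using E(1) by (intro P.nn_integral_curve_measure measurable_restrict_space1 borel_measurable_indicator)
    also have "\<dots> = (\<integral>\<^sup>+t. affine_density z t * indicator E (z t) * indicator {0..<L} t \<partial>lebesgue)"
      by (rule nn_integral_restrict_space) auto
    finally show ?thesis .
  qed
  define \<tau> where "\<tau> t = (SOME s. s \<in> {0..<L2} \<and> z2 s = z1 t)" for t
  have \<tau>: "\<tau> t \<in> {0..<L2}" "z2 (\<tau> t) = z1 t" if "z1 t \<in> E" for t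
  proof -
    have "z1 t \<in> frontier K2" using that E2 by blast
    then obtain s where "0 \<le> s" "s < 0 + L2" "z2 s = z1 t" by (rule P2.frontier_z)
    then have "s \<in> {0..<L2} \<and> z2 s = z1 t" by simp
    then have "\<tau> t \<in> {0..<L2} \<and> z2 (\<tau> t) = z1 t" unfolding \<tau>_def by (rule someI)
    then show "\<tau> t \<in> {0..<L2}" "z2 (\<tau> t) = z1 t" by auto
  qed
  \<comment> \<open>The point \<open>z2 0\<close> is excluded, since \<open>\<tau>\<close> may jump
    there between the two ends of \<open>{0..<L2}\<close>; this costs at most one parameter.\<close>
  define S where "S = {t. 0 < t \<and> t < L1 \<and> z1 t \<in> E \<and> t \<notin> P1.bad' \<and> z1 t \<noteq> z2 0}"
  have [measurable]: "S \<in> sets borel" unfolding S_def by measurable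
  define \<Theta> where "\<Theta> s = indicator {0..<L2} s * indicator E (z2 s) * max 0 (root 3 (P2.\<kappa> s))" for s :: real
  have [measurable]: "\<Theta> \<in> borel_measurable borel" unfolding \<Theta>_def[abs_def] by measurable
  have loc: "\<exists>\<epsilon>>0. \<forall>h. \<bar>h\<bar> < \<epsilon> \<longrightarrow> z1 (t + h) = z2 (\<tau> t + h)" if "t \<in> S" for t
  proof -
    have "z1 t \<in> E" using that by (simp add: S_def)
    then show ?thesis using E(2) \<tau>(2)[of t]
      by (intro local_unique[OF P1.param_axioms P2.param_axioms w U]) auto
  qed
  have \<tau>_der: "(\<tau> has_field_derivative 1) (at t within S)" if t: "t \<in> S" for t
  proof -
    obtain \<epsilon> where \<epsilon>: "\<epsilon> > 0" "\<And>h. \<bar>h\<bar> < \<epsilon> \<Longrightarrow> z1 (t + h) = z2 (\<tau> t + h)" using loc[OF t] by blast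
    have tE: "z1 t \<in> E" using t by (simp add: S_def)
    have \<tau>0: "0 < \<tau> t" "\<tau> t < L2"
    proof -
      have "\<tau> t \<noteq> 0" using \<tau>(2)[OF tE] t by (auto simp: S_def)
      then show "0 < \<tau> t" "\<tau> t < L2" using \<tau>(1)[OF tE] by auto
    qed
    have "((\<lambda>y. y + (\<tau> t - t)) has_field_derivative 1) (at t within S)" by (auto intro!: derivative_eq_intros)
    then show ?thesis
    proof (rule has_field_derivative_transform_within)
      show "0 < min \<epsilon> (min (\<tau> t) (L2 - \<tau> t))" using \<epsilon> \<tau>0 by simp
      fix y assume y: "y \<in> S" "dist y t < min \<epsilon> (min (\<tau> t) (L2 - \<tau> t))"
      then have yh: "\<bar>y - t\<bar> < \<epsilon>" "\<bar>y - t\<bar> < \<tau> t" "\<bar>y - t\<bar> < L2 - \<tau> t" by (auto simp: dist_real_def)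
      have yE: "z1 y \<in> E" using y by (simp add: S_def)
      have "z2 (\<tau> y) = z2 (\<tau> t + (y - t))" using \<epsilon>(2)[OF yh(1)] \<tau>(2)[OF yE] by simp
      moreover have "\<bar>\<tau> y - (\<tau> t + (y - t))\<bar> < L2" using \<tau>(1)[OF yE] yh(2,3) by (auto simp: abs_less_iff)
      ultimately have "\<tau> y = \<tau> t + (y - t)" by (rule P2.inj_z)
      then show "y + (\<tau> t - t) = \<tau> y" by simp
    qed (rule t)
  qed
  have \<tau>_inj: "inj_on \<tau> S"
  proof (rule inj_onI)
    fix s t assume st: "s \<in> S" "t \<in> S" "\<tau> s = \<tau> t"
    then have "z1 s = z1 t" using \<tau>(2)[of s] \<tau>(2)[of t] by (simp add: S_def)
    then show "s = t" using st by (intro P1.inj_z) (auto simp: S_def)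
  qed
  have dens: "affine_density z1 t \<le> ennreal (\<Theta> (\<tau> t))" if t: "t \<in> S" for t
  proof -
    obtain \<epsilon> where \<epsilon>: "\<epsilon> > 0" "\<And>h. \<bar>h\<bar> < \<epsilon> \<Longrightarrow> z1 (t + h) = z2 (\<tau> t + h)" using loc[OF t] by blast
    have tE: "z1 t \<in> E" and tb: "t \<notin> P1.bad" using t P1.bad'(1) by (auto simp: S_def)
    have deq: "P1.d (t + h) = P2.d (\<tau> t + h)" if "\<bar>h\<bar> < \<epsilon>" for h
      by (rule right_deriv_local[OF \<epsilon> that P2.d_deriv P1.d_deriv])
    have "(P1.d has_vector_derivative P1.d' t) (at (\<tau> t + (t - \<tau> t)))" using P1.not_bad(1)[OF tb] by simp
    then have "((\<lambda>s. P1.d (s + (t - \<tau> t))) has_vector_derivative P1.d' t) (at (\<tau> t))"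
    proof -
      assume "(P1.d has_vector_derivative P1.d' t) (at (\<tau> t + (t - \<tau> t)))"
      moreover have "((\<lambda>s. s + (t - \<tau> t)) has_vector_derivative 1) (at (\<tau> t))"
        unfolding has_real_derivative_iff_has_vector_derivative[symmetric] by (auto intro!: derivative_eq_intros)
      ultimately show ?thesis
        using vector_diff_chain_at[of "\<lambda>s. s + (t - \<tau> t)" 1 "\<tau> t" P1.d "P1.d' t"] by (simp add: comp_def)
    qed
    then have "(P2.d has_vector_derivative P1.d' t) (at (\<tau> t))"
    proof (rule has_vector_derivative_transform_within[OF _ \<epsilon>(1)])
      fix s assume "dist s (\<tau> t) < \<epsilon>"
      then show "P1.d (s + (t - \<tau> t)) = P2.d s" using deq[of "s - \<tau> t"] by (simp add: dist_real_def algebra_simps)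
    qed simp
    then have tb2: "\<tau> t \<notin> P2.bad" and d'eq: "P2.d' (\<tau> t) = P1.d' t"
      by (auto simp: P2.bad_def P2.d'_def vector_derivative_at)
    have "P1.\<kappa> t = P2.\<kappa> (\<tau> t)" using P1.not_bad(3)[OF tb] P2.not_bad(3)[OF tb2] d'eq deq[of 0] \<epsilon>(1) by simp
    then have "affine_density z1 t = ennreal (root 3 (P2.\<kappa> (\<tau> t)))" using P1.not_bad(4)[OF tb] by simp
    also have "\<dots> \<le> ennreal (\<Theta> (\<tau> t))" using \<tau>[OF tE] tE by (intro ennreal_leI) (simp add: \<Theta>_def)
    finally show ?thesis .
  qed
  have "emeasure P1.curve_measure E = (\<integral>\<^sup>+t. affine_density z1 t * indicator E (z1 t) * indicator {0..<L1} t \<partial>lebesgue)"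
    using E by (intro meas b1) auto
  also have "\<dots> \<le> (\<integral>\<^sup>+t. ennreal (\<bar>1\<bar> * \<Theta> (\<tau> t)) * indicator S t \<partial>lebesgue)"
  proof (rule nn_integral_mono_AE)
    define N where "N = {t \<in> {0..<L1}. z1 t = z2 0}"
    have "N \<subseteq> {x} " if "x \<in> N" for x
    proof
      fix y assume "y \<in> N"
      then have "y = x" using that by (intro P1.inj_z) (auto simp: N_def)
      then show "y \<in> {x}" by simp
    qed
    then have "finite N"
    proof (cases "N = {}")
      case False
      then obtain x where "x \<in> N" by blast
      then have "N \<subseteq> {x}" using \<open>\<And>x. x \<in> N \<Longrightarrow> N \<subseteq> {x}\<close> by blast
      then show ?thesis by (rule finite_subset) simp
    qed simp
    then have "N \<union> {0} \<in> null_sets lborel" by (intro finite_imp_null_set_lborel) auto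
    from AE_completion[OF AE_not_in[OF this]] AE_completion[OF AE_not_in[OF P1.bad'(3)]]
    have "AE t in lebesgue. t \<notin> N \<union> {0}" "AE t in lebesgue. t \<notin> P1.bad'" .
    then show "AE t in lebesgue. affine_density z1 t * indicator E (z1 t) * indicator {0..<L1} t \<le> ennreal (\<bar>1\<bar> * \<Theta> (\<tau> t)) * indicator S t"
    proof eventually_elim
      case (elim t)
      show ?case
      proof (cases "t \<in> S")
        case True
        then show ?thesis using dens[OF True] by (auto split: split_indicator)
      next
        case False
        then have "z1 t \<notin> E \<or> t \<notin> {0..<L1}" using elim by (auto simp: S_def N_def)
        then show ?thesis by auto
      qed
    qed
  qed
  also have "\<dots> \<le> (\<integral>\<^sup>+s. ennreal (\<Theta> s) \<partial>lborel)"
    using \<tau>_der \<tau>_inj by (intro nn_integral_change_of_variables_1_le[where g = \<tau> and g' = "\<lambda>_. 1"]) (auto simp: \<Theta>_def)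
  also have "\<dots> = (\<integral>\<^sup>+s. ennreal (\<Theta> s) \<partial>lebesgue)" by (rule nn_integral_completion[symmetric])
  also have "\<dots> \<le> (\<integral>\<^sup>+t. affine_density z2 t * indicator E (z2 t) * indicator {0..<L2} t \<partial>lebesgue)"
  proof (rule nn_integral_mono_AE)
    have "AE t in lborel. t \<notin> P2.bad'" using P2.bad'(3) by (rule AE_not_in)
    then have "AE t in lebesgue. t \<notin> P2.bad'" by (rule AE_completion)
    then show "AE t in lebesgue. ennreal (\<Theta> t) \<le> affine_density z2 t * indicator E (z2 t) * indicator {0..<L2} t"
    proof eventually_elim
      case (elim t)
      then have "t \<notin> P2.bad" using P2.bad'(1) by blast
      then show ?case using P2.not_bad(4)[of t] by (auto simp: \<Theta>_def max_def ennreal_neg split: split_indicator)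
    qed
  qed
  also have "\<dots> = emeasure P2.curve_measure E" using E2 by (intro meas[symmetric] b2) auto
  finally show ?thesis .
qed

lemma affine_arclength_compact_le:
  assumes K1: "convex K1" "bounded K1" and K2: "convex K2" "bounded K2" and w: "w \<in> interior K1" "w \<in> interior K2"
    and U: "open U" "K1 \<inter> U = K2 \<inter> U" and E: "E \<in> sets borel" "E \<subseteq> frontier K1 \<inter> U"
  shows "emeasure (affine_arclength_compact K1) E \<le> emeasure (affine_arclength_compact K2) E"
proof -
  have "interior K1 \<noteq> {}" "interior K2 \<noteq> {}" using w by auto
  then obtain L1 z1 L2 z2 where bp: "bounded_param K1 L1 z1" "bounded_param K2 L2 z2"
    and eq: "affine_arclength_compact K1 = bounded_param.curve_measure K1 L1 z1"
      "affine_arclength_compact K2 = bounded_param.curve_measure K2 L2 z2"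
    using affine_arclength_compact_eq[OF K1] affine_arclength_compact_eq[OF K2] by blast
  show ?thesis unfolding eq by (rule curve_measure_le[OF bp w U(1) frontier_Int_open_cong[OF U] E])
qed

text \<open>A simple function below \<open>H\<close> is integrated over the truncated curves, where
  the bound \<open>c\<close> holds; its finite sum commutes with the increasing limits of the
  measures.\<close>

lemma affine_arclength_le:
  fixes H :: "real^2 \<Rightarrow> ennreal"
  assumes K: "open K" "convex K" "K \<noteq> {}"
    and c: "\<And>K'. convex K' \<Longrightarrow> bounded K' \<Longrightarrow> interior K' \<noteq> {} \<Longrightarrow> (\<integral>\<^sup>+x. H x \<partial>affine_arclength_compact K') \<le> c"
  shows "(\<integral>\<^sup>+x. H x \<partial>affine_arclength K) \<le> c"
proof (cases "bounded K")
  case True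
  then show ?thesis using K c[of K] by (simp add: affine_arclength_def interior_open)
next
  case False
  define B where "B N = box (vec (- real N)) (vec (real N) :: real^2)" for N
  define KN where "KN N = K \<inter> cbox (vec (- real N)) (vec (real N))" for N
  define \<nu> where "\<nu> N = affine_arclength_compact (KN N)" for N
  define R where "R = restrict_space borel (frontier K)"
  define M where "M = affine_arclength K"
  have M_def': "M = measure_of (frontier K) (sets R) (\<lambda>E. lim (\<lambda>N. emeasure (\<nu> N) (E \<inter> B N)))"
    using False by (simp add: M_def affine_arclength_def R_def \<nu>_def KN_def B_def)
  have Rsp: "space R = frontier K" by (simp add: R_def space_restrict_space)
  have sM: "sets M = sets R" and spM: "space M = frontier K"
    unfolding M_def' using sets.sigma_sets_eq[of R] sets.space_closed[of R] Rsp by auto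
  have R: "E \<in> sets R \<longleftrightarrow> E \<in> sets borel \<and> E \<subseteq> frontier K" for E
    unfolding R_def by (subst sets_restrict_space_iff) (auto simp: frontier_closed)
  obtain w where w: "w \<in> K" using K(3) by blast
  \<comment> \<open>From \<open>N0\<close> on all truncations share the interior point
    \<open>w\<close>, which comparing their orientations requires.\<close>
  obtain N0 where N0: "norm w < real N0" using reals_Archimedean2 by blast
  have B_mono: "B N \<subseteq> B N'" if "N \<le> N'" for N N'
  proof
    fix x assume "x \<in> B N"
    then have "- real N < x $ i \<and> x $ i < real N" for i by (simp add: B_def mem_box_cart)
    moreover have "real N \<le> real N'" using that by simp
    ultimately have "- real N' < x $ i \<and> x $ i < real N'" for i by (smt (verit))
    then show "x \<in> B N'" by (simp add: B_def mem_box_cart)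
  qed
  have wB: "w \<in> B N" if "N0 \<le> N" for N
  proof -
    have "\<bar>w $ i\<bar> < real N" for i using component_le_norm_cart[of w i] N0 that by (smt (verit) of_nat_mono)
    then show ?thesis by (auto simp: B_def mem_box_cart abs_less_iff minus_less_iff)
  qed
  have BB: "B N \<subseteq> cbox (vec (- real N)) (vec (real N))" for N unfolding B_def by (rule box_subset_cbox)
  have KN_B: "KN N \<inter> B N' = K \<inter> B N'" if "N' \<le> N" for N N' using BB[of N] B_mono[OF that] by (auto simp: KN_def)
  have oB: "open (B N)" for N by (simp add: B_def open_box)
  have iKN: "w \<in> interior (KN N)" if "N0 \<le> N" for N
  proof (rule interiorI)
    show "open (K \<inter> B N)" using K(1) oB by blast
    show "w \<in> K \<inter> B N" using w wB[OF that] by simp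
    show "K \<inter> B N \<subseteq> KN N" using KN_B[of N N] by blast
  qed
  have KN: "convex (KN N)" "bounded (KN N)" for N
    unfolding KN_def using K(2) by (auto intro: convex_Int bounded_Int)
  have fr: "frontier (KN N) \<inter> B N' = frontier K \<inter> B N'" if "N' \<le> N" for N N'
    by (rule frontier_Int_open_cong[OF oB KN_B[OF that]])
  have sets\<nu>: "E \<inter> B N' \<in> sets (\<nu> N)" if "E \<in> sets R" "N0 \<le> N" "N' \<le> N" for E N N'
  proof -
    have "E \<inter> B N' \<subseteq> frontier (KN N)" using that fr[OF that(3)] R by blast
    moreover have "E \<inter> B N' \<in> sets borel" using that(1) R oB by auto
    ultimately have "E \<inter> B N' \<in> sets (restrict_space borel (frontier (KN N)))"
      by (subst sets_restrict_space_iff) (auto simp: frontier_closed)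
    then show ?thesis using sets_affine_arclength_compact[OF KN, of N] iKN[OF that(2)] unfolding \<nu>_def by blast
  qed
  have mono: "emeasure (\<nu> N) (E \<inter> B N) \<le> emeasure (\<nu> N') (E \<inter> B N')" if E: "E \<in> sets R" and N: "N0 \<le> N" "N \<le> N'" for E N N'
  proof -
    have "emeasure (\<nu> N) (E \<inter> B N) \<le> emeasure (\<nu> N') (E \<inter> B N)"
      unfolding \<nu>_def
    proof (rule affine_arclength_compact_le[OF KN KN])
      show "w \<in> interior (KN N)" "w \<in> interior (KN N')" using iKN N by auto
      show "KN N \<inter> B N = KN N' \<inter> B N" using KN_B N by auto
      show "E \<inter> B N \<in> sets borel" using E R oB by auto
      show "E \<inter> B N \<subseteq> frontier (KN N) \<inter> B N" using E R fr[of N N] by auto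
    qed (rule oB)
    also have "\<dots> \<le> emeasure (\<nu> N') (E \<inter> B N')"
      using B_mono[OF N(2)] sets\<nu>[OF E, of N' N'] N by (intro emeasure_mono) auto
    finally show ?thesis .
  qed
  define a where "a E k = emeasure (\<nu> (k + N0)) (E \<inter> B (k + N0))" for E k
  have a_mono: "incseq (a E)" if "E \<in> sets R" for E
    unfolding incseq_def a_def using mono[OF that] by simp
  \<comment> \<open>\<open>measure_of\<close> yields the given set function if that is a measure and
    the zero measure otherwise; the upper bound holds in both cases.\<close>
  have M_le: "emeasure M E \<le> (SUP k. a E k)" if E: "E \<in> sets R" for E
  proof -
    have "(a E) \<longlonglongrightarrow> (SUP k. a E k)" using a_mono[OF E] by (rule LIMSEQ_SUP)
    then have "(\<lambda>N. emeasure (\<nu> N) (E \<inter> B N)) \<longlonglongrightarrow> (SUP k. a E k)"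
      unfolding a_def[abs_def] by (rule LIMSEQ_offset)
    then have "lim (\<lambda>N. emeasure (\<nu> N) (E \<inter> B N)) = (SUP k. a E k)" by (rule limI)
    then show ?thesis unfolding M_def' emeasure_measure_of_conv by auto
  qed
  show ?thesis
    unfolding M_def[symmetric] nn_integral_def
  proof (rule SUP_least)
    fix g assume "g \<in> {g. simple_function M g \<and> g \<le> H}"
    then have g: "simple_function M g" "g \<le> H" by auto
    define E where "E y = g -` {y} \<inter> space M" for y
    define Y where "Y = g ` space M"
    have fY: "finite Y" and ER: "\<And>y. y \<in> Y \<Longrightarrow> E y \<in> sets R" using g(1) by (auto simp: simple_function_def Y_def E_def sM)
    have "integral\<^sup>S M g = (\<Sum>y\<in>Y. y * emeasure M (E y))" by (simp add: simple_integral_def Y_def E_def)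
    also have "\<dots> \<le> (\<Sum>y\<in>Y. y * (SUP k. a (E y) k))" using ER by (intro sum_mono mult_left_mono M_le) auto
    also have "\<dots> = (\<Sum>y\<in>Y. SUP k. y * a (E y) k)" by (simp add: SUP_mult_left_ennreal)
    also have "\<dots> = (SUP k. \<Sum>y\<in>Y. y * a (E y) k)"
      using a_mono[OF ER] by (intro ennreal_SUP_sum[symmetric]) (auto simp: incseq_def intro: mult_left_mono)
    also have "\<dots> \<le> c"
    proof (rule SUP_least)
      fix k
      have N: "N0 \<le> k + N0" by simp
      have "(\<Sum>y\<in>Y. y * a (E y) k) = (\<Sum>y\<in>Y. \<integral>\<^sup>+x. y * indicator (E y \<inter> B (k + N0)) x \<partial>\<nu> (k + N0))"
        unfolding a_def using sets\<nu>[OF ER N] by (intro sum.cong refl nn_integral_cmult_indicator[symmetric]) auto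
      also have "\<dots> = (\<integral>\<^sup>+x. (\<Sum>y\<in>Y. y * indicator (E y \<inter> B (k + N0)) x) \<partial>\<nu> (k + N0))"
        using sets\<nu>[OF ER N] by (intro nn_integral_sum[symmetric] borel_measurable_times_ennreal borel_measurable_indicator) auto
      also have "\<dots> \<le> (\<integral>\<^sup>+x. H x \<partial>\<nu> (k + N0))"
      proof (rule nn_integral_mono)
        fix x
        have "(\<Sum>y\<in>Y. y * indicator (E y \<inter> B (k + N0)) x) \<le> (\<Sum>y\<in>Y. if y = g x then g x else 0)"
          by (intro sum_mono) (auto simp: E_def split: split_indicator)
        also have "\<dots> \<le> g x" using fY by (simp add: sum.delta)
        also have "\<dots> \<le> H x" using g(2) by (simp add: le_fun_def)
        finally show "(\<Sum>y\<in>Y. y * indicator (E y \<inter> B (k + N0)) x) \<le> H x" .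
      qed
      also have "\<dots> \<le> c" unfolding \<nu>_def using iKN[OF N] by (intro c KN) auto
      finally show "(\<Sum>y\<in>Y. y * a (E y) k) \<le> c" .
    qed
    finally show "integral\<^sup>S M g \<le> c" .
  qed
qed

lemma sets_affine_arclength: "sets (affine_arclength K) = sets (restrict_space borel (frontier K))"
proof (cases "bounded K")
  case True
  then show ?thesis by (simp add: affine_arclength_def affine_arclength_compact_def split_beta Let_def)
next
  case False
  let ?R = "restrict_space borel (frontier K)"
  have "space ?R = frontier K" by (simp add: space_restrict_space)
  then show ?thesis using False sets.sigma_sets_eq[of ?R] sets.space_closed[of ?R] by (simp add: affine_arclength_def)
qed

section \<open>Passage from Lebesgue to Borel measurable data\<close>

lemma borel_version:
  fixes f :: "'a::euclidean_space \<Rightarrow> complex"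
  assumes "f \<in> borel_measurable lebesgue"
  obtains f' where "f' \<in> borel_measurable borel" "AE x in lborel. f x = f' x"
proof -
  have "(\<lambda>x. Re (f x)) \<in> borel_measurable lebesgue" "(\<lambda>x. Im (f x)) \<in> borel_measurable lebesgue" using assms by measurable
  then obtain a b where ab: "a \<in> borel_measurable lborel" "AE x in lborel. Re (f x) = a x"
    "b \<in> borel_measurable lborel" "AE x in lborel. Im (f x) = b x"
    using completion_ex_borel_measurable_real by metis
  show ?thesis
  proof (rule that[of "\<lambda>x. complex_of_real (a x) + \<i> * complex_of_real (b x)"])
    show "(\<lambda>x. complex_of_real (a x) + \<i> * complex_of_real (b x)) \<in> borel_measurable borel" using ab(1,3) by simp
    show "AE x in lborel. f x = complex_of_real (a x) + \<i> * complex_of_real (b x)"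
      using ab(2,4) by eventually_elim (simp add: complex_eq_iff)
  qed
qed

text \<open>An integrable \<open>f\<close> is replaced by a Borel version. If \<open>f\<close> is
  not integrable, neither is its product with the unimodular \<open>eker\<close>, so the Fourier
  integral has the default value 0 at every frequency, and \<open>f'\<close> is 0.\<close>

lemma fourier_eq_ft:
  obtains f' where "integrable lborel f'" "\<And>u. fourier f u = ft f' u"
    "\<And>p. (\<integral>\<^sup>+x. ennreal_powr (ennreal (norm (f' x))) p \<partial>lborel) \<le> (\<integral>\<^sup>+x. ennreal_powr (ennreal (norm (f x))) p \<partial>lebesgue)"
proof (cases "integrable lebesgue f")
  case True
  then have fm: "f \<in> borel_measurable lebesgue" by auto
  obtain f' where f' [measurable]: "f' \<in> borel_measurable borel" and eq: "AE x in lborel. f x = f' x" by (rule borel_version[OF fm])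
  have eq': "AE x in lebesgue. f x = f' x" using eq by (rule AE_completion)
  have f'l: "f' \<in> borel_measurable lebesgue" by (simp add: measurable_completion)
  have "integrable lebesgue f'" using True integrable_cong_AE[OF fm f'l eq'] by simp
  then have int: "integrable lborel f'" by (subst (asm) integrable_completion) auto
  have "fourier f u = ft f' u" for u
  proof -
    have e: "(\<lambda>x. eker x u) \<in> borel_measurable lebesgue" by (simp add: measurable_completion)
    have "fourier f u = (LINT x|lebesgue. f x * eker x u)" by (simp add: fourier_def eker_def)
    also have "\<dots> = (LINT x|lebesgue. f' x * eker x u)"
    proof (rule integral_cong_AE)
      show "(\<lambda>x. f x * eker x u) \<in> borel_measurable lebesgue" "(\<lambda>x. f' x * eker x u) \<in> borel_measurable lebesgue"
        using fm f'l e by (auto intro: borel_measurable_times)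
      show "AE x in lebesgue. f x * eker x u = f' x * eker x u" using eq' by eventually_elim simp
    qed
    also have "\<dots> = ft f' u" unfolding ft_def by (rule integral_completion) measurable
    finally show ?thesis .
  qed
  moreover have "(\<integral>\<^sup>+x. ennreal_powr (ennreal (norm (f' x))) p \<partial>lborel) \<le> (\<integral>\<^sup>+x. ennreal_powr (ennreal (norm (f x))) p \<partial>lebesgue)" for p
    unfolding nn_integral_completion using eq by (intro nn_integral_mono_AE) (auto elim!: eventually_mono)
  ultimately show ?thesis using int by (intro that)
next
  case False
  have "fourier f u = 0" for u
  proof -
    have "\<not> integrable lebesgue (\<lambda>x. f x * eker x u)"
    proof
      assume i: "integrable lebesgue (\<lambda>x. f x * eker x u)"
      have e: "(\<lambda>x. eker x (- u)) \<in> borel_measurable lebesgue" by (simp add: measurable_completion)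
      have "eker x u * eker x (- u) = 1" for x by (simp add: eker_def exp_add[symmetric])
      then have eq: "f x = f x * eker x u * eker x (- u)" for x by (simp add: mult.assoc)
      have "integrable lebesgue f"
        using i
      proof (rule Bochner_Integration.integrable_bound)
        have "(\<lambda>x. f x * eker x u * eker x (- u)) \<in> borel_measurable lebesgue"
          using borel_measurable_times[OF borel_measurable_integrable[OF i] e] .
        then show "f \<in> borel_measurable lebesgue" unfolding eq[symmetric] by simp
      qed (simp add: norm_mult)
      then show False using False by simp
    qed
    then show ?thesis by (simp add: fourier_def eker_def not_integrable_integral_eq)
  qed
  then show ?thesis by (intro that[of "\<lambda>_. 0"]) (auto simp: ft_def)
qed

lemma integral_lborel_reflect:
  fixes f :: "'a::euclidean_space \<Rightarrow> complex"
  assumes [measurable]: "f \<in> borel_measurable borel"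
  shows "(LINT x|lborel. f (t - x)) = (LINT x|lborel. f x)"
proof -
  have "lborel = distr lborel borel (\<lambda>x. t + (- 1) *\<^sub>R x :: 'a)"
    by (subst (1) lborel_affine[of "- 1" t]) (auto simp: density_1 one_ennreal_def[symmetric])
  then have *: "lborel = distr lborel borel (\<lambda>x. t - x :: 'a)" by simp
  show ?thesis by (subst (2) *, subst integral_distr) auto
qed

lemma negligible_reflect:
  assumes "negligible (N :: 'a::euclidean_space set)" shows "negligible {y. x - y \<in> N}"
proof -
  obtain N' where N': "N \<subseteq> N'" "N' \<in> sets borel" "N' \<in> null_sets lborel" "negligible N'" by (rule negligible_borel_cover[OF assms])
  note N'(2) [measurable]
  have m: "{y. x - y \<in> N'} \<in> sets borel" by measurable
  have "emeasure lborel {y. x - y \<in> N'} = (\<integral>\<^sup>+y. indicator {y. x - y \<in> N'} y \<partial>lborel)"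
    using m by (intro nn_integral_indicator[symmetric]) simp
  also have "\<dots> = (\<integral>\<^sup>+y. indicator N' (x - y) \<partial>lborel)"
    by (intro nn_integral_cong) (auto split: split_indicator)
  also have "\<dots> = (\<integral>\<^sup>+y. indicator N' y \<partial>lborel)" by (rule nn_integral_lborel_shift(3)) measurable
  also have "\<dots> = 0" using N'(2,3) by (subst nn_integral_indicator) auto
  finally have "{y. x - y \<in> N'} \<in> null_sets lborel" using m by auto
  then have "negligible {y. x - y \<in> N'}" unfolding negligible_iff_null_sets null_sets_completion_iff2 by blast
  then show ?thesis by (rule negligible_subset) (use N'(1) in blast)
qed

text \<open>Reflection about \<open>x / 2\<close> preserves null sets and Lebesgue measure. Hence
  changing \<open>g\<close> on a null set alters no average, and the averages may be written as
  integrals over \<open>w = x - y\<close>.\<close>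

lemma maximal_op_eq_mop:
  assumes g: "g \<in> borel_measurable lebesgue" and g' [measurable]: "g' \<in> borel_measurable borel"
    and eq: "AE x in lborel. g x = g' x" and f [measurable]: "f \<in> borel_measurable borel"
  shows "maximal_op g (ft f) x = mop f g' x"
proof -
  obtain N where N: "N \<in> null_sets lborel" "{x. g x \<noteq> g' x} \<subseteq> N" using AE_E[OF eq] by (metis (no_types, lifting) space_borel space_lborel UNIV_I Collect_cong null_setsI)
  have neg: "negligible {y. x - y \<in> N}"
    using N(1) by (intro negligible_reflect) (auto simp: negligible_iff_null_sets null_sets_completion_iff2)
  have av: "(LINT y|lebesgue. ft f (x - y) * g (x - y) * complex_of_real (inverse (measure lebesgue (cbox (- v) v)) * indicator (cbox (- v) v) y))
      = bavg f g' v x" if v: "\<forall>i. 0 < v $ i" for v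
  proof -
    have "cbox (- v) v \<noteq> {}" using v by (auto simp: interval_ne_empty_cart less_imp_le)
    then have "measure lebesgue (cbox (- v) v) = (2 * v $ 1) * (2 * v $ 2)"
      by (simp add: content_cbox_cart prod_2 UNIV_2)
    then have rk: "inverse (measure lebesgue (cbox (- v) v)) * indicator (cbox (- v) v) y = rkern v y" for y
      by (simp add: rkern_def field_simps)
    have m': "(\<lambda>y. ft f (x - y) * g' (x - y) * complex_of_real (rkern v y)) \<in> borel_measurable borel" by measurable
    then have ml: "(\<lambda>y. ft f (x - y) * g' (x - y) * complex_of_real (rkern v y)) \<in> borel_measurable lebesgue" by (simp add: measurable_completion)
    have "(LINT y|lebesgue. ft f (x - y) * g (x - y) * complex_of_real (rkern v y)) = (LINT y|lebesgue. ft f (x - y) * g' (x - y) * complex_of_real (rkern v y))"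
    proof (rule integral_cong_AE)
      show "(\<lambda>y. ft f (x - y) * g (x - y) * complex_of_real (rkern v y)) \<in> borel_measurable lebesgue"
      proof (rule measurable_lebesgue_negligible[OF ml neg])
        fix y assume "y \<notin> {y. x - y \<in> N}"
        then have "g (x - y) = g' (x - y)" using N(2) by blast
        then show "ft f (x - y) * g' (x - y) * complex_of_real (rkern v y) = ft f (x - y) * g (x - y) * complex_of_real (rkern v y)" by simp
      qed
      have "AE y in lebesgue. y \<notin> {y. x - y \<in> N}" using neg unfolding negligible_iff_null_sets by (rule AE_not_in)
      then show "AE y in lebesgue. ft f (x - y) * g (x - y) * complex_of_real (rkern v y) = ft f (x - y) * g' (x - y) * complex_of_real (rkern v y)"
      proof eventually_elim
        case (elim y)
        then have "g (x - y) = g' (x - y)" using N(2) by blast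
        then show ?case by simp
      qed
    qed (rule ml)
    also have "\<dots> = (LINT y|lborel. ft f (x - y) * g' (x - y) * complex_of_real (rkern v y))" by (rule integral_completion) (use m' in simp)
    also have "\<dots> = bavg f g' v x"
      unfolding bavg_def using integral_lborel_reflect[of "\<lambda>w. ft f w * g' w * complex_of_real (rkern v (x - w))" x] by simp
    finally show ?thesis unfolding rk .
  qed
  have rect: "centred_rectangles = (\<lambda>v. cbox (- v) v) ` {v. 0 < v $ 1 \<and> 0 < v $ 2}"
    unfolding centred_rectangles_def by (auto simp: forall_2)
  show ?thesis
    unfolding maximal_op_def mop_def rect image_image
    by (intro SUP_cong refl arg_cong[where f = "\<lambda>x. ennreal (norm x)"] av) (auto simp: forall_2)
qed

lemma borel_measurable_mop:
  assumes f: "integrable lborel f" and g [measurable]: "g \<in> borel_measurable borel" and g1: "\<And>v. norm (g v) \<le> 1"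
  shows "mop f g \<in> borel_measurable borel"
proof -
  have [measurable]: "f \<in> borel_measurable borel" using f by auto
  obtain Q :: "nat \<Rightarrow> real^2" where "\<And>x. mop f g x = (SUP n. ennreal (norm (bavg f g (Q n) x)))"
    using mop_countable[OF f g g1] by blast
  then have "mop f g = (\<lambda>x. SUP n. ennreal (norm (bavg f g (Q n) x)))" by blast
  then show ?thesis by simp
qed

lemma mop_le:
  assumes f: "integrable lborel f" and g: "g \<in> borel_measurable borel" "\<And>v. norm (g v) \<le> 1"
  shows "mop f g x \<le> (\<integral>\<^sup>+x. ennreal (norm (f x)) \<partial>lborel)"
proof -
  have "mop f g x \<le> ennreal (LINT x|lborel. norm (f x))"
    unfolding mop_def using norm_bavg_le[OF f g] by (intro SUP_least ennreal_leI) auto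
  then show ?thesis using f by (subst nn_integral_eq_integral) auto
qed

text \<open>\<open>g'\<close> is a Borel version of \<open>g\<close>, replaced by 0 where its
  modulus exceeds 1: the kernel estimates use the bound at every point, whereas the essential
  supremum gives it only almost everywhere.\<close>

lemma maximal_op_fourier:
  assumes g: "g \<in> borel_measurable lebesgue" and g1: "Lnorm \<infinity> lebesgue (\<lambda>x. ennreal (norm (g x))) = 1"
  obtains f' g' where "integrable lborel f'" "g' \<in> borel_measurable borel" "\<And>v. norm (g' v) \<le> 1"
    "maximal_op g (fourier f) = mop f' g'"
    "\<And>p. (\<integral>\<^sup>+x. ennreal_powr (ennreal (norm (f' x))) p \<partial>lborel) \<le> (\<integral>\<^sup>+x. ennreal_powr (ennreal (norm (f x))) p \<partial>lebesgue)"
proof -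
  obtain f' where f': "integrable lborel f'" "\<And>u. fourier f u = ft f' u"
    "\<And>p. (\<integral>\<^sup>+x. ennreal_powr (ennreal (norm (f' x))) p \<partial>lborel) \<le> (\<integral>\<^sup>+x. ennreal_powr (ennreal (norm (f x))) p \<partial>lebesgue)"
    using fourier_eq_ft[of f] by blast
  obtain g0 where g0 [measurable]: "g0 \<in> borel_measurable borel" and eq: "AE x in lborel. g x = g0 x" by (rule borel_version[OF g])
  define g' where "g' x = (if norm (g0 x) \<le> 1 then g0 x else 0)" for x
  have g': "g' \<in> borel_measurable borel" "\<And>v. norm (g' v) \<le> 1" unfolding g'_def[abs_def] by auto
  have "AE x in lebesgue. ennreal (norm (g x)) \<le> 1"
    using esssup_AE[of "\<lambda>x. ennreal (norm (g x))" lebesgue] g1 by (simp add: Lnorm_def)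
  then have "AE x in lborel. ennreal (norm (g x)) \<le> 1" by (simp only: AE_completion_iff)
  with eq have "AE x in lborel. g x = g' x" by eventually_elim (simp add: g'_def)
  then have "maximal_op g (ft f') x = mop f' g' x" for x
    using f'(1) by (intro maximal_op_eq_mop g g'(1)) auto
  moreover have "fourier f = ft f'" using f'(2) by blast
  ultimately have "maximal_op g (fourier f) = mop f' g'" by auto
  then show ?thesis using f'(1,3) g' by (intro that[of f' g'])
qed

section \<open>Exponents and conclusion\<close>

lemma conj_exponent_1: assumes "1 / ennreal 1 + 1 / p' = 1" shows "p' = top"
proof -
  have "1 + 1 / p' = 1 + (0::ennreal)" using assms by simp
  then have "1 / p' = 0" by (subst (asm) ennreal_add_left_cancel) simp
  then show ?thesis by (simp add: ennreal_divide_eq_0_iff)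
qed

text \<open>From \<open>1 / p > 3 / 4\<close> the reciprocal of the conjugate exponent is below 1/4;
  an infinite conjugate exponent would force \<open>p = 1\<close>.\<close>

lemma conj_exponent:
  assumes p: "1 < p" "p < 4 / 3" and p': "1 / ennreal p + 1 / p' = 1"
  obtains b where "p' = ennreal b" "4 < b" "1 / p + 1 / b = 1"
proof (cases p')
  case (real b)
  have "b \<noteq> 0" using p' real by auto
  then have "0 < b" using real by simp
  then have "ennreal (1 / p + 1 / b) = 1"
    using p' p real by (simp add: divide_ennreal[symmetric])
  then have eq: "1 / p + 1 / b = 1" using p \<open>0 < b\<close> by (simp only: ennreal_eq_1)
  moreover have "3 / 4 < 1 / p" using p by (simp add: field_simps)
  then have "1 / b < 1 / 4" using eq by linarith
  then have "4 < b" using \<open>0 < b\<close> by (simp add: field_simps)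
  ultimately show ?thesis using real by (intro that[of b])
next
  case top
  then have "ennreal (1 / p) = 1" using p' p by (simp add: divide_ennreal[symmetric])
  then show ?thesis using p by (simp only: ennreal_eq_1) simp
qed

theorem theorem1p3:
  fixes p :: real and p' q :: ennreal
  assumes "1 \<le> p" and "p < 4 / 3"
    and "1 / ennreal p + 1 / p' = 1"
    and "q = p' / 3"
  shows "\<exists>C::ennreal. C < \<infinity> \<and>
    (\<forall>(g :: real^2 \<Rightarrow> complex) (K :: (real^2) set) (f :: real^2 \<Rightarrow> complex).
       g \<in> borel_measurable lebesgue \<longrightarrow>
       Lnorm \<infinity> lebesgue (\<lambda>x. ennreal (norm (g x))) = 1 \<longrightarrow>
       open K \<longrightarrow> convex K \<longrightarrow> K \<noteq> {} \<longrightarrow>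
       schwartz f \<longrightarrow>
       Lnorm q (affine_arclength K) (maximal_op g (fourier f))
         \<le> C * Lnorm (ennreal p) lebesgue (\<lambda>x. ennreal (norm (f x))))"
proof (cases "p = 1")
  case True
  \<comment> \<open>The exponent conjugate to 1 is infinite, so the left-hand norm is an essential
    supremum, and the constant is 1.\<close>
  have q: "q = \<infinity>" using conj_exponent_1[of p'] assms(3,4) True by (simp add: ennreal_top_divide)
  have "Lnorm q (affine_arclength K) (maximal_op g (fourier f)) \<le> 1 * Lnorm (ennreal p) lebesgue (\<lambda>x. ennreal (norm (f x)))"
    if g: "g \<in> borel_measurable lebesgue" "Lnorm \<infinity> lebesgue (\<lambda>x. ennreal (norm (g x))) = 1" for g f :: "real^2 \<Rightarrow> complex" and K
  proof -
    obtain f' g' where f': "integrable lborel f'" and g': "g' \<in> borel_measurable borel" "\<And>v. norm (g' v) \<le> 1"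
      and eq: "maximal_op g (fourier f) = mop f' g'"
      and le: "\<And>p. (\<integral>\<^sup>+x. ennreal_powr (ennreal (norm (f' x))) p \<partial>lborel) \<le> (\<integral>\<^sup>+x. ennreal_powr (ennreal (norm (f x))) p \<partial>lebesgue)"
      using maximal_op_fourier[OF g, where f = f] by blast
    have "mop f' g' \<in> borel_measurable (restrict_space borel (frontier K))"
      by (rule measurable_restrict_space1[OF borel_measurable_mop[OF f' g']])
    then have m: "mop f' g' \<in> borel_measurable (affine_arclength K)"
      using measurable_cong_sets[OF sets_affine_arclength refl] by blast
    have "esssup (affine_arclength K) (mop f' g') \<le> (\<integral>\<^sup>+x. ennreal (norm (f' x)) \<partial>lborel)"
      using mop_le[OF f' g'] by (intro esssup_I m) auto
    also have "\<dots> \<le> (\<integral>\<^sup>+x. ennreal (norm (f x)) \<partial>lebesgue)" using le[of 1] by simp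
    finally show ?thesis unfolding q eq using True by (simp add: Lnorm_def)
  qed
  then show ?thesis by (intro exI[of _ 1]) auto
next
  case False
  then have p: "1 < p" using assms by simp
  obtain b where b: "p' = ennreal b" "4 < b" "1 / p + 1 / b = 1" by (rule conj_exponent[OF p assms(2,3)])
  define s where "s = b / 3"
  \<comment> \<open>This solves \<open>b = 2 * (r / (r - 1))\<close>, and \<open>r < 2\<close> means
    \<open>4 < b\<close>. The second identity in \<open>rb\<close> says that
    \<open>2 * r / (3 - r)\<close>, the exponent from the energy estimate, is conjugate to
    \<open>s\<close>; this fixes \<open>q\<close> as a third of \<open>p'\<close>.\<close>
  define r where "r = b / (b - 2)"
  have q: "q = ennreal s" using assms(4) b by (simp add: s_def divide_ennreal[symmetric])
  have s: "1 < s" using b by (simp add: s_def)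
  have r: "1 < r" "r < 2" using b by (auto simp: r_def field_simps)
  have "r - 1 = 2 / (b - 2)" "3 - r = (2 * b - 6) / (b - 2)" using b by (auto simp: r_def field_simps)
  then have "2 * (r / (r - 1)) = b" "2 * r / (3 - r) = 2 * b / (2 * b - 6)" using b by (auto simp: r_def)
  moreover have "2 * b / (2 * b - 6) = s / (s - 1)" using b by (simp add: s_def field_simps)
  ultimately have rb: "1 / p + 1 / (2 * (r / (r - 1))) = 1" "2 * r / (3 - r) = s / (s - 1)" using b(3) by simp_all
  \<comment> \<open>The 4 counts the pieces of a curve, and the power \<open>1 / s\<close> comes
    from taking the norm.\<close>
  define C where "C = ennreal (4 powr (1 / s)) * ennreal (max_const r)"
  have "Lnorm q (affine_arclength K) (maximal_op g (fourier f)) \<le> C * Lnorm (ennreal p) lebesgue (\<lambda>x. ennreal (norm (f x)))"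
    if g: "g \<in> borel_measurable lebesgue" "Lnorm \<infinity> lebesgue (\<lambda>x. ennreal (norm (g x))) = 1"
      and K: "open K" "convex K" "K \<noteq> {}" for g f :: "real^2 \<Rightarrow> complex" and K
  proof -
    obtain f' g' where f': "integrable lborel f'" and g': "g' \<in> borel_measurable borel" "\<And>v. norm (g' v) \<le> 1"
      and eq: "maximal_op g (fourier f) = mop f' g'"
      and le: "\<And>p. (\<integral>\<^sup>+x. ennreal_powr (ennreal (norm (f' x))) p \<partial>lborel) \<le> (\<integral>\<^sup>+x. ennreal_powr (ennreal (norm (f x))) p \<partial>lebesgue)"
      using maximal_op_fourier[OF g, where f = f] by blast
    let ?B = "ennreal (max_const r) * ennreal_powr (\<integral>\<^sup>+x. ennreal_powr (ennreal (norm (f' x))) p \<partial>lborel) (1 / p)"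
    have "(\<integral>\<^sup>+x. ennreal_powr (mop f' g' x) s \<partial>affine_arclength K) \<le> 4 * ennreal_powr ?B s"
      by (rule affine_arclength_le[OF K]) (rule compact_maximal[OF _ _ _ r p rb(1) s rb(2) f' g'])
    then have "ennreal_powr (\<integral>\<^sup>+x. ennreal_powr (mop f' g' x) s \<partial>affine_arclength K) (1 / s) \<le> ennreal_powr (4 * ennreal_powr ?B s) (1 / s)"
      using s by (intro ennreal_powr_mono) auto
    also have "\<dots> = ennreal_powr 4 (1 / s) * ?B" using s by (simp add: ennreal_powr_mult ennreal_powr_powr)
    also have "ennreal_powr 4 (1 / s) = ennreal (4 powr (1 / s))" using ennreal_powr_ennreal[of 4 "1 / s"] by simp
    also have "ennreal (4 powr (1 / s)) * ?B \<le> C * ennreal_powr (\<integral>\<^sup>+x. ennreal_powr (ennreal (norm (f x))) p \<partial>lebesgue) (1 / p)"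
      unfolding C_def mult.assoc using p by (intro mult_left_mono ennreal_powr_mono le) auto
    finally show ?thesis unfolding q eq using s p by (simp add: Lnorm_def)
  qed
  moreover have "C < \<infinity>" by (simp add: C_def ennreal_mult_less_top)
  ultimately show ?thesis by (intro exI[of _ C]) auto
qed

end
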